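(* Let $f$ be a real or complex elementary map with an invariant elliptic curve $\mathcal{C}$. If the transverse Lyapunov exponent $\mathrm{Lyap}_{\mathcal{C}}(f)$ is strictly negative, then the attracting basin $B(\mathcal{C})$, consisting of points whose orbit converges to $\mathcal{C}$, has strictly positive Lebesgue measure. In fact any neighborhood of a point of $\mathcal{C}$ intersects $B(\mathcal{C})$ in a set of positive measure. Similarly, if such an $f$ has an invariant line $\mathcal{L}$ with strictly negative transverse Lyapunov exponent, then the attracting basin of $\mathcal{L}$ (the set of points whose orbit converges to $\mathcal{L}$) has positive measure, and intersects any neighborhood of a point of $\mathcal{L}$ in a set of positive measure.
   Context: Let $K=\mathbb{R}$ or $\mathbb{C}$ and $\mathbb{P}^2=\mathbb{P}^2(K)$. A rational map $f$ of $\mathbb{P}^2$ is given by three homogeneous polynomials over $K$ of the same degree $d\ge2$ without common factor; the indeterminacy set $\mathcal{I}_f$ is the set of their common zeros. A curve $\mathcal{C}$ is invariant if it contains no indeterminacy points and $f(\mathcal{C})=\mathcal{C}$. The map $f$ is elementary with center $p_0\in\mathbb{P}^2$ if every line through $p_0$ maps to a line through $p_0$. Elliptic curves here are smooth. In the complex case, $\mathcal{C}\subset\mathbb{P}^2(\mathbb{C})$ is biholomorphic to some $\mathbb{C}/\Omega$ with $\Omega$ a lattice; $f|_{\mathcal{C}}$ lifts to an affine map $t\mapsto at+b$ with $|a|^2=d$, and the normalized Lebesgue measure of $\mathbb{C}/\Omega$ pushes forward to the canonical $f$-invariant ergodic probability measure $\lambda$ on $\mathcal{C}$. In the real case, $\mathcal{C}$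 denotes a connected component of the real locus of a smooth elliptic curve defined over $\mathbb{R}$ (invariant under the complexified map), mapped onto itself by $f$; it has a parametrization $\mathbb{R}/\mathbb{Z}\to\mathcal{C}$ in which $f$ is affine with constant integer multiplier, and $\lambda$ is the push-forward of Lebesgue measure. Transverse Lyapunov exponent: for a smooth invariant curve $\mathcal{C}$ let $T_{\pitchfork}(\mathcal{C},p)=T(\mathbb{P}^2,p)/T(\mathcal{C},p)$. The derivative of $f$ induces linear maps $f'_{\pitchfork}(p):T_{\pitchfork}(\mathcal{C},p)\to T_{\pitchfork}(\mathcal{C},f(p))$. Choosing any continuous norm on the line bundle with fibers $T_{\pitchfork}(\mathcal{C},p)$, $$\mathrm{Lyap}_{\mathcal{C}}(f)=\int_{\mathcal{C}}\log\|f'_{\pitchfork}(p)\|\,d\lambda(p),$$ which is independent of the choice of norm and equals $\lim_{k\to\infty}\frac1k\log\|(f^{\circ k})'_{\pitchfork}(p)\|$ for almost every $p\in\mathcal{C}$. For an elementary map with an invariant elliptic curve, an invariant line $\mathcal{L}$ not passing through $p_0$ carries a canonical ergodic $f$-invariant probability measure absolutely continuous with respect to Lebesgue measure ($f|_{\mathcal{L}}$ is a Lattès map: projection from $p_0$ maps $\mathcal{C}$ to $\mathcal{L}$ and semiconjugates $f|_{\mathcal{C}}$ to $f|_{\mathcal{L}}$; the measure is the push-forward of $\lambda$). The transverse Lyapunov exponent of $\mathcal{L}$ is defined by the same integral formula using this measure; it is understood that a line to which a transverse exponent is assigned does not pass through $p_0$. *)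

theory Defs
  imports "HOL-Analysis.Analysis" "HOL-Library.Poly_Mapping"
begin

section \<open>The projective plane\<close>

quotient_type (overloaded) 'k proj2 = "'k::field ^ 3" / partial:
  "\<lambda>v w. v \<noteq> 0 \<and> w \<noteq> 0 \<and> (\<exists>c. w = c *s v)"
proof (rule part_equivpI)
  show "\<exists>v::'k^3. v \<noteq> 0 \<and> v \<noteq> 0 \<and> (\<exists>c. v = c *s v)"
    by (rule exI[of _ "1::'k^3"], intro conjI exI[of _ 1]) (simp_all add: vec_eq_iff)
next
  show "symp (\<lambda>v w :: 'k^3. v \<noteq> 0 \<and> w \<noteq> 0 \<and> (\<exists>c. w = c *s v))"
  proof (rule sympI, elim conjE exE, intro conjI)
    fix v w :: "'k^3" and c assume "w = c *s v" "w \<noteq> 0"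
    moreover from this have "c \<noteq> 0" by auto
    ultimately have "v = inverse c *s w" by (simp add: vector_smult_assoc)
    then show "\<exists>c. v = c *s w" ..
  qed
next
  show "transp (\<lambda>v w :: 'k^3. v \<noteq> 0 \<and> w \<noteq> 0 \<and> (\<exists>c. w = c *s v))"
    by (rule transpI) (metis vector_smult_assoc)
qed

text \<open>\<open>to_proj2 v\<close> is the point with homogeneous coordinates \<open>v\<close>; it is unspecified for \<open>v = 0\<close>.\<close>

definition to_proj2 :: "'k::field ^ 3 \<Rightarrow> 'k proj2" where
  "to_proj2 v = abs_proj2 v"

lemma rep_proj2_nonzero: "rep_proj2 p \<noteq> 0"
  using Quotient_rep_reflp[OF Quotient_proj2, of p] by auto

lemma to_proj2_rep [simp]: "to_proj2 (rep_proj2 p) = p"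
  unfolding to_proj2_def using Quotient_abs_rep[OF Quotient_proj2] .

lemma to_proj2_eq_iff:
  assumes "v \<noteq> 0" "w \<noteq> 0"
  shows "to_proj2 v = to_proj2 w \<longleftrightarrow> (\<exists>c. w = c *s v)"
proof -
  have refl: "\<exists>c. u = c *s u" for u :: "'a^3"
    by (rule exI[of _ 1]) simp
  show ?thesis
    unfolding to_proj2_def
    using Quotient_rel[OF Quotient_proj2, of v w] assms refl by blast
qed

text \<open>The quotient topology.\<close>

instantiation proj2 :: (real_normed_field) topological_space
begin

definition open_proj2 :: "'a proj2 set \<Rightarrow> bool" where
  "open_proj2 U \<longleftrightarrow> open {v. v \<noteq> 0 \<and> to_proj2 v \<in> U}"

instance
proof
  have "{v::'a^3. v \<noteq> 0 \<and> to_proj2 v \<in> UNIV} = - {0}" by auto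
  then show "open (UNIV :: 'a proj2 set)" unfolding open_proj2_def by (simp add: open_Compl)
next
  fix S T :: "'a proj2 set" assume "open S" "open T"
  moreover have "{v. v \<noteq> 0 \<and> to_proj2 v \<in> S \<inter> T}
      = {v. v \<noteq> 0 \<and> to_proj2 v \<in> S} \<inter> {v. v \<noteq> 0 \<and> to_proj2 v \<in> T}" by auto
  ultimately show "open (S \<inter> T)" unfolding open_proj2_def by (simp add: open_Int)
next
  fix \<S> :: "'a proj2 set set" assume "\<forall>S\<in>\<S>. open S"
  moreover have "{v. v \<noteq> 0 \<and> to_proj2 v \<in> \<Union>\<S>} = (\<Union>S\<in>\<S>. {v. v \<noteq> 0 \<and> to_proj2 v \<in> S})" by auto
  ultimately show "open (\<Union>\<S>)" unfolding open_proj2_def by auto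
qed

end

text \<open>The push-forward of normalized Lebesgue measure on the unit ball of \<open>K\<^sup>3\<close>. It is a smooth
  measure of positive density on the projective plane, hence represents its Lebesgue measure class.\<close>

definition proj2_volume :: "'k::{real_normed_field,euclidean_space} proj2 measure" where
  "proj2_volume = distr (uniform_measure lborel (ball 0 1)) borel to_proj2"

lemma borel_measurable_to_proj2:
  "(to_proj2 :: 'k::{real_normed_field,euclidean_space} ^ 3 \<Rightarrow> _) \<in> borel \<rightarrow>\<^sub>M borel"
proof (rule borel_measurableI)
  fix U :: "'k proj2 set" assume "open U"
  then have "open {v. v \<noteq> 0 \<and> to_proj2 v \<in> U}" unfolding open_proj2_def .
  moreover have "to_proj2 -` U \<inter> space borel
      = {v. v \<noteq> 0 \<and> to_proj2 v \<in> U} \<union> (if to_proj2 0 \<in> U then {0} else {})" by auto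
  ultimately show "to_proj2 -` U \<inter> space borel \<in> sets (borel :: ('k^3) measure)"
    by (simp add: borel_open borel_closed)
qed


section \<open>Ternary polynomials, plane curves and rational maps\<close>

type_synonym 'k poly3 = "(3 \<Rightarrow>\<^sub>0 nat) \<Rightarrow>\<^sub>0 'k"

definition eval3 :: "'k::field poly3 \<Rightarrow> 'k ^ 3 \<Rightarrow> 'k" where
  "eval3 P v = (\<Sum>m\<in>Poly_Mapping.keys P. Poly_Mapping.lookup P m * (\<Prod>i\<in>UNIV. (v $ i) ^ Poly_Mapping.lookup m i))"

definition homogeneous :: "nat \<Rightarrow> 'k::zero poly3 \<Rightarrow> bool" where
  "homogeneous d P \<longleftrightarrow> (\<forall>m\<in>Poly_Mapping.keys P. (\<Sum>i\<in>UNIV. Poly_Mapping.lookup m i) = d)"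

definition zero_set :: "'k::field poly3 \<Rightarrow> 'k proj2 set" where
  "zero_set G = {to_proj2 v | v. v \<noteq> 0 \<and> eval3 G v = 0}"

definition smooth_curve :: "'k::real_normed_field poly3 \<Rightarrow> bool" where
  "smooth_curve G \<longleftrightarrow> (\<exists>m>0. homogeneous m G) \<and>
     (\<forall>v. v \<noteq> 0 \<and> eval3 G v = 0 \<longrightarrow> frechet_derivative (eval3 G) (at v) \<noteq> (\<lambda>w. 0))"

definition linear_form :: "'k::zero poly3 \<Rightarrow> bool" where
  "linear_form H \<longleftrightarrow> homogeneous 1 H \<and> H \<noteq> 0"

definition line :: "'k::field proj2 set \<Rightarrow> bool" where
  "line L \<longleftrightarrow> (\<exists>H. linear_form H \<and> L = zero_set H)"

type_synonym 'k polymap = "'k poly3 ^ 3"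

definition evalmap :: "'k::field polymap \<Rightarrow> 'k ^ 3 \<Rightarrow> 'k ^ 3" where
  "evalmap F v = (\<chi> i. eval3 (F $ i) v)"

definition rational_map :: "nat \<Rightarrow> 'k::field polymap \<Rightarrow> bool" where
  "rational_map d F \<longleftrightarrow> 2 \<le> d \<and> (\<forall>i. homogeneous d (F $ i)) \<and>
     (\<forall>q. (\<forall>i. q dvd F $ i) \<longrightarrow> q dvd 1)"

definition indeterminacy :: "'k::field polymap \<Rightarrow> 'k proj2 set" where
  "indeterminacy F = {to_proj2 v | v. v \<noteq> 0 \<and> evalmap F v = 0}"

text \<open>By homogeneity the choice of homogeneous coordinates is irrelevant outside the indeterminacy
  set; on the indeterminacy set the value is unspecified.\<close>

definition ratmap :: "'k::field polymap \<Rightarrow> 'k proj2 \<Rightarrow> 'k proj2" where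
  "ratmap F p = to_proj2 (evalmap F (rep_proj2 p))"

lemma eval3_scale:
  assumes "homogeneous d P"
  shows "eval3 P (c *s v) = c ^ d * eval3 P v"
proof -
  have "Poly_Mapping.lookup P m * (\<Prod>i\<in>UNIV. ((c *s v) $ i) ^ Poly_Mapping.lookup m i) =
      c ^ d * (Poly_Mapping.lookup P m * (\<Prod>i\<in>UNIV. (v $ i) ^ Poly_Mapping.lookup m i))"
    if "m \<in> Poly_Mapping.keys P" for m
  proof -
    have "(\<Sum>i\<in>UNIV. Poly_Mapping.lookup m i) = d"
      using assms that unfolding homogeneous_def by blast
    then have "c ^ d = (\<Prod>i\<in>UNIV. c ^ Poly_Mapping.lookup m i)"
      by (metis power_sum)
    then show ?thesis by (simp add: power_mult_distrib prod.distrib mult_ac)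
  qed
  then show ?thesis unfolding eval3_def sum_distrib_left by (rule sum.cong[OF refl])
qed

lemma ratmap_to_proj2:
  assumes "rational_map d F" "v \<noteq> 0" "evalmap F v \<noteq> 0"
  shows "ratmap F (to_proj2 v) = to_proj2 (evalmap F v)"
proof -
  obtain c where c: "rep_proj2 (to_proj2 v) = c *s v"
    using to_proj2_eq_iff[OF assms(2) rep_proj2_nonzero, of "to_proj2 v"] by auto
  then have "c \<noteq> 0" using rep_proj2_nonzero[of "to_proj2 v"] by auto
  have "evalmap F (c *s v) = c ^ d *s evalmap F v"
    using assms(1) unfolding rational_map_def evalmap_def
    by (simp add: vec_eq_iff eval3_scale)
  moreover have "c ^ d *s evalmap F v \<noteq> 0"
    using \<open>c \<noteq> 0\<close> assms(3) by (simp add: vec_eq_iff)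
  ultimately show ?thesis
    unfolding ratmap_def c using to_proj2_eq_iff[OF assms(3), of "c ^ d *s evalmap F v"] by auto
qed

definition invariant_curve :: "'k::field polymap \<Rightarrow> 'k proj2 set \<Rightarrow> bool" where
  "invariant_curve F C \<longleftrightarrow> C \<inter> indeterminacy F = {} \<and> ratmap F ` C = C"

text \<open>A line \<open>maps to\<close> a line if the image of its determinate points is contained in that line:
  over the reals the image is in general a proper subset.\<close>

definition elementary :: "'k::field polymap \<Rightarrow> 'k proj2 \<Rightarrow> bool" where
  "elementary F p0 \<longleftrightarrow> (\<forall>L. line L \<and> p0 \<in> L \<longrightarrow>
     (\<exists>L'. line L' \<and> p0 \<in> L' \<and> ratmap F ` (L - indeterminacy F) \<subseteq> L'))"

definition basin :: "'k::real_normed_field polymap \<Rightarrow> 'k proj2 set \<Rightarrow> 'k proj2 set" where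
  "basin F C = {p. (\<forall>n. (ratmap F ^^ n) p \<notin> indeterminacy F) \<and>
     (\<forall>U. open U \<and> C \<subseteq> U \<longrightarrow> (\<forall>\<^sub>F n in sequentially. (ratmap F ^^ n) p \<in> U))}"

definition basin_positive ::
    "'k::{real_normed_field,euclidean_space} polymap \<Rightarrow> 'k proj2 set \<Rightarrow> bool" where
  "basin_positive F C \<longleftrightarrow> emeasure proj2_volume (basin F C) > 0 \<and>
     (\<forall>p\<in>C. \<forall>U. open U \<and> p \<in> U \<longrightarrow> emeasure proj2_volume (U \<inter> basin F C) > 0)"


section \<open>Transverse Lyapunov exponents\<close>

text \<open>The tangent space of the plane at the point \<open>p\<close> with coordinates \<open>v\<close> is encoded by
  homogeneous coordinates: \<open>(v, w)\<close> denotes the image of the vector \<open>w\<close> at \<open>v\<close> under the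
  differential of \<open>to_proj2\<close>. Thus \<open>(v, w)\<close> and \<open>(c v, c w)\<close> denote the same tangent vector, \<open>w\<close>
  matters only modulo \<open>v\<close>, and \<open>f\<close> acts by \<open>(v, w) \<mapsto> (F v, DF(v) w)\<close>. A point of the smooth curve
  \<open>G = 0\<close> has as tangent line the kernel of \<open>DG(v)\<close>, which contains \<open>v\<close> by Euler's identity. A norm
  on the normal line bundle of a part \<open>C\<close> of this curve is then a function \<open>N v w\<close> which is a
  seminorm in \<open>w\<close> with kernel the tangent line and is compatible with change of coordinates.\<close>

definition transverse_norm ::
    "'k::real_normed_field poly3 \<Rightarrow> 'k proj2 set \<Rightarrow> ('k ^ 3 \<Rightarrow> 'k ^ 3 \<Rightarrow> real) \<Rightarrow> bool" where
  "transverse_norm G C N \<longleftrightarrow>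
     (\<forall>v w w' a c. v \<noteq> 0 \<and> to_proj2 v \<in> C \<longrightarrow>
        N v (w + w') \<le> N v w + N v w' \<and>
        N v (a *s w) = norm a * N v w \<and>
        (N v w = 0 \<longleftrightarrow> frechet_derivative (eval3 G) (at v) w = 0) \<and>
        (c \<noteq> 0 \<longrightarrow> N (c *s v) (c *s w) = N v w)) \<and>
     continuous_on ({v. v \<noteq> 0 \<and> to_proj2 v \<in> C} \<times> UNIV) (\<lambda>(v, w). N v w)"

text \<open>The operator norm of the transverse derivative at \<open>p\<close>. Since the normal spaces are
  one-dimensional, all \<open>w\<close> of norm 1 give the same value.\<close>

definition transverse_deriv_norm ::
    "'k::real_normed_field polymap \<Rightarrow> ('k ^ 3 \<Rightarrow> 'k ^ 3 \<Rightarrow> real) \<Rightarrow> 'k proj2 \<Rightarrow> real" where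
  "transverse_deriv_norm F N p = (let v = rep_proj2 p in
     SUP w\<in>{w. N v w = 1}. N (evalmap F v) (frechet_derivative (evalmap F) (at v) w))"

definition log_ereal :: "real \<Rightarrow> ereal" where
  "log_ereal x = (if x = 0 then -\<infinity> else ereal (ln x))"

text \<open>The integral is the difference of the integrals of the positive and negative parts
  (\<open>e2ennreal\<close> truncates negative numbers to 0). The former is finite, the latter may be infinite:
  the exponent is \<open>-\<infinity>\<close> if the transverse derivative vanishes along \<open>C\<close>.\<close>

definition transverse_lyapunov ::
    "'k::real_normed_field polymap \<Rightarrow> ('k ^ 3 \<Rightarrow> 'k ^ 3 \<Rightarrow> real) \<Rightarrow> 'k proj2 set \<Rightarrow> 'k proj2 measure \<Rightarrow> ereal"
  where
  "transverse_lyapunov F N C \<mu> =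
     enn2ereal (\<integral>\<^sup>+p\<in>C. e2ennreal (log_ereal (transverse_deriv_norm F N p)) \<partial>\<mu>) -
     enn2ereal (\<integral>\<^sup>+p\<in>C. e2ennreal (- log_ereal (transverse_deriv_norm F N p)) \<partial>\<mu>)"


section \<open>Elliptic curves and their canonical measures\<close>

definition period_lattice :: "complex \<Rightarrow> complex \<Rightarrow> complex set" where
  "period_lattice \<omega>1 \<omega>2 = {of_int m * \<omega>1 + of_int n * \<omega>2 | m n. True}"

text \<open>Holomorphy is expressed by local holomorphic lifts \<open>h\<close> to homogeneous coordinates; the map is
  immersive at \<open>s\<close> iff \<open>h'(s)\<close> is not proportional to \<open>h(s)\<close>.\<close>

definition holomorphic_immersion :: "(complex \<Rightarrow> complex proj2) \<Rightarrow> bool" where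
  "holomorphic_immersion \<phi> \<longleftrightarrow> (\<forall>t. \<exists>S h. open S \<and> t \<in> S \<and>
     (\<forall>i. (\<lambda>s. h s $ i) holomorphic_on S) \<and>
     (\<forall>s\<in>S. h s \<noteq> 0 \<and> \<phi> s = to_proj2 (h s) \<and>
        (\<nexists>c. (\<chi> i. deriv (\<lambda>s. h s $ i) s) = c *s h s)))"

text \<open>\<open>\<phi>\<close> is the universal covering of \<open>C\<close> obtained from a biholomorphic map from the torus
  \<open>\<complex>/\<Omega>\<close> onto \<open>C\<close>, where \<open>\<Omega>\<close> is the lattice spanned by \<open>\<omega>1\<close> and \<open>\<omega>2\<close>.\<close>

definition uniformization ::
    "complex \<Rightarrow> complex \<Rightarrow> (complex \<Rightarrow> complex proj2) \<Rightarrow> complex proj2 set \<Rightarrow> bool" where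
  "uniformization \<omega>1 \<omega>2 \<phi> C \<longleftrightarrow> Im (\<omega>2 / \<omega>1) \<noteq> 0 \<and> holomorphic_immersion \<phi> \<and> \<phi> ` UNIV = C \<and>
     (\<forall>s t. \<phi> s = \<phi> t \<longleftrightarrow> s - t \<in> period_lattice \<omega>1 \<omega>2)"

definition torus_measure ::
    "complex \<Rightarrow> complex \<Rightarrow> (complex \<Rightarrow> complex proj2) \<Rightarrow> complex proj2 measure" where
  "torus_measure \<omega>1 \<omega>2 \<phi> = distr
     (uniform_measure lborel {of_real x * \<omega>1 + of_real y * \<omega>2 | x y. x \<in> {0..<1} \<and> y \<in> {0..<1}})
     borel \<phi>"

definition complexify :: "real poly3 \<Rightarrow> complex poly3" where
  "complexify P = Poly_Mapping.map complex_of_real P"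

definition complexify_map :: "real polymap \<Rightarrow> complex polymap" where
  "complexify_map F = (\<chi> i. complexify (F $ i))"

text \<open>\<open>\<psi>\<close> induces a homeomorphism from \<open>\<real>/\<int>\<close> onto \<open>C\<close> in which \<open>f\<close> is affine. The multiplier
  \<open>a\<close> satisfies \<open>\<bar>a\<bar> \<ge> 2\<close>, and then \<open>\<psi>\<close> is unique up to a rotation and a reflection of \<open>\<real>/\<int>\<close>, so
  that the associated measure depends only on \<open>f\<close> and \<open>C\<close>.\<close>

definition affine_parametrization ::
    "real polymap \<Rightarrow> (real \<Rightarrow> real proj2) \<Rightarrow> real proj2 set \<Rightarrow> bool" where
  "affine_parametrization F \<psi> C \<longleftrightarrow> continuous_on UNIV \<psi> \<and> \<psi> ` UNIV = C \<and>
     (\<forall>s t. \<psi> s = \<psi> t \<longleftrightarrow> s - t \<in> \<int>) \<and>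
     (\<exists>(a::int) b. \<forall>t. ratmap F (\<psi> t) = \<psi> (of_int a * t + b))"

definition circle_measure :: "(real \<Rightarrow> real proj2) \<Rightarrow> real proj2 measure" where
  "circle_measure \<psi> = distr (uniform_measure lborel {0..<1}) borel \<psi>"

definition proj_from :: "'k::field proj2 \<Rightarrow> 'k proj2 set \<Rightarrow> 'k proj2 \<Rightarrow> 'k proj2" where
  "proj_from p0 L p = (THE q. q \<in> L \<and> (\<exists>M. line M \<and> p0 \<in> M \<and> p \<in> M \<and> q \<in> M))"

definition line_measure ::
    "'k::real_normed_field proj2 \<Rightarrow> 'k proj2 set \<Rightarrow> 'k proj2 measure \<Rightarrow> 'k proj2 measure" where
  "line_measure p0 L \<mu> = distr \<mu> borel (proj_from p0 L)"

end

theory Submission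
  imports Defs "HOL-Complex_Analysis.Conformal_Mappings" "HOL-Computational_Algebra.Fundamental_Theorem_Algebra"
begin

text \<open>Let \<open>p\<^sub>0\<close> be the center. In homogeneous coordinates the cross product \<open>cr e v\<close> with a vector \<open>e\<close> over
  \<open>p\<^sub>0\<close> is the normal of the line through \<open>p\<^sub>0\<close> and \<open>[v]\<close>. Since \<open>f\<close> is elementary, it maps lines
  through \<open>p\<^sub>0\<close> to such lines, and this action is semiconjugate to the action on the curve, which the uniformization
  turns into an affine map \<open>t \<mapsto> a t + b\<close>. So the plane is, near the curve, fibered by invariant lines over
  an expanding affine dynamical system.

  The multiplier satisfies \<open>\<bar>a\<bar> > 1\<close> (\<open>multiplier_expanding\<close>): an automorphism of the curve has an iterate that
  is a translation, and a polynomial map of large degree cannot induce a translation, because its degree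
  is bounded by the orders of zeros of a linear form along the curve. Hence the affine map is ergodic, and
  the maximal ergodic theorem (\<open>maximal_ergodic\<close>) shows that, when the transverse exponent is negative, a set
  of parameters of positive measure has transverse derivatives whose products decay exponentially from
  the start on. Along the line through \<open>p\<^sub>0\<close> over such a parameter, a segment of uniform size around the
  point of the curve is attracted to the curve (\<open>transverse_growth\<close>). These segments fill a set of
  positive measure (\<open>volume_of_segments\<close>), because the slope of the line is a local coordinate on the curve
  off countably many parameters. Expansion spreads them out: every open set of parameters contains
  preimages of good parameters (\<open>T_iter_covers\<close>), which localizes the statement near every point of the
  curve (\<open>attracting\<close>). For an invariant line the same argument applies to the projection of the
  parametrization from \<open>p\<^sub>0\<close> (\<open>attracting_line\<close>).

  The geometric input is as follows. The center is not on the curve (\<open>center_not_on_curve\<close>), as otherwise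
  the derivative at the center would act on the lines as a projective-linear map; if it is degenerate,
  the curve lies on a line, and if it is injective, it contradicts expansion. A smooth curve of genus one has degree three (\<open>degree_three\<close>), by a maximum
  principle for sections of line bundles. In the real case the parametrized component lifts to a straight
  line in the universal covering of the complex curve (\<open>linear_parametrization\<close>), so that all complex facts
  are inherited. Finally every real line through the center meets the component (\<open>no_missed_line\<close>): otherwise
  the slope has a maximum on the circle, the fold there is magnified by the dynamics to a global symmetry
  of the curve along the lines through the center, and this symmetry would be a fixed-point free
  involution of the three points of the cubic on a generic line.\<close>

section \<open>Vector algebra in three dimensions\<close>

definition cr :: "'k::field ^ 3 => 'k ^ 3 => 'k ^ 3" where
  "cr u v = vector [u$2 * v$3 - u$3 * v$2, u$3 * v$1 - u$1 * v$3, u$1 * v$2 - u$2 * v$1]"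

definition dt :: "'k::field ^ 3 => 'k ^ 3 => 'k" where
  "dt u v = (\<Sum>i\<in>UNIV. u$i * v$i)"

lemma dt3: "dt u v = u$1 * v$1 + u$2 * v$2 + u$3 * v$3"
  by (simp add: dt_def sum_3)

lemma cr_nth: "cr u v $ 1 = u$2 * v$3 - u$3 * v$2" "cr u v $ 2 = u$3 * v$1 - u$1 * v$3"
  "cr u v $ 3 = u$1 * v$2 - u$2 * v$1"
  by (simp_all add: cr_def)

lemmas v3 = vec_eq_iff forall_3 cr_nth dt3

lemma cr_self [simp]: "cr u u = 0" and cr_zero [simp]: "cr u 0 = 0" "cr 0 u = 0"
  by (simp_all add: v3)

lemma cr_add: "cr u (v + w) = cr u v + cr u w" and cr_diff: "cr u (v - w) = cr u v - cr u w"
  and cr_smult: "cr u (c *s v) = c *s cr u v" and cr_smult_left: "cr (c *s u) v = c *s cr u v"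
  and cr_swap: "cr u v = - cr v u"
  by (simp_all add: v3 algebra_simps)

lemma dt_add: "dt u (v + w) = dt u v + dt u w" and dt_diff: "dt u (v - w) = dt u v - dt u w"
  and dt_smult [simp]: "dt u (c *s v) = c * dt u v" and dt_smult_left [simp]: "dt (c *s u) v = c * dt u v"
  and dt_comm: "dt u v = dt v u" and dt_zero [simp]: "dt u 0 = 0" "dt 0 u = 0"
  by (simp_all add: v3 algebra_simps)

lemma dt_cr [simp]: "dt (cr u v) u = 0" "dt (cr u v) v = 0"
  by (simp_all add: v3 algebra_simps)

lemma smult_zero [simp]: "0 *s (v::'k::field^3) = 0" "c *s (0::'k^3) = 0"
  by (simp_all add: vec_eq_iff)

lemma smult_eq_0: "c *s (v::'k::field^3) = 0 \<longleftrightarrow> c = 0 \<or> v = 0"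
  by (auto simp: vec_eq_iff)

lemma nonzero_nth: "(v::'k::field^3) \<noteq> 0 ==> \<exists>i. v$i \<noteq> 0"
  by (auto simp: vec_eq_iff)

lemma cr_eq_0D:
  fixes e u :: "'k::field^3"
  assumes "cr e u = 0" "e \<noteq> 0"
  obtains c where "u = c *s e"
proof -
  obtain i where i: "e$i \<noteq> 0" using nonzero_nth[OF assms(2)] by auto
  have "cr e u $ 1 = 0" "cr e u $ 2 = 0" "cr e u $ 3 = 0" by (simp_all only: assms(1) zero_index)
  then have eq: "e$1*u$2 = e$2*u$1" "e$3*u$1 = e$1*u$3" "e$2*u$3 = e$3*u$2"
    unfolding cr_nth by (simp_all only: right_minus_eq)
  have "e$i * u$j = e$j * u$i" for j
    using exhaust_3[of i] exhaust_3[of j] eq by auto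
  then have "u = (u$i/e$i) *s e"
    using i by (simp add: vec_eq_iff field_simps)
  then show thesis by (rule that)
qed

lemma cr_cr: "cr (cr e y) a = dt e a *s y - dt y a *s e"
  by (simp add: v3 algebra_simps)

text \<open>Both \<open>e \<times> y\<close> and the coefficient vector \<open>a\<close> are orthogonal to \<open>e\<close> and \<open>y\<close>.\<close>

lemma cr_parallel_normal:
  assumes "dt a e = 0" "dt a y = 0" "a \<noteq> 0"
  obtains c where "cr e y = c *s (a :: 'k::field^3)"
proof -
  have "cr (cr e y) a = 0" using assms by (simp add: cr_cr dt_comm[of e] dt_comm[of y])
  then have "cr a (cr e y) = 0" by (subst cr_swap) simp
  then show thesis using cr_eq_0D assms(3) that by metis
qed

lemma norm_smult [simp]: "norm (c *s v) = norm c * norm (v::'k::real_normed_field^3)"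
  by (simp add: norm_vec_def norm_mult L2_set_right_distrib)

lemma continuous_on_vec3: "(\<And>i. continuous_on S (\<lambda>x. f x $ i)) ==> continuous_on S (f :: _ => 'k::real_normed_field^3)"
  using continuous_on_vec_lambda[of S "\<lambda>i x. f x $ i"] by simp

lemma tendsto_vec3: "(\<And>i. ((\<lambda>x. f x $ i) \<longlongrightarrow> l $ i) F) ==> ((f :: _ => 'k::real_normed_field^3) \<longlongrightarrow> l) F"
  by (rule vec_tendstoI)

lemma cr_nth_cases: "\<exists>j k. \<forall>u v. cr u v $ i = u$j * v$k - u$k * (v::'k::field^3)$j"
  using exhaust_3[of i] cr_nth by metis

lemma continuous_on_cr [continuous_intros]:
  assumes "continuous_on S f" "continuous_on S g"
  shows "continuous_on S (\<lambda>x. cr (f x) (g x :: 'k::real_normed_field^3))"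
proof (rule continuous_on_vec3)
  fix i obtain j k where "\<forall>u v. cr u v $ i = u$j * v$k - u$k * (v::'k^3)$j"
    using cr_nth_cases[where 'k='k] by blast
  then show "continuous_on S (\<lambda>x. cr (f x) (g x) $ i)"
    by (auto intro!: continuous_intros assms)
qed

lemma continuous_on_dt [continuous_intros]:
  assumes "continuous_on S f" "continuous_on S g"
  shows "continuous_on S (\<lambda>x. dt (f x) (g x :: 'k::real_normed_field^3))"
  unfolding dt_def by (intro continuous_intros assms)

lemma continuous_on_smult [continuous_intros]:
  assumes "continuous_on S f" "continuous_on S g"
  shows "continuous_on S (\<lambda>x. f x *s (g x :: 'k::real_normed_field^3))"
  by (rule continuous_on_vec3) (auto intro!: continuous_intros assms)

section \<open>Polynomial functions\<close>

lemma has_derivative_vec3: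
  fixes f :: "'a::real_normed_vector => 'k::real_normed_field^3"
  assumes "\<And>i. ((\<lambda>x. f x $ i) has_derivative (\<lambda>x. f' x $ i)) F"
  shows "(f has_derivative f') F"
proof -
  have expand: "v = (\<Sum>i\<in>UNIV. v $ i *s axis i 1)" for v :: "'k^3"
    by (simp add: vec_eq_iff axis_def if_distrib[where f="\<lambda>x. _ * x"] cong: if_cong)
  have bl: "bounded_linear (\<lambda>x. x *s (w::'k^3))" for w
    by (rule bounded_linear_intro[where K="norm w"]) (auto simp: vec_eq_iff algebra_simps)
  have "((\<lambda>x. \<Sum>i\<in>UNIV. f x $ i *s axis i 1) has_derivative (\<lambda>x. \<Sum>i\<in>UNIV. f' x $ i *s axis i 1)) F"
    by (intro has_derivative_sum bounded_linear.has_derivative[OF bl] assms)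
  then show ?thesis using expand by (metis (no_types, lifting) ext)
qed

text \<open>Polynomial functions on \<open>K\<^sup>3\<close>, described by closure properties instead of coefficients:
  this makes them stable under composition and under taking partial derivatives.\<close>

inductive pfun :: "('k::real_normed_field ^ 3 => 'k) => bool" where
  pfun_const: "pfun (\<lambda>v. c)"
| pfun_coord: "pfun (\<lambda>v. v $ i)"
| pfun_add: "pfun f ==> pfun g ==> pfun (\<lambda>v. f v + g v)"
| pfun_mult: "pfun f ==> pfun g ==> pfun (\<lambda>v. f v * g v)"

lemma pfun_sum: "(\<And>i. i \<in> A ==> pfun (f i)) ==> pfun (\<lambda>v. \<Sum>i\<in>A. f i v)"
  by (induction A rule: infinite_finite_induct) (auto intro: pfun.intros)

lemma pfun_prod: "(\<And>i. i \<in> A ==> pfun (f i)) ==> pfun (\<lambda>v. \<Prod>i\<in>A. f i v)"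
  by (induction A rule: infinite_finite_induct) (auto intro: pfun.intros)

lemma pfun_power: "pfun f ==> pfun (\<lambda>v. f v ^ n)"
  by (induction n) (auto intro: pfun.intros)

lemma pfun_eval3: "pfun (eval3 P)"
  unfolding eval3_def by (intro pfun_sum pfun_mult pfun_const pfun_prod pfun_power pfun_coord)

lemma pfun_dt: "pfun (\<lambda>v. dt a v)"
  unfolding dt_def by (intro pfun_sum pfun_mult pfun_const pfun_coord)

lemma pfun_compose: "pfun f ==> (\<And>i. pfun (\<lambda>v. F v $ i)) ==> pfun (\<lambda>v. f (F v))"
  by (induction rule: pfun.induct) (auto intro: pfun.intros)

lemma pfun_evalmap: "pfun (\<lambda>v. evalmap F v $ i)"
  unfolding evalmap_def by (simp add: pfun_eval3)

lemma pfun_continuous: "pfun f ==> continuous_on S f"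
  by (induction rule: pfun.induct) (auto intro!: continuous_intros)

lemma pfun_holomorphic:
  assumes "pfun f" "\<And>i. (\<lambda>s. h s $ i) holomorphic_on S"
  shows "(\<lambda>s. f (h s)) holomorphic_on S"
  using assms(1) by induction (auto intro!: holomorphic_intros assms(2))

definition grad :: "('k::real_normed_field ^ 3 => 'k) => 'k ^ 3 => 'k ^ 3" where
  "grad f v = (\<chi> i. frechet_derivative f (at v) (axis i 1))"

lemma pfun_deriv_ex:
  "pfun f ==> \<exists>g. (\<forall>i. pfun (\<lambda>v. g v $ i)) \<and> (\<forall>v. (f has_derivative (\<lambda>w. dt (g v) w)) (at v))"
proof (induction rule: pfun.induct)
  case (pfun_const c)
  show ?case by (rule exI[of _ "\<lambda>v. 0"]) (auto intro!: pfun.intros derivative_eq_intros)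
next
  case (pfun_coord i)
  have "((\<lambda>v. v $ i) has_derivative (\<lambda>w. w $ i)) (at v)" for v :: "'a^3"
    by (intro bounded_linear_imp_has_derivative bounded_linear_vec_nth)
  moreover have "dt (axis i 1) w = w $ i" for w :: "'a^3"
    unfolding dt_def axis_def by (simp add: if_distrib[where f="\<lambda>x. x * _"] cong: if_cong)
  ultimately show ?case by (intro exI[of _ "\<lambda>v. axis i 1"]) (auto intro!: pfun.intros)
next
  case (pfun_add f g)
  then obtain a b where "\<forall>i. pfun (\<lambda>v. a v $ i)" "\<forall>v. (f has_derivative (\<lambda>w. dt (a v) w)) (at v)"
    "\<forall>i. pfun (\<lambda>v. b v $ i)" "\<forall>v. (g has_derivative (\<lambda>w. dt (b v) w)) (at v)" by blast
  then show ?case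
    by (intro exI[of _ "\<lambda>v. a v + b v"])
      (auto intro!: pfun.intros derivative_eq_intros simp: dt3 algebra_simps)
next
  case (pfun_mult f g)
  then obtain a b where ab: "\<forall>i. pfun (\<lambda>v. a v $ i)" "\<forall>v. (f has_derivative (\<lambda>w. dt (a v) w)) (at v)"
    "\<forall>i. pfun (\<lambda>v. b v $ i)" "\<forall>v. (g has_derivative (\<lambda>w. dt (b v) w)) (at v)" by blast
  have "((\<lambda>v. f v * g v) has_derivative (\<lambda>w. f v * dt (b v) w + dt (a v) w * g v)) (at v)" for v
    using has_derivative_mult ab(2,4) by blast
  moreover have "f v * dt (b v) w + dt (a v) w * g v = dt (f v *s b v + g v *s a v) w" for v w
    by (simp add: dt3 algebra_simps)
  ultimately show ?case
    using ab pfun_mult.hyps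
    by (intro exI[of _ "\<lambda>v. f v *s b v + g v *s a v"]) (auto intro!: pfun.intros)
qed

lemma
  assumes "pfun f"
  shows pfun_has_derivative: "(f has_derivative (\<lambda>w. dt (grad f v) w)) (at v)"
    and pfun_grad: "pfun (\<lambda>v. grad f v $ i)"
proof -
  obtain g where g: "\<And>i. pfun (\<lambda>v. g v $ i)" "\<And>v. (f has_derivative (\<lambda>w. dt (g v) w)) (at v)"
    using pfun_deriv_ex[OF assms] by blast
  have "grad f v = g v" for v
    using frechet_derivative_at[OF g(2)[of v], symmetric]
    by (simp add: grad_def vec_eq_iff dt_def axis_def if_distrib[where f="\<lambda>x. _ * x"] cong: if_cong)
  with g show "(f has_derivative (\<lambda>w. dt (grad f v) w)) (at v)" "pfun (\<lambda>v. grad f v $ i)"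
    by simp_all
qed

lemma pfun_frechet: "pfun f ==> frechet_derivative f (at v) = (\<lambda>w. dt (grad f v) w)"
  using pfun_has_derivative frechet_derivative_at by metis

lemma continuous_on_grad: "pfun f ==> continuous_on S (grad f)"
  by (rule continuous_on_vec3) (simp add: pfun_grad pfun_continuous)

lemma axis_dt: "dt a (axis i 1) = a $ i"
  by (simp add: dt_def axis_def if_distrib[where f="\<lambda>x. _ * x"] cong: if_cong)

lemma dt_ext: "(\<And>w. dt a w = dt b w) ==> a = b"
  by (metis axis_dt vec_eq_iff)

lemma pfun_along_line:
  assumes "pfun f"
  shows "((\<lambda>s. f (v + s *s w)) has_field_derivative dt (grad f (v + s *s w)) w) (at s)"
proof -
  have l: "((\<lambda>s. v + s *s w) has_derivative (\<lambda>x. x *s w)) (at s)"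
  proof (rule has_derivative_vec3)
    fix i
    show "((\<lambda>s. (v + s *s w) $ i) has_derivative (\<lambda>x. (x *s w) $ i)) (at s)"
      by (auto intro!: derivative_eq_intros)
  qed
  have "((\<lambda>s. f (v + s *s w)) has_derivative (\<lambda>x. dt (grad f (v + s *s w)) (x *s w))) (at s)"
    using has_derivative_compose[OF l pfun_has_derivative[OF assms]] by simp
  then show ?thesis
    by (simp add: has_field_derivative_def mult.commute[of _ "dt _ _"])
qed

text \<open>Polynomial maps have a derivative that is again computed by gradients.\<close>

definition jac :: "('k::real_normed_field ^ 3 => 'k ^ 3) => 'k ^ 3 => 'k ^ 3 => 'k ^ 3" where
  "jac F v w = (\<chi> i. dt (grad (\<lambda>u. F u $ i) v) w)"

lemma jac_has_derivative:
  assumes "\<And>i. pfun (\<lambda>v. F v $ i)"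
  shows "(F has_derivative jac F v) (at v)"
  by (rule has_derivative_vec3) (auto simp: jac_def intro: pfun_has_derivative assms)

lemma jac_smult: "jac F v (c *s w) = c *s jac F v w" and jac_add: "jac F v (w + w') = jac F v w + jac F v w'"
  and jac_diff: "jac F v (w - w') = jac F v w - jac F v w'"
  by (simp_all add: jac_def vec_eq_iff dt_add dt_diff)

lemma grad_compose:
  assumes "pfun f" "\<And>i. pfun (\<lambda>v. F v $ i)"
  shows "dt (grad (\<lambda>v. f (F v)) v) w = dt (grad f (F v)) (jac F v w)"
proof -
  have "((\<lambda>v. f (F v)) has_derivative (\<lambda>w. dt (grad f (F v)) (jac F v w))) (at v)"
    by (rule has_derivative_compose[where f=F and g=f, OF jac_has_derivative pfun_has_derivative])
      (rule assms)+
  moreover have "((\<lambda>v. f (F v)) has_derivative (\<lambda>w. dt (grad (\<lambda>v. f (F v)) v) w)) (at v)"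
    by (rule pfun_has_derivative[OF pfun_compose[OF assms]])
  ultimately show ?thesis using has_derivative_unique by metis
qed

lemma grad_homogeneous:
  assumes "pfun f" "\<And>c v. f (c *s v) = c ^ m * f v"
  shows "c *s grad f (c *s v) = c ^ m *s grad f v"
proof (rule dt_ext)
  fix w
  have "((\<lambda>s. f (c *s v + s *s (c *s w))) has_field_derivative dt (grad f (c *s v + 0 *s (c *s w))) (c *s w)) (at 0)"
    by (rule pfun_along_line[OF assms(1)])
  moreover have "((\<lambda>s. c ^ m * f (v + s *s w)) has_field_derivative c ^ m * dt (grad f (v + 0 *s w)) w) (at 0)"
    by (rule DERIV_cmult[OF pfun_along_line[OF assms(1)]])
  moreover have "f (c *s v + s *s (c *s w)) = c ^ m * f (v + s *s w)" for s
    using assms(2)[of c "v + s *s w"] by (simp add: vector_add_ldistrib vector_smult_assoc mult.commute)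
  ultimately have "dt (grad f (c *s v)) (c *s w) = c ^ m * dt (grad f v) w"
    using DERIV_unique by auto
  then show "dt (c *s grad f (c *s v)) w = dt (c ^ m *s grad f v) w" by simp
qed

lemma euler_identity:
  assumes "pfun f" "\<And>c v. f (c *s v) = c ^ m * f v"
  shows "dt (grad f v) v = of_nat m * f v"
proof -
  have "((\<lambda>s. f (v + s *s v)) has_field_derivative dt (grad f (v + 0 *s v)) v) (at 0)"
    by (rule pfun_along_line[OF assms(1)])
  moreover have "((\<lambda>s. (1 + s) ^ m * f v) has_field_derivative of_nat m * f v) (at 0)"
    by (auto intro!: derivative_eq_intros)
  moreover have "f (v + s *s v) = (1 + s) ^ m * f v" for s
    using assms(2)[of "1 + s" v] by (simp add: vector_sadd_rdistrib)
  ultimately show ?thesis using DERIV_unique by auto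
qed

lemma jac_homogeneous:
  assumes "\<And>i. pfun (\<lambda>v. F v $ i)" "\<And>c v. F (c *s v) = c ^ d *s F v"
  shows "jac F (c *s v) (c *s w) = c ^ d *s jac F v w"
proof -
  have "dt (grad (\<lambda>u. F u $ i) (c *s v)) (c *s w) = dt (c *s grad (\<lambda>u. F u $ i) (c *s v)) w" for i by simp
  moreover have "c *s grad (\<lambda>u. F u $ i) (c *s v) = c ^ d *s grad (\<lambda>u. F u $ i) v" for i
    by (rule grad_homogeneous[OF assms(1)]) (simp add: assms(2))
  ultimately show ?thesis by (simp add: jac_def vec_eq_iff)
qed

lemma jac_euler:
  assumes "\<And>i. pfun (\<lambda>v. F v $ i)" "\<And>c v. F (c *s v) = c ^ d *s F v"
  shows "jac F v v = of_nat d *s F v"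
proof -
  have "dt (grad (\<lambda>u. F u $ i) v) v = of_nat d * F v $ i" for i
    by (rule euler_identity[OF assms(1)]) (simp add: assms(2))
  then show ?thesis by (simp add: jac_def vec_eq_iff)
qed

lemma evalmap_frechet: "frechet_derivative (evalmap F) (at v) = jac (evalmap F) v"
  using frechet_derivative_at[OF jac_has_derivative[of "evalmap F" v, OF pfun_evalmap]] by simp

lemma evalmap_scale: "rational_map d F ==> evalmap F (c *s v) = c ^ d *s evalmap F v"
  by (simp add: rational_map_def evalmap_def vec_eq_iff eval3_scale)

lemma continuous_on_evalmap: "continuous_on S (evalmap (F :: 'k::real_normed_field polymap))"
  by (rule continuous_on_vec3) (rule pfun_continuous[OF pfun_evalmap])

lemma evalmap_nonzero: "rational_map d F ==> evalmap F v \<noteq> 0 ==> v \<noteq> 0"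
  using evalmap_scale[of d F 0 v] by (auto simp: rational_map_def power_0_left)

section \<open>Lines and points of the projective plane\<close>

lemma single_one_eq_iff: "Poly_Mapping.single i (1::nat) = Poly_Mapping.single j 1 \<longleftrightarrow> i = j"
  by (metis lookup_single_eq lookup_single_not_eq zero_neq_one)

lemma linear_form_dt:
  assumes "linear_form H"
  obtains a where "a \<noteq> 0" "eval3 H = dt a"
proof -
  let ?e = "\<lambda>i::3. Poly_Mapping.single i (1::nat)"
  define a where "a = (\<chi> i. Poly_Mapping.lookup H (?e i))"
  have key: "m \<in> range ?e" if "m \<in> Poly_Mapping.keys H" for m
  proof -
    have "Poly_Mapping.lookup m 1 + Poly_Mapping.lookup m 2 + Poly_Mapping.lookup m 3 = 1"
      using assms that by (auto simp: linear_form_def homogeneous_def sum_3)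
    then consider "Poly_Mapping.lookup m 1 = 1 \<and> Poly_Mapping.lookup m 2 = 0 \<and> Poly_Mapping.lookup m 3 = 0"
      | "Poly_Mapping.lookup m 1 = 0 \<and> Poly_Mapping.lookup m 2 = 1 \<and> Poly_Mapping.lookup m 3 = 0"
      | "Poly_Mapping.lookup m 1 = 0 \<and> Poly_Mapping.lookup m 2 = 0 \<and> Poly_Mapping.lookup m 3 = 1" by linarith
    then have "m = ?e 1 \<or> m = ?e 2 \<or> m = ?e 3"
      by cases (auto simp: poly_mapping_eq_iff fun_eq_iff forall_3 lookup_single)
    then show ?thesis by blast
  qed
  have inj: "inj ?e" by (rule injI) (simp only: single_one_eq_iff)
  have prod: "(\<Prod>j\<in>UNIV. v $ j ^ Poly_Mapping.lookup (?e i) j) = v $ i" for v :: "'a^3" and i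
  proof -
    have "v $ j ^ Poly_Mapping.lookup (?e i) j = (if j = i then v $ j else 1)" for j
      by (simp add: lookup_single when_def)
    then show ?thesis by simp
  qed
  have ev: "eval3 H v = dt a v" for v
  proof -
    have "eval3 H v = (\<Sum>m\<in>range ?e. Poly_Mapping.lookup H m * (\<Prod>i\<in>UNIV. v $ i ^ Poly_Mapping.lookup m i))"
      unfolding eval3_def using key by (intro sum.mono_neutral_left) (auto simp: in_keys_iff)
    also have "\<dots> = (\<Sum>i\<in>UNIV. a $ i * v $ i)"
      by (subst sum.reindex[OF inj]) (simp add: prod a_def del: One_nat_def)
    finally show ?thesis by (simp add: dt_def)
  qed
  have "H \<noteq> 0" using assms by (simp add: linear_form_def)
  then obtain m where "m \<in> Poly_Mapping.keys H" by (metis equals0I keys_eq_empty)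
  then obtain i where "a $ i \<noteq> 0" using key[of m] by (auto simp: a_def in_keys_iff)
  then have "a \<noteq> 0" by auto
  then show thesis using that ev by blast
qed

lemma dt_linear_form:
  assumes "a \<noteq> (0::'k::field^3)"
  obtains H where "linear_form H" "eval3 H = dt a"
proof -
  let ?e = "\<lambda>i::3. Poly_Mapping.single i (1::nat)"
  define H where "H = (\<Sum>i\<in>UNIV. Poly_Mapping.single (?e i) (a $ i))"
  have lk: "Poly_Mapping.lookup H (?e i) = a $ i" for i
  proof -
    have "Poly_Mapping.lookup H (?e i) = (\<Sum>j\<in>UNIV. if j = i then a $ j else 0)"
      unfolding H_def lookup_sum lookup_single when_def single_one_eq_iff by simp
    then show ?thesis by simp
  qed
  have keys: "Poly_Mapping.keys H \<subseteq> range ?e"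
  proof -
    have "Poly_Mapping.keys H \<subseteq> (\<Union>i\<in>UNIV. Poly_Mapping.keys (Poly_Mapping.single (?e i) (a $ i)))"
      unfolding H_def by (rule keys_sum)
    then show ?thesis by (fastforce split: if_splits)
  qed
  have "homogeneous 1 H"
    unfolding homogeneous_def
  proof
    fix m assume "m \<in> Poly_Mapping.keys H"
    then obtain i where "m = ?e i" using keys by blast
    then show "(\<Sum>j\<in>UNIV. Poly_Mapping.lookup m j) = 1"
      by (simp add: lookup_single when_def)
  qed
  moreover obtain i where "a $ i \<noteq> 0" using nonzero_nth assms by blast
  then have "H \<noteq> 0" using lk[of i] by auto
  ultimately have lf: "linear_form H" by (simp add: linear_form_def)
  then obtain b where b: "eval3 H = dt b" by (rule linear_form_dt)
  have "b $ i = a $ i" for i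
  proof -
    have "(\<Prod>j\<in>UNIV. (axis i 1 :: 'k^3) $ j ^ Poly_Mapping.lookup (?e l) j) = (if l = i then 1 else 0)" for l
    proof -
      have "(axis i 1 :: 'k^3) $ j ^ Poly_Mapping.lookup (?e l) j = (if j = l then (if l = i then 1 else 0) else 1)" for j
        by (auto simp: lookup_single when_def axis_def)
      then show ?thesis by simp
    qed
    moreover have "eval3 H (axis i 1) =
        (\<Sum>m\<in>range ?e. Poly_Mapping.lookup H m * (\<Prod>j\<in>UNIV. (axis i 1 :: 'k^3) $ j ^ Poly_Mapping.lookup m j))"
      unfolding eval3_def using keys by (intro sum.mono_neutral_left) (auto simp: in_keys_iff)
    moreover have "inj ?e" by (rule injI) (simp only: single_one_eq_iff)
    ultimately have "eval3 H (axis i 1) = (\<Sum>l\<in>UNIV. a $ l * (if l = i then 1 else 0))"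
      by (simp add: sum.reindex lk del: One_nat_def)
    then have "eval3 H (axis i 1) = a $ i" by (simp add: if_distrib cong: if_cong)
    moreover have "dt b (axis i 1) = b $ i"
      by (simp add: dt_def axis_def if_distrib[where f="\<lambda>x. _ * x"] cong: if_cong)
    ultimately show ?thesis by (simp add: b)
  qed
  then have "eval3 H = dt a" using b by (metis vec_eq_iff)
  with lf show thesis by (rule that)
qed

lemma zero_set_iff:
  assumes "homogeneous m G" "v \<noteq> 0"
  shows "to_proj2 v \<in> zero_set G \<longleftrightarrow> eval3 G v = 0"
proof
  assume "to_proj2 v \<in> zero_set G"
  then obtain w where w: "w \<noteq> 0" "eval3 G w = 0" "to_proj2 w = to_proj2 v" by (auto simp: zero_set_def)
  then obtain c where "v = c *s w" using to_proj2_eq_iff assms(2) by blast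
  then show "eval3 G v = 0" using eval3_scale[OF assms(1)] w by simp
qed (use assms in \<open>auto simp: zero_set_def\<close>)

lemma indeterminacy_iff:
  assumes "rational_map d F" "v \<noteq> 0"
  shows "to_proj2 v \<in> indeterminacy F \<longleftrightarrow> evalmap F v = 0"
proof
  assume "to_proj2 v \<in> indeterminacy F"
  then obtain w where w: "w \<noteq> 0" "evalmap F w = 0" "to_proj2 w = to_proj2 v" by (auto simp: indeterminacy_def)
  then obtain c where "v = c *s w" using to_proj2_eq_iff assms(2) by blast
  then show "evalmap F v = 0" using evalmap_scale[OF assms(1)] w by simp
qed (use assms in \<open>auto simp: indeterminacy_def\<close>)

lemma linear_form_zero_set:
  assumes "linear_form H" "eval3 H = dt a" "v \<noteq> 0"
  shows "to_proj2 v \<in> zero_set H \<longleftrightarrow> dt a v = 0"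
  using zero_set_iff[of 1 H v] assms by (simp add: linear_form_def)

lemma to_proj2_smult: "c \<noteq> 0 ==> v \<noteq> 0 ==> to_proj2 (c *s v) = to_proj2 v"
  by (metis smult_eq_0 to_proj2_eq_iff)

lemma to_proj2_cases: obtains v where "p = to_proj2 v" "v \<noteq> 0"
  by (metis rep_proj2_nonzero to_proj2_rep)

text \<open>Elementarity on the level of coefficient vectors of lines: the whole plane with normal \<open>a\<close>
  through \<open>e\<close> is mapped into one plane through \<open>e\<close>.\<close>

lemma elementary_normal:
  assumes "rational_map d F" "elementary F (to_proj2 e)" "e \<noteq> 0" "a \<noteq> 0" "dt a e = 0"
  obtains a' where "a' \<noteq> 0" "dt a' e = 0" "\<And>x. dt a x = 0 ==> dt a' (evalmap F x) = 0"
proof -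
  obtain H where H: "linear_form H" "eval3 H = dt a" by (rule dt_linear_form[OF assms(4)])
  have "line (zero_set H)" using H by (auto simp: line_def)
  moreover have "to_proj2 e \<in> zero_set H" using linear_form_zero_set[OF H] assms by simp
  ultimately obtain L' where L': "line L'" "to_proj2 e \<in> L'" "ratmap F ` (zero_set H - indeterminacy F) \<subseteq> L'"
    using assms(2) unfolding elementary_def by blast
  then obtain H' where H': "linear_form H'" "L' = zero_set H'" by (auto simp: line_def)
  then obtain a' where a': "a' \<noteq> 0" "eval3 H' = dt a'" using linear_form_dt by blast
  show thesis
  proof
    show "a' \<noteq> 0" by fact
    show "dt a' e = 0" using linear_form_zero_set[OF H'(1) a'(2) assms(3)] L' H' by simp
    fix x assume x: "dt a x = 0"
    show "dt a' (evalmap F x) = 0"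
    proof (cases "evalmap F x = 0")
      case False
      then have "x \<noteq> 0" using evalmap_nonzero[OF assms(1)] by blast
      then have "to_proj2 x \<in> zero_set H - indeterminacy F"
        using linear_form_zero_set[OF H] x indeterminacy_iff[OF assms(1)] False by simp
      then have "to_proj2 (evalmap F x) \<in> L'"
        using L'(3) ratmap_to_proj2[OF assms(1) \<open>x \<noteq> 0\<close> False] by fastforce
      then show ?thesis using linear_form_zero_set[OF H'(1) a'(2) False] H' by simp
    qed simp
  qed
qed

lemma elementary_parallel:
  assumes "rational_map d F" "elementary F (to_proj2 e)" "e \<noteq> 0"
    "cr e v \<noteq> 0" "cr e (evalmap F v) \<noteq> 0" "dt (cr e v) x = 0"
  obtains c where "cr e (evalmap F x) = c *s cr e (evalmap F v)"
proof -
  obtain a where a: "a \<noteq> 0" "dt a e = 0" "\<And>x. dt (cr e v) x = 0 ==> dt a (evalmap F x) = 0"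
    using elementary_normal[OF assms(1-4)] dt_cr by metis
  obtain c where c: "cr e (evalmap F v) = c *s a"
    using cr_parallel_normal[of a e "evalmap F v"] a dt_cr(2) by metis
  obtain c' where c': "cr e (evalmap F x) = c' *s a"
    using cr_parallel_normal[of a e "evalmap F x"] a assms(6) by metis
  have "c \<noteq> 0" using c assms(5) by auto
  then have "cr e (evalmap F x) = (c'/c) *s cr e (evalmap F v)"
    using c c' by (simp add: vector_smult_assoc)
  then show thesis by (rule that)
qed

lemma coeff_mult_degree_le:
  fixes p q :: "'a::comm_ring_1 poly"
  assumes "degree p \<le> a" "degree q \<le> b"
  shows "coeff (p * q) (a + b) = coeff p a * coeff q b"
proof -
  have "(\<Sum>i\<le>a + b. coeff p i * coeff q (a + b - i)) = (\<Sum>i\<in>{a}. coeff p i * coeff q (a + b - i))"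
  proof (rule sum.mono_neutral_right)
    show "\<forall>i\<in>{..a + b} - {a}. coeff p i * coeff q (a + b - i) = 0"
    proof
      fix i assume i: "i \<in> {..a + b} - {a}"
      then have "a < i \<or> b < a + b - i" by auto
      then show "coeff p i * coeff q (a + b - i) = 0" 
        using assms coeff_eq_0[of p i] coeff_eq_0[of q "a + b - i"] by auto
    qed
  qed auto
  then show ?thesis by (simp add: coeff_mult)
qed

text \<open>On a line with direction \<open>e\<close>, a form of degree \<open>m\<close> is a polynomial of one variable with
  leading coefficient its value at \<open>e\<close>.\<close>

lemma eval3_line_poly:
  assumes "homogeneous m G"
  obtains p where "\<And>z. poly p z = eval3 G (v + z *s e)" "degree p \<le> m" "coeff p m = eval3 G e"
proof -
  have pow: "degree ([:a, b:] ^ n) \<le> n \<and> coeff ([:a, b:] ^ n) n = b ^ n" for a b :: 'a and n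
  proof (induction n)
    case (Suc n)
    have d1: "degree [:a, b:] \<le> 1" by simp
    then have "degree ([:a, b:] * [:a, b:] ^ n) \<le> 1 + n"
      using Suc by (intro order_trans[OF degree_mult_le] add_mono) auto
    moreover have "coeff ([:a, b:] * [:a, b:] ^ n) (1 + n) = coeff [:a, b:] 1 * coeff ([:a, b:] ^ n) n"
      using Suc d1 by (intro coeff_mult_degree_le) auto
    ultimately show ?case using Suc by (simp del: mult_pCons_left mult_pCons_right)
  qed simp
  have pr: "degree (\<Prod>i\<in>A. [:v$i, e$i:] ^ k i) \<le> (\<Sum>i\<in>A. k i) \<and>
      coeff (\<Prod>i\<in>A. [:v$i, e$i:] ^ k i) (\<Sum>i\<in>A. k i) = (\<Prod>i\<in>A. (e$i) ^ k i)" if "finite A" for A and k :: "3 => nat"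
    using that
  proof (induction A rule: finite_induct)
    case (insert x A)
    let ?p = "[:v$x, e$x:] ^ k x" and ?q = "\<Prod>i\<in>A. [:v$i, e$i:] ^ k i"
    have "degree (?p * ?q) \<le> k x + (\<Sum>i\<in>A. k i)"
      using pow insert by (intro order_trans[OF degree_mult_le] add_mono) auto
    moreover have "coeff (?p * ?q) (k x + (\<Sum>i\<in>A. k i)) = coeff ?p (k x) * coeff ?q (\<Sum>i\<in>A. k i)"
      using pow insert by (intro coeff_mult_degree_le) auto
    ultimately show ?case using insert pow by simp
  qed simp
  define p where "p = (\<Sum>m\<in>Poly_Mapping.keys G. smult (Poly_Mapping.lookup G m) (\<Prod>i\<in>UNIV. [:v$i, e$i:] ^ Poly_Mapping.lookup m i))"
  have deg: "(\<Sum>i\<in>UNIV. Poly_Mapping.lookup k i) = m" if "k \<in> Poly_Mapping.keys G" for k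
    using assms that by (auto simp: homogeneous_def)
  show thesis
  proof
    show "poly p z = eval3 G (v + z *s e)" for z
      by (simp add: p_def eval3_def poly_sum poly_prod poly_power mult.commute)
    show "degree p \<le> m"
      unfolding p_def by (intro degree_sum_le finite_keys order_trans[OF degree_smult_le]) (use pr[of UNIV] deg in force)
    show "coeff p m = eval3 G e"
      unfolding p_def coeff_sum eval3_def by (rule sum.cong) (use pr[of UNIV] deg in force)+
  qed
qed

section \<open>Topology of the projective plane\<close>

lemma open_proj2_iff: "open (U :: 'k::real_normed_field proj2 set) \<longleftrightarrow> open {v. v \<noteq> 0 \<and> to_proj2 v \<in> U}"
  by (simp add: open_proj2_def)

lemma continuous_on_to_proj2:
  fixes h :: "'a::topological_space => 'k::real_normed_field ^ 3"
  assumes "continuous_on S h" "\<And>x. x \<in> S ==> h x \<noteq> 0"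
  shows "continuous_on S (\<lambda>x. to_proj2 (h x))"
proof -
  have "continuous_on {v::'k^3. v \<noteq> 0} to_proj2"
    unfolding continuous_on_open_invariant
  proof (intro allI impI)
    fix B :: "'k proj2 set" assume "open B"
    then show "\<exists>A. open A \<and> A \<inter> {v. v \<noteq> 0} = to_proj2 -` B \<inter> {v. v \<noteq> 0}"
      by (intro exI[of _ "{v. v \<noteq> 0 \<and> to_proj2 v \<in> B}"]) (auto simp: open_proj2_iff)
  qed
  then show ?thesis
    by (rule continuous_on_compose2[where g = to_proj2 and f = h, OF _ assms(1)]) (use assms(2) in auto)
qed

text \<open>A function on the cone that does not depend on the scale defines an open set of the plane.\<close>

lemma open_to_proj2_Collect:
  fixes f :: "'k::real_normed_field ^ 3 => 'b::topological_space"
  assumes "continuous_on {v. v \<noteq> 0} f" "open U" "\<And>c v. c \<noteq> 0 ==> v \<noteq> 0 ==> f (c *s v) \<in> U \<longleftrightarrow> f v \<in> U"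
  shows "open {to_proj2 v | v. v \<noteq> 0 \<and> f v \<in> U}"
proof -
  have "{w. w \<noteq> 0 \<and> to_proj2 w \<in> {to_proj2 v | v. v \<noteq> 0 \<and> f v \<in> U}} = {w. w \<noteq> 0} \<inter> f -` U"
  proof (intro equalityI subsetI; clarsimp)
    fix w v assume "w \<noteq> 0" "to_proj2 w = to_proj2 v" "v \<noteq> 0" "f v \<in> U"
    then obtain c where "w = c *s v" by (metis to_proj2_eq_iff)
    then show "f w \<in> U" using assms(3) \<open>w \<noteq> 0\<close> \<open>v \<noteq> 0\<close> \<open>f v \<in> U\<close> by auto
  next
    fix w assume "w \<noteq> 0" "f w \<in> U"
    then show "\<exists>v. to_proj2 w = to_proj2 v \<and> v \<noteq> 0 \<and> f v \<in> U" by blast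
  qed
  moreover have "open ({w. w \<noteq> 0} \<inter> f -` U)"
    by (rule continuous_open_preimage[OF assms(1) _ assms(2)])
      (simp add: open_Collect_neq continuous_on_const continuous_on_id)
  ultimately show ?thesis by (simp add: open_proj2_iff)
qed

instance proj2 :: (real_normed_field) t2_space
proof
  fix p q :: "'a proj2" assume "p \<noteq> q"
  obtain v w where vw: "p = to_proj2 v" "v \<noteq> 0" "q = to_proj2 w" "w \<noteq> 0"
    by (metis to_proj2_cases)
  define f where "f = (\<lambda>x::'a^3. norm (cr v x) / norm x)"
  have "cr v w \<noteq> 0" using \<open>p \<noteq> q\<close> vw by (metis cr_eq_0D to_proj2_eq_iff)
  then have pos: "0 < f w" using vw by (simp add: f_def)
  have inv: "f (c *s x) = f x" if "c \<noteq> 0" for c x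
    using that by (simp add: f_def cr_smult)
  have cont: "continuous_on {x. x \<noteq> 0} f"
    unfolding f_def by (intro continuous_intros) auto
  define U where "U = {to_proj2 x | x. x \<noteq> 0 \<and> f x \<in> {..<f w/2}}"
  define V where "V = {to_proj2 x | x. x \<noteq> 0 \<and> f x \<in> {f w/2<..}}"
  have "open U" unfolding U_def by (rule open_to_proj2_Collect[OF cont]) (simp_all add: inv)
  moreover have "open V" unfolding V_def by (rule open_to_proj2_Collect[OF cont]) (simp_all add: inv)
  moreover have "p \<in> U"
  proof -
    have "f v \<in> {..<f w/2}" using pos by (simp add: f_def)
    then show ?thesis unfolding U_def vw(1) using vw(2) by blast
  qed
  moreover have "q \<in> V"
  proof -
    have "f w / 2 < f w" using pos by linarith
    then have "f w \<in> {f w/2<..}" by (simp only: greaterThan_iff)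
    with vw(3,4) show ?thesis unfolding V_def by blast
  qed
  moreover have "U \<inter> V = {}"
  proof -
    have same: "f x = f y" if xy: "to_proj2 x = to_proj2 y" "x \<noteq> 0" "y \<noteq> 0" for x y
    proof -
      obtain c where c: "y = c *s x" using to_proj2_eq_iff[OF xy(2,3)] xy(1) by blast
      then have "c \<noteq> 0" using xy by auto
      then show ?thesis using inv c by simp
    qed
    show ?thesis
    proof (rule ccontr)
      assume "U \<inter> V \<noteq> {}"
      then obtain x y where "to_proj2 x = to_proj2 y" "x \<noteq> 0" "y \<noteq> 0" "f x < f w/2" "f w/2 < f y"
        unfolding U_def V_def by (auto simp: set_eq_iff)
      then show False using same[of x y] by linarith
    qed
  qed
  ultimately show "\<exists>U V. open U \<and> open V \<and> p \<in> U \<and> q \<in> V \<and> U \<inter> V = {}" by blast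
qed

definition pcone :: "'k::real_normed_field proj2 set => ('k ^ 3) set" where
  "pcone U = {v. v \<noteq> 0 \<and> to_proj2 v \<in> U}"

lemma pcone_smult: "c \<noteq> 0 ==> c *s v \<in> pcone U \<longleftrightarrow> v \<in> pcone U"
  by (auto simp: pcone_def smult_eq_0 to_proj2_smult)

lemma compact_pcone_sphere:
  fixes X :: "'k::{real_normed_field,euclidean_space} proj2 set"
  assumes "compact X"
  shows "compact (pcone X \<inter> sphere 0 1)"
proof -
  have "open {v. v \<noteq> 0 \<and> to_proj2 v \<in> - X}"
    using compact_imp_closed[OF assms] open_proj2_iff[of "- X"] by (simp add: open_Compl)
  moreover have "pcone X \<inter> sphere 0 1 = sphere 0 1 - {v. v \<noteq> 0 \<and> to_proj2 v \<in> - X}"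
    by (auto simp: pcone_def)
  ultimately show ?thesis by (simp add: compact_diff)
qed

lemma closed_indeterminacy: "rational_map d F ==> closed (indeterminacy (F :: 'k::real_normed_field polymap))"
proof -
  assume F: "rational_map d F"
  have "{v. v \<noteq> 0 \<and> to_proj2 v \<in> - indeterminacy F} = {v. v \<noteq> 0} \<inter> {v. evalmap F v \<noteq> 0}"
    using indeterminacy_iff[OF F] by auto
  moreover have "open \<dots>"
    by (intro open_Int open_Collect_neq continuous_on_evalmap continuous_on_const continuous_on_id)
  ultimately show ?thesis by (simp add: closed_def open_proj2_iff)
qed

lemma continuous_on_ratmap:
  assumes "rational_map d (F :: 'k::real_normed_field polymap)"
  shows "continuous_on (- indeterminacy F) (ratmap F)"
proof -
  have op: "open (ratmap F -` U \<inter> - indeterminacy F)" if "open U" for U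
  proof -
    have "{v. v \<noteq> 0 \<and> to_proj2 v \<in> ratmap F -` U \<inter> - indeterminacy F} = evalmap F -` {v. v \<noteq> 0 \<and> to_proj2 v \<in> U}"
      using indeterminacy_iff[OF assms] ratmap_to_proj2[OF assms] evalmap_nonzero[OF assms] by auto
    moreover have "open \<dots>"
      using that by (intro open_vimage continuous_on_evalmap) (simp add: open_proj2_iff)
    ultimately show ?thesis by (simp add: open_proj2_iff)
  qed
  show ?thesis unfolding continuous_on_open_invariant using op by blast
qed

lemma ratmap_borel_measurable:
  assumes "rational_map d (F :: 'k::{real_normed_field,euclidean_space} polymap)"
  shows "ratmap F \<in> borel \<rightarrow>\<^sub>M borel"
proof (rule borel_measurableI)
  fix U :: "'k proj2 set" assume U: "open U"
  obtain A where A: "open A" "A \<inter> - indeterminacy F = ratmap F -` U \<inter> - indeterminacy F"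
    using continuous_on_ratmap[OF assms] U unfolding continuous_on_open_invariant by blast
  have "evalmap F (rep_proj2 p) = 0" if "p \<in> indeterminacy F" for p
    using indeterminacy_iff[OF assms rep_proj2_nonzero, of p] that by simp
  then have "ratmap F -` U \<inter> space borel =
      (A - indeterminacy F) \<union> (if to_proj2 0 \<in> U then indeterminacy F else {})"
    using A by (auto simp: ratmap_def)
  then show "ratmap F -` U \<inter> space borel \<in> sets borel"
    using A closed_indeterminacy[OF assms] by auto
qed

text \<open>A compact set of the plane has a countable base of neighbourhoods, since its cone meets the
  sphere in a compact set. This makes the basin a Borel set.\<close>

lemma compact_nhd_base:
  fixes X :: "'k::{real_normed_field,euclidean_space} proj2 set"
  assumes "compact X"
  obtains B :: "nat => 'k proj2 set" where "\<And>n. open (B n)" "\<And>n. X \<subseteq> B n" "\<And>U. open U ==> X \<subseteq> U ==> \<exists>n. B n \<subseteq> U"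
proof (cases "X = {}")
  case True
  show thesis by (rule that[of "\<lambda>n. {}"]) (auto simp: True)
next
  case False
  let ?S = "pcone X \<inter> sphere 0 1"
  have unit: "\<exists>v\<in>?S. to_proj2 v = p" if "p \<in> X" for p
  proof -
    obtain v where v: "p = to_proj2 v" "v \<noteq> 0" by (rule to_proj2_cases)
    let ?c = "of_real (inverse (norm v)) :: 'k"
    have "to_proj2 (?c *s v) = p" using v by (subst to_proj2_smult) auto
    moreover have "?c *s v \<noteq> 0" using v by (simp add: smult_eq_0)
    ultimately show ?thesis using v that by (intro bexI[of _ "?c *s v"]) (auto simp: pcone_def norm_inverse)
  qed
  have ne: "?S \<noteq> {}" using False unit by blast
  define g where "g = (\<lambda>v::'k^3. infdist ((of_real (inverse (norm v)) :: 'k) *s v) ?S)"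
  have g_inv: "g (c *s v) = g v" if c: "c \<noteq> 0" "v \<noteq> 0" for c v
  proof -
    let ?u = "of_real (inverse (norm c)) * c"
    have u: "norm ?u = 1" using c by (simp add: norm_mult norm_inverse)
    have gen: "infdist (u *s w) ?S \<le> infdist w ?S" if u: "norm u = 1" for u :: 'k and w
    proof -
      have "infdist (u *s w) ?S \<le> dist w a" if a: "a \<in> ?S" for a
      proof -
        have "u *s a \<in> ?S" using a u pcone_smult[of u a X] by (cases "u = 0") auto
        then have "infdist (u *s w) ?S \<le> dist (u *s w) (u *s a)" by (rule infdist_le)
        also have "\<dots> = dist w a"
        proof -
          have "u *s w - u *s a = u *s (w - a)" by (simp add: vec_eq_iff algebra_simps)
          then show ?thesis by (simp only: dist_norm norm_smult u mult_1)
        qed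
        finally show ?thesis .
      qed
      then show ?thesis unfolding infdist_def[of w] using ne by (auto intro!: cINF_greatest)
    qed
    let ?w = "(of_real (inverse (norm v)) :: 'k) *s v"
    have "(of_real (inverse (norm (c *s v))) :: 'k) *s (c *s v) = ?u *s ?w"
      by (simp add: vector_smult_assoc mult_ac)
    moreover have "infdist (?u *s ?w) ?S = infdist ?w ?S"
    proof (rule antisym)
      have "inverse ?u * ?u = 1" using c by (intro left_inverse) auto
      then have eq: "inverse ?u *s (?u *s ?w) = ?w" by (metis vector_smult_assoc vector_smult_lid)
      have n1: "norm (inverse ?u) = 1" by (simp only: norm_inverse u inverse_1)
      have "infdist (inverse ?u *s (?u *s ?w)) ?S \<le> infdist (?u *s ?w) ?S" by (rule gen[OF n1])
      then show "infdist ?w ?S \<le> infdist (?u *s ?w) ?S" by (simp only: eq)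
    qed (rule gen[OF u])
    ultimately show ?thesis by (simp only: g_def)
  qed
  have g_cont: "continuous_on {v. v \<noteq> 0} g"
    unfolding g_def by (intro continuous_intros) auto
  define B where "B = (\<lambda>n::nat. {to_proj2 v | v. v \<noteq> 0 \<and> g v \<in> {..<inverse (real (Suc n))}})"
  have g_unit: "g v = infdist v ?S" if "norm v = 1" for v using that by (simp add: g_def)
  show thesis
  proof
    show "open (B n)" for n
      unfolding B_def by (rule open_to_proj2_Collect[OF g_cont]) (auto simp: g_inv)
    show "X \<subseteq> B n" for n
    proof
      fix p assume "p \<in> X"
      then obtain v where v: "v \<in> ?S" "to_proj2 v = p" using unit by blast
      then have "g v = 0" using g_unit[of v] by simp
      then show "p \<in> B n" using v by (auto simp: B_def pcone_def intro!: exI[of _ v])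
    qed
    fix U assume U: "open U" "X \<subseteq> U"
    have "open {v. v \<noteq> 0 \<and> to_proj2 v \<in> U}" using U by (simp add: open_proj2_iff)
    moreover have "?S \<subseteq> {v. v \<noteq> 0 \<and> to_proj2 v \<in> U}" using U by (auto simp: pcone_def)
    ultimately obtain \<epsilon> where \<epsilon>: "\<epsilon> > 0" "{x. infdist x ?S \<le> \<epsilon>} \<subseteq> {v. v \<noteq> 0 \<and> to_proj2 v \<in> U}"
      using compact_in_open_separated[OF ne compact_pcone_sphere[OF assms]] by blast
    obtain n where n: "inverse (real (Suc n)) < \<epsilon>" using reals_Archimedean \<epsilon> by blast
    have "B n \<subseteq> U"
    proof
      fix p assume "p \<in> B n"
      then obtain v where v: "p = to_proj2 v" "v \<noteq> 0" "g v < inverse (real (Suc n))" by (auto simp: B_def)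
      let ?w = "(of_real (inverse (norm v)) :: 'k) *s v"
      have "infdist ?w ?S \<le> \<epsilon>" using v n by (simp add: g_def)
      then have "to_proj2 ?w \<in> U" using \<epsilon> by blast
      then show "p \<in> U" using v to_proj2_smult[of "of_real (inverse (norm v))" v] by simp
    qed
    then show "\<exists>n. B n \<subseteq> U" ..
  qed
qed

lemma basin_borel:
  fixes F :: "'k::{real_normed_field,euclidean_space} polymap"
  assumes "rational_map d F" "compact X"
  shows "basin F X \<in> sets borel"
proof -
  obtain B :: "nat => 'k proj2 set" where B: "\<And>n. open (B n)" "\<And>n. X \<subseteq> B n"
      "\<And>U. open U ==> X \<subseteq> U ==> \<exists>n. B n \<subseteq> U"
    using compact_nhd_base[OF assms(2)] by blast
  have conv: "(\<forall>U. open U \<and> X \<subseteq> U --> (\<forall>\<^sub>F n in sequentially. q n \<in> U)) \<longleftrightarrow> (\<forall>m. \<exists>N. \<forall>n\<ge>N. q n \<in> B m)"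
    for q :: "nat => 'k proj2"
    using B unfolding eventually_sequentially by (meson subsetD)
  have iter: "(ratmap F ^^ n) \<in> borel \<rightarrow>\<^sub>M borel" for n
    by (induction n) (auto simp: o_def intro!: measurable_compose[OF _ ratmap_borel_measurable[OF assms(1)]])
  have eq: "basin F X = (\<Inter>n. (ratmap F ^^ n) -` (- indeterminacy F) \<inter> space borel) \<inter>
      (\<Inter>m. \<Union>N. \<Inter>n\<in>{N..}. (ratmap F ^^ n) -` B m \<inter> space borel)"
    unfolding basin_def conv by (rule set_eqI) (simp, simp add: Ball_def)
  have "(ratmap F ^^ n) -` (- indeterminacy F) \<inter> space borel \<in> sets borel"
    "(ratmap F ^^ n) -` B m \<inter> space borel \<in> sets borel" for n m
    using measurable_sets[OF iter, of "- indeterminacy F" n] measurable_sets[OF iter, of "B m" n]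
      closed_indeterminacy[OF assms(1)] B(1) by (simp_all add: borel_open borel_closed)
  then show ?thesis unfolding eq by (intro sets.Int sets.countable_INT'' sets.countable_UN' sets.countable_INT') auto
qed

section \<open>Expanding affine maps of a torus\<close>

locale fundamental_domain =
  fixes Q \<Omega> :: "'k::{real_normed_field,euclidean_space} set"
  assumes Q_borel [measurable]: "Q \<in> sets borel" and Q_bounded: "bounded Q"
    and Q_pos: "emeasure lborel Q > 0"
    and countable_\<Omega>: "countable \<Omega>" and minus_\<Omega>: "\<omega> \<in> \<Omega> ==> - \<omega> \<in> \<Omega>"
    and tiling: "\<exists>!\<omega>. \<omega> \<in> \<Omega> \<and> x + \<omega> \<in> Q"
begin

definition periodic :: "('k => 'b) => bool" where
  "periodic g \<longleftrightarrow> (\<forall>x. \<forall>\<omega>\<in>\<Omega>. g (x + \<omega>) = g x)"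

lemma Q_finite: "emeasure lborel Q < \<infinity>"
  using emeasure_bounded_finite[OF Q_bounded] by simp

lemma nn_integral_tiles: "(\<integral>\<^sup>+\<omega>. indicator Q (x + \<omega>) \<partial>count_space \<Omega>) = 1"
proof -
  obtain \<omega>0 where \<omega>0: "\<omega>0 \<in> \<Omega>" "x + \<omega>0 \<in> Q"
    and uniq: "\<And>\<omega>. \<omega> \<in> \<Omega> ==> x + \<omega> \<in> Q ==> \<omega> = \<omega>0"
    by (metis tiling[of x])
  have iff: "x + \<omega> \<in> Q \<longleftrightarrow> \<omega> = \<omega>0" if "\<omega> \<in> \<Omega>" for \<omega>
    using uniq[OF that] \<omega>0 by auto
  have "(\<integral>\<^sup>+\<omega>. indicator Q (x + \<omega>) \<partial>count_space \<Omega>) = (\<integral>\<^sup>+\<omega>. indicator {\<omega>0} \<omega> \<partial>count_space \<Omega>)"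
    using iff by (intro nn_integral_cong) (simp add: indicator_def)
  also have "\<dots> = 1" using \<omega>0(1) by (subst nn_integral_indicator) auto
  finally show ?thesis .
qed

lemma nn_integral_tiles_minus: "(\<integral>\<^sup>+\<omega>. indicator Q (x - \<omega>) \<partial>count_space \<Omega>) = 1"
proof -
  obtain \<omega>0 where \<omega>0: "\<omega>0 \<in> \<Omega>" "x + \<omega>0 \<in> Q"
    and uniq: "\<And>\<omega>. \<omega> \<in> \<Omega> ==> x + \<omega> \<in> Q ==> \<omega> = \<omega>0"
    by (metis tiling[of x])
  have iff: "x - \<omega> \<in> Q \<longleftrightarrow> \<omega> = - \<omega>0" if "\<omega> \<in> \<Omega>" for \<omega>
    using uniq[of "- \<omega>"] that minus_\<Omega>[OF that] \<omega>0 by auto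
  have "(\<integral>\<^sup>+\<omega>. indicator Q (x - \<omega>) \<partial>count_space \<Omega>) = (\<integral>\<^sup>+\<omega>. indicator {- \<omega>0} \<omega> \<partial>count_space \<Omega>)"
    using iff by (intro nn_integral_cong) (simp add: indicator_def)
  also have "\<dots> = 1" using minus_\<Omega>[OF \<omega>0(1)] by (subst nn_integral_indicator) auto
  finally show ?thesis .
qed

lemma nn_integral_lborel_shift:
  fixes f :: "'k => ennreal"
  assumes [measurable]: "f \<in> borel_measurable borel"
  shows "(\<integral>\<^sup>+x. f (x + y) \<partial>lborel) = (\<integral>\<^sup>+x. f x \<partial>lborel)"
proof -
  have "(\<integral>\<^sup>+x. f x \<partial>lborel) = (\<integral>\<^sup>+x. f x \<partial>distr lborel borel ((+) y))"
    by (simp add: lborel_distr_plus)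
  also have "\<dots> = (\<integral>\<^sup>+x. f (y + x) \<partial>lborel)" by (subst nn_integral_distr) auto
  finally show ?thesis by (simp add: add.commute)
qed

text \<open>Cutting the translate of \<open>Q\<close> by the tiles and moving every piece back to \<open>Q\<close>.\<close>

lemma nn_integral_translate:
  fixes g :: "'k => ennreal"
  assumes [measurable]: "g \<in> borel_measurable borel" and per: "periodic g"
  shows "(\<integral>\<^sup>+x\<in>Q. g (x + y) \<partial>lborel) = (\<integral>\<^sup>+x\<in>Q. g x \<partial>lborel)"
proof -
  have "(\<integral>\<^sup>+x\<in>Q. g (x + y) \<partial>lborel) =
      (\<integral>\<^sup>+x. \<integral>\<^sup>+\<omega>. g (x + y) * indicator Q x * indicator Q (x + y + \<omega>) \<partial>count_space \<Omega> \<partial>lborel)"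
    by (simp add: nn_integral_cmult nn_integral_tiles)
  also have "\<dots> = (\<integral>\<^sup>+\<omega>. \<integral>\<^sup>+x. g (x + y) * indicator Q x * indicator Q (x + y + \<omega>) \<partial>lborel \<partial>count_space \<Omega>)"
    by (rule nn_integral_count_space_nn_integral[OF countable_\<Omega>]) measurable
  also have "\<dots> = (\<integral>\<^sup>+\<omega>. \<integral>\<^sup>+x. g x * indicator Q x * indicator Q (x - y - \<omega>) \<partial>lborel \<partial>count_space \<Omega>)"
  proof (rule nn_integral_cong)
    fix \<omega> assume "\<omega> \<in> space (count_space \<Omega>)"
    then have \<omega>: "\<omega> \<in> \<Omega>" by simp
    have "(\<integral>\<^sup>+x. g x * indicator Q x * indicator Q (x - y - \<omega>) \<partial>lborel) =
        (\<integral>\<^sup>+x. g (x + (y + \<omega>)) * indicator Q (x + (y + \<omega>)) * indicator Q (x + (y + \<omega>) - y - \<omega>) \<partial>lborel)"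
      by (rule nn_integral_lborel_shift[symmetric]) measurable
    also have "\<dots> = (\<integral>\<^sup>+x. g (x + y) * indicator Q x * indicator Q (x + y + \<omega>) \<partial>lborel)"
      using per \<omega> by (intro nn_integral_cong) (simp add: periodic_def add.assoc[symmetric] mult_ac)
    finally show "(\<integral>\<^sup>+x. g (x + y) * indicator Q x * indicator Q (x + y + \<omega>) \<partial>lborel) =
        (\<integral>\<^sup>+x. g x * indicator Q x * indicator Q (x - y - \<omega>) \<partial>lborel)" by simp
  qed
  also have "\<dots> = (\<integral>\<^sup>+x. \<integral>\<^sup>+\<omega>. g x * indicator Q x * indicator Q (x - y - \<omega>) \<partial>count_space \<Omega> \<partial>lborel)"
    by (rule nn_integral_count_space_nn_integral[OF countable_\<Omega>, symmetric]) measurable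
  also have "\<dots> = (\<integral>\<^sup>+x\<in>Q. g x \<partial>lborel)"
    by (simp add: nn_integral_cmult nn_integral_tiles_minus)
  finally show ?thesis .
qed

end

locale torus_affine = fundamental_domain Q \<Omega> for Q \<Omega> :: "'k::{real_normed_field,euclidean_space} set" +
  fixes a b :: 'k
  assumes expand: "1 < norm a" and mult_\<Omega>: "\<omega> \<in> \<Omega> ==> a * \<omega> \<in> \<Omega>"
begin

definition T :: "'k => 'k" where "T x = a * x + b"

lemma a_nonzero: "a \<noteq> 0" using expand by auto

lemma T_measurable [measurable]: "T \<in> borel \<rightarrow>\<^sub>M borel"
  unfolding T_def by measurable

lemma periodic_T: "periodic g ==> periodic (\<lambda>x. g (T x))"
proof -
  assume g: "periodic g"
  have "T (x + \<omega>) = T x + a * \<omega>" for x \<omega> by (simp add: T_def algebra_simps)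
  then show ?thesis using g mult_\<Omega> by (simp add: periodic_def)
qed

lemma T_iter: "\<exists>c. \<forall>x. (T ^^ n) x = a ^ n * x + c"
proof (induction n)
  case (Suc n)
  then obtain c where c: "\<And>x. (T ^^ n) x = a ^ n * x + c" by blast
  have "(T ^^ Suc n) x = a ^ Suc n * x + (a * c + b)" for x
  proof -
    have "(T ^^ Suc n) x = T (a ^ n * x + c)" by (simp add: c)
    also have "\<dots> = a ^ Suc n * x + (a * c + b)" by (simp add: T_def algebra_simps)
    finally show ?thesis .
  qed
  then show ?case by blast
qed (rule exI[of _ 0], simp)

lemma T_iter_measurable [measurable]: "(T ^^ n) \<in> borel \<rightarrow>\<^sub>M borel"
  by (induction n) (auto simp: o_def intro: measurable_compose[OF _ T_measurable])

lemma periodic_T_iter: "periodic g ==> periodic (\<lambda>x. g ((T ^^ n) x))"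
proof (induction n)
  case (Suc n)
  then have "periodic (\<lambda>x. g ((T ^^ n) (T x)))" by (intro periodic_T)
  then show ?case by (simp add: funpow_Suc_right del: funpow.simps)
qed simp

text \<open>The push-forward of the invariant functional under \<open>T\<close> is again translation invariant, because
  \<open>T\<close> is onto; averaging it over all translations by \<open>Q\<close> shows that it equals the functional.\<close>

lemma nn_integral_T:
  fixes g :: "'k => ennreal"
  assumes [measurable]: "g \<in> borel_measurable borel" and per: "periodic g"
  shows "(\<integral>\<^sup>+x\<in>Q. g (T x) \<partial>lborel) = (\<integral>\<^sup>+x\<in>Q. g x \<partial>lborel)"
proof -
  have shift: "(\<integral>\<^sup>+x\<in>Q. g (T x) \<partial>lborel) = (\<integral>\<^sup>+x\<in>Q. g (T x + y) \<partial>lborel)" for y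
  proof -
    have "(\<integral>\<^sup>+x\<in>Q. g (T (x + y / a)) \<partial>lborel) = (\<integral>\<^sup>+x\<in>Q. g (T x) \<partial>lborel)"
      by (rule nn_integral_translate[OF _ periodic_T[OF per]]) measurable
    moreover have "T (x + y / a) = T x + y" for x
      using a_nonzero by (simp add: T_def field_simps)
    ultimately show ?thesis by simp
  qed
  have "emeasure lborel Q * (\<integral>\<^sup>+x\<in>Q. g (T x) \<partial>lborel) =
      (\<integral>\<^sup>+y. (\<integral>\<^sup>+x\<in>Q. g (T x) \<partial>lborel) * indicator Q y \<partial>lborel)"
    by (subst nn_integral_cmult_indicator) (auto simp: mult.commute)
  also have "\<dots> = (\<integral>\<^sup>+y. (\<integral>\<^sup>+x. g (T x + y) * indicator Q x * indicator Q y \<partial>lborel) \<partial>lborel)"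
  proof (rule nn_integral_cong)
    fix y
    show "(\<integral>\<^sup>+x\<in>Q. g (T x) \<partial>lborel) * indicator Q y = (\<integral>\<^sup>+x. g (T x + y) * indicator Q x * indicator Q y \<partial>lborel)"
      unfolding shift[of y] by (rule nn_integral_multc[symmetric]) measurable
  qed
  also have "\<dots> = (\<integral>\<^sup>+x. (\<integral>\<^sup>+y. g (T x + y) * indicator Q x * indicator Q y \<partial>lborel) \<partial>lborel)"
    by (rule lborel_pair.Fubini') measurable
  also have "\<dots> = (\<integral>\<^sup>+x. (\<integral>\<^sup>+y\<in>Q. g (y + T x) \<partial>lborel) * indicator Q x \<partial>lborel)"
    by (subst nn_integral_multc[symmetric]) (auto intro!: nn_integral_cong simp: mult_ac add.commute)
  also have "\<dots> = (\<integral>\<^sup>+x. (\<integral>\<^sup>+y\<in>Q. g y \<partial>lborel) * indicator Q x \<partial>lborel)"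
    by (subst nn_integral_translate[OF _ per]) auto
  also have "\<dots> = emeasure lborel Q * (\<integral>\<^sup>+y\<in>Q. g y \<partial>lborel)"
    by (subst nn_integral_cmult_indicator) (auto simp: mult.commute)
  finally show ?thesis
    using Q_pos Q_finite by (auto simp: ennreal_mult_cancel_left)
qed

text \<open>The maximal ergodic inequality, in the form that a function of negative mean has partial
  sums that are never positive on a set of positive measure. The functions \<open>mx n\<close> are the running
  maxima \<open>max 0 (S\<^sub>1, \<dots>, S\<^sub>n)\<close> of the partial sums.\<close>

primrec mx :: "('k => real) => nat => 'k => real" where
  "mx \<theta> 0 x = 0"
| "mx \<theta> (Suc n) x = max 0 (\<theta> x + mx \<theta> n (T x))"

lemma maximal_ergodic:
  fixes \<theta> :: "'k => real"
  assumes meas [measurable]: "\<theta> \<in> borel_measurable borel" and per: "periodic \<theta>"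
    and bd: "\<And>x. \<bar>\<theta> x\<bar> \<le> B"
    and neg: "(\<integral>x. \<theta> x \<partial>density lborel (indicator Q)) < 0"
  shows "emeasure lborel {x\<in>Q. \<forall>n. (\<Sum>k<n. \<theta> ((T ^^ k) x)) \<le> 0} > 0"
proof (rule ccontr)
  define M where "M = density lborel (indicator Q :: 'k => ennreal)"
  have [simp]: "sets M = sets borel" "space M = UNIV" by (simp_all add: M_def)
  have mxm [measurable]: "mx \<theta> n \<in> borel_measurable borel" for n
  proof (induction n)
    case (Suc n)
    have "(\<lambda>x. mx \<theta> n (T x)) \<in> borel_measurable borel" by (rule measurable_compose[OF T_measurable Suc])
    then show ?case by simp
  qed simp
  have mxM [measurable]: "mx \<theta> n \<in> borel_measurable M" "(\<lambda>x. mx \<theta> n (T x)) \<in> borel_measurable M"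
    "\<theta> \<in> borel_measurable M" for n
    using mxm meas measurable_compose[OF T_measurable mxm] by (simp_all add: measurable_def)
  have mxper: "periodic (mx \<theta> n)" for n
  proof (induction n)
    case (Suc n)
    then have "periodic (\<lambda>x. mx \<theta> n (T x))" by (rule periodic_T)
    then show ?case using per by (simp add: periodic_def)
  qed (simp add: periodic_def)
  have B0: "0 \<le> B" using bd[of 0] by linarith
  have mx0: "0 \<le> mx \<theta> n x" for n x by (cases n) auto
  have mxB: "mx \<theta> n x \<le> real n * B" for n x
  proof (induction n arbitrary: x)
    case (Suc n)
    show ?case using Suc[of "T x"] bd[of x] B0 by (simp add: algebra_simps)
  qed simp
  have mono: "mx \<theta> n x \<le> mx \<theta> (Suc n) x" for n x
  proof (induction n arbitrary: x)
    case (Suc n)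
    show ?case using Suc[of "T x"] unfolding mx.simps(2)[of _ n x] mx.simps(2)[of _ "Suc n" x]
      by (intro max.mono order_refl add_left_mono)
  qed simp
  have sum_le: "(\<Sum>k<n. \<theta> ((T ^^ k) x)) \<le> mx \<theta> n x" for n x
  proof (induction n arbitrary: x)
    case (Suc n)
    have "(\<Sum>k<Suc n. \<theta> ((T ^^ k) x)) = \<theta> x + (\<Sum>k<n. \<theta> ((T ^^ k) (T x)))"
      by (simp add: sum.lessThan_Suc_shift funpow_Suc_right del: funpow.simps sum.lessThan_Suc)
    then show ?case using Suc[of "T x"] by simp
  qed simp
  interpret M: finite_measure M
    using Q_finite by (intro finite_measureI) (simp add: M_def emeasure_density nn_integral_cmult_indicator)
  have int\<theta>: "integrable M \<theta>" using bd by (intro M.integrable_const_bound[of _ B]) auto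
  have intmx: "integrable M (mx \<theta> n)" "integrable M (\<lambda>x. mx \<theta> n (T x))" for n
    using mxB mx0 by (intro M.integrable_const_bound[of _ "real n * B"]; simp)+
  have inv: "(\<integral>x. mx \<theta> n (T x) \<partial>M) = (\<integral>x. mx \<theta> n x \<partial>M)" for n
  proof -
    have "(\<integral>\<^sup>+x. ennreal (mx \<theta> n (T x)) \<partial>M) = (\<integral>\<^sup>+x. ennreal (mx \<theta> n x) \<partial>M)"
      using nn_integral_T[of "\<lambda>x. ennreal (mx \<theta> n x)"] mxper[of n]
        measurable_compose[OF T_measurable mxm[of n]]
      by (simp add: M_def nn_integral_density periodic_def mult.commute)
    then show ?thesis by (subst (1 2) integral_eq_nn_integral) (auto simp: mx0)
  qed
  define A where "A n = {x. mx \<theta> (Suc n) x > 0}" for n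
  have A [measurable]: "A n \<in> sets borel" for n unfolding A_def by measurable
  have AM [measurable]: "(\<lambda>x. indicator (A n) x * \<theta> x) \<in> borel_measurable M" for n
    using A by (intro borel_measurable_times borel_measurable_indicator mxM) simp
  have Aint: "0 \<le> (\<integral>x. indicator (A n) x * \<theta> x \<partial>M)" for n
  proof -
    have "0 = (\<integral>x. mx \<theta> (Suc n) x - mx \<theta> (Suc n) (T x) \<partial>M)"
      using intmx inv by (subst Bochner_Integration.integral_diff) (auto simp del: mx.simps)
    also have "\<dots> \<le> (\<integral>x. indicator (A n) x * \<theta> x \<partial>M)"
    proof (rule integral_mono)
      show "integrable M (\<lambda>x. mx \<theta> (Suc n) x - mx \<theta> (Suc n) (T x))"
        using intmx by (intro Bochner_Integration.integrable_diff) (auto simp del: mx.simps)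
      show "integrable M (\<lambda>x. indicator (A n) x * \<theta> x)"
        using bd B0 AM by (intro M.integrable_const_bound[of _ B] AE_I2) (auto simp: indicator_def abs_mult)
      fix x
      show "mx \<theta> (Suc n) x - mx \<theta> (Suc n) (T x) \<le> indicator (A n) x * \<theta> x"
      proof (cases "x \<in> A n")
        case True
        then have "mx \<theta> (Suc n) x = \<theta> x + mx \<theta> n (T x)" by (auto simp: A_def)
        then show ?thesis using True mono[of n "T x"] by simp
      next
        case False
        then have "mx \<theta> (Suc n) x = 0" using mx0[of "Suc n" x] unfolding A_def by force
        then show ?thesis using False mx0[of "Suc n" "T x"] by simp
      qed
    qed
    finally show ?thesis .
  qed
  assume "\<not> 0 < emeasure lborel {x\<in>Q. \<forall>n. (\<Sum>k<n. \<theta> ((T ^^ k) x)) \<le> 0}"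
  then have null: "emeasure lborel {x\<in>Q. \<forall>n. (\<Sum>k<n. \<theta> ((T ^^ k) x)) \<le> 0} = 0" by simp
  have Em: "{x\<in>Q. \<forall>n. (\<Sum>k<n. \<theta> ((T ^^ k) x)) \<le> 0} \<in> sets lborel"
  proof -
    have "(\<lambda>x. \<theta> ((T ^^ k) x)) \<in> borel_measurable borel" for k
      by (rule measurable_compose[OF T_iter_measurable meas])
    then have "{x \<in> space borel. \<forall>n. (\<Sum>k<n. \<theta> ((T ^^ k) x)) \<le> 0} \<in> sets borel" by measurable
    moreover have "{x\<in>Q. \<forall>n. (\<Sum>k<n. \<theta> ((T ^^ k) x)) \<le> 0} = Q \<inter> {x \<in> space borel. \<forall>n. (\<Sum>k<n. \<theta> ((T ^^ k) x)) \<le> 0}"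
      by auto
    ultimately show ?thesis by simp
  qed
  have AE: "AE x in M. \<exists>n. 0 < (\<Sum>k<n. \<theta> ((T ^^ k) x))"
  proof -
    have "AE x in lborel. x \<notin> {x\<in>Q. \<forall>n. (\<Sum>k<n. \<theta> ((T ^^ k) x)) \<le> 0}"
      using null Em by (intro AE_not_in) (simp add: null_sets_def)
    then have "AE x in lborel. x \<in> Q --> (\<exists>n. 0 < (\<Sum>k<n. \<theta> ((T ^^ k) x)))"
      by (rule AE_mp) (auto simp: not_le)
    then show ?thesis unfolding M_def by (subst AE_density) (auto simp: indicator_def elim: AE_mp)
  qed
  have "(\<lambda>n. \<integral>x. indicator (A n) x * \<theta> x \<partial>M) \<longlonglongrightarrow> (\<integral>x. \<theta> x \<partial>M)"
  proof (rule integral_dominated_convergence[where w="\<lambda>_. B"])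
    show "AE x in M. (\<lambda>n. indicator (A n) x * \<theta> x) \<longlonglongrightarrow> \<theta> x"
      using AE
    proof (rule AE_mp, intro AE_I2 impI)
      fix x assume "\<exists>n. 0 < (\<Sum>k<n. \<theta> ((T ^^ k) x))"
      then obtain n where "0 < mx \<theta> n x" using sum_le by (meson less_le_trans)
      then have "x \<in> A k" if "n \<le> k" for k
        using lift_Suc_mono_le[of "\<lambda>n. mx \<theta> n x" n "Suc k", OF mono] that by (auto simp: A_def simp del: mx.simps)
      then have "\<forall>\<^sub>F k in sequentially. indicator (A k) x * \<theta> x = \<theta> x"
        by (intro eventually_sequentiallyI[of n]) simp
      then show "(\<lambda>n. indicator (A n) x * \<theta> x) \<longlonglongrightarrow> \<theta> x" by (rule tendsto_eventually)
    qed
  qed (use bd B0 AM mxM in \<open>auto simp: indicator_def intro: AE_I2\<close>)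
  then have "0 \<le> (\<integral>x. \<theta> x \<partial>M)" using Aint by (intro LIMSEQ_le_const) auto
  then show False using neg by (simp add: M_def)
qed

text \<open>A ball is stretched by the iterates of \<open>T\<close> until it contains a translate of \<open>Q\<close>.\<close>

lemma T_iter_covers:
  assumes E [measurable]: "E \<in> sets borel" and per: "\<And>x \<omega>. \<omega> \<in> \<Omega> ==> x + \<omega> \<in> E \<longleftrightarrow> x \<in> E"
    and pos: "emeasure lborel (E \<inter> Q) > 0" and r: "r > 0"
  obtains n where "\<not> negligible {t \<in> ball t0 r. (T ^^ n) t \<in> E}"
proof -
  obtain R where R: "\<And>x. x \<in> Q ==> norm x \<le> R" using Q_bounded by (auto simp: bounded_iff)
  obtain n where n: "norm a ^ n > (2 * R + 1) / r" using real_arch_pow[OF expand] by blast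
  obtain c where c: "\<And>x. (T ^^ n) x = a ^ n * x + c" using T_iter by blast
  let ?t1 = "(T ^^ n) t0"
  obtain \<omega> where \<omega>: "\<omega> \<in> \<Omega>" "?t1 + \<omega> \<in> Q" using tiling by blast
  let ?N = "{t \<in> ball t0 r. (T ^^ n) t \<in> E}"
  have an: "a ^ n \<noteq> 0" using a_nonzero by simp
  have sub: "E \<inter> Q \<subseteq> (\<lambda>t. (T ^^ n) t + \<omega>) ` ?N"
  proof
    fix x assume x: "x \<in> E \<inter> Q"
    let ?t = "(x - \<omega> - c) / a ^ n"
    have Tt: "(T ^^ n) ?t = x - \<omega>" using an by (simp add: c)
    have "(T ^^ n) t0 - (T ^^ n) ?t = a ^ n * (t0 - ?t)" unfolding c by (simp add: algebra_simps)
    then have "norm a ^ n * dist t0 ?t = norm (?t1 - (x - \<omega>))"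
      by (simp add: Tt dist_norm norm_mult norm_power)
    also have "\<dots> = norm ((?t1 + \<omega>) - x)" by (simp add: algebra_simps)
    also have "\<dots> \<le> 2 * R" using norm_triangle_ineq4[of "?t1 + \<omega>" x] R[of x] R[of "?t1 + \<omega>"] \<omega> x by auto
    also have "\<dots> < norm a ^ n * r" using n r by (simp add: field_simps)
    finally have "dist t0 ?t < r" using a_nonzero by (simp add: mult_less_cancel_left_pos)
    moreover have "x - \<omega> \<in> E" using per[OF \<omega>(1), of "x - \<omega>"] x by simp
    ultimately have "?t \<in> ?N" by (simp add: Tt)
    moreover have "x = (T ^^ n) ?t + \<omega>" by (simp add: Tt)
    ultimately show "x \<in> (\<lambda>t. (T ^^ n) t + \<omega>) ` ?N" by blast
  qed
  have "\<not> negligible ?N"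
  proof
    assume N: "negligible ?N"
    have "(\<lambda>t. (T ^^ n) t + \<omega>) differentiable_on ?N"
      unfolding c differentiable_on_def
      by (intro ballI) (auto intro!: derivative_eq_intros simp: differentiable_def)
    from negligible_differentiable_image_negligible[OF _ N this] have "negligible (E \<inter> Q)"
      using sub negligible_subset by auto
    then have "E \<inter> Q \<in> null_sets lebesgue" by (simp add: negligible_iff_null_sets)
    then have "emeasure lebesgue (E \<inter> Q) = 0" by auto
    then show False using pos by simp
  qed
  then show thesis by (rule that)
qed

end

section \<open>Volume of families of line segments\<close>

lemma borel_negligible_iff:
  fixes S :: "'a::euclidean_space set"
  assumes "S \<in> sets borel"
  shows "negligible S \<longleftrightarrow> emeasure lborel S = 0"
proof -
  have "negligible S \<longleftrightarrow> emeasure lebesgue S = 0"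
    using assms by (auto simp: negligible_iff_null_sets null_sets_def)
  then show ?thesis using assms by simp
qed

lemma pcone_borel:
  fixes B :: "'k::{real_normed_field,euclidean_space} proj2 set"
  assumes "B \<in> sets borel"
  shows "pcone B \<in> sets borel"
proof -
  have "pcone B = (to_proj2 -` B \<inter> space borel) - {0}" by (auto simp: pcone_def)
  then show ?thesis using measurable_sets[OF borel_measurable_to_proj2 assms] by simp
qed

lemma proj2_volume_zero:
  fixes B :: "'k::{real_normed_field,euclidean_space} proj2 set"
  assumes "B \<in> sets borel" "emeasure proj2_volume B = 0"
  shows "negligible (pcone B \<inter> ball 0 1)"
proof -
  have [measurable]: "(to_proj2 :: 'k^3 => _) \<in> borel \<rightarrow>\<^sub>M borel" by (rule borel_measurable_to_proj2)
  let ?A = "to_proj2 -` B :: ('k^3) set"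
  have A: "?A \<in> sets borel" using measurable_sets[OF borel_measurable_to_proj2 assms(1)] by simp
  have "0 = emeasure (uniform_measure lborel (ball 0 1)) ?A"
    using assms unfolding proj2_volume_def by (subst (asm) emeasure_distr) auto
  also have "\<dots> = emeasure lborel (ball 0 1 \<inter> ?A) / emeasure lborel (ball (0::'k^3) 1)"
    using A by (intro emeasure_uniform_measure) auto
  finally have "emeasure lborel (ball 0 1 \<inter> ?A) = 0"
    using emeasure_bounded_finite[OF bounded_ball, of "0::'k^3" 1] by (auto simp: ennreal_divide_eq_0_iff)
  then have "negligible (ball 0 1 \<inter> ?A)" using A by (subst borel_negligible_iff) auto
  then show ?thesis by (rule negligible_subset) (auto simp: pcone_def)
qed

lemma vec_nth_differentiable: "(\<lambda>v::'k::real_normed_field^3. v $ i) differentiable (at v within A)"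
  by (rule bounded_linear_imp_differentiable) (rule bounded_linear_vec_nth)

lemma cr_nth_differentiable: "(\<lambda>v::'k::real_normed_field^3. cr e v $ i) differentiable (at v within A)"
proof -
  obtain j k where "\<forall>u v. cr u v $ i = u$j * v$k - u$k * (v::'k^3)$j"
    using cr_nth_cases[where 'k='k] by blast
  then show ?thesis by (simp add: vec_nth_differentiable)
qed

text \<open>The map \<open>(t, c, z) \<mapsto> c (h t + z e)\<close> has a differentiable inverse, so it pulls back the null set
  of representatives of \<open>B\<close> to a null set, and Fubini's theorem applies.\<close>

lemma volume_of_segments:
  fixes h :: "'k::{real_normed_field,euclidean_space} => 'k ^ 3"
  assumes S: "open S" and hd: "\<And>l. (\<lambda>t. h t $ l) differentiable_on S" and e: "e \<noteq> 0"
    and i: "\<And>t. t \<in> S ==> cr e (h t) $ i \<noteq> 0"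
    and \<sigma>D: "\<sigma> differentiable_on D" and sD: "\<And>t. t \<in> S ==> cr e (h t) $ j / cr e (h t) $ i \<in> D"
    and \<sigma>: "\<And>t. t \<in> S ==> \<sigma> (cr e (h t) $ j / cr e (h t) $ i) = t"
    and B: "B \<in> sets borel" and E: "\<not> negligible E" "E \<subseteq> S"
    and seg: "\<And>t. t \<in> E ==> \<exists>z0 \<epsilon>. 0 < \<epsilon> \<and> (\<forall>z. norm (z - z0) < \<epsilon> --> to_proj2 (h t + z *s e) \<in> B)"
  shows "emeasure proj2_volume B > 0"
proof (rule ccontr)
  assume "\<not> ?thesis"
  then have N: "negligible (pcone B \<inter> ball 0 1)" using B by (intro proj2_volume_zero) auto
  define W where "W = S \<times> (- {0::'k}) \<times> (UNIV :: 'k set)"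
  define \<Theta> where "\<Theta> = (\<lambda>(t, c, z). c *s (h t + z *s e))"
  define R where "R = {p \<in> W. \<Theta> p \<in> pcone B \<inter> ball 0 1}"
  obtain l where l: "e $ l \<noteq> 0" using nonzero_nth[OF e] by blast
  have hcont: "continuous_on S h"
    by (rule continuous_on_vec3) (rule differentiable_imp_continuous_on[OF hd])
  have W: "open W" unfolding W_def using S by (intro open_Times) auto
  have \<Theta>cont: "continuous_on W \<Theta>"
    unfolding \<Theta>_def case_prod_beta W_def
    by (intro continuous_intros continuous_on_compose2[OF hcont]) auto
  have R: "R \<in> sets borel"
  proof -
    have "\<Theta> \<in> borel_measurable (restrict_space borel W)"
      by (rule borel_measurable_continuous_on_restrict[OF \<Theta>cont])
    then have "\<Theta> -` (pcone B \<inter> ball 0 1) \<inter> space (restrict_space borel W) \<in> sets (restrict_space borel W)"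
      by (rule measurable_sets) (auto intro: pcone_borel[OF B])
    then have "\<Theta> -` (pcone B \<inter> ball 0 1) \<inter> W \<in> sets borel"
      using W by (auto simp: sets_restrict_space_iff space_restrict_space)
    moreover have "R = \<Theta> -` (pcone B \<inter> ball 0 1) \<inter> W" by (auto simp: R_def)
    ultimately show ?thesis by simp
  qed
  define tt where "tt = (\<lambda>v. \<sigma> (cr e v $ j / cr e v $ i))"
  define cc where "cc = (\<lambda>v. cr e v $ i / cr e (h (tt v)) $ i)"
  define zz where "zz = (\<lambda>v. (v $ l / cc v - h (tt v) $ l) / e $ l)"
  have inv: "cr e (\<Theta> (t, c, z)) $ i \<noteq> 0" "cr e (\<Theta> (t, c, z)) $ j / cr e (\<Theta> (t, c, z)) $ i = cr e (h t) $ j / cr e (h t) $ i"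
      "tt (\<Theta> (t, c, z)) = t" "cc (\<Theta> (t, c, z)) = c" "zz (\<Theta> (t, c, z)) = z"
    if "(t, c, z) \<in> W" for t c z
  proof -
    have tc: "t \<in> S" "c \<noteq> 0" using that by (auto simp: W_def)
    have cr: "cr e (\<Theta> (t, c, z)) = c *s cr e (h t)"
      by (simp add: \<Theta>_def cr_smult cr_add)
    show 1: "cr e (\<Theta> (t, c, z)) $ i \<noteq> 0" "cr e (\<Theta> (t, c, z)) $ j / cr e (\<Theta> (t, c, z)) $ i = cr e (h t) $ j / cr e (h t) $ i"
      using i[OF tc(1)] tc(2) by (simp_all add: cr)
    show 2: "tt (\<Theta> (t, c, z)) = t" unfolding tt_def 1 by (rule \<sigma>[OF tc(1)])
    show 3: "cc (\<Theta> (t, c, z)) = c" unfolding cc_def 2 using i[OF tc(1)] by (simp add: cr)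
    show "zz (\<Theta> (t, c, z)) = z" unfolding zz_def 2 3 using tc l by (simp add: \<Theta>_def field_simps)
  qed
  have negR: "negligible R"
  proof -
    let ?V = "\<Theta> ` R"
    have V: "cr e v $ i \<noteq> 0" "cr e v $ j / cr e v $ i \<in> D" "tt v \<in> S" "cr e (h (tt v)) $ i \<noteq> 0" "cc v \<noteq> 0"
      if v: "v \<in> ?V" for v
    proof -
      obtain t c z where p: "(t, c, z) \<in> W" "v = \<Theta> (t, c, z)" using v by (auto simp: R_def)
      then have "t \<in> S" "c \<noteq> 0" by (auto simp: W_def)
      then show "cr e v $ i \<noteq> 0" "cr e v $ j / cr e v $ i \<in> D" "tt v \<in> S" "cr e (h (tt v)) $ i \<noteq> 0" "cc v \<noteq> 0"
        unfolding p(2) inv(2-4)[OF p(1)] using inv(1)[OF p(1)] sD i by auto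
    qed
    have d1: "(\<lambda>v. cr e v $ j / cr e v $ i) differentiable_on ?V"
      unfolding differentiable_on_def using V by (auto intro!: differentiable_divide cr_nth_differentiable)
    have d2: "tt differentiable_on ?V"
      unfolding tt_def by (rule differentiable_on_compose[OF d1 differentiable_on_subset[OF \<sigma>D]]) (use V in blast)
    have d3: "(\<lambda>v. h (tt v) $ k) differentiable_on ?V" for k
      by (rule differentiable_on_compose[where f="\<lambda>t. h t $ k", OF d2 differentiable_on_subset[OF hd]]) (use V in blast)
    have d4: "(\<lambda>v. cr e (h (tt v)) $ i) differentiable_on ?V"
    proof -
      obtain j k where "\<forall>u v. cr u v $ i = u$j * v$k - u$k * (v::'k^3)$j"
        using cr_nth_cases[where 'k='k] by blast
      then show ?thesis using d3 by (simp add: differentiable_on_def)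
    qed
    have d5: "cc differentiable_on ?V"
      using d4 V unfolding cc_def differentiable_on_def
      by (auto intro!: differentiable_divide cr_nth_differentiable)
    have d6: "zz differentiable_on ?V"
      using d3 d5 V l unfolding zz_def differentiable_on_def
      by (auto intro!: differentiable_divide differentiable_diff vec_nth_differentiable)
    have d: "(\<lambda>v. (tt v, cc v, zz v)) differentiable_on ?V"
      using d2 d5 d6 unfolding differentiable_on_def by (auto intro!: differentiable_Pair)
    have V0: "negligible ?V" using N by (rule negligible_subset) (auto simp: R_def)
    have "negligible ((\<lambda>v. (tt v, cc v, zz v)) ` ?V)"
      by (rule negligible_differentiable_image_negligible[OF _ V0 d]) simp
    moreover have "R \<subseteq> (\<lambda>v. (tt v, cc v, zz v)) ` ?V"
    proof
      fix p assume "p \<in> R"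
      moreover obtain t c z where "p = (t, c, z)" by (cases p)
      ultimately show "p \<in> (\<lambda>v. (tt v, cc v, zz v)) ` ?V"
        using inv[of t c z] by (intro image_eqI[of _ _ "\<Theta> p"]) (auto simp: R_def)
    qed
    ultimately show ?thesis by (rule negligible_subset)
  qed
  have Rm: "R \<in> sets (lborel \<Otimes>\<^sub>M lborel)" using R by (simp only: lborel_prod sets_lborel)
  have "emeasure (lborel \<Otimes>\<^sub>M lborel) R = 0"
    using negR R by (simp add: lborel_prod borel_negligible_iff)
  then have "(\<integral>\<^sup>+t. emeasure lborel (Pair t -` R) \<partial>lborel) = 0"
    by (simp add: lborel.emeasure_pair_measure_alt[OF Rm])
  then have "AE t in lborel. emeasure lborel (Pair t -` R) = 0"
    using lborel.measurable_emeasure_Pair[OF Rm] by (subst (asm) nn_integral_0_iff_AE) auto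
  then obtain Z where Z: "Z \<in> null_sets lborel" "{t. emeasure lborel (Pair t -` R) \<noteq> 0} \<subseteq> Z"
    by (elim AE_E) (auto simp: null_sets_def)
  have "negligible Z" using Z(1) by (auto simp: null_sets_def borel_negligible_iff)
  moreover have "E \<subseteq> Z"
  proof
    fix t assume t: "t \<in> E"
    then have tS: "t \<in> S" using E by blast
    obtain z0 \<epsilon> where z: "0 < \<epsilon>" "\<And>z. norm (z - z0) < \<epsilon> ==> to_proj2 (h t + z *s e) \<in> B" using seg[OF t] by blast
    define M where "M = norm (h t) + (norm z0 + \<epsilon>) * norm e + 1"
    have M: "M > 0" using z by (simp add: M_def add_nonneg_pos)
    define V where "V = (ball 0 (1/M) - {0::'k}) \<times> ball z0 \<epsilon>"
    have "V \<subseteq> Pair t -` R"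
    proof
      fix p assume "p \<in> V"
      obtain c y where "p = (c, y)" by (cases p)
      with \<open>p \<in> V\<close> have p: "p = (c, y)" "norm c < 1/M" "c \<noteq> 0" "norm (y - z0) < \<epsilon>"
        by (auto simp: V_def dist_norm norm_minus_commute)
      have "norm y \<le> norm z0 + \<epsilon>" using p(4) norm_triangle_ineq2[of y z0] by linarith
      then have "norm (h t + y *s e) \<le> norm (h t) + (norm z0 + \<epsilon>) * norm e"
        by (intro order_trans[OF norm_triangle_ineq]) (auto intro: mult_right_mono)
      then have le: "norm (h t + y *s e) \<le> M" by (simp add: M_def)
      have nz: "h t + y *s e \<noteq> 0"
      proof
        assume "h t + y *s e = 0"
        then have "cr e (h t + y *s e) = 0" by simp
        then have "cr e (h t) = 0" by (simp add: cr_add cr_smult)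
        then show False using i[OF tS] by simp
      qed
      have "norm c * norm (h t + y *s e) \<le> norm c * M" using le by (intro mult_left_mono) auto
      also have "\<dots> < 1" using p(2) M by (simp add: field_simps)
      finally have lt: "norm c * norm (h t + y *s e) < 1" .
      have \<Theta>p: "\<Theta> (t, p) = c *s (h t + y *s e)" by (simp only: \<Theta>_def p(1) case_prod_conv)
      have "norm (\<Theta> (t, p)) < 1" unfolding \<Theta>p norm_smult by (rule lt)
      moreover have "\<Theta> (t, p) \<in> pcone B"
        unfolding \<Theta>p pcone_smult[OF p(3)] using z(2)[OF p(4)] nz by (simp add: pcone_def)
      ultimately show "p \<in> Pair t -` R" using tS p by (simp add: R_def W_def)
    qed
    moreover have Vo: "open V" unfolding V_def by (intro open_Times open_Diff) auto
    moreover have "V \<noteq> {}"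
    proof -
      have "of_real (1/(2*M)) \<in> ball 0 (1/M) - {0::'k}" using M by (simp add: norm_divide field_simps)
      moreover have "z0 \<in> ball z0 \<epsilon>" using z by simp
      ultimately show ?thesis unfolding V_def by blast
    qed
    ultimately have "\<not> negligible V" "V \<subseteq> Pair t -` R" using open_not_negligible by blast+
    then have "emeasure lborel V \<noteq> 0" using Vo by (simp add: borel_negligible_iff)
    moreover have "emeasure lborel V \<le> emeasure lborel (Pair t -` R)"
      using \<open>V \<subseteq> Pair t -` R\<close> sets_Pair1[OF Rm, of t] by (intro emeasure_mono) auto
    ultimately have "emeasure lborel (Pair t -` R) \<noteq> 0" by auto
    then show "t \<in> Z" using Z(2) by blast
  qed
  ultimately show False using E(1) negligible_subset by blast
qed

section \<open>Growth of a defining function under the map\<close>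

lemma compact_local_uniform:
  fixes K :: "'a::metric_space set"
  assumes "compact K" and anti: "\<And>\<rho> \<rho>' v. P \<rho> v ==> 0 < \<rho>' ==> \<rho>' \<le> \<rho> ==> P \<rho>' v"
    and loc: "\<And>v0. v0 \<in> K ==> \<exists>\<rho>>0. \<forall>v\<in>K. dist v v0 < \<rho> --> P \<rho> v"
  shows "\<exists>\<rho>>0::real. \<forall>v\<in>K. P \<rho> v"
proof (cases "K = {}")
  case False
  obtain \<rho> where \<rho>: "\<And>v0. v0 \<in> K ==> \<rho> v0 > 0" "\<And>v0 v. v0 \<in> K ==> v \<in> K ==> dist v v0 < \<rho> v0 ==> P (\<rho> v0) v"
    using loc by metis
  have "K \<subseteq> (\<Union>v\<in>K. ball v (\<rho> v))" using \<rho>(1) by force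
  then obtain F where F: "F \<subseteq> K" "finite F" "K \<subseteq> (\<Union>v\<in>F. ball v (\<rho> v))"
    using compactE_image[OF assms(1), of K "\<lambda>v. ball v (\<rho> v)"] by (metis open_ball)
  have "F \<noteq> {}" using F False by auto
  then have pos: "Min (\<rho> ` F) > 0" using F \<rho>(1) by (subst Min_gr_iff) auto
  have "P (Min (\<rho> ` F)) v" if v: "v \<in> K" for v
  proof -
    obtain v0 where v0: "v0 \<in> F" "dist v v0 < \<rho> v0" using F(3) v by (auto simp: dist_commute)
    show ?thesis
      using F v0 pos by (intro anti[OF \<rho>(2)[of v0 v]]) (auto simp: v)
  qed
  then show ?thesis using pos by blast
qed (auto intro: exI[of _ 1])

text \<open>Near a regular zero \<open>v0\<close> of \<open>g\<close>, a function \<open>A\<close> that vanishes on the zero set of \<open>g\<close> is at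
  most \<open>\<bar>g\<bar>\<close> times the ratio of the transverse derivatives, up to an error: moving from \<open>x\<close> in a
  transverse direction \<open>n\<close> one meets a zero of \<open>g\<close> at a distance close to \<open>\<bar>g x\<bar>\<close>, by contraction.\<close>

lemma transverse_growth:
  fixes g A :: "'k::{real_normed_field,euclidean_space} ^ 3 => 'k"
  assumes g: "pfun g" and A: "pfun A" and v0: "g v0 = 0" and n: "dt (grad g v0) n = 1"
    and van: "\<And>x. g x = 0 ==> A x = 0" and \<eta>: "\<eta> > 0"
  shows "\<exists>\<rho>>0. \<forall>x. dist x v0 < \<rho> --> norm (A x) \<le> (norm (dt (grad A v0) n) + \<eta>) * norm (g x)"
proof -
  define \<alpha> where "\<alpha> = norm (dt (grad A v0) n)"
  define \<epsilon> where "\<epsilon> = min (1/2) (\<eta> / (1 + \<alpha> + \<eta>))"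
  have \<alpha>: "0 \<le> \<alpha>" by (simp add: \<alpha>_def)
  have \<epsilon>: "0 < \<epsilon>" "\<epsilon> \<le> 1/2" "\<epsilon> * (1 + \<alpha> + \<eta>) \<le> \<eta>"
  proof -
    show "0 < \<epsilon>" using \<alpha> \<eta> by (auto simp: \<epsilon>_def)
    show "\<epsilon> \<le> 1/2" unfolding \<epsilon>_def by (rule min.cobounded1)
    have "\<epsilon> \<le> \<eta> / (1 + \<alpha> + \<eta>)" by (simp add: \<epsilon>_def)
    then show "\<epsilon> * (1 + \<alpha> + \<eta>) \<le> \<eta>" using \<alpha> \<eta> by (simp add: pos_le_divide_eq)
  qed
  have "continuous_on UNIV (\<lambda>x. dt (grad g x) n)" "continuous_on UNIV (\<lambda>x. dt (grad A x) n)" "continuous_on UNIV g"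
    by (intro continuous_intros continuous_on_grad pfun_continuous g A)+
  then have c: "isCont (\<lambda>x. dt (grad g x) n) v0" "isCont (\<lambda>x. dt (grad A x) n) v0" "isCont g v0"
    by (simp_all add: continuous_on_eq_continuous_at)
  obtain r1 where r1: "r1 > 0" "\<And>x. dist x v0 < r1 ==> dist (dt (grad g x) n) 1 < \<epsilon>"
    using c(1) \<epsilon>(1) n unfolding continuous_at_eps_delta by metis
  obtain r2 where r2: "r2 > 0" "\<And>x. dist x v0 < r2 ==> dist (dt (grad A x) n) (dt (grad A v0) n) < \<epsilon>"
    using c(2) \<epsilon>(1) unfolding continuous_at_eps_delta by metis
  define r where "r = min r1 r2"
  have r: "r > 0" "r \<le> r1" "r \<le> r2" using r1 r2 by (auto simp: r_def)
  define \<delta>0 where "\<delta>0 = r / (4 * (norm n + 1))"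
  have "\<delta>0 > 0" unfolding \<delta>0_def using r by (simp add: add_nonneg_pos)
  then obtain r3 where r3: "r3 > 0" "\<And>x. dist x v0 < r3 ==> dist (g x) 0 < \<delta>0"
    using c(3) v0 unfolding continuous_at_eps_delta by metis
  define \<rho> where "\<rho> = min r3 (r/2)"
  have "\<rho> > 0" using r r3 by (simp add: \<rho>_def)
  moreover have "norm (A x) \<le> (\<alpha> + \<eta>) * norm (g x)" if x: "dist x v0 < \<rho>" for x
  proof (cases "g x = 0")
    case False
    define \<delta> where "\<delta> = 2 * norm (g x)"
    have \<delta>: "0 < \<delta>" "\<delta> * norm n < r/2"
    proof -
      have "norm (g x) < \<delta>0" using r3(2)[of x] x by (simp add: \<rho>_def)
      then have "\<delta> * norm n \<le> 2 * \<delta>0 * norm n" unfolding \<delta>_def by (intro mult_right_mono) auto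
      also have "\<dots> = (r/2) * (norm n / (norm n + 1))"
      proof -
        have "2 * (r / (4 * y)) * u = (r/2) * (u / y)" if "y \<noteq> 0" for u y :: real
          using that by (simp add: field_simps)
        moreover have "norm n + 1 \<noteq> 0" using norm_ge_zero[of n] by linarith
        ultimately show ?thesis unfolding \<delta>0_def by blast
      qed
      also have "\<dots> < (r/2) * 1" using r by (intro mult_strict_left_mono) (auto simp: divide_less_eq add_nonneg_pos)
      finally show "\<delta> * norm n < r/2" by simp
    qed (use False in \<open>simp add: \<delta>_def\<close>)
    have near: "dist (x + s *s n) v0 < r" if "s \<in> cball 0 \<delta>" for s
    proof -
      have "norm (s *s n) \<le> \<delta> * norm n" using that by (auto intro: mult_right_mono)
      then have "dist (x + s *s n) x < r/2" using \<delta> by (simp add: dist_norm)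
      moreover have "dist x v0 < r/2" using x by (simp add: \<rho>_def)
      ultimately show ?thesis using dist_triangle[of "x + s *s n" v0 x] by linarith
    qed
    define \<phi> where "\<phi> = (\<lambda>s. s - g (x + s *s n))"
    have lip: "norm (\<phi> s - \<phi> s') \<le> \<epsilon> * norm (s - s')" if "s \<in> cball 0 \<delta>" "s' \<in> cball 0 \<delta>" for s s'
    proof (rule field_differentiable_bound[where S = "cball 0 \<delta>" and f' = "\<lambda>s. 1 - dt (grad g (x + s *s n)) n"])
      show "(\<phi> has_field_derivative 1 - dt (grad g (x + z *s n)) n) (at z within cball 0 \<delta>)" for z
        unfolding \<phi>_def
        by (rule has_field_derivative_at_within) (intro DERIV_diff DERIV_ident pfun_along_line g)
      show "norm (1 - dt (grad g (x + z *s n)) n) \<le> \<epsilon>" if "z \<in> cball 0 \<delta>" for z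
        using r1(2)[of "x + z *s n"] near[OF that] r by (simp add: dist_norm norm_minus_commute)
    qed (use that in auto)
    have lip0: "norm (\<phi> s) \<le> norm (g x) + \<epsilon> * norm s" if "s \<in> cball 0 \<delta>" for s
    proof -
      have "norm (\<phi> s) \<le> norm (\<phi> s - \<phi> 0) + norm (\<phi> 0)" using norm_triangle_ineq[of "\<phi> s - \<phi> 0" "\<phi> 0"] by simp
      then show ?thesis using lip[OF that, of 0] \<delta> by (simp add: \<phi>_def)
    qed
    have "\<exists>!s. s \<in> cball 0 \<delta> \<and> \<phi> s = s"
    proof (rule Banach_fix[where c = "1/2"])
      show "\<phi> ` cball 0 \<delta> \<subseteq> cball 0 \<delta>"
      proof (rule image_subsetI)
        fix s assume s: "s \<in> cball (0::'k) \<delta>"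
        have "\<epsilon> * norm s \<le> 1/2 * \<delta>" using s \<epsilon> by (intro mult_mono) auto
        then show "\<phi> s \<in> cball 0 \<delta>" using lip0[OF s] by (simp add: \<delta>_def)
      qed
      show "dist (\<phi> s) (\<phi> s') \<le> 1/2 * dist s s'" if "s \<in> cball 0 \<delta>" "s' \<in> cball 0 \<delta>" for s s'
        using lip[OF that] mult_right_mono[OF \<epsilon>(2), of "norm (s - s')"] by (simp add: dist_norm)
    qed (use \<delta> in \<open>auto simp: complete_eq_closed\<close>)
    then obtain s where s: "s \<in> cball 0 \<delta>" "\<phi> s = s" by blast
    have zero: "g (x + s *s n) = 0" using s(2) by (simp add: \<phi>_def)
    have sb: "norm s * (1 - \<epsilon>) \<le> norm (g x)" using lip0[OF s(1)] s(2) by (simp add: algebra_simps)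
    have "norm (A (x + s *s n) - A (x + 0 *s n)) \<le> (\<alpha> + \<epsilon>) * norm (s - 0)"
    proof (rule field_differentiable_bound[where S = "cball 0 \<delta>" and f' = "\<lambda>s. dt (grad A (x + s *s n)) n" and f = "\<lambda>s. A (x + s *s n)"])
      show "((\<lambda>s. A (x + s *s n)) has_field_derivative dt (grad A (x + z *s n)) n) (at z within cball 0 \<delta>)" for z
        by (rule has_field_derivative_at_within) (intro pfun_along_line A)
      show "norm (dt (grad A (x + z *s n)) n) \<le> \<alpha> + \<epsilon>" if "z \<in> cball 0 \<delta>" for z
        using r2(2)[of "x + z *s n"] near[OF that] r unfolding dist_norm \<alpha>_def
        by (smt (verit) norm_triangle_sub)
    qed (use s \<delta> in auto)
    then have "norm (A x) \<le> (\<alpha> + \<epsilon>) * norm s" using van[OF zero] by simp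
    also have "\<dots> \<le> (\<alpha> + \<eta>) * (1 - \<epsilon>) * norm s"
      using \<epsilon>(3) by (intro mult_right_mono) (auto simp: algebra_simps)
    also have "\<dots> \<le> (\<alpha> + \<eta>) * norm (g x)"
      using mult_left_mono[OF sb, of "\<alpha> + \<eta>"] \<alpha> \<eta> by (simp add: mult_ac)
    finally show ?thesis .
  qed (simp add: van)
  ultimately show ?thesis unfolding \<alpha>_def by blast
qed

text \<open>A connected piece of a line through \<open>e\<close> on which a form is small must be short, since the
  form has finitely many zeros on the line: some small circle avoids them.\<close>

lemma small_sublevel_components:
  fixes G :: "'k::{real_normed_field,euclidean_space} poly3"
  assumes hom: "homogeneous m G" and e: "eval3 G e \<noteq> 0" and K: "compact K" and \<eta>: "\<eta> > 0"
  shows "\<exists>\<epsilon>>0. \<forall>v\<in>K. \<forall>D. connected D \<and> 0 \<in> D \<and> (\<forall>z\<in>D. norm (eval3 G (v + z *s e)) < \<epsilon>) --> D \<subseteq> ball 0 \<eta>"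
proof (rule compact_local_uniform[OF K])
  fix v0 assume "v0 \<in> K"
  obtain p where p: "\<And>z. poly p z = eval3 G (v0 + z *s e)" "coeff p m = eval3 G e"
    using eval3_line_poly[OF hom] by blast
  have "p \<noteq> 0" using p(2) e by auto
  then have "finite (norm ` {z. poly p z = 0})" using poly_roots_finite by blast
  then have "infinite ({0<..<\<eta>} - norm ` {z. poly p z = 0})"
    using \<eta> by (intro Diff_infinite_finite) (auto simp: infinite_Ioo)
  then obtain r where r: "0 < r" "r < \<eta>" "r \<notin> norm ` {z. poly p z = 0}"
    by (metis Diff_iff finite.emptyI ex_in_conv greaterThanLessThan_iff)
  let ?g = "\<lambda>(v, z). eval3 G (v + z *s e)"
  have gc: "continuous_on A ?g" for A
    unfolding case_prod_beta
    by (intro continuous_on_compose2[OF pfun_continuous[OF pfun_eval3, of UNIV]] continuous_intros) auto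
  have "compact (cball v0 1 \<times> sphere (0::'k) r)" by (intro compact_Times) auto
  then have uc: "uniformly_continuous_on (cball v0 1 \<times> sphere (0::'k) r) ?g"
    using gc by (rule compact_uniformly_continuous[rotated])
  have "continuous_on (sphere 0 r) (\<lambda>z. norm (poly p z))" by (intro continuous_intros)
  moreover have "sphere (0::'k) r \<noteq> {}" using r by simp
  ultimately obtain z0 where z0: "z0 \<in> sphere 0 r" "\<And>z. z \<in> sphere 0 r ==> norm (poly p z0) \<le> norm (poly p z)"
    using continuous_attains_inf[OF compact_sphere] by blast
  define \<epsilon> where "\<epsilon> = norm (poly p z0) / 2"
  have \<epsilon>: "\<epsilon> > 0" using z0(1) r(3) by (auto simp: \<epsilon>_def image_iff)
  obtain d where d: "d > 0" "\<And>x y. x \<in> cball v0 1 \<times> sphere 0 r ==> y \<in> cball v0 1 \<times> sphere 0 r ==> dist x y < d ==> dist (?g x) (?g y) < \<epsilon>"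
    using uc \<epsilon> unfolding uniformly_continuous_on_def by metis
  have big: "\<epsilon> \<le> norm (eval3 G (v + z *s e))" if "dist v v0 < min d 1" "norm z = r" for v z
  proof -
    have "dist (?g (v, z)) (?g (v0, z)) < \<epsilon>"
      using that by (intro d(2)) (auto simp: dist_Pair_Pair dist_commute)
    moreover have "2 * \<epsilon> \<le> norm (?g (v0, z))" using z0(2)[of z] that by (simp add: \<epsilon>_def p)
    ultimately show ?thesis by (simp add: dist_norm) (smt (verit) norm_triangle_sub norm_minus_commute)
  qed
  define \<rho> where "\<rho> = min \<epsilon> (min d 1)"
  have "\<rho> > 0" using \<epsilon> d by (simp add: \<rho>_def)
  moreover have "D \<subseteq> ball 0 \<eta>"
    if v: "dist v v0 < \<rho>" and D: "connected D" "0 \<in> D" "\<And>z. z \<in> D ==> norm (eval3 G (v + z *s e)) < \<rho>" for v D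
  proof
    fix z assume z: "z \<in> D"
    have "connected (norm ` D)" by (intro connected_continuous_image continuous_intros D)
    have "norm z < \<eta>"
    proof (rule ccontr)
      assume "\<not> norm z < \<eta>"
      then have "r \<in> norm ` D"
        using connectedD_interval[OF \<open>connected (norm ` D)\<close>, of 0 "norm z" r] D(2) z r by (auto simp: image_iff)
      then obtain w where "w \<in> D" "norm w = r" by auto
      then show False using D(3)[of w] big[of v w] v by (auto simp: \<rho>_def)
    qed
    then show "z \<in> ball 0 \<eta>" by simp
  qed
  ultimately show "\<exists>\<rho>>0. \<forall>v\<in>K. dist v v0 < \<rho> --> (\<forall>D. connected D \<and> 0 \<in> D \<and> (\<forall>z\<in>D. norm (eval3 G (v + z *s e)) < \<rho>) --> D \<subseteq> ball 0 \<eta>)"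
    by blast
qed (meson less_le_trans)

section \<open>Attraction in the elementary case\<close>

text \<open>The slope of the line through \<open>e\<close> and \<open>\<gamma> t\<close> is a local coordinate for \<open>t\<close>.\<close>

definition slope_chart :: "'k::{real_normed_field,euclidean_space} ^ 3 => ('k => 'k proj2) => 'k => bool" where
  "slope_chart e \<gamma> t0 \<longleftrightarrow> (\<exists>S h i j D \<sigma>. open S \<and> t0 \<in> S \<and> (\<forall>l. (\<lambda>t. h t $ l) differentiable_on S) \<and>
     \<sigma> differentiable_on D \<and>
     (\<forall>t\<in>S. cr e (h t) $ i \<noteq> 0 \<and> cr e (h t) $ j / cr e (h t) $ i \<in> D \<and>
        \<sigma> (cr e (h t) $ j / cr e (h t) $ i) = t) \<and>
     (\<forall>t\<in>S. \<forall>v. v \<noteq> 0 \<and> to_proj2 v = \<gamma> t --> (\<exists>c. cr e v = c *s cr e (h t))))"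

locale elementary_curve = torus_affine Q \<Omega> a b
  for Q \<Omega> :: "'k::{real_normed_field,euclidean_space} set" and a b +
  fixes F :: "'k polymap" and d m :: nat and e :: "'k ^ 3" and G :: "'k poly3"
    and X :: "'k proj2 set" and \<gamma> :: "'k => 'k proj2"
  assumes F: "rational_map d F" and elem: "elementary F (to_proj2 e)" and e: "e \<noteq> 0"
    and hom: "homogeneous m G" and m: "0 < m" and Ge: "eval3 G e \<noteq> 0"
    and smooth: "\<And>v. v \<noteq> 0 ==> eval3 G v = 0 ==> grad (eval3 G) v \<noteq> 0"
    and invar: "\<And>v. v \<noteq> 0 ==> eval3 G v = 0 ==> evalmap F v \<noteq> 0 \<and> eval3 G (evalmap F v) = 0"
    and \<gamma>: "continuous_on UNIV \<gamma>" and X: "X = range \<gamma>" and XG: "X \<subseteq> zero_set G" and \<gamma>_per: "periodic \<gamma>"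
    and semi: "\<And>t. ratmap F (\<gamma> t) = \<gamma> (T t)"
    and charts: "countable {t. \<not> slope_chart e \<gamma> t}"
begin

definition A :: "'k ^ 3 => 'k" where "A v = eval3 G (evalmap F v)"

definition \<kappa> :: "'k ^ 3 => real" where "\<kappa> v = norm (grad A v) / norm (grad (eval3 G) v)"

definition \<tau> :: "'k ^ 3 => real" where "\<tau> v = \<kappa> v / norm (cr e (evalmap F v)) ^ m"

definition Xhat :: "('k ^ 3) set" where "Xhat = {v \<in> pcone X. norm (cr e v) = 1}"

lemma pfun_A: "pfun A"
proof -
  have "pfun (\<lambda>v. eval3 G (evalmap F v))" by (rule pfun_compose[OF pfun_eval3 pfun_evalmap])
  then show ?thesis by (simp add: A_def[abs_def])
qed

lemma A_scale: "A (c *s v) = c ^ (d * m) * A v"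
  by (simp add: A_def evalmap_scale[OF F] eval3_scale[OF hom] power_mult)

lemma pconeX: "v \<in> pcone X ==> v \<noteq> 0 \<and> eval3 G v = 0"
  using XG zero_set_iff[OF hom] by (auto simp: pcone_def)

lemma cr_pcone: "v \<in> pcone X ==> cr e v \<noteq> 0"
proof
  assume v: "v \<in> pcone X" "cr e v = 0"
  then obtain c where "v = c *s e" using cr_eq_0D e by metis
  then have "c ^ m * eval3 G e = 0" "c \<noteq> 0" using pconeX[OF v(1)] eval3_scale[OF hom] by auto
  then show False using Ge by simp
qed

lemma compact_X: "compact X"
proof -
  have "X = \<gamma> ` closure Q"
  proof
    show "X \<subseteq> \<gamma> ` closure Q"
    proof
      fix p assume "p \<in> X"
      then obtain t where t: "p = \<gamma> t" using X by auto
      obtain \<omega> where "\<omega> \<in> \<Omega>" "t + \<omega> \<in> Q" using tiling by blast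
      then have "p = \<gamma> (t + \<omega>)" "t + \<omega> \<in> closure Q" using \<gamma>_per t closure_subset by (auto simp: periodic_def)
      then show "p \<in> \<gamma> ` closure Q" by blast
    qed
  qed (use X in auto)
  moreover have "compact (closure Q)" using bounded_closure[OF Q_bounded] by (simp add: compact_eq_bounded_closed)
  ultimately show ?thesis using compact_continuous_image[OF continuous_on_subset[OF \<gamma>]] by auto
qed

lemma normalize_Xhat:
  assumes "v \<in> pcone X"
  shows "(of_real (inverse (norm (cr e v))) :: 'k) *s v \<in> Xhat"
  using cr_pcone[OF assms] assms by (simp add: Xhat_def pcone_smult cr_smult norm_inverse)

lemma compact_Xhat: "compact Xhat"
proof -
  let ?f = "\<lambda>v. (of_real (inverse (norm (cr e v))) :: 'k) *s v"
  have eq: "Xhat = ?f ` (pcone X \<inter> sphere 0 1)"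
  proof
    show "?f ` (pcone X \<inter> sphere 0 1) \<subseteq> Xhat" using normalize_Xhat by blast
    show "Xhat \<subseteq> ?f ` (pcone X \<inter> sphere 0 1)"
    proof
      fix v assume v: "v \<in> Xhat"
      then have v0: "v \<noteq> 0" "norm (cr e v) = 1" "v \<in> pcone X" by (auto simp: Xhat_def pcone_def)
      define s where "s = (of_real (inverse (norm v)) :: 'k)"
      have s: "s \<noteq> 0" "norm s = inverse (norm v)" using v0 by (auto simp: s_def norm_inverse)
      have m1: "s *s v \<in> pcone X \<inter> sphere 0 1" using v0 s by (simp add: pcone_smult)
      have f1: "?f (s *s v) = v"
      proof -
        have "norm (cr e (s *s v)) = inverse (norm v)" by (simp only: cr_smult norm_smult s(2) v0(2) mult_1_right)
        then have "?f (s *s v) = (of_real (norm v) * s) *s v" by (simp add: vector_smult_assoc)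
        also have "of_real (norm v) * s = 1" using v0(1) by (simp add: s_def)
        finally show ?thesis by simp
      qed
      show "v \<in> ?f ` (pcone X \<inter> sphere 0 1)" by (rule image_eqI[of v ?f, OF f1[symmetric] m1])
    qed
  qed
  have "continuous_on (pcone X \<inter> sphere 0 1) ?f"
    by (intro continuous_intros) (auto dest: cr_pcone)
  then show ?thesis unfolding eq by (rule compact_continuous_image[OF _ compact_pcone_sphere[OF compact_X]])
qed

lemma F_pcone: "v \<in> pcone X ==> evalmap F v \<in> pcone X \<and> to_proj2 (evalmap F v) = ratmap F (to_proj2 v)"
proof -
  assume v: "v \<in> pcone X"
  then have F0: "evalmap F v \<noteq> 0" using invar pconeX by blast
  then have eq: "to_proj2 (evalmap F v) = ratmap F (to_proj2 v)" using ratmap_to_proj2[OF F] pconeX[OF v] by simp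
  obtain t where "to_proj2 v = \<gamma> t" using v X by (auto simp: pcone_def)
  then have "to_proj2 (evalmap F v) \<in> X" using eq semi X by auto
  then show ?thesis using eq F0 by (simp add: pcone_def)
qed

definition V :: "'k => 'k ^ 3" where "V t = (SOME v. v \<in> Xhat \<and> to_proj2 v = \<gamma> t)"

lemma V: "V t \<in> Xhat" "to_proj2 (V t) = \<gamma> t"
proof -
  obtain v where v: "\<gamma> t = to_proj2 v" "v \<noteq> 0" by (rule to_proj2_cases)
  moreover have "\<gamma> t \<in> X" using X by blast
  ultimately have "v \<in> pcone X" by (simp add: pcone_def)
  then have "\<exists>v. v \<in> Xhat \<and> to_proj2 v = \<gamma> t"
    using normalize_Xhat[of v] v cr_pcone[of v] to_proj2_smult[of "of_real (inverse (norm (cr e v)))" v]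
    by (intro exI[of _ "(of_real (inverse (norm (cr e v))) :: 'k) *s v"]) simp
  then have "V t \<in> Xhat \<and> to_proj2 (V t) = \<gamma> t" unfolding V_def by (rule someI_ex)
  then show "V t \<in> Xhat" "to_proj2 (V t) = \<gamma> t" by auto
qed

lemma V_pcone: "V t \<in> pcone X" and V_norm: "norm (cr e (V t)) = 1" and V_nonzero: "V t \<noteq> 0"
  using V(1)[of t] by (auto simp: Xhat_def pcone_def)

lemma F_V: obtains \<mu> where "evalmap F (V t) = \<mu> *s V (T t)" "\<mu> \<noteq> 0" "norm \<mu> = norm (cr e (evalmap F (V t)))"
proof -
  have "to_proj2 (V (T t)) = to_proj2 (evalmap F (V t))" "evalmap F (V t) \<noteq> 0"
    using F_pcone[OF V_pcone, of t] V(2) semi by (auto simp: pcone_def)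
  then obtain \<mu> where \<mu>: "evalmap F (V t) = \<mu> *s V (T t)"
    using to_proj2_eq_iff[OF V_nonzero[of "T t"]] by blast
  show thesis
  proof
    show "\<mu> \<noteq> 0" using \<mu> \<open>evalmap F (V t) \<noteq> 0\<close> by auto
    show "norm \<mu> = norm (cr e (evalmap F (V t)))" by (simp add: \<mu> cr_smult V_norm)
  qed fact
qed

lemma transverse_direction:
  assumes "v \<in> pcone X" obtains n where "dt (grad (eval3 G) v) n = 1"
proof -
  obtain i where i: "grad (eval3 G) v $ i \<noteq> 0" using smooth pconeX[OF assms] nonzero_nth by blast
  have "dt (grad (eval3 G) v) ((1 / grad (eval3 G) v $ i) *s axis i 1) = 1"
    using i by (simp add: axis_dt)
  then show thesis by (rule that)
qed

lemma A_vanishes: "eval3 G v = 0 ==> A v = 0"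
  using invar[of v] A_scale[of 0 0] F m
  by (cases "v = 0") (auto simp: A_def rational_map_def power_0_left split: if_splits)

lemma grad_A_kernel:
  assumes v: "v \<in> pcone X" and w: "dt (grad (eval3 G) v) w = 0"
  shows "dt (grad A v) w = 0"
proof -
  obtain n where n: "dt (grad (eval3 G) v) n = 1" using transverse_direction[OF v] .
  define C where "C = norm (dt (grad A v) n) + 1"
  obtain \<rho> where \<rho>: "\<rho> > 0" "\<And>x. dist x v < \<rho> ==> norm (A x) \<le> C * norm (eval3 G x)"
    using transverse_growth[OF pfun_eval3 pfun_A _ n A_vanishes, of 1] pconeX[OF v] by (auto simp: C_def)
  have lim: "((\<lambda>s. f (v + s *s w) / s) \<longlongrightarrow> dt (grad f v) w) (at 0)" if "pfun f" "f v = 0" for f :: "'k^3 => 'k"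
    using pfun_along_line[OF that(1), of v w 0] that(2) by (simp add: has_field_derivative_iff)
  have l1: "((\<lambda>s. norm (A (v + s *s w) / s)) \<longlongrightarrow> norm (dt (grad A v) w)) (at 0)"
    by (intro tendsto_norm lim pfun_A A_vanishes) (simp add: pconeX[OF v])
  have l2: "((\<lambda>s. C * norm (eval3 G (v + s *s w) / s)) \<longlongrightarrow> C * norm (dt (grad (eval3 G) v) w)) (at 0)"
    by (intro tendsto_mult_left tendsto_norm lim pfun_eval3) (simp add: pconeX[OF v])
  have ev: "\<forall>\<^sub>F s in at 0. norm (A (v + s *s w) / s) \<le> C * norm (eval3 G (v + s *s w) / s)"
  proof -
    have "((\<lambda>s. v + s *s w) \<longlongrightarrow> v + 0 *s w) (at 0)"
      by (rule tendsto_vec3) (auto intro!: tendsto_eq_intros)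
    then have "\<forall>\<^sub>F s in at 0. dist (v + s *s w) v < \<rho>" using \<rho>(1) by (intro tendstoD) auto
    then show ?thesis
    proof eventually_elim
      case (elim s)
      then show ?case using \<rho>(2)[OF elim] by (simp add: norm_divide divide_right_mono)
    qed
  qed
  have "norm (dt (grad A v) w) \<le> C * norm (dt (grad (eval3 G) v) w)"
    by (rule tendsto_le[OF _ l2 l1 ev]) simp
  then show ?thesis using w by simp
qed

lemma grad_A:
  assumes v: "v \<in> pcone X"
  obtains k where "grad A v = k *s grad (eval3 G) v" "norm k = \<kappa> v"
proof -
  obtain n where n: "dt (grad (eval3 G) v) n = 1" using transverse_direction[OF v] .
  define k where "k = dt (grad A v) n"
  have eq: "grad A v = k *s grad (eval3 G) v"
  proof (rule dt_ext)
    fix w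
    have "dt (grad (eval3 G) v) (w - dt (grad (eval3 G) v) w *s n) = 0" using n by (simp add: dt_diff)
    then have "dt (grad A v) (w - dt (grad (eval3 G) v) w *s n) = 0" by (rule grad_A_kernel[OF v])
    then show "dt (grad A v) w = dt (k *s grad (eval3 G) v) w" by (simp add: dt_diff k_def mult.commute)
  qed
  moreover have "norm k = \<kappa> v" using smooth pconeX[OF v] by (simp add: \<kappa>_def eq)
  ultimately show thesis by (rule that)
qed

lemma continuous_on_\<kappa>: "continuous_on (pcone X) \<kappa>"
  unfolding \<kappa>_def
  by (intro continuous_intros continuous_on_grad pfun_A pfun_eval3) (use smooth pconeX in auto)

lemma continuous_on_\<tau>: "continuous_on Xhat \<tau>"
  unfolding \<tau>_def
  by (intro continuous_intros continuous_on_subset[OF continuous_on_\<kappa>] continuous_on_evalmap)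
    (use F_pcone cr_pcone in \<open>auto simp: Xhat_def\<close>)

lemma \<kappa>_nonneg: "0 \<le> \<kappa> v" and \<tau>_nonneg: "0 \<le> \<tau> v"
  by (simp_all add: \<kappa>_def \<tau>_def)

lemma growth_local:
  assumes v0: "v0 \<in> Xhat" and \<eta>: "\<eta> > 0"
  shows "\<exists>\<rho>>0. \<forall>x. dist x v0 < \<rho> --> cr e (evalmap F x) \<noteq> 0 \<and>
    norm (A x) / norm (cr e (evalmap F x)) ^ m \<le> (\<tau> v0 + \<eta>) * norm (eval3 G x)"
proof -
  have v0': "v0 \<in> pcone X" using v0 by (simp add: Xhat_def)
  obtain n where n: "dt (grad (eval3 G) v0) n = 1" using transverse_direction[OF v0'] .
  obtain k where k: "grad A v0 = k *s grad (eval3 G) v0" "norm k = \<kappa> v0" using grad_A[OF v0'] .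
  define P where "P = (\<lambda>x. norm (cr e (evalmap F x)) ^ m)"
  have P0: "P v0 > 0" using F_pcone[OF v0'] cr_pcone by (simp add: P_def)
  define \<eta>' where "\<eta>' = \<eta> * P v0 / 2"
  have \<eta>': "\<eta>' > 0" using \<eta> P0 by (simp add: \<eta>'_def)
  obtain \<rho>1 where \<rho>1: "\<rho>1 > 0" "\<And>x. dist x v0 < \<rho>1 ==> norm (A x) \<le> (\<kappa> v0 + \<eta>') * norm (eval3 G x)"
    using transverse_growth[OF pfun_eval3 pfun_A _ n A_vanishes \<eta>'] pconeX[OF v0'] n k by auto
  have "continuous_on UNIV P"
    unfolding P_def by (intro continuous_intros continuous_on_evalmap)
  then have Pc: "isCont P v0" by (simp add: continuous_on_eq_continuous_at)
  then have "isCont (\<lambda>x. (\<kappa> v0 + \<eta>') / P x) v0" using P0 by (intro continuous_intros) auto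
  then have "((\<lambda>x. (\<kappa> v0 + \<eta>') / P x) \<longlongrightarrow> (\<kappa> v0 + \<eta>') / P v0) (at v0)" by (simp add: isCont_def)
  moreover have "(\<kappa> v0 + \<eta>') / P v0 < \<tau> v0 + \<eta>"
  proof -
    have "\<tau> v0 = \<kappa> v0 / P v0" by (simp add: \<tau>_def P_def)
    then have "(\<kappa> v0 + \<eta>') / P v0 = \<tau> v0 + \<eta> / 2" using P0 by (simp add: \<eta>'_def add_divide_distrib)
    then show ?thesis using \<eta> by simp
  qed
  ultimately have "\<forall>\<^sub>F x in at v0. (\<kappa> v0 + \<eta>') / P x < \<tau> v0 + \<eta>" by (rule order_tendstoD)
  moreover have "\<forall>\<^sub>F x in at v0. P x > 0" using Pc P0 by (intro order_tendstoD) (auto simp: isCont_def)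
  ultimately have "\<forall>\<^sub>F x in at v0. (\<kappa> v0 + \<eta>') / P x < \<tau> v0 + \<eta> \<and> P x > 0" by (rule eventually_conj)
  then obtain \<rho>2 where \<rho>2: "\<rho>2 > 0" "\<And>x. x \<noteq> v0 ==> dist x v0 < \<rho>2 ==> (\<kappa> v0 + \<eta>') / P x < \<tau> v0 + \<eta> \<and> P x > 0"
    by (auto simp: eventually_at)
  show ?thesis
  proof (intro exI[of _ "min \<rho>1 \<rho>2"] conjI allI impI)
    fix x assume x: "dist x v0 < min \<rho>1 \<rho>2"
    have *: "(\<kappa> v0 + \<eta>') / P x < \<tau> v0 + \<eta> \<and> P x > 0"
      using \<rho>2(2)[of x] x P0 \<open>(\<kappa> v0 + \<eta>') / P v0 < \<tau> v0 + \<eta>\<close> by (cases "x = v0") auto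
    then show "cr e (evalmap F x) \<noteq> 0" using m by (auto simp: P_def power_0_left)
    have "norm (A x) / P x \<le> (\<kappa> v0 + \<eta>') * norm (eval3 G x) / P x"
      using \<rho>1(2)[of x] x * by (intro divide_right_mono) auto
    also have "\<dots> = ((\<kappa> v0 + \<eta>') / P x) * norm (eval3 G x)" by simp
    also have "\<dots> \<le> (\<tau> v0 + \<eta>) * norm (eval3 G x)" using * by (intro mult_right_mono) auto
    finally show "norm (A x) / norm (cr e (evalmap F x)) ^ m \<le> (\<tau> v0 + \<eta>) * norm (eval3 G x)"
      by (simp add: P_def)
  qed (use \<rho>1 \<rho>2 in auto)
qed

lemma dist_add_smult: "dist (v + z *s e) v0 \<le> dist v v0 + norm z * norm e"
  using norm_triangle_ineq[of "v - v0" "z *s e"] by (simp add: dist_norm algebra_simps)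

lemma growth:
  assumes \<eta>: "\<eta> > 0"
  shows "\<exists>\<rho>>0. \<forall>v\<in>Xhat. \<forall>z. norm z < \<rho> --> cr e (evalmap F (v + z *s e)) \<noteq> 0 \<and>
    norm (A (v + z *s e)) / norm (cr e (evalmap F (v + z *s e))) ^ m \<le> (\<tau> v + \<eta>) * norm (eval3 G (v + z *s e))"
proof (rule compact_local_uniform[OF compact_Xhat])
  fix v0 assume v0: "v0 \<in> Xhat"
  obtain \<rho>1 where \<rho>1: "\<rho>1 > 0" "\<And>x. dist x v0 < \<rho>1 ==> cr e (evalmap F x) \<noteq> 0 \<and>
      norm (A x) / norm (cr e (evalmap F x)) ^ m \<le> (\<tau> v0 + \<eta>/2) * norm (eval3 G x)"
    using growth_local[OF v0, of "\<eta>/2"] \<eta> by auto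
  obtain \<rho>2 where \<rho>2: "\<rho>2 > 0" "\<And>v. v \<in> Xhat ==> dist v v0 < \<rho>2 ==> dist (\<tau> v) (\<tau> v0) < \<eta>/2"
    using continuous_on_\<tau> v0 \<eta> unfolding continuous_on_iff by (metis half_gt_zero)
  define \<rho> where "\<rho> = min \<rho>2 (\<rho>1 / (1 + norm e))"
  have "\<rho> > 0" using \<rho>1 \<rho>2 by (simp add: \<rho>_def add_pos_nonneg)
  moreover have "cr e (evalmap F (v + z *s e)) \<noteq> 0 \<and>
      norm (A (v + z *s e)) / norm (cr e (evalmap F (v + z *s e))) ^ m \<le> (\<tau> v + \<eta>) * norm (eval3 G (v + z *s e))"
    if v: "v \<in> Xhat" "dist v v0 < \<rho>" and z: "norm z < \<rho>" for v z
  proof -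
    have "dist (v + z *s e) v0 \<le> dist v v0 + norm z * norm e" by (rule dist_add_smult)
    also have "\<dots> < \<rho> + \<rho> * norm e" using v z by (intro add_less_le_mono mult_right_mono) auto
    also have "\<dots> = \<rho> * (1 + norm e)" by (simp add: algebra_simps)
    also have "\<dots> \<le> \<rho>1"
      using mult_right_mono[of \<rho> "\<rho>1 / (1 + norm e)" "1 + norm e"] by (simp add: \<rho>_def add_nonneg_eq_0_iff split: if_splits)
    finally have *: "dist (v + z *s e) v0 < \<rho>1" .
    have "\<bar>\<tau> v - \<tau> v0\<bar> < \<eta>/2" using \<rho>2(2)[of v] v by (simp add: \<rho>_def dist_real_def)
    then have "\<tau> v0 + \<eta>/2 \<le> \<tau> v + \<eta>" by linarith
    then have "(\<tau> v0 + \<eta>/2) * norm (eval3 G (v + z *s e)) \<le> (\<tau> v + \<eta>) * norm (eval3 G (v + z *s e))"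
      by (intro mult_right_mono) auto
    then show ?thesis using \<rho>1(2)[OF *] by linarith
  qed
  ultimately show "\<exists>\<rho>>0. \<forall>v\<in>Xhat. dist v v0 < \<rho> --> (\<forall>z. norm z < \<rho> --> cr e (evalmap F (v + z *s e)) \<noteq> 0 \<and>
    norm (A (v + z *s e)) / norm (cr e (evalmap F (v + z *s e))) ^ m \<le> (\<tau> v + \<eta>) * norm (eval3 G (v + z *s e)))"
    by blast
qed (meson less_le_trans)

text \<open>By elementarity the point \<open>V t + z e\<close> of the line through \<open>e\<close> is mapped to the line through
  \<open>V (T t)\<close>; \<open>\<zeta> t z\<close> is the coordinate of its image there.\<close>

definition \<zeta> :: "'k => 'k => 'k" where
  "\<zeta> t z = (SOME z'. \<exists>\<nu>. \<nu> \<noteq> 0 \<and> evalmap F (V t + z *s e) = \<nu> *s (V (T t) + z' *s e))"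

lemma fibre_map:
  assumes "cr e (evalmap F (V t + z *s e)) \<noteq> 0" and i: "cr e (V (T t)) $ i \<noteq> 0" and l: "e $ l \<noteq> 0"
  defines "\<nu> \<equiv> cr e (evalmap F (V t + z *s e)) $ i / cr e (V (T t)) $ i"
  shows "\<nu> \<noteq> 0" "norm \<nu> = norm (cr e (evalmap F (V t + z *s e)))"
    "evalmap F (V t + z *s e) = \<nu> *s (V (T t) + \<zeta> t z *s e)"
    "\<zeta> t z = (evalmap F (V t + z *s e) $ l / \<nu> - V (T t) $ l) / e $ l"
proof -
  let ?x = "V t + z *s e"
  obtain \<mu> where \<mu>: "evalmap F (V t) = \<mu> *s V (T t)" "\<mu> \<noteq> 0" using F_V by metis
  have "cr e (evalmap F (V t)) \<noteq> 0" using F_pcone[OF V_pcone] cr_pcone by blast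
  moreover have "dt (cr e (V t)) ?x = 0" by (simp add: dt_add)
  ultimately obtain c where "cr e (evalmap F ?x) = c *s cr e (evalmap F (V t))"
    using elementary_parallel[OF F elem e cr_pcone[OF V_pcone]] by metis
  then have par: "cr e (evalmap F ?x) = (c * \<mu>) *s cr e (V (T t))"
    by (simp add: \<mu> cr_smult vector_smult_assoc)
  then have lam: "\<nu> = c * \<mu>" using i by (simp add: \<nu>_def)
  show l0: "\<nu> \<noteq> 0" using assms(1) par lam by auto
  show "norm \<nu> = norm (cr e (evalmap F ?x))" by (simp add: par lam V_norm norm_mult)
  have "cr e (evalmap F ?x - \<nu> *s V (T t)) = 0" by (simp add: cr_diff cr_smult par lam)
  then obtain c' where c': "evalmap F ?x - \<nu> *s V (T t) = c' *s e" using cr_eq_0D e by metis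
  then have "evalmap F ?x = \<nu> *s (V (T t) + (c'/\<nu>) *s e)"
    using l0 by (simp add: vector_add_ldistrib vector_smult_assoc algebra_simps)
  then have ex: "\<exists>z' \<nu>. \<nu> \<noteq> 0 \<and> evalmap F ?x = \<nu> *s (V (T t) + z' *s e)" using l0 by blast
  obtain \<nu>' where \<nu>': "\<nu>' \<noteq> 0" "evalmap F ?x = \<nu>' *s (V (T t) + \<zeta> t z *s e)"
    using someI_ex[OF ex] unfolding \<zeta>_def by blast
  have "cr e (evalmap F ?x) $ i = \<nu>' * cr e (V (T t)) $ i" by (simp add: \<nu>'(2) cr_smult cr_add)
  then have "\<nu>' = \<nu>" using i by (simp add: \<nu>_def)
  then show eq: "evalmap F ?x = \<nu> *s (V (T t) + \<zeta> t z *s e)" using \<nu>' by simp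
  show "\<zeta> t z = (evalmap F ?x $ l / \<nu> - V (T t) $ l) / e $ l"
    unfolding eq using l0 l by (simp add: field_simps)
qed

lemma fibre_map':
  assumes "cr e (evalmap F (V t + z *s e)) \<noteq> 0"
  obtains \<nu> where "\<nu> \<noteq> 0" "norm \<nu> = norm (cr e (evalmap F (V t + z *s e)))"
    "evalmap F (V t + z *s e) = \<nu> *s (V (T t) + \<zeta> t z *s e)"
proof -
  obtain i l where "cr e (V (T t)) $ i \<noteq> 0" "e $ l \<noteq> 0"
    using nonzero_nth[OF cr_pcone[OF V_pcone]] nonzero_nth[OF e] by metis
  from fibre_map(1-3)[OF assms this] show thesis by (rule that)
qed

lemma continuous_on_\<zeta>:
  assumes "\<And>z. z \<in> S ==> cr e (evalmap F (V t + z *s e)) \<noteq> 0"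
  shows "continuous_on S (\<zeta> t)"
proof -
  obtain i l where il: "cr e (V (T t)) $ i \<noteq> 0" "e $ l \<noteq> 0"
    using nonzero_nth[OF cr_pcone[OF V_pcone]] nonzero_nth[OF e] by metis
  have c: "continuous_on S (\<lambda>z. evalmap F (V t + z *s e))"
    by (intro continuous_on_compose2[OF continuous_on_evalmap[of UNIV]] continuous_intros) auto
  have "continuous_on S (\<lambda>z. (evalmap F (V t + z *s e) $ l /
      (cr e (evalmap F (V t + z *s e)) $ i / cr e (V (T t)) $ i) - V (T t) $ l) / e $ l)"
    by (intro continuous_intros c) (use fibre_map(1)[OF assms il] il in auto)
  moreover have "\<zeta> t z = (evalmap F (V t + z *s e) $ l /
      (cr e (evalmap F (V t + z *s e)) $ i / cr e (V (T t)) $ i) - V (T t) $ l) / e $ l" if "z \<in> S" for z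
    by (rule fibre_map(4)[OF assms[OF that] il])
  ultimately show ?thesis by (simp cong: continuous_on_cong)
qed

lemma \<zeta>_0: "\<zeta> t 0 = 0"
proof -
  have c: "cr e (evalmap F (V t + 0 *s e)) \<noteq> 0" using F_pcone[OF V_pcone] cr_pcone by simp
  then obtain \<nu> where l: "\<nu> \<noteq> 0" "evalmap F (V t + 0 *s e) = \<nu> *s (V (T t) + \<zeta> t 0 *s e)"
    using fibre_map' by metis
  obtain \<mu> where \<mu>: "evalmap F (V t) = \<mu> *s V (T t)" "\<mu> \<noteq> 0" using F_V by metis
  have eq: "\<mu> *s V (T t) = \<nu> *s V (T t) + (\<nu> * \<zeta> t 0) *s e"
    using l(2) \<mu>(1) by (simp add: vector_add_ldistrib vector_smult_assoc)
  then have "cr e (\<mu> *s V (T t)) = cr e (\<nu> *s V (T t) + (\<nu> * \<zeta> t 0) *s e)" by simp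
  then have "\<mu> *s cr e (V (T t)) = \<nu> *s cr e (V (T t))" by (simp add: cr_smult cr_add)
  then have "(\<mu> - \<nu>) *s cr e (V (T t)) = 0" by (simp add: vector_sub_rdistrib)
  then have "\<mu> = \<nu>" using cr_pcone[OF V_pcone] by (simp add: smult_eq_0)
  then have "(\<nu> * \<zeta> t 0) *s e = 0" using eq by simp
  then show ?thesis using l(1) e by (simp add: smult_eq_0)
qed

end

lemma countable_negligible: "countable S ==> negligible (S :: 'a::euclidean_space set)"
  by (simp add: negligible_iff_null_sets null_sets_completionI countable_imp_null_set_lborel)

lemma basin_backward:
  assumes "p \<notin> indeterminacy F" "ratmap F p \<in> basin F X"
  shows "p \<in> basin F X"
proof -
  have S: "(ratmap F ^^ n) (ratmap F p) = (ratmap F ^^ Suc n) p" for n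
    by (simp add: funpow_swap1)
  have "(ratmap F ^^ n) p \<notin> indeterminacy F" for n
    using assms S by (cases n) (auto simp: basin_def simp del: funpow.simps(2))
  moreover have "\<forall>\<^sub>F n in sequentially. (ratmap F ^^ n) p \<in> U" if "open U" "X \<subseteq> U" for U
  proof -
    have "\<forall>\<^sub>F n in sequentially. (ratmap F ^^ n) (ratmap F p) \<in> U" using assms(2) that by (simp add: basin_def)
    then show ?thesis unfolding S by (rule eventually_sequentially_Suc[THEN iffD1])
  qed
  ultimately show ?thesis by (simp add: basin_def)
qed

context elementary_curve
begin

definition pt :: "'k => 'k => 'k proj2" where "pt t z = to_proj2 (V t + z *s e)"

lemma line_nonzero: "V t + z *s e \<noteq> 0"
proof
  assume "V t + z *s e = 0"
  then have "cr e (V t + z *s e) = 0" by simp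
  then show False using cr_pcone[OF V_pcone] by (simp add: cr_add cr_smult)
qed

lemma pt_step:
  assumes "cr e (evalmap F (V t + z *s e)) \<noteq> 0"
  shows "pt t z \<notin> indeterminacy F" "ratmap F (pt t z) = pt (T t) (\<zeta> t z)"
proof -
  have F0: "evalmap F (V t + z *s e) \<noteq> 0" using assms by auto
  then show "pt t z \<notin> indeterminacy F" unfolding pt_def using indeterminacy_iff[OF F line_nonzero] by simp
  obtain \<nu> where \<nu>: "\<nu> \<noteq> 0" "evalmap F (V t + z *s e) = \<nu> *s (V (T t) + \<zeta> t z *s e)"
    using fibre_map'[OF assms] by metis
  have "ratmap F (pt t z) = to_proj2 (evalmap F (V t + z *s e))"
    unfolding pt_def by (rule ratmap_to_proj2[OF F line_nonzero F0])
  also have "\<dots> = pt (T t) (\<zeta> t z)" unfolding \<nu>(2) pt_def by (rule to_proj2_smult[OF \<nu>(1) line_nonzero])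
  finally show "ratmap F (pt t z) = pt (T t) (\<zeta> t z)" .
qed

lemma continuous_on_line: "continuous_on S (\<lambda>z. V t + z *s e)"
  by (intro continuous_intros)

lemma short_segments_in_open:
  assumes "open U" "X \<subseteq> U"
  shows "\<exists>\<rho>>0. \<forall>v\<in>Xhat. \<forall>z. norm z < \<rho> --> to_proj2 (v + z *s e) \<in> U"
proof (rule compact_local_uniform[OF compact_Xhat])
  fix v0 assume "v0 \<in> Xhat"
  then have "v0 \<in> {v. v \<noteq> 0 \<and> to_proj2 v \<in> U}" using assms(2) by (auto simp: Xhat_def pcone_def)
  moreover have "open {v. v \<noteq> 0 \<and> to_proj2 v \<in> U}" using assms(1) by (simp add: open_proj2_iff)
  ultimately obtain r where r: "r > 0" "ball v0 r \<subseteq> {v. v \<noteq> 0 \<and> to_proj2 v \<in> U}"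
    unfolding open_contains_ball by blast
  define \<rho> where "\<rho> = r / (1 + norm e)"
  have pos: "1 + norm e > 0" by (simp add: add_pos_nonneg)
  have "\<rho> > 0" using r pos by (simp add: \<rho>_def)
  moreover have "to_proj2 (v + z *s e) \<in> U" if "dist v v0 < \<rho>" "norm z < \<rho>" for v z
  proof -
    have "dist (v + z *s e) v0 \<le> dist v v0 + norm z * norm e" by (rule dist_add_smult)
    also have "\<dots> < \<rho> + \<rho> * norm e" using that by (intro add_less_le_mono mult_right_mono) auto
    also have "\<rho> + \<rho> * norm e = \<rho> * (1 + norm e)" by (simp add: algebra_simps)
    also have "\<dots> = r" using pos by (simp add: \<rho>_def)
    finally have "v + z *s e \<in> ball v0 r" by (simp add: dist_commute)
    then show ?thesis using r by blast
  qed
  ultimately show "\<exists>\<rho>>0. \<forall>v\<in>Xhat. dist v v0 < \<rho> --> (\<forall>z. norm z < \<rho> --> to_proj2 (v + z *s e) \<in> U)" by blast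
qed (meson less_le_trans)

primrec zs :: "'k => nat => 'k => 'k" where
  "zs t 0 z = z"
| "zs t (Suc k) z = \<zeta> ((T ^^ k) t) (zs t k z)"

text \<open>The image of a small disc under \<open>f\<^sup>k\<close> stays a connected subset of a line through \<open>e\<close> that
  contains a point of the curve, and \<open>G\<close> is small on it; hence it is short, and the growth
  estimate continues to hold at the next step.\<close>

lemma segment_in_basin:
  assumes \<eta>: "\<eta> > 0" and q: "0 \<le> q" "q < 1"
    and prod: "\<And>n. (\<Prod>k<n. \<tau> (V ((T ^^ k) t)) + \<eta>) \<le> C * q ^ n"
  shows "\<exists>\<epsilon>>0. \<forall>z. norm z < \<epsilon> --> pt t z \<in> basin F X"
proof -
  let ?t = "\<lambda>k. (T ^^ k) t"
  let ?G = "\<lambda>k z. norm (eval3 G (V (?t k) + z *s e))"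
  obtain \<rho> where \<rho>: "\<rho> > 0" "\<And>v z. v \<in> Xhat ==> norm z < \<rho> ==> cr e (evalmap F (v + z *s e)) \<noteq> 0 \<and>
    norm (A (v + z *s e)) / norm (cr e (evalmap F (v + z *s e))) ^ m \<le> (\<tau> v + \<eta>) * norm (eval3 G (v + z *s e))"
    using growth[OF \<eta>] by blast
  obtain \<epsilon>0 where \<epsilon>0: "\<epsilon>0 > 0" "\<And>v D. v \<in> Xhat ==> connected D ==> 0 \<in> D ==>
      (\<And>z. z \<in> D ==> norm (eval3 G (v + z *s e)) < \<epsilon>0) ==> D \<subseteq> ball 0 \<rho>"
    using small_sublevel_components[OF hom Ge compact_Xhat \<rho>(1)] by metis
  have C: "C \<ge> 1" using prod[of 0] by simp
  have "continuous_on UNIV (\<lambda>z. ?G 0 z)"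
    by (intro continuous_intros continuous_on_compose2[OF pfun_continuous[OF pfun_eval3, of UNIV]] continuous_on_line) auto
  then have "isCont (\<lambda>z. ?G 0 z) 0" by (simp add: continuous_on_eq_continuous_at)
  moreover have "?G 0 0 = 0" using pconeX[OF V_pcone] by simp
  ultimately obtain \<epsilon>1 where \<epsilon>1: "\<epsilon>1 > 0" "\<And>z. dist z 0 < \<epsilon>1 ==> dist (?G 0 z) 0 < \<epsilon>0 / C"
    using \<epsilon>0(1) C unfolding continuous_at_eps_delta by (metis divide_pos_pos less_le_trans zero_less_one)
  define \<epsilon> where "\<epsilon> = min \<rho> \<epsilon>1"
  define D where "D = ball (0::'k) \<epsilon>"
  have \<epsilon>: "\<epsilon> > 0" using \<rho> \<epsilon>1 by (simp add: \<epsilon>_def)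
  have G0: "C * ?G 0 z < \<epsilon>0" if "z \<in> D" for z
    using \<epsilon>1(2)[of z] that C by (simp add: D_def \<epsilon>_def field_simps)
  have main: "continuous_on D (zs t k) \<and> zs t k 0 = 0 \<and>
      (\<forall>z\<in>D. ?G k (zs t k z) \<le> (\<Prod>j<k. \<tau> (V (?t j)) + \<eta>) * ?G 0 z \<and> norm (zs t k z) < \<rho>)" for k
  proof (induction k)
    case 0
    show ?case by (auto simp: D_def \<epsilon>_def intro: continuous_intros)
  next
    case (Suc k)
    then have IH: "continuous_on D (zs t k)" "zs t k 0 = 0"
      "\<And>z. z \<in> D ==> ?G k (zs t k z) \<le> (\<Prod>j<k. \<tau> (V (?t j)) + \<eta>) * ?G 0 z"
      "\<And>z. z \<in> D ==> norm (zs t k z) < \<rho>" by auto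
    have nz: "cr e (evalmap F (V (?t k) + z *s e)) \<noteq> 0" if "norm z < \<rho>" for z
      using \<rho>(2)[OF V(1) that] by blast
    have cont: "continuous_on D (zs t (Suc k))"
    proof -
      have "continuous_on D (\<lambda>z. \<zeta> (?t k) (zs t k z))"
        by (rule continuous_on_compose2[OF continuous_on_\<zeta>[of "{z. norm z < \<rho>}" "?t k"] IH(1)])
          (use nz IH(4) in auto)
      then show ?thesis by simp
    qed
    have zero: "zs t (Suc k) 0 = 0" using IH(2) \<zeta>_0 by simp
    have gr: "?G (Suc k) (zs t (Suc k) z) \<le> (\<Prod>j<Suc k. \<tau> (V (?t j)) + \<eta>) * ?G 0 z" if z: "z \<in> D" for z
    proof -
      let ?x = "V (?t k) + zs t k z *s e"
      have nzx: "cr e (evalmap F ?x) \<noteq> 0" using nz IH(4)[OF z] by blast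
      obtain \<nu> where \<nu>: "\<nu> \<noteq> 0" "norm \<nu> = norm (cr e (evalmap F ?x))"
        "evalmap F ?x = \<nu> *s (V (T (?t k)) + \<zeta> (?t k) (zs t k z) *s e)"
        by (rule fibre_map'[OF nzx])
      have "norm (A ?x) = norm \<nu> ^ m * ?G (Suc k) (zs t (Suc k) z)"
        unfolding A_def \<nu>(3) eval3_scale[OF hom] by (simp add: norm_mult norm_power)
      then have "?G (Suc k) (zs t (Suc k) z) = norm (A ?x) / norm (cr e (evalmap F ?x)) ^ m"
        using \<nu>(1,2) nzx by (simp add: field_simps)
      also have "\<dots> \<le> (\<tau> (V (?t k)) + \<eta>) * ?G k (zs t k z)"
        using \<rho>(2)[OF V(1) IH(4)[OF z], of "?t k"] by blast
      also have "\<dots> \<le> (\<tau> (V (?t k)) + \<eta>) * ((\<Prod>j<k. \<tau> (V (?t j)) + \<eta>) * ?G 0 z)"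
        using IH(3)[OF z] \<tau>_nonneg[of "V (?t k)"] \<eta> by (intro mult_left_mono) auto
      finally show ?thesis by (simp only: prod.lessThan_Suc mult_ac)
    qed
    have small: "?G (Suc k) (zs t (Suc k) z) < \<epsilon>0" if z: "z \<in> D" for z
    proof -
      have "?G (Suc k) (zs t (Suc k) z) \<le> (C * q ^ Suc k) * ?G 0 z"
        by (rule order_trans[OF gr[OF z] mult_right_mono[OF prod norm_ge_zero]])
      also have "\<dots> \<le> (C * 1) * ?G 0 z"
        using q C by (intro mult_right_mono mult_left_mono power_le_one) auto
      also have "\<dots> < \<epsilon>0" using G0[OF z] by simp
      finally show ?thesis .
    qed
    have "zs t (Suc k) ` D \<subseteq> ball 0 \<rho>"
    proof (rule \<epsilon>0(2)[OF V(1)[of "?t (Suc k)"]])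
      show "connected (zs t (Suc k) ` D)"
        by (rule connected_continuous_image[OF cont]) (simp add: D_def)
      show "0 \<in> zs t (Suc k) ` D" using zero \<epsilon> by (intro image_eqI[of _ _ 0]) (auto simp: D_def)
    qed (use small in blast)
    then show ?case using cont zero gr by (auto simp del: zs.simps prod.lessThan_Suc)
  qed
  have nz: "cr e (evalmap F (V (?t k) + zs t k z *s e)) \<noteq> 0" if "z \<in> D" for k z
    using \<rho>(2)[OF V(1), of "zs t k z" "?t k"] main[of k] that by blast
  have orbit: "(ratmap F ^^ k) (pt t z) = pt (?t k) (zs t k z)" if z: "z \<in> D" for k z
  proof (induction k)
    case (Suc k)
    then show ?case using pt_step(2)[OF nz[OF z, of k]] by simp
  qed simp
  have "pt t z \<in> basin F X" if z: "z \<in> D" for z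
    unfolding basin_def
  proof (intro CollectI conjI allI impI)
    show "(ratmap F ^^ k) (pt t z) \<notin> indeterminacy F" for k
      unfolding orbit[OF z] by (rule pt_step(1)[OF nz[OF z]])
    fix U assume U: "open U \<and> X \<subseteq> U"
    then obtain \<rho>2 where \<rho>2: "\<rho>2 > 0" "\<And>v z. v \<in> Xhat ==> norm z < \<rho>2 ==> to_proj2 (v + z *s e) \<in> U"
      using short_segments_in_open[of U] by blast
    obtain \<epsilon>2 where \<epsilon>2: "\<epsilon>2 > 0" "\<And>v D. v \<in> Xhat ==> connected D ==> 0 \<in> D ==>
        (\<And>z. z \<in> D ==> norm (eval3 G (v + z *s e)) < \<epsilon>2) ==> D \<subseteq> ball 0 \<rho>2"
      using small_sublevel_components[OF hom Ge compact_Xhat \<rho>2(1)] by metis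
    have "(\<lambda>k. \<epsilon>0 * q ^ k) \<longlonglongrightarrow> \<epsilon>0 * 0"
      using q by (intro tendsto_intros LIMSEQ_power_zero) auto
    then have "\<forall>\<^sub>F k in sequentially. \<epsilon>0 * q ^ k < \<epsilon>2" using \<epsilon>2(1) by (intro order_tendstoD) auto
    then show "\<forall>\<^sub>F k in sequentially. (ratmap F ^^ k) (pt t z) \<in> U"
    proof eventually_elim
      case (elim k)
      have "zs t k ` D \<subseteq> ball 0 \<rho>2"
      proof (rule \<epsilon>2(2)[OF V(1)[of "?t k"]])
        show "connected (zs t k ` D)"
          by (rule connected_continuous_image) (use main in \<open>auto simp: D_def\<close>)
        show "0 \<in> zs t k ` D" using main[of k] \<epsilon> by (intro image_eqI[of _ _ 0]) (auto simp: D_def)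
        fix y assume "y \<in> zs t k ` D"
        then obtain x where x: "x \<in> D" "y = zs t k x" by blast
        have "?G k y \<le> (\<Prod>j<k. \<tau> (V (?t j)) + \<eta>) * ?G 0 x" using main[of k] x by blast
        also have "\<dots> \<le> (C * q ^ k) * ?G 0 x" by (intro mult_right_mono prod) auto
        also have "\<dots> = (C * ?G 0 x) * q ^ k" by simp
        also have "\<dots> \<le> \<epsilon>0 * q ^ k" using G0[OF x(1)] q by (intro mult_right_mono) auto
        finally show "?G k y < \<epsilon>2" using elim by linarith
      qed
      then have "norm (zs t k z) < \<rho>2" using z by auto
      then have "pt (?t k) (zs t k z) \<in> U" unfolding pt_def by (rule \<rho>2(2)[OF V(1)])
      then show ?case by (simp only: orbit[OF z])
    qed
  qed
  then show ?thesis using \<epsilon> by (intro exI[of _ \<epsilon>]) (auto simp: D_def)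
qed

lemma segment_pullback:
  assumes "\<exists>\<epsilon>>0. \<forall>z. norm z < \<epsilon> --> pt ((T ^^ n) t) z \<in> basin F X"
  shows "\<exists>\<epsilon>>0. \<forall>z. norm z < \<epsilon> --> pt t z \<in> basin F X"
  using assms
proof (induction n arbitrary: t)
  case (Suc n)
  then have "\<exists>\<epsilon>>0. \<forall>z. norm z < \<epsilon> --> pt ((T ^^ n) (T t)) z \<in> basin F X"
    by (simp add: funpow_swap1)
  then obtain \<epsilon> where \<epsilon>: "\<epsilon> > 0" "\<And>z. norm z < \<epsilon> ==> pt (T t) z \<in> basin F X" using Suc.IH by blast
  obtain \<rho> where \<rho>: "\<rho> > 0" "\<And>z. norm z < \<rho> ==> cr e (evalmap F (V t + z *s e)) \<noteq> 0"
    using growth[of 1] V(1) by auto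
  have "continuous_on (ball 0 \<rho>) (\<zeta> t)" using \<rho>(2) by (intro continuous_on_\<zeta>) auto
  then have "isCont (\<zeta> t) 0" using \<rho>(1) by (simp add: continuous_on_eq_continuous_at)
  then obtain \<delta> where \<delta>: "\<delta> > 0" "\<And>z. dist z 0 < \<delta> ==> dist (\<zeta> t z) 0 < \<epsilon>"
    using \<epsilon>(1) \<zeta>_0 unfolding continuous_at_eps_delta by metis
  show ?case
  proof (intro exI[of _ "min \<rho> \<delta>"] conjI allI impI)
    fix z :: 'k assume "norm z < min \<rho> \<delta>"
    then have nz: "cr e (evalmap F (V t + z *s e)) \<noteq> 0" and small: "norm (\<zeta> t z) < \<epsilon>"
      using \<rho>(2) \<delta>(2)[of z] by auto
    have "ratmap F (pt t z) \<in> basin F X" unfolding pt_step(2)[OF nz] by (rule \<epsilon>(2)[OF small])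
    then show "pt t z \<in> basin F X" by (rule basin_backward[OF pt_step(1)[OF nz]])
  qed (use \<rho> \<delta> in auto)
qed auto

text \<open>Positive volume from a non-null set of parameters: some chart of the slope meets the set in
  a non-null set.\<close>

lemma volume_of_good_segments:
  assumes B: "B \<in> sets borel" and E: "\<not> negligible E"
    and seg: "\<And>t. t \<in> E ==> \<exists>\<epsilon>>0. \<forall>z. norm z < \<epsilon> --> pt t z \<in> B"
  shows "emeasure proj2_volume B > 0"
proof -
  define good where "good S \<longleftrightarrow> (\<exists>h i j D \<sigma>. open S \<and> (\<forall>l. (\<lambda>t. h t $ l) differentiable_on S) \<and>
     \<sigma> differentiable_on D \<and>
     (\<forall>t\<in>S. cr e (h t) $ i \<noteq> 0 \<and> cr e (h t) $ j / cr e (h t) $ i \<in> D \<and>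
        \<sigma> (cr e (h t) $ j / cr e (h t) $ i) = t) \<and>
     (\<forall>t\<in>S. \<forall>v. v \<noteq> 0 \<and> to_proj2 v = \<gamma> t --> (\<exists>c. cr e v = c *s cr e (h t))))" for S
  have "open S" if "S \<in> Collect good" for S using that unfolding good_def by blast
  then obtain \<F> where \<F>: "\<F> \<subseteq> Collect good" "countable \<F>" "\<Union>\<F> = \<Union>(Collect good)"
    using Lindelof[of "Collect good"] by metis
  have cover: "E \<subseteq> (\<Union>S\<in>\<F>. E \<inter> S) \<union> {t. \<not> slope_chart e \<gamma> t}"
  proof
    fix t assume t: "t \<in> E"
    show "t \<in> (\<Union>S\<in>\<F>. E \<inter> S) \<union> {t. \<not> slope_chart e \<gamma> t}"
    proof (cases "slope_chart e \<gamma> t")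
      case True
      then obtain S where "good S" "t \<in> S" unfolding slope_chart_def good_def by blast
      then have "t \<in> \<Union>\<F>" using \<F>(3) by blast
      then show ?thesis using t by blast
    qed simp
  qed
  have "\<exists>S\<in>\<F>. \<not> negligible (E \<inter> S)"
  proof (rule ccontr)
    assume "\<not> ?thesis"
    then have "negligible (\<Union>S\<in>\<F>. E \<inter> S)"
      using \<F>(2) by (intro negligible_countable_Union) auto
    moreover have "negligible {t. \<not> slope_chart e \<gamma> t}" using charts by (rule countable_negligible)
    ultimately have "negligible ((\<Union>S\<in>\<F>. E \<inter> S) \<union> {t. \<not> slope_chart e \<gamma> t})" by (rule negligible_Un)
    then show False using cover E negligible_subset by blast
  qed
  then obtain S where S: "good S" "\<not> negligible (E \<inter> S)" using \<F>(1) by blast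
  then obtain h i j D \<sigma> where h: "open S" "\<And>l. (\<lambda>t. h t $ l) differentiable_on S" "\<sigma> differentiable_on D"
    "\<And>t. t \<in> S ==> cr e (h t) $ i \<noteq> 0" "\<And>t. t \<in> S ==> cr e (h t) $ j / cr e (h t) $ i \<in> D"
    "\<And>t. t \<in> S ==> \<sigma> (cr e (h t) $ j / cr e (h t) $ i) = t"
    "\<And>t v. t \<in> S ==> v \<noteq> 0 ==> to_proj2 v = \<gamma> t ==> \<exists>c. cr e v = c *s cr e (h t)"
    unfolding good_def by blast
  show ?thesis
  proof (rule volume_of_segments[OF h(1,2) e h(4) h(3) h(5) h(6) B S(2)])
    fix t assume t: "t \<in> E \<inter> S"
    obtain c where c: "cr e (V t) = c *s cr e (h t)" using h(7)[of t "V t"] t V_nonzero V(2) by blast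
    have c0: "c \<noteq> 0" using c cr_pcone[OF V_pcone, of t] by auto
    have "cr e (V t - c *s h t) = 0" by (simp add: cr_diff cr_smult c)
    then obtain y where y: "V t - c *s h t = y *s e" using cr_eq_0D e by metis
    then have Vt: "V t = c *s h t + y *s e" by (simp add: algebra_simps)
    obtain \<epsilon> where \<epsilon>: "\<epsilon> > 0" "\<And>z. norm z < \<epsilon> ==> pt t z \<in> B" using seg[of t] t by blast
    have "to_proj2 (h t + z *s e) \<in> B" if z: "norm (z - y/c) < \<epsilon> / norm c" for z
    proof -
      have "c * z - y = c * (z - y/c)" using c0 by (simp add: right_diff_distrib)
      then have "norm (c * z - y) = norm c * norm (z - y/c)" by (simp only: norm_mult)
      also have "\<dots> < \<epsilon>" using z c0 by (simp add: field_simps)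
      finally have "pt t (c * z - y) \<in> B" by (rule \<epsilon>(2))
      moreover have eq: "V t + (c * z - y) *s e = c *s (h t + z *s e)"
        unfolding Vt by (simp add: vec_eq_iff algebra_simps)
      moreover have "h t + z *s e \<noteq> 0"
      proof
        assume "h t + z *s e = 0"
        then have "V t + (c * z - y) *s e = 0" unfolding eq by (simp only: smult_zero)
        then show False using line_nonzero by blast
      qed
      ultimately show ?thesis unfolding pt_def using to_proj2_smult[OF c0] by metis
    qed
    then show "\<exists>z0 \<epsilon>. 0 < \<epsilon> \<and> (\<forall>z. norm (z - z0) < \<epsilon> --> to_proj2 (h t + z *s e) \<in> B)"
      using \<epsilon>(1) c0 by (intro exI[of _ "y/c"] exI[of _ "\<epsilon> / norm c"]) auto
  qed auto
qed

lemma basin_positive_from_good_set: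
  assumes E: "E \<in> sets borel" and per: "\<And>x \<omega>. \<omega> \<in> \<Omega> ==> x + \<omega> \<in> E \<longleftrightarrow> x \<in> E"
    and pos: "emeasure lborel (E \<inter> Q) > 0"
    and good: "\<And>t. t \<in> E ==> \<exists>\<epsilon>>0. \<forall>z. norm z < \<epsilon> --> pt t z \<in> basin F X"
  shows "basin_positive F X"
proof -
  have bB: "basin F X \<in> sets borel" by (rule basin_borel[OF F compact_X])
  have loc: "emeasure proj2_volume (U \<inter> basin F X) > 0" if p: "p \<in> X" and U: "open U" "p \<in> U" for p U
  proof -
    obtain t0 where t0: "p = \<gamma> t0" using p X by auto
    have "open (\<gamma> -` U)" using \<gamma> U(1) by (intro open_vimage) auto
    moreover have "t0 \<in> \<gamma> -` U" using t0 U(2) by simp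
    ultimately obtain r where r: "r > 0" "ball t0 r \<subseteq> \<gamma> -` U" by (rule openE)
    obtain n where n: "\<not> negligible {t \<in> ball t0 r. (T ^^ n) t \<in> E}"
      using T_iter_covers[OF E per pos r(1)] by blast
    show ?thesis
    proof (rule volume_of_good_segments[OF _ n])
      show "U \<inter> basin F X \<in> sets borel" using bB U(1) by auto
      fix t assume t: "t \<in> {t \<in> ball t0 r. (T ^^ n) t \<in> E}"
      then obtain \<epsilon> where \<epsilon>: "\<epsilon> > 0" "\<And>z. norm z < \<epsilon> ==> pt t z \<in> basin F X"
        using segment_pullback good by blast
      have "continuous_on UNIV (pt t)"
        unfolding pt_def[abs_def] by (intro continuous_on_to_proj2 continuous_on_line line_nonzero)
      then have "open (pt t -` U)" using U(1) by (intro open_vimage) auto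
      moreover have "0 \<in> pt t -` U" using t r(2) V(2)[of t] by (auto simp: pt_def)
      ultimately obtain \<epsilon>' where \<epsilon>': "\<epsilon>' > 0" "ball 0 \<epsilon>' \<subseteq> pt t -` U" unfolding open_contains_ball by blast
      show "\<exists>\<epsilon>>0. \<forall>z. norm z < \<epsilon> --> pt t z \<in> U \<inter> basin F X"
        using \<epsilon> \<epsilon>' by (intro exI[of _ "min \<epsilon> \<epsilon>'"]) auto
    qed
  qed
  have "\<gamma> 0 \<in> X" using X by blast
  then have "emeasure proj2_volume (UNIV \<inter> basin F X) > 0" by (intro loc) auto
  then show ?thesis using loc by (auto simp: basin_positive_def)
qed

end

lemma dt_minus [simp]: "dt u (- v) = - dt u v"
  by (simp add: dt3)

lemma log_truncation:
  fixes x :: real and M :: nat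
  assumes "0 \<le> x"
  shows "e2ennreal (log_ereal x) = ennreal (ln (max x (exp (- real M))))"
    and "min (e2ennreal (- log_ereal x)) (of_nat M) = ennreal (- ln (max x (exp (- real M))))"
proof -
  consider "x = 0" | "0 < x" "x \<le> exp (- real M)" | "exp (- real M) < x" using assms by linarith
  then show "e2ennreal (log_ereal x) = ennreal (ln (max x (exp (- real M))))"
  proof cases
    case 2
    then have "ln x \<le> - real M" by (metis exp_gt_zero ln_exp ln_le_cancel_iff)
    also have "\<dots> \<le> 0" by simp
    finally show ?thesis using 2 by (simp add: log_ereal_def max_def ennreal_neg)
  next
    case 3
    then have "0 < x" by (meson exp_gt_zero less_trans)
    then show ?thesis using 3 by (simp add: log_ereal_def max_def)
  qed (simp add: log_ereal_def max_def ennreal_neg e2ennreal_neg)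
  consider "x = 0" | "0 < x" "x \<le> exp (- real M)" | "exp (- real M) < x" using assms by linarith
  then show "min (e2ennreal (- log_ereal x)) (of_nat M) = ennreal (- ln (max x (exp (- real M))))"
  proof cases
    case 1
    then show ?thesis by (simp add: log_ereal_def max_def ennreal_of_nat_eq_real_of_nat)
  next
    case 2
    then have "ln x \<le> - real M" by (metis exp_gt_zero ln_exp ln_le_cancel_iff)
    then have "ennreal (real M) \<le> ennreal (- ln x)" by (intro ennreal_leI) simp
    then have "min (ennreal (- ln x)) (ennreal (real M)) = ennreal (real M)" by (rule min_absorb2)
    moreover have "max x (exp (- real M)) = exp (- real M)" using 2 by simp
    ultimately show ?thesis using 2 by (simp add: log_ereal_def ennreal_of_nat_eq_real_of_nat)
  next
    case 3
    then have x: "0 < x" by (meson exp_gt_zero less_trans)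
    then have "- real M \<le> ln x" using 3 by (metis exp_gt_zero less_imp_le ln_exp ln_le_cancel_iff)
    then have "ennreal (- ln x) \<le> ennreal (real M)" by (intro ennreal_leI) simp
    then show ?thesis using 3 x by (simp add: log_ereal_def max_def ennreal_of_nat_eq_real_of_nat min_def)
  qed
qed

lemma SUP_min_of_nat: "(SUP M. min x (of_nat M)) = (x :: ennreal)"
proof (cases "x = top")
  case True
  then show ?thesis by (simp add: ennreal_SUP_of_nat_eq_top)
next
  case False
  then obtain n where "x < of_nat n" using ennreal_Ex_less_of_nat top.not_eq_extremum by blast
  then show ?thesis by (intro antisym SUP_least SUP_upper2[of n]) (auto simp: min_def)
qed

locale elementary_curve_norm = elementary_curve Q \<Omega> a b F d m e G X \<gamma>
  for Q \<Omega> :: "'k::{real_normed_field,euclidean_space} set" and a b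
    and F :: "'k polymap" and d m :: nat and e :: "'k ^ 3" and G :: "'k poly3"
    and X :: "'k proj2 set" and \<gamma> :: "'k => 'k proj2" +
  fixes N :: "'k ^ 3 => 'k ^ 3 => real"
  assumes N: "transverse_norm G X N"
begin

lemma
  assumes "v \<in> pcone X"
  shows N_triangle: "N v (w + w') \<le> N v w + N v w'" and N_scale: "N v (s *s w) = norm s * N v w"
    and N_zero: "N v w = 0 \<longleftrightarrow> dt (grad (eval3 G) v) w = 0"
    and N_rescale: "s \<noteq> 0 ==> N (s *s v) (s *s w) = N v w"
  using N assms unfolding transverse_norm_def pfun_frechet[OF pfun_eval3] pcone_def by blast+

lemma N_cont: "continuous_on (pcone X) (\<lambda>v. N v w)"
proof -
  have "continuous_on (pcone X \<times> UNIV) (\<lambda>(v, w). N v w)" using N by (simp add: transverse_norm_def pcone_def)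
  moreover have "continuous_on (pcone X) (\<lambda>v. (v, w))" by (intro continuous_intros)
  ultimately show ?thesis using continuous_on_compose2[of "pcone X \<times> UNIV" "\<lambda>(v, w). N v w" "pcone X" "\<lambda>v. (v, w)"]
    by auto
qed

definition nrm :: "'k ^ 3 => 'k ^ 3" where "nrm v = (SOME n. dt (grad (eval3 G) v) n = 1)"

text \<open>A norm on the one-dimensional normal space is a multiple \<open>wt\<close> of \<open>\<bar>DG\<bar>\<close>.\<close>

definition wt :: "'k ^ 3 => real" where "wt v = N v (nrm v)"

lemma nrm: "v \<in> pcone X ==> dt (grad (eval3 G) v) (nrm v) = 1"
  unfolding nrm_def by (rule someI_ex) (metis transverse_direction)

lemma N_nonneg: "v \<in> pcone X ==> 0 \<le> N v w"
  using N_triangle[of v w "(-1) *s w"] N_scale[of v "-1" w] N_zero[of v "w + (-1) *s w"]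
  by (simp add: dt_add)

lemma wt_pos: "v \<in> pcone X ==> 0 < wt v"
  using N_nonneg[of v "nrm v"] N_zero[of v "nrm v"] nrm[of v] by (simp add: wt_def less_le)

lemma N_eq:
  assumes v: "v \<in> pcone X"
  shows "N v w = norm (dt (grad (eval3 G) v) w) * wt v"
proof -
  let ?s = "dt (grad (eval3 G) v) w"
  define u where "u = w - ?s *s nrm v"
  have u0: "dt (grad (eval3 G) v) u = 0" using nrm[OF v] by (simp add: u_def dt_diff)
  have "N v u = 0" "N v ((-1) *s u) = 0" using u0 by (simp_all add: N_zero[OF v])
  moreover have "w = u + ?s *s nrm v" "?s *s nrm v = w + (-1) *s u" by (simp_all add: u_def)
  ultimately have "N v w \<le> N v (?s *s nrm v)" "N v (?s *s nrm v) \<le> N v w"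
    using N_triangle[OF v, of u "?s *s nrm v"] N_triangle[OF v, of w "(-1) *s u"] by simp_all
  then show ?thesis using N_scale[OF v, of ?s "nrm v"] by (simp add: wt_def)
qed

lemma wt_scale:
  assumes v: "v \<in> pcone X" and s: "s \<noteq> 0"
  shows "norm s ^ m * wt (s *s v) = wt v"
proof -
  have sv: "s *s v \<in> pcone X" using pcone_smult[OF s] v by simp
  have g: "s *s grad (eval3 G) (s *s v) = s ^ m *s grad (eval3 G) v"
    by (rule grad_homogeneous[OF pfun_eval3 eval3_scale[OF hom]])
  have "wt v = N (s *s v) (s *s nrm v)" using N_rescale[OF v s] by (simp add: wt_def)
  also have "\<dots> = norm (dt (s *s grad (eval3 G) (s *s v)) (nrm v)) * wt (s *s v)"
    unfolding N_eq[OF sv] by simp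
  also have "\<dots> = norm s ^ m * wt (s *s v)" unfolding g using nrm[OF v] by (simp add: norm_power)
  finally show ?thesis by simp
qed

lemma wt_cont: "continuous_on (pcone X) wt"
proof (unfold continuous_on_eq_continuous_within, intro ballI)
  fix v0 assume v0: "v0 \<in> pcone X"
  let ?f = "\<lambda>v. N v (nrm v0) / norm (dt (grad (eval3 G) v) (nrm v0))"
  have gc: "continuous_on (pcone X) (\<lambda>v. dt (grad (eval3 G) v) (nrm v0))"
    by (intro continuous_intros continuous_on_grad pfun_eval3)
  then obtain r where r: "r > 0" "\<And>v. v \<in> pcone X ==> dist v v0 < r ==> dist (dt (grad (eval3 G) v) (nrm v0)) 1 < 1"
    using v0 nrm[OF v0] unfolding continuous_on_iff by (metis zero_less_one)
  have ne: "dt (grad (eval3 G) v) (nrm v0) \<noteq> 0" if "v \<in> pcone X" "dist v v0 < r" for v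
    using r(2)[OF that] by (auto simp: dist_norm)
  have c: "continuous (at v0 within pcone X) ?f"
  proof (intro continuous_intros)
    show "continuous (at v0 within pcone X) (\<lambda>v. N v (nrm v0))"
      using N_cont v0 by (simp add: continuous_on_eq_continuous_within)
    show "continuous (at v0 within pcone X) (\<lambda>v. dt (grad (eval3 G) v) (nrm v0))"
      using gc v0 by (simp add: continuous_on_eq_continuous_within)
  qed (use nrm[OF v0] in simp)
  show "continuous (at v0 within pcone X) wt"
    by (rule continuous_transform_within[OF c r(1) v0]) (simp add: N_eq ne)
qed

definition \<Phi> :: "'k ^ 3 => real" where "\<Phi> v = \<kappa> v * wt (evalmap F v) / wt v"

lemma \<kappa>_scale:
  assumes "s \<noteq> 0"
  shows "\<kappa> (s *s v) * norm s ^ m = norm s ^ (d * m) * \<kappa> v"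
proof -
  have "s *s grad A (s *s v) = s ^ (d * m) *s grad A v"
    by (rule grad_homogeneous[OF pfun_A A_scale])
  then have 1: "norm s * norm (grad A (s *s v)) = norm s ^ (d * m) * norm (grad A v)"
    by (metis norm_power norm_smult)
  have "s *s grad (eval3 G) (s *s v) = s ^ m *s grad (eval3 G) v"
    by (rule grad_homogeneous[OF pfun_eval3 eval3_scale[OF hom]])
  then have 2: "norm s * norm (grad (eval3 G) (s *s v)) = norm s ^ m * norm (grad (eval3 G) v)"
    by (metis norm_power norm_smult)
  have s: "norm s \<noteq> 0" using assms by simp
  have "\<kappa> (s *s v) = (norm s * norm (grad A (s *s v))) / (norm s * norm (grad (eval3 G) (s *s v)))"
    using s by (simp add: \<kappa>_def)
  also have "\<dots> = norm s ^ (d * m) * norm (grad A v) / (norm s ^ m * norm (grad (eval3 G) v))"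
    by (simp only: 1 2)
  finally show ?thesis using s by (simp add: \<kappa>_def)
qed

lemma \<Phi>_scale:
  assumes v: "v \<in> pcone X" and s: "s \<noteq> 0"
  shows "\<Phi> (s *s v) = \<Phi> v"
proof -
  have Fv: "evalmap F v \<in> pcone X" using F_pcone[OF v] by blast
  have n: "norm s > 0" using s by simp
  have "norm (s ^ d) ^ m * wt (s ^ d *s evalmap F v) = wt (evalmap F v)"
    using s by (intro wt_scale[OF Fv]) auto
  then have "wt (evalmap F (s *s v)) = wt (evalmap F v) / norm s ^ (d * m)"
    using n by (simp add: evalmap_scale[OF F] norm_power power_mult field_simps)
  moreover have "wt (s *s v) = wt v / norm s ^ m" using wt_scale[OF v s] n by (simp add: field_simps)
  moreover have "\<kappa> (s *s v) = norm s ^ (d * m) * \<kappa> v / norm s ^ m"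
    using \<kappa>_scale[OF s, of v] n by (simp add: field_simps)
  ultimately show ?thesis using n wt_pos[OF v] by (simp add: \<Phi>_def)
qed

lemma transverse_deriv_norm_eq:
  assumes v: "v \<in> pcone X"
  shows "transverse_deriv_norm F N (to_proj2 v) = \<Phi> v"
proof -
  let ?v = "rep_proj2 (to_proj2 v)"
  obtain s where s: "?v = s *s v"
    using to_proj2_eq_iff[OF conjunct1[OF pconeX[OF v]] rep_proj2_nonzero[of "to_proj2 v"]] by auto
  have "s \<noteq> 0" using rep_proj2_nonzero[of "to_proj2 v"] unfolding s by (auto simp del: smult_eq_0)
  have w: "?v \<in> pcone X" unfolding s pcone_smult[OF \<open>s \<noteq> 0\<close>] by (rule v)
  have Fw: "evalmap F ?v \<in> pcone X" using F_pcone[OF w] by blast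
  obtain k where k: "grad A ?v = k *s grad (eval3 G) ?v" "norm k = \<kappa> ?v" by (rule grad_A[OF w])
  have val: "N (evalmap F ?v) (jac (evalmap F) ?v u) = \<Phi> ?v" if u: "N ?v u = 1" for u
  proof -
    have "dt (grad (eval3 G) (evalmap F ?v)) (jac (evalmap F) ?v u) = dt (grad A ?v) u"
      using grad_compose[OF pfun_eval3 pfun_evalmap, of G F ?v u] by (simp add: A_def[abs_def])
    then have "N (evalmap F ?v) (jac (evalmap F) ?v u) = \<kappa> ?v * norm (dt (grad (eval3 G) ?v) u) * wt (evalmap F ?v)"
      using k by (simp add: N_eq[OF Fw] norm_mult)
    moreover have "norm (dt (grad (eval3 G) ?v) u) = 1 / wt ?v"
      using u wt_pos[OF w] N_eq[OF w, of u] by (simp add: field_simps)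
    ultimately show ?thesis by (simp add: \<Phi>_def)
  qed
  have "N ?v ((of_real (1 / wt ?v) :: 'k) *s nrm ?v) = 1"
    using wt_pos[OF w] nrm[OF w] by (simp add: N_eq[OF w] norm_divide)
  then have ne: "{u. N ?v u = 1} \<noteq> {}" by blast
  have "transverse_deriv_norm F N (to_proj2 v) = (SUP u\<in>{u. N ?v u = 1}. \<Phi> ?v)"
    unfolding transverse_deriv_norm_def Let_def evalmap_frechet using val by (intro SUP_cong) auto
  also have "\<dots> = \<Phi> ?v" using ne by simp
  also have "\<dots> = \<Phi> v" unfolding s by (rule \<Phi>_scale[OF v \<open>s \<noteq> 0\<close>])
  finally show ?thesis .
qed

definition \<Psi> :: "'k => real" where "\<Psi> t = transverse_deriv_norm F N (\<gamma> t)"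

lemma \<Psi>_eq: "\<Psi> t = \<tau> (V t) * wt (V (T t)) / wt (V t)"
proof -
  obtain \<mu> where \<mu>: "evalmap F (V t) = \<mu> *s V (T t)" "\<mu> \<noteq> 0" "norm \<mu> = norm (cr e (evalmap F (V t)))"
    by (rule F_V)
  have "norm \<mu> ^ m * wt (evalmap F (V t)) = wt (V (T t))"
    unfolding \<mu>(1) by (rule wt_scale[OF V_pcone \<mu>(2)])
  moreover have "norm \<mu> > 0" using \<mu>(2) by simp
  ultimately have "wt (evalmap F (V t)) = wt (V (T t)) / norm \<mu> ^ m" by (simp add: field_simps)
  moreover have "\<Psi> t = \<Phi> (V t)" using transverse_deriv_norm_eq[OF V_pcone, of t] by (simp only: \<Psi>_def V(2))
  ultimately show ?thesis by (simp add: \<Phi>_def \<tau>_def \<mu>(3))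
qed

lemma \<Psi>_nonneg: "0 \<le> \<Psi> t"
  using \<tau>_nonneg wt_pos[OF V_pcone] by (simp add: \<Psi>_eq less_imp_le)

lemma \<Phi>_cont: "continuous_on (pcone X) \<Phi>"
proof -
  have "continuous_on (pcone X) (\<lambda>v. wt (evalmap F v))"
    by (rule continuous_on_compose2[OF wt_cont continuous_on_evalmap]) (use F_pcone in blast)
  then show ?thesis unfolding \<Phi>_def
    by (intro continuous_intros continuous_on_\<kappa> wt_cont) (auto dest: wt_pos)
qed

lemma Xhat_pcone: "Xhat \<subseteq> pcone X" by (auto simp: Xhat_def)

lemma wt_bounds: obtains c1 c2 where "0 < c1" "\<And>v. v \<in> Xhat ==> c1 \<le> wt v" "\<And>v. v \<in> Xhat ==> wt v \<le> c2"
proof -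
  have c: "continuous_on Xhat wt" by (rule continuous_on_subset[OF wt_cont Xhat_pcone])
  have ne: "Xhat \<noteq> {}" using V(1) by blast
  obtain v1 where v1: "v1 \<in> Xhat" "\<And>v. v \<in> Xhat ==> wt v1 \<le> wt v"
    using continuous_attains_inf[OF compact_Xhat ne c] by blast
  obtain v2 where v2: "\<And>v. v \<in> Xhat ==> wt v \<le> wt v2"
    using continuous_attains_sup[OF compact_Xhat ne c] by blast
  show thesis by (rule that[of "wt v1" "wt v2"]) (use v1 v2 wt_pos Xhat_pcone in auto)
qed

lemma \<Psi>_bounded: "\<exists>B. \<forall>t. \<Psi> t \<le> B"
proof -
  have "continuous_on Xhat \<Phi>" by (rule continuous_on_subset[OF \<Phi>_cont Xhat_pcone])
  moreover have "Xhat \<noteq> {}" using V(1) by blast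
  ultimately obtain v2 where v2: "\<And>v. v \<in> Xhat ==> \<Phi> v \<le> \<Phi> v2"
    using continuous_attains_sup[OF compact_Xhat] by blast
  have "\<Psi> t = \<Phi> (V t)" for t using transverse_deriv_norm_eq[OF V_pcone, of t] by (simp only: \<Psi>_def V(2))
  then show ?thesis using v2 V(1) by metis
qed

definition gX :: "'k proj2 => real" where "gX p = (if p \<in> X then transverse_deriv_norm F N p else 1)"

lemma gX_measurable [measurable]: "gX \<in> borel_measurable borel"
  unfolding borel_measurable_iff_ge
proof
  fix c
  let ?K = "(pcone X \<inter> sphere 0 1) \<inter> \<Phi> -` {c..}"
  have cS: "compact (pcone X \<inter> sphere 0 1)" by (rule compact_pcone_sphere[OF compact_X])
  have "closed ?K"
    by (rule continuous_closed_preimage[OF continuous_on_subset[OF \<Phi>_cont] compact_imp_closed[OF cS]]) auto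
  then have "compact ?K" using compact_Int_closed[OF cS] by (metis inf_left_idem)
  moreover have "continuous_on ?K (\<lambda>v. to_proj2 v)"
    by (rule continuous_on_to_proj2) (auto intro: continuous_intros simp: pcone_def)
  ultimately have "compact (to_proj2 ` ?K)" using compact_continuous_image by blast
  then have cl: "closed (to_proj2 ` ?K)" by (rule compact_imp_closed)
  have "{p \<in> X. c \<le> transverse_deriv_norm F N p} = to_proj2 ` ?K"
  proof (intro equalityI subsetI)
    fix p assume p: "p \<in> {p \<in> X. c \<le> transverse_deriv_norm F N p}"
    obtain v where v: "p = to_proj2 v" "v \<noteq> 0" by (rule to_proj2_cases)
    let ?s = "of_real (inverse (norm v)) :: 'k"
    have s: "?s \<noteq> 0" "norm ?s = inverse (norm v)" using v by (auto simp: norm_inverse)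
    have vX: "v \<in> pcone X" using p v by (simp add: pcone_def)
    then have "?s *s v \<in> pcone X" using pcone_smult[OF s(1)] by blast
    moreover have "norm (?s *s v) = 1" using v(2) by (simp only: norm_smult s(2)) simp
    moreover have "c \<le> \<Phi> (?s *s v)" unfolding \<Phi>_scale[OF vX s(1)] using p transverse_deriv_norm_eq[OF vX] v(1) by simp
    moreover have "p = to_proj2 (?s *s v)" unfolding v(1) by (rule to_proj2_smult[OF s(1) v(2), symmetric])
    ultimately show "p \<in> to_proj2 ` ?K" by (intro image_eqI[of p to_proj2 "?s *s v"]) auto
  next
    fix p assume "p \<in> to_proj2 ` ?K"
    then obtain v where "v \<in> pcone X" "c \<le> \<Phi> v" "p = to_proj2 v" by auto
    then show "p \<in> {p \<in> X. c \<le> transverse_deriv_norm F N p}"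
      using transverse_deriv_norm_eq by (auto simp: pcone_def)
  qed
  moreover have "{p \<in> space borel. c \<le> gX p} = {p \<in> X. c \<le> transverse_deriv_norm F N p} \<union> (if c \<le> 1 then - X else {})"
    by (auto simp: gX_def)
  ultimately show "{p \<in> space borel. c \<le> gX p} \<in> sets borel"
    using cl compact_imp_closed[OF compact_X] by auto
qed

lemma \<gamma>_in_X: "\<gamma> t \<in> X"
  using X by blast

lemma \<gamma>_measurable [measurable]: "\<gamma> \<in> borel \<rightarrow>\<^sub>M borel"
  using \<gamma> by (rule borel_measurable_continuous_onI)

lemma \<Psi>_measurable [measurable]: "\<Psi> \<in> borel_measurable borel"
proof -
  have "\<Psi> = (\<lambda>t. gX (\<gamma> t))" by (rule ext) (simp add: \<Psi>_def gX_def \<gamma>_in_X)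
  then show ?thesis by simp
qed

lemma curve_integral:
  fixes f :: "real => ennreal"
  assumes [measurable]: "f \<in> borel_measurable borel"
  shows "(\<integral>\<^sup>+p\<in>X. f (transverse_deriv_norm F N p) \<partial>distr (uniform_measure lborel Q) borel \<gamma>) =
    (\<integral>\<^sup>+t\<in>Q. f (\<Psi> t) \<partial>lborel) / emeasure lborel Q"
proof -
  have [measurable]: "X \<in> sets borel" using compact_imp_closed[OF compact_X] by simp
  have "(\<integral>\<^sup>+p\<in>X. f (transverse_deriv_norm F N p) \<partial>distr (uniform_measure lborel Q) borel \<gamma>) =
      (\<integral>\<^sup>+p. f (gX p) * indicator X p \<partial>distr (uniform_measure lborel Q) borel \<gamma>)"
    by (intro nn_integral_cong) (simp add: gX_def indicator_def)
  also have "\<dots> = (\<integral>\<^sup>+t. f (gX (\<gamma> t)) * indicator X (\<gamma> t) \<partial>uniform_measure lborel Q)"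
    by (subst nn_integral_distr) auto
  also have "\<dots> = (\<integral>\<^sup>+t. f (\<Psi> t) \<partial>uniform_measure lborel Q)"
    by (intro nn_integral_cong) (simp add: gX_def \<Psi>_def \<gamma>_in_X)
  also have "\<dots> = (\<integral>\<^sup>+t\<in>Q. f (\<Psi> t) \<partial>lborel) / emeasure lborel Q"
    by (rule nn_integral_uniform_measure) auto
  finally show ?thesis .
qed

definition \<theta> :: "nat => 'k => real" where "\<theta> M t = ln (max (\<Psi> t) (exp (- real M)))"

lemma \<theta>_periodic: "periodic (\<theta> M)"
  using \<gamma>_per by (simp add: periodic_def \<theta>_def \<Psi>_def)

lemma \<theta>_measurable [measurable]: "\<theta> M \<in> borel_measurable borel"
  unfolding \<theta>_def by measurable

lemma exp_\<theta>: "exp (\<theta> M t) = max (\<Psi> t) (exp (- real M))"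
  unfolding \<theta>_def by (rule exp_ln) (simp add: less_max_iff_disj)

lemma \<theta>_bounded: "\<exists>B. \<forall>t. \<bar>\<theta> M t\<bar> \<le> B"
proof -
  obtain B where B: "\<And>t. \<Psi> t \<le> B" using \<Psi>_bounded by blast
  define B' where "B' = max B (exp (- real M))"
  have B': "B' > 0" by (simp add: B'_def less_max_iff_disj)
  have "\<theta> M t \<le> ln B'" for t
    unfolding \<theta>_def using B[of t] B' by (subst ln_le_cancel_iff) (auto simp: B'_def less_max_iff_disj)
  moreover have "- real M \<le> \<theta> M t" for t
  proof -
    have "exp (- real M) \<le> exp (\<theta> M t)" unfolding exp_\<theta> by simp
    then show ?thesis by simp
  qed
  ultimately have "\<bar>\<theta> M t\<bar> \<le> max (real M) (ln B')" for t by (smt (verit))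
  then show ?thesis by blast
qed

text \<open>The truncation at level \<open>M\<close> still has a negative mean for large \<open>M\<close>, by monotone convergence.\<close>

lemma truncated_mean_negative:
  assumes "transverse_lyapunov F N X (distr (uniform_measure lborel Q) borel \<gamma>) < 0"
  obtains M where "(\<integral>t. \<theta> M t \<partial>density lborel (indicator Q)) < 0"
proof -
  let ?P = "\<integral>\<^sup>+t\<in>Q. e2ennreal (log_ereal (\<Psi> t)) \<partial>lborel"
  let ?R = "\<integral>\<^sup>+t\<in>Q. e2ennreal (- log_ereal (\<Psi> t)) \<partial>lborel"
  have m1 [measurable]: "(\<lambda>x. e2ennreal (log_ereal x)) \<in> borel_measurable borel"
    "(\<lambda>x. e2ennreal (- log_ereal x)) \<in> borel_measurable borel"
    unfolding log_ereal_def by measurable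
  have lyap: "enn2ereal (?P / emeasure lborel Q) - enn2ereal (?R / emeasure lborel Q) < 0"
    using assms unfolding transverse_lyapunov_def curve_integral[OF m1(1)] curve_integral[OF m1(2)] .
  have "?P < ?R"
  proof (rule ccontr)
    assume "\<not> ?P < ?R"
    then have "?R / emeasure lborel Q \<le> ?P / emeasure lborel Q" by (intro divide_right_mono_ennreal) simp
    then have "0 \<le> enn2ereal (?P / emeasure lborel Q) - enn2ereal (?R / emeasure lborel Q)"
      by (intro ereal_diff_positive) (simp add: less_eq_ennreal.rep_eq)
    then show False using lyap by simp
  qed
  also have "?R = (\<integral>\<^sup>+t. (SUP M. min (e2ennreal (- log_ereal (\<Psi> t))) (of_nat M) * indicator Q t) \<partial>lborel)"
    by (simp add: SUP_mult_right_ennreal[symmetric] SUP_min_of_nat)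
  also have "\<dots> = (SUP M. \<integral>\<^sup>+t. min (e2ennreal (- log_ereal (\<Psi> t))) (of_nat M) * indicator Q t \<partial>lborel)"
    by (rule nn_integral_monotone_convergence_SUP)
      (auto simp: incseq_def le_fun_def intro!: mult_right_mono min.mono)
  finally obtain M where M: "?P < (\<integral>\<^sup>+t. min (e2ennreal (- log_ereal (\<Psi> t))) (of_nat M) * indicator Q t \<partial>lborel)"
    by (auto simp: less_SUP_iff)
  define M0 where "M0 = density lborel (indicator Q :: 'k => ennreal)"
  have [simp]: "sets M0 = sets borel" "space M0 = UNIV" by (simp_all add: M0_def)
  interpret M0: finite_measure M0
    using Q_finite by (intro finite_measureI) (simp add: M0_def emeasure_density nn_integral_cmult_indicator)
  have \<theta>M [measurable]: "\<theta> M \<in> borel_measurable M0" using \<theta>_measurable by (simp add: measurable_def)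
  obtain B where B: "\<And>t. \<bar>\<theta> M t\<bar> \<le> B" using \<theta>_bounded by blast
  have int: "integrable M0 (\<theta> M)" using B by (intro M0.integrable_const_bound[of _ B] AE_I2) auto
  have pos: "(\<integral>\<^sup>+t. ennreal (\<theta> M t) \<partial>M0) = ?P"
    by (simp add: M0_def nn_integral_density \<theta>_def log_truncation(1)[OF \<Psi>_nonneg, of _ M] mult.commute)
  have neg: "(\<integral>\<^sup>+t. ennreal (- \<theta> M t) \<partial>M0) = (\<integral>\<^sup>+t. min (e2ennreal (- log_ereal (\<Psi> t))) (of_nat M) * indicator Q t \<partial>lborel)"
    by (simp add: M0_def nn_integral_density \<theta>_def log_truncation(2)[OF \<Psi>_nonneg, of _ M] mult.commute)
  have lt: "(\<integral>\<^sup>+t. ennreal (\<theta> M t) \<partial>M0) < (\<integral>\<^sup>+t. ennreal (- \<theta> M t) \<partial>M0)" using M pos neg by simp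
  have fin: "(\<integral>\<^sup>+t. ennreal (- \<theta> M t) \<partial>M0) < top"
  proof -
    have "(\<integral>\<^sup>+t. ennreal (- \<theta> M t) \<partial>M0) \<le> (\<integral>\<^sup>+t. ennreal B \<partial>M0)"
      using B by (intro nn_integral_mono ennreal_leI) (metis abs_ge_minus_self order_trans)
    also have "\<dots> = ennreal B * emeasure M0 UNIV" by simp
    also have "\<dots> < top"
    proof -
      have "emeasure M0 UNIV < top" by (metis M0.emeasure_finite infinity_ennreal_def less_top)
      then show ?thesis by (simp add: ennreal_mult_less_top)
    qed
    finally show ?thesis .
  qed
  have "enn2real (\<integral>\<^sup>+t. ennreal (\<theta> M t) \<partial>M0) < enn2real (\<integral>\<^sup>+t. ennreal (- \<theta> M t) \<partial>M0)"
    using lt fin by (simp add: enn2real_less_iff less_trans[OF lt fin])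
  then have "(\<integral>t. \<theta> M t \<partial>M0) < 0" by (simp add: real_lebesgue_integral_def[OF int])
  then show thesis using that unfolding M0_def by blast
qed

lemma product_bound:
  assumes \<eta>: "\<eta> > 0" and sums: "\<And>n. (\<Sum>k<n. \<theta> M ((T ^^ k) t) + \<eta>) \<le> 0"
  shows "\<exists>\<eta>1>0. \<exists>C. \<forall>n. (\<Prod>k<n. \<tau> (V ((T ^^ k) t)) + \<eta>1) \<le> C * exp (- \<eta>/2) ^ n"
proof -
  obtain c1 c2 where c: "0 < c1" "\<And>v. v \<in> Xhat ==> c1 \<le> wt v" "\<And>v. v \<in> Xhat ==> wt v \<le> c2"
    by (rule wt_bounds) blast
  have c2: "0 < c2" using c V(1)[of t] by (meson less_le_trans)
  define r where "r k = wt (V ((T ^^ k) t))" for k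
  have r: "c1 \<le> r k" "r k \<le> c2" "0 < r k" for k
    using c V(1)[of "(T ^^ k) t"] unfolding r_def by (auto intro: less_le_trans)
  define \<eta>1 where "\<eta>1 = (exp (\<eta>/2) - 1) * exp (- real M) * c1 / c2"
  have \<eta>1: "\<eta>1 > 0" using \<eta> c c2 by (simp add: \<eta>1_def)
  have step: "\<tau> (V ((T ^^ k) t)) + \<eta>1 \<le> exp (\<eta>/2 + \<theta> M ((T ^^ k) t)) * (r k / r (Suc k))" for k
  proof -
    let ?E = "exp (\<theta> M ((T ^^ k) t))"
    have "\<Psi> ((T ^^ k) t) = \<tau> (V ((T ^^ k) t)) * r (Suc k) / r k" by (simp add: \<Psi>_eq r_def)
    then have \<tau>: "\<tau> (V ((T ^^ k) t)) = \<Psi> ((T ^^ k) t) * (r k / r (Suc k))"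
      using r(3)[of k] r(3)[of "Suc k"] by (simp add: field_simps)
    have ratio: "c1 / c2 \<le> r k / r (Suc k)"
      using r[of k] r[of "Suc k"] c c2 by (intro frac_le) auto
    have le: "\<Psi> ((T ^^ k) t) \<le> ?E" "exp (- real M) \<le> ?E" unfolding exp_\<theta> by simp_all
    have "\<eta>1 = ((exp (\<eta>/2) - 1) * exp (- real M)) * (c1 / c2)" by (simp add: \<eta>1_def)
    also have "\<dots> \<le> ((exp (\<eta>/2) - 1) * ?E) * (r k / r (Suc k))"
      using le(2) ratio \<eta> c c2 by (intro mult_mono mult_left_mono) auto
    finally have "\<eta>1 \<le> (exp (\<eta>/2) - 1) * ?E * (r k / r (Suc k))" .
    moreover have "\<tau> (V ((T ^^ k) t)) \<le> ?E * (r k / r (Suc k))"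
      unfolding \<tau> using le(1) r(3) by (intro mult_right_mono) (auto simp: less_imp_le)
    ultimately have "\<tau> (V ((T ^^ k) t)) + \<eta>1 \<le> (exp (\<eta>/2) * ?E) * (r k / r (Suc k))"
      by (simp add: algebra_simps)
    then show ?thesis by (simp add: exp_add)
  qed
  have prod: "(\<Prod>k<n. \<tau> (V ((T ^^ k) t)) + \<eta>1) \<le> exp (\<Sum>k<n. \<eta>/2 + \<theta> M ((T ^^ k) t)) * (r 0 / r n)" for n
  proof (induction n)
    case 0
    show ?case using r(3)[of 0] by simp
  next
    case (Suc n)
    have "(\<Prod>k<Suc n. \<tau> (V ((T ^^ k) t)) + \<eta>1) \<le>
        (exp (\<Sum>k<n. \<eta>/2 + \<theta> M ((T ^^ k) t)) * (r 0 / r n)) * (exp (\<eta>/2 + \<theta> M ((T ^^ n) t)) * (r n / r (Suc n)))"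
      unfolding prod.lessThan_Suc using Suc step[of n] \<tau>_nonneg[of "V ((T ^^ n) t)"] \<eta>1 r(3)[of 0] r(3)[of n]
      by (intro mult_mono) auto
    also have "\<dots> = exp (\<Sum>k<Suc n. \<eta>/2 + \<theta> M ((T ^^ k) t)) * (r 0 / r (Suc n))"
      using r(3)[of n] by (simp add: exp_add)
    finally show ?case .
  qed
  have "(\<Prod>k<n. \<tau> (V ((T ^^ k) t)) + \<eta>1) \<le> (c2 / c1) * exp (- \<eta>/2) ^ n" for n
  proof -
    have "(\<Sum>k<n. \<eta>/2 + \<theta> M ((T ^^ k) t)) = (\<Sum>k<n. \<theta> M ((T ^^ k) t) + \<eta>) - real n * (\<eta>/2)"
      by (simp add: sum.distrib)
    then have "(\<Sum>k<n. \<eta>/2 + \<theta> M ((T ^^ k) t)) \<le> real n * (- \<eta>/2)" using sums[of n] by simp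
    then have "exp (\<Sum>k<n. \<eta>/2 + \<theta> M ((T ^^ k) t)) \<le> exp (- \<eta>/2) ^ n"
      by (subst exp_of_nat_mult[symmetric]) simp
    moreover have "r 0 / r n \<le> c2 / c1" using r[of 0] r[of n] c c2 by (intro frac_le) auto
    ultimately have "exp (\<Sum>k<n. \<eta>/2 + \<theta> M ((T ^^ k) t)) * (r 0 / r n) \<le> exp (- \<eta>/2) ^ n * (c2 / c1)"
      using r(3)[of 0] r(3)[of n] by (intro mult_mono) auto
    then show ?thesis using prod[of n] by (simp add: mult.commute)
  qed
  then show ?thesis using \<eta>1 by blast
qed

theorem attracting:
  assumes "transverse_lyapunov F N X (distr (uniform_measure lborel Q) borel \<gamma>) < 0"
  shows "basin_positive F X"
proof -
  obtain M where M: "(\<integral>t. \<theta> M t \<partial>density lborel (indicator Q)) < 0"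
    by (rule truncated_mean_negative[OF assms])
  define M0 where "M0 = density lborel (indicator Q :: 'k => ennreal)"
  have [simp]: "sets M0 = sets borel" "space M0 = UNIV" by (simp_all add: M0_def)
  have em: "emeasure M0 UNIV = emeasure lborel Q"
    by (simp add: M0_def emeasure_density nn_integral_cmult_indicator)
  interpret M0: finite_measure M0 using Q_finite by (intro finite_measureI) (simp add: em)
  have vol: "measure M0 UNIV > 0"
    using Q_pos Q_finite em by (simp add: measure_def enn2real_positive_iff)
  obtain B where B: "\<And>t. \<bar>\<theta> M t\<bar> \<le> B" using \<theta>_bounded by blast
  define I where "I = (\<integral>t. \<theta> M t \<partial>M0)"
  define \<eta> where "\<eta> = - I / (2 * measure M0 UNIV)"
  have I: "I < 0" using M by (simp add: I_def M0_def)
  then have \<eta>: "\<eta> > 0" using vol by (simp add: \<eta>_def divide_neg_pos)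
  have "\<theta> M \<in> borel_measurable M0" using \<theta>_measurable by (simp add: measurable_def)
  then have "integrable M0 (\<theta> M)" using B by (intro M0.integrable_const_bound[of _ B] AE_I2) auto
  then have "(\<integral>t. \<theta> M t + \<eta> \<partial>M0) = I + \<eta> * measure M0 UNIV"
    by (subst Bochner_Integration.integral_add) (auto simp: I_def)
  also have "\<dots> = I / 2" using vol by (simp add: \<eta>_def)
  finally have neg: "(\<integral>t. \<theta> M t + \<eta> \<partial>density lborel (indicator Q)) < 0" using I by (simp add: M0_def)
  have per: "periodic (\<lambda>t. \<theta> M t + \<eta>)" using \<theta>_periodic[of M] by (simp add: periodic_def)
  have bd: "\<bar>\<theta> M t + \<eta>\<bar> \<le> B + \<eta>" for t using B[of t] \<eta> by linarith
  define E where "E = {t. \<forall>n. (\<Sum>k<n. \<theta> M ((T ^^ k) t) + \<eta>) \<le> 0}"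
  have "emeasure lborel {t \<in> Q. \<forall>n. (\<Sum>k<n. \<theta> M ((T ^^ k) t) + \<eta>) \<le> 0} > 0"
    by (rule maximal_ergodic[of "\<lambda>t. \<theta> M t + \<eta>" "B + \<eta>"]) (use per bd neg in auto)
  then have E: "emeasure lborel (E \<inter> Q) > 0" by (simp add: E_def Collect_conj_eq Int_commute)
  show ?thesis
  proof (rule basin_positive_from_good_set[OF _ _ E])
    have "(\<lambda>x. \<theta> M ((T ^^ k) x)) \<in> borel_measurable borel" for k
      by (rule measurable_compose[OF T_iter_measurable \<theta>_measurable])
    then have "{t \<in> space borel. \<forall>n. (\<Sum>k<n. \<theta> M ((T ^^ k) t) + \<eta>) \<le> 0} \<in> sets borel" by measurable
    then show "E \<in> sets borel" by (simp add: E_def)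
    show "x + \<omega> \<in> E \<longleftrightarrow> x \<in> E" if "\<omega> \<in> \<Omega>" for x \<omega>
      using periodic_T_iter[OF \<theta>_periodic[of M]] that by (simp add: E_def periodic_def)
    fix t assume "t \<in> E"
    then obtain \<eta>1 C where *: "\<eta>1 > 0" "\<And>n. (\<Prod>k<n. \<tau> (V ((T ^^ k) t)) + \<eta>1) \<le> C * exp (- \<eta>/2) ^ n"
      using product_bound[OF \<eta>, of M t] by (auto simp: E_def)
    show "\<exists>\<epsilon>>0. \<forall>z. norm z < \<epsilon> --> pt t z \<in> basin F X"
      by (rule segment_in_basin[OF *(1) _ _ *(2)]) (use \<eta> in auto)
  qed
qed

end

section \<open>Uniformized elliptic curves\<close>

definition dv :: "(complex => complex ^ 3) => complex => complex ^ 3" where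
  "dv h s = (\<chi> i. deriv (\<lambda>s. h s $ i) s)"

lemma deriv_at_inverse_composition:
  fixes \<gamma> f :: "'a::real_normed_field => 'a"
  assumes f: "(f has_field_derivative l) (at (\<gamma> t0))" "l \<noteq> 0" and \<gamma>: "isCont \<gamma> t0"
    and g: "((\<lambda>t. f (\<gamma> t)) has_field_derivative k) (at t0)"
  shows "(\<gamma> has_field_derivative k / l) (at t0)"
proof -
  obtain p where p: "\<And>z. f z - f (\<gamma> t0) = p z * (z - \<gamma> t0)" "isCont p (\<gamma> t0)" "p (\<gamma> t0) = l"
    using f(1) unfolding CARAT_DERIV by blast
  obtain q where q: "\<And>t. f (\<gamma> t) - f (\<gamma> t0) = q t * (t - t0)" "isCont q t0" "q t0 = k"
    using g unfolding CARAT_DERIV by blast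
  have pc: "isCont (\<lambda>t. p (\<gamma> t)) t0" by (rule isCont_o2[OF \<gamma> p(2)])
  then have "\<forall>\<^sub>F t in at t0. p (\<gamma> t) \<noteq> 0"
    using f(2) p(3) by (intro tendsto_imp_eventually_ne[of _ l]) (auto simp: isCont_def)
  moreover have "\<forall>\<^sub>F t in at t0. t \<noteq> t0" by (simp add: eventually_at_filter)
  ultimately have "\<forall>\<^sub>F t in at t0. q t / p (\<gamma> t) = (\<gamma> t - \<gamma> t0) / (t - t0)"
  proof eventually_elim
    case (elim t)
    have "q t * (t - t0) = p (\<gamma> t) * (\<gamma> t - \<gamma> t0)" using p(1)[of "\<gamma> t"] q(1)[of t] by simp
    then show ?case using elim by (simp add: field_simps)
  qed
  moreover have "((\<lambda>t. q t / p (\<gamma> t)) \<longlongrightarrow> k / l) (at t0)"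
    using pc q p f(2) by (intro tendsto_divide) (auto simp: isCont_def)
  ultimately have "((\<lambda>t. (\<gamma> t - \<gamma> t0) / (t - t0)) \<longlongrightarrow> k / l) (at t0)"
    by (rule Lim_transform_eventually[rotated])
  then show ?thesis by (simp add: has_field_derivative_iff)
qed

lemma slope_coordinate:
  assumes hol: "\<And>i. (\<lambda>s. h s $ i) holomorphic_on S" and S: "open S" "s0 \<in> S" and imm: "cr (h s0) (dv h s0) \<noteq> 0"
  obtains j k l where "h s0 $ k \<noteq> 0" "((\<lambda>s. h s $ j / h s $ k) has_field_derivative l) (at s0)" "l \<noteq> 0"
proof -
  have D: "((\<lambda>s. h s $ i) has_field_derivative dv h s0 $ i) (at s0)" for i
    using holomorphic_derivI[OF hol S] by (simp add: dv_def)
  obtain i where i: "cr (h s0) (dv h s0) $ i \<noteq> 0" using nonzero_nth[OF imm] by blast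
  obtain j k where "\<forall>u v :: complex^3. cr u v $ i = u$j * v$k - u$k * v$j" using cr_nth_cases by blast
  then have jk: "h s0 $ j * dv h s0 $ k - h s0 $ k * dv h s0 $ j \<noteq> 0" using i by metis
  have gen: "\<exists>j k l. h s0 $ k \<noteq> 0 \<and> ((\<lambda>s. h s $ j / h s $ k) has_field_derivative l) (at s0) \<and> l \<noteq> 0"
    if ab: "h s0 $ b \<noteq> 0" "h s0 $ a * dv h s0 $ b - h s0 $ b * dv h s0 $ a \<noteq> 0" for a b
  proof -
    have "((\<lambda>s. h s $ a / h s $ b) has_field_derivative
        (dv h s0 $ a * h s0 $ b - h s0 $ a * dv h s0 $ b) / (h s0 $ b * h s0 $ b)) (at s0)"
      by (rule DERIV_divide[OF D D ab(1)])
    moreover have "(dv h s0 $ a * h s0 $ b - h s0 $ a * dv h s0 $ b) / (h s0 $ b * h s0 $ b) \<noteq> 0"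
      using ab by (auto simp: mult.commute)
    ultimately show ?thesis using ab(1) by blast
  qed
  have "\<exists>j k l. h s0 $ k \<noteq> 0 \<and> ((\<lambda>s. h s $ j / h s $ k) has_field_derivative l) (at s0) \<and> l \<noteq> 0"
  proof (cases "h s0 $ k = 0")
    case True
    then have "h s0 $ j \<noteq> 0" using jk by auto
    moreover have "h s0 $ k * dv h s0 $ j - h s0 $ j * dv h s0 $ k \<noteq> 0" using jk by (auto simp: algebra_simps)
    ultimately show ?thesis by (rule gen)
  next
    case False
    then show ?thesis using jk by (rule gen)
  qed
  then show thesis using that by blast
qed

text \<open>The identity theorem for a set that is locally the zero set of a holomorphic function.\<close>

lemma local_zero_set_identity:
  fixes R :: "complex set"
  assumes loc: "\<And>t. \<exists>r>0. \<exists>w. w holomorphic_on ball t r \<and> (\<forall>s\<in>ball t r. s \<in> R \<longleftrightarrow> w s = 0)"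
    and lim: "t0 islimpt R"
  shows "R = UNIV"
proof -
  define L where "L = {t. t islimpt R}"
  have ball: "\<exists>r>0. ball t r \<subseteq> R" if t: "t \<in> L" for t
  proof -
    obtain r w where r: "r > 0" and w: "w holomorphic_on ball t r" "\<forall>s\<in>ball t r. s \<in> R \<longleftrightarrow> w s = 0"
      using loc by blast
    have "\<forall>\<^sub>F y in at t. y \<in> ball t r" using r by (intro eventually_at_in_open') auto
    then have "t islimpt (R \<inter> ball t r)" using t by (intro islimpt_Int_eventually) (simp_all add: L_def)
    moreover have "\<And>s. s \<in> R \<inter> ball t r ==> w s = 0" using w(2) by blast
    ultimately have "w z = 0" if "z \<in> ball t r" for z
      using analytic_continuation[OF w(1) open_ball connected_ball, of "R \<inter> ball t r" t z] r that by auto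
    then show ?thesis using w(2) r by blast
  qed
  have "open L"
    unfolding open_contains_ball
  proof
    fix t assume "t \<in> L"
    then obtain r where r: "r > 0" "ball t r \<subseteq> R" using ball by blast
    have "ball t r \<subseteq> L"
    proof
      fix z assume "z \<in> ball t r"
      then have "z islimpt ball t r" by (intro interior_limit_point) (simp add: interior_open)
      then show "z \<in> L" using r(2) by (simp add: L_def islimpt_subset)
    qed
    then show "\<exists>r>0. ball t r \<subseteq> L" using r(1) by blast
  qed
  moreover have "closed L" unfolding L_def by (rule closed_limpts)
  moreover have "L \<noteq> {}" using lim by (auto simp: L_def)
  ultimately have L: "L = UNIV" using clopen[of L] by blast
  have "t \<in> R" for t
  proof -
    have "t \<in> L" unfolding L by (rule UNIV_I)
    then obtain r where r: "r > 0" "ball t r \<subseteq> R" using ball by blast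
    then have "t \<in> ball t r" by simp
    then show ?thesis using r(2) by (rule subsetD[rotated])
  qed
  then show ?thesis by blast
qed

locale uniformized =
  fixes \<omega>1 \<omega>2 :: complex and \<phi> :: "complex => complex proj2" and C :: "complex proj2 set"
  assumes unif: "uniformization \<omega>1 \<omega>2 \<phi> C"
begin

definition "\<Omega> = period_lattice \<omega>1 \<omega>2"
definition "Q = {of_real x * \<omega>1 + of_real y * \<omega>2 | x y. x \<in> {0..<1} \<and> y \<in> {0..<1}}"

definition xc :: "complex => real" where "xc t = Im (t * cnj \<omega>2) / Im (\<omega>1 * cnj \<omega>2)"
definition yc :: "complex => real" where "yc t = Im (t * cnj \<omega>1) / Im (\<omega>2 * cnj \<omega>1)"

lemma range_\<phi>: "range \<phi> = C" and \<phi>_eq: "\<phi> s = \<phi> t \<longleftrightarrow> s - t \<in> \<Omega>" and immersion: "holomorphic_immersion \<phi>"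
  using unif by (auto simp: uniformization_def \<Omega>_def)

lemma \<phi>_C [simp]: "\<phi> t \<in> C" using range_\<phi> by blast

lemma nondeg: "Im (\<omega>1 * cnj \<omega>2) \<noteq> 0" "Im (\<omega>2 * cnj \<omega>1) \<noteq> 0"
proof -
  have "Im (\<omega>2 / \<omega>1) \<noteq> 0" using unif by (simp add: uniformization_def)
  then show "Im (\<omega>2 * cnj \<omega>1) \<noteq> 0" by (simp only: Im_complex_div_eq_0 not_False_eq_True)
  moreover have "Im (\<omega>1 * cnj \<omega>2) = - Im (\<omega>2 * cnj \<omega>1)" by simp
  ultimately show "Im (\<omega>1 * cnj \<omega>2) \<noteq> 0" by (metis neg_equal_0_iff_equal)
qed

lemma coords_add: "xc (s + t) = xc s + xc t" "yc (s + t) = yc s + yc t"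
  and coords_diff: "xc (s - t) = xc s - xc t" "yc (s - t) = yc s - yc t"
  and coords_minus: "xc (- t) = - xc t" "yc (- t) = - yc t"
  by (simp_all add: xc_def yc_def add_divide_distrib diff_divide_distrib ring_distribs)

lemma coords_comb: "xc (of_real x * \<omega>1 + of_real y * \<omega>2) = x" "yc (of_real x * \<omega>1 + of_real y * \<omega>2) = y"
proof -
  have x: "Im ((of_real x * \<omega>1 + of_real y * \<omega>2) * cnj \<omega>2) = x * Im (\<omega>1 * cnj \<omega>2)"
    and y: "Im ((of_real x * \<omega>1 + of_real y * \<omega>2) * cnj \<omega>1) = y * Im (\<omega>2 * cnj \<omega>1)"
    by (simp_all add: algebra_simps)
  show "xc (of_real x * \<omega>1 + of_real y * \<omega>2) = x" "yc (of_real x * \<omega>1 + of_real y * \<omega>2) = y"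
    unfolding xc_def yc_def x y using nondeg by simp_all
qed

lemma coords: "of_real (xc t) * \<omega>1 + of_real (yc t) * \<omega>2 = t"
proof -
  define D where "D = Im (\<omega>1 * cnj \<omega>2)"
  have D: "D \<noteq> 0" "Im (\<omega>2 * cnj \<omega>1) = - D" using nondeg by (auto simp: D_def)
  have "of_real D * (of_real (xc t) * \<omega>1 + of_real (yc t) * \<omega>2) = of_real D * t"
  proof -
    have "D * xc t = Im (t * cnj \<omega>2)" "D * yc t = - Im (t * cnj \<omega>1)"
    proof -
      have "D * (u / D) = u" "D * (u / - D) = - u" for u using D(1) by simp_all
      then show "D * xc t = Im (t * cnj \<omega>2)" "D * yc t = - Im (t * cnj \<omega>1)"
        unfolding xc_def yc_def D(2) D_def[symmetric] by blast+
    qed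
    then have "of_real D * (of_real (xc t) * \<omega>1 + of_real (yc t) * \<omega>2) =
        of_real (Im (t * cnj \<omega>2)) * \<omega>1 - of_real (Im (t * cnj \<omega>1)) * \<omega>2"
      by (metis (no_types, lifting) diff_conv_add_uminus distrib_left minus_mult_left mult.assoc of_real_minus of_real_mult)
    also have "\<dots> = of_real D * t"
      by (simp add: D_def complex_eq_iff algebra_simps)
    finally show ?thesis .
  qed
  then show ?thesis using D by simp
qed

lemma coords_inject: "xc s = xc t ==> yc s = yc t ==> s = t"
  by (metis coords)

lemma continuous_coords: "continuous_on S xc" "continuous_on S yc"
  unfolding xc_def[abs_def] yc_def[abs_def] by (intro continuous_intros; use nondeg in simp)+

lemma \<Omega>_iff: "t \<in> \<Omega> \<longleftrightarrow> xc t \<in> \<int> \<and> yc t \<in> \<int>"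
proof
  assume "t \<in> \<Omega>"
  then obtain m n where "t = of_real (of_int m) * \<omega>1 + of_real (of_int n) * \<omega>2"
    by (auto simp: \<Omega>_def period_lattice_def)
  then show "xc t \<in> \<int> \<and> yc t \<in> \<int>" by (simp only: coords_comb) simp
next
  assume "xc t \<in> \<int> \<and> yc t \<in> \<int>"
  then obtain m n where "xc t = of_int m" "yc t = of_int n" by (auto elim!: Ints_cases)
  then have "t = of_int m * \<omega>1 + of_int n * \<omega>2" using coords[of t] by simp
  then show "t \<in> \<Omega>" by (auto simp: \<Omega>_def period_lattice_def)
qed

lemma Q_iff: "t \<in> Q \<longleftrightarrow> 0 \<le> xc t \<and> xc t < 1 \<and> 0 \<le> yc t \<and> yc t < 1"
proof
  assume "t \<in> Q"
  then show "0 \<le> xc t \<and> xc t < 1 \<and> 0 \<le> yc t \<and> yc t < 1" by (auto simp: Q_def coords_comb)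
next
  assume "0 \<le> xc t \<and> xc t < 1 \<and> 0 \<le> yc t \<and> yc t < 1"
  then show "t \<in> Q" unfolding Q_def using coords[of t] by (intro CollectI exI[of _ "xc t"] exI[of _ "yc t"]) auto
qed

lemma \<Omega>_minus: "\<omega> \<in> \<Omega> ==> - \<omega> \<in> \<Omega>" and \<Omega>_add: "\<omega> \<in> \<Omega> ==> \<omega>' \<in> \<Omega> ==> \<omega> + \<omega>' \<in> \<Omega>" and \<Omega>_0: "0 \<in> \<Omega>"
  and \<Omega>_diff: "\<omega> \<in> \<Omega> ==> \<omega>' \<in> \<Omega> ==> \<omega> - \<omega>' \<in> \<Omega>"
  by (auto simp: \<Omega>_iff coords_minus coords_add coords_diff) (auto simp: xc_def yc_def)

lemma countable_\<Omega>: "countable \<Omega>"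
proof -
  have "\<Omega> = (\<lambda>(m, n). of_int m * \<omega>1 + of_int n * \<omega>2) ` (UNIV :: (int \<times> int) set)"
    by (auto simp: \<Omega>_def period_lattice_def)
  then show ?thesis by simp
qed

lemma tiling: "\<exists>!\<omega>. \<omega> \<in> \<Omega> \<and> t + \<omega> \<in> Q"
proof
  let ?w = "of_real (- of_int \<lfloor>xc t\<rfloor>) * \<omega>1 + of_real (- of_int \<lfloor>yc t\<rfloor>) * \<omega>2"
  have "xc ?w = - of_int \<lfloor>xc t\<rfloor>" "yc ?w = - of_int \<lfloor>yc t\<rfloor>" by (rule coords_comb)+
  then show "?w \<in> \<Omega> \<and> t + ?w \<in> Q"
    unfolding \<Omega>_iff Q_iff coords_add by simp linarith
  fix \<omega> assume w: "\<omega> \<in> \<Omega> \<and> t + \<omega> \<in> Q"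
  then obtain m n where mn: "xc \<omega> = of_int m" "yc \<omega> = of_int n" by (auto simp: \<Omega>_iff elim!: Ints_cases)
  have "m = - \<lfloor>xc t\<rfloor>" "n = - \<lfloor>yc t\<rfloor>" using w unfolding Q_iff coords_add mn by linarith+
  then show "\<omega> = ?w" by (intro coords_inject) (simp_all only: coords_comb mn of_int_minus)
qed

lemma bounded_Q: "bounded Q"
proof -
  have "norm t \<le> norm \<omega>1 + norm \<omega>2" if "t \<in> Q" for t
  proof -
    have "norm t \<le> norm (of_real (xc t) * \<omega>1) + norm (of_real (yc t) * \<omega>2)"
      using norm_triangle_ineq coords by metis
    also have "\<dots> \<le> 1 * norm \<omega>1 + 1 * norm \<omega>2"
      using that by (simp only: norm_mult norm_of_real) (intro add_mono mult_right_mono; auto simp: Q_iff)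
    finally show ?thesis by simp
  qed
  then show ?thesis unfolding bounded_iff by blast
qed

sublocale fundamental_domain Q \<Omega>
proof
  have "Q = {t. 0 \<le> xc t} \<inter> {t. xc t < 1} \<inter> ({t. 0 \<le> yc t} \<inter> {t. yc t < 1})" by (auto simp: Q_iff)
  moreover have "closed {t. 0 \<le> xc t}" "closed {t. 0 \<le> yc t}" "open {t. xc t < 1}" "open {t. yc t < 1}"
    by (auto intro!: closed_Collect_le open_Collect_less continuous_coords continuous_on_const)
  ultimately show "Q \<in> sets borel" by (auto intro!: sets.Int borel_closed borel_open)
  let ?O = "{t. 0 < xc t} \<inter> {t. xc t < 1} \<inter> ({t. 0 < yc t} \<inter> {t. yc t < 1})"
  have O: "open ?O" by (auto intro!: open_Int open_Collect_less continuous_coords continuous_on_const)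
  have "of_real (1/2) * \<omega>1 + of_real (1/2) * \<omega>2 \<in> ?O" by (simp add: coords_comb del: of_real_divide)
  then have "\<not> negligible ?O" using open_not_negligible[OF O] by blast
  then have "emeasure lborel ?O \<noteq> 0" using O by (subst borel_negligible_iff[symmetric]) auto
  moreover have "emeasure lborel ?O \<le> emeasure lborel Q"
    using \<open>Q \<in> sets borel\<close> by (intro emeasure_mono) (auto simp: Q_iff)
  ultimately show "0 < emeasure lborel Q" by (metis le_zero_eq zero_less_iff_neq_zero)
qed (rule bounded_Q countable_\<Omega> \<Omega>_minus tiling | assumption)+

definition lift :: "complex set => (complex => complex ^ 3) => bool" where
  "lift S h \<longleftrightarrow> open S \<and> (\<forall>i. (\<lambda>s. h s $ i) holomorphic_on S) \<and>
     (\<forall>s\<in>S. h s \<noteq> 0 \<and> \<phi> s = to_proj2 (h s) \<and> cr (h s) (dv h s) \<noteq> 0)"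

lemma lift_exists: obtains S h where "lift S h" "t \<in> S"
proof -
  obtain S h where h: "open S" "t \<in> S" "\<forall>i. (\<lambda>s. h s $ i) holomorphic_on S"
    "\<forall>s\<in>S. h s \<noteq> 0 \<and> \<phi> s = to_proj2 (h s) \<and> (\<nexists>c. (\<chi> i. deriv (\<lambda>s. h s $ i) s) = c *s h s)"
    using immersion[unfolded holomorphic_immersion_def, rule_format, of t] by (elim exE conjE) metis
  have "cr (h s) (dv h s) \<noteq> 0" if "s \<in> S" for s
  proof
    assume "cr (h s) (dv h s) = 0"
    then obtain c where "dv h s = c *s h s" by (rule cr_eq_0D) (use h(4) \<open>s \<in> S\<close> in blast)
    then show False using h(4) \<open>s \<in> S\<close> unfolding dv_def by blast
  qed
  then have "lift S h" using h unfolding lift_def by blast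
  then show thesis using h(2) by (rule that)
qed

lemma lift_subset: "lift S h ==> open S' ==> S' \<subseteq> S ==> lift S' h"
  by (auto simp: lift_def intro: holomorphic_on_subset)

lemma lift_deriv: "lift S h ==> s \<in> S ==> ((\<lambda>s. h s $ i) has_field_derivative dv h s $ i) (at s)"
  by (auto simp: lift_def dv_def intro: holomorphic_derivI)

lemma lift_cont: "lift S h ==> continuous_on S h"
  by (rule continuous_on_vec3) (auto simp: lift_def intro: holomorphic_on_imp_continuous_on)

lemma dv_holomorphic: "lift S h ==> (\<lambda>s. dv h s $ i) holomorphic_on S"
  by (auto simp: lift_def dv_def intro: holomorphic_deriv)

lemma continuous_\<phi>: "continuous_on UNIV \<phi>"
proof (rule continuous_at_imp_continuous_on, rule ballI)
  fix t obtain S h where h: "lift S h" "t \<in> S" by (rule lift_exists)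
  have "continuous_on S (\<lambda>s. to_proj2 (h s))"
    by (rule continuous_on_to_proj2[OF lift_cont[OF h(1)]]) (use h in \<open>auto simp: lift_def\<close>)
  then have "continuous_on S \<phi>" by (rule continuous_on_eq) (use h(1) in \<open>simp add: lift_def\<close>)
  moreover have "open S" using h(1) by (simp add: lift_def)
  ultimately show "isCont \<phi> t" using continuous_on_eq_continuous_at[of S \<phi>] h(2) by blast
qed

lemma periodic_\<phi>: "\<omega> \<in> \<Omega> ==> \<phi> (t + \<omega>) = \<phi> t"
  by (simp add: \<phi>_eq)

lemma compact_closure_Q: "compact (closure Q)"
  using bounded_closure[OF bounded_Q] by (simp add: compact_eq_bounded_closed)

lemma reduce_Q: obtains \<omega> where "\<omega> \<in> \<Omega>" "t + \<omega> \<in> closure Q"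
  using tiling[of t] closure_subset by blast

text \<open>Two lifts of points with the same image differ by a holomorphic factor, up to a translation.\<close>

lemma lift_change:
  assumes h1: "lift S1 h1" "s \<in> S1" and h2: "lift S2 h2" "t \<in> S2" and st: "\<phi> s = \<phi> t"
  obtains g g' where "g \<noteq> 0" "h2 t = g *s h1 s" "dv h2 t = g *s dv h1 s + g' *s h1 s"
proof -
  define \<omega> where "\<omega> = t - s"
  have \<omega>: "\<omega> \<in> \<Omega>" using \<phi>_eq[of t s] st by (simp add: \<omega>_def)
  obtain i where i: "h1 s $ i \<noteq> 0" using nonzero_nth h1 by (metis lift_def)
  define g where "g u = h2 (u + \<omega>) $ i / h1 u $ i" for u
  have par: "h2 (u + \<omega>) $ j * h1 u $ i = h2 (u + \<omega>) $ i * h1 u $ j" if "u \<in> S1" "u + \<omega> \<in> S2" for u j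
  proof -
    have "to_proj2 (h1 u) = to_proj2 (h2 (u + \<omega>))" "h1 u \<noteq> 0" "h2 (u + \<omega>) \<noteq> 0"
      using h1(1) h2(1) that periodic_\<phi>[OF \<omega>, of u] by (auto simp: lift_def)
    then obtain c where "h2 (u + \<omega>) = c *s h1 u" using to_proj2_eq_iff by blast
    then show ?thesis by simp
  qed
  have op: "open S1" "open S2" using h1 h2 by (auto simp: lift_def)
  have D2: "((\<lambda>u. h2 (u + \<omega>) $ j) has_field_derivative dv h2 t $ j) (at s)" for j
  proof -
    have "((\<lambda>s. h2 s $ j) has_field_derivative dv h2 t $ j) (at (s + \<omega>))"
      using lift_deriv[OF h2] by (simp add: \<omega>_def)
    then show ?thesis by (simp add: DERIV_shift)
  qed
  have D1: "((\<lambda>u. h1 u $ j) has_field_derivative dv h1 s $ j) (at s)" for j by (rule lift_deriv[OF h1])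
  have ev: "\<forall>\<^sub>F u in nhds s. u \<in> S1 \<and> u + \<omega> \<in> S2"
  proof (rule eventually_conj)
    show "\<forall>\<^sub>F u in nhds s. u \<in> S1" using op h1 by (intro eventually_nhds_in_open) auto
    have "open ((\<lambda>u. u + \<omega>) -` S2)" using op by (intro open_vimage continuous_intros) auto
    then have "\<forall>\<^sub>F u in nhds s. u \<in> (\<lambda>u. u + \<omega>) -` S2"
      using h2 by (intro eventually_nhds_in_open) (auto simp: \<omega>_def)
    then show "\<forall>\<^sub>F u in nhds s. u + \<omega> \<in> S2" by simp
  qed
  have E: "dv h2 t $ j * h1 s $ i + dv h1 s $ i * h2 t $ j = dv h2 t $ i * h1 s $ j + dv h1 s $ j * h2 t $ i" for j
  proof (rule DERIV_unique)
    show "((\<lambda>u. h2 (u + \<omega>) $ j * h1 u $ i) has_field_derivative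
        dv h2 t $ j * h1 s $ i + dv h1 s $ i * h2 t $ j) (at s)"
      using DERIV_mult[OF D2[of j] D1[of i]] by (simp add: \<omega>_def)
    have "((\<lambda>u. h2 (u + \<omega>) $ i * h1 u $ j) has_field_derivative
        dv h2 t $ i * h1 s $ j + dv h1 s $ j * h2 t $ i) (at s)"
      using DERIV_mult[OF D2[of i] D1[of j]] by (simp add: \<omega>_def)
    moreover have "\<forall>\<^sub>F u in nhds s. h2 (u + \<omega>) $ j * h1 u $ i = h2 (u + \<omega>) $ i * h1 u $ j"
      using ev par by (auto elim: eventually_mono)
    ultimately show "((\<lambda>u. h2 (u + \<omega>) $ j * h1 u $ i) has_field_derivative
        dv h2 t $ i * h1 s $ j + dv h1 s $ j * h2 t $ i) (at s)"
      by (subst DERIV_cong_ev[OF refl _ refl])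
  qed
  define g0 where "g0 = h2 t $ i / h1 s $ i"
  have g0: "h2 t = g0 *s h1 s"
    using par[of s] h1(2) h2(2) i by (simp add: vec_eq_iff g0_def \<omega>_def field_simps)
  show thesis
  proof
    show "g0 \<noteq> 0" using g0 h2 by (auto simp: lift_def)
    show "h2 t = g0 *s h1 s" by fact
    show "dv h2 t = g0 *s dv h1 s + ((dv h2 t $ i - g0 * dv h1 s $ i) / h1 s $ i) *s h1 s"
    proof (subst vec_eq_iff, rule allI)
      fix j
      have "dv h2 t $ j * h1 s $ i = (g0 * dv h1 s $ j) * h1 s $ i + (dv h2 t $ i - g0 * dv h1 s $ i) * h1 s $ j"
        using E[of j] unfolding g0 by (simp add: algebra_simps)
      then show "dv h2 t $ j = (g0 *s dv h1 s + ((dv h2 t $ i - g0 * dv h1 s $ i) / h1 s $ i) *s h1 s) $ j"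
        using i by (simp add: field_simps)
    qed
  qed
qed

text \<open>Continuous maps into the curve lift to the universal covering: the two coordinates modulo 1
  are continuous unit complex numbers on the curve, and their logarithms are the coordinates of the lift.\<close>

lemma continuous_lift:
  fixes Y :: "'a::real_normed_vector => complex proj2"
  assumes Y: "continuous_on UNIV Y" "\<And>t. Y t \<in> C"
  obtains \<gamma> where "continuous_on UNIV \<gamma>" "\<And>t. \<phi> (\<gamma> t) = Y t"
proof -
  define ex where "ex u = exp (2 * of_real pi * \<i> * of_real u)" for u :: real
  have ex_eq: "ex u = ex u' \<longleftrightarrow> u - u' \<in> \<int>" for u u'
  proof
    assume "ex u = ex u'"
    then obtain n where "2 * of_real pi * \<i> * of_real u = 2 * of_real pi * \<i> * of_real u' + of_int (2 * n) * (of_real pi * \<i>)"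
      unfolding ex_def exp_eq by (auto simp: mult_ac)
    then have "(2 * of_real pi * \<i>) * of_real u = (2 * of_real pi * \<i>) * (of_real u' + of_int n)"
      by (simp add: algebra_simps)
    then have "complex_of_real u = of_real u' + of_int n" by (subst (asm) mult_left_cancel) auto
    then have "u = u' + of_int n" by (metis of_real_add of_real_eq_iff of_real_of_int_eq)
    then show "u - u' \<in> \<int>" by simp
  next
    assume "u - u' \<in> \<int>"
    then obtain n where "u = u' + of_int n" by (metis Ints_cases add.commute diff_add_cancel)
    then show "ex u = ex u'"
      unfolding ex_def exp_eq by (intro exI[of _ n]) (simp add: algebra_simps)
  qed
  have coord: "\<exists>g. continuous_on UNIV g \<and> (\<forall>t s. \<phi> s = Y t --> ex (co s) = ex (g t))"
    if co: "continuous_on UNIV co" "\<And>s t. s - t \<in> \<Omega> ==> co s - co t \<in> \<int>" for co :: "complex => real"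
  proof -
    define \<tau> where "\<tau> p = ex (co (SOME s. \<phi> s = p))" for p
    have \<tau>\<phi>: "\<tau> (\<phi> s) = ex (co s)" for s
    proof -
      have "\<phi> (SOME s'. \<phi> s' = \<phi> s) = \<phi> s" by (rule someI_ex) blast
      then show ?thesis using co(2) \<phi>_eq ex_eq by (simp add: \<tau>_def)
    qed
    have exc: "continuous_on UNIV (\<lambda>s. ex (co s))" unfolding ex_def by (intro continuous_intros co(1))
    have \<tau>c: "continuous_on C \<tau>"
      unfolding continuous_on_closed_invariant
    proof (intro allI impI)
      fix B :: "complex set" assume B: "closed B"
      let ?A = "\<phi> ` (closure Q \<inter> (\<lambda>s. ex (co s)) -` B)"
      have "closed ((\<lambda>s. ex (co s)) -` B)" using exc B by (intro closed_vimage) auto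
      then have "compact (closure Q \<inter> (\<lambda>s. ex (co s)) -` B)" by (intro compact_Int_closed compact_closure_Q)
      then have "compact ?A" by (rule compact_continuous_image[OF continuous_on_subset[OF continuous_\<phi> subset_UNIV]])
      then have "closed ?A" by (rule compact_imp_closed)
      moreover have "?A \<inter> C = \<tau> -` B \<inter> C"
      proof
        show "?A \<inter> C \<subseteq> \<tau> -` B \<inter> C" using \<tau>\<phi> by auto
        show "\<tau> -` B \<inter> C \<subseteq> ?A \<inter> C"
        proof
          fix p assume p: "p \<in> \<tau> -` B \<inter> C"
          then obtain s where s: "p = \<phi> s" using range_\<phi> by blast
          obtain \<omega> where \<omega>: "\<omega> \<in> \<Omega>" "s + \<omega> \<in> closure Q" by (rule reduce_Q)
          have "p = \<phi> (s + \<omega>)" using s periodic_\<phi>[OF \<omega>(1)] by simp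
          then show "p \<in> ?A \<inter> C" using p \<omega> \<tau>\<phi>[of "s + \<omega>"] by auto
        qed
      qed
      ultimately show "\<exists>A. closed A \<and> A \<inter> C = \<tau> -` B \<inter> C" by blast
    qed
    have Yc: "continuous_on UNIV (\<lambda>t. \<tau> (Y t))" by (rule continuous_on_compose2[OF \<tau>c Y(1)]) (use Y in auto)
    have nz: "\<tau> p \<noteq> 0" for p by (simp add: \<tau>_def ex_def)
    obtain L where L: "continuous_on UNIV L" "\<And>t. t \<in> UNIV ==> \<tau> (Y t) = exp (L t)"
      using continuous_logarithm_on_contractible[OF Yc convex_imp_contractible[OF convex_UNIV] nz] by metis
    have "ex (co s) = ex (Im (L t) / (2 * pi))" if "\<phi> s = Y t" for s t
    proof -
      have eq: "exp (L t) = ex (co s)" using L(2)[OF UNIV_I, of t] \<tau>\<phi>[of s] that by simp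
      then have "norm (exp (L t)) = 1" by (simp add: ex_def)
      then have "Re (L t) = 0" by simp
      then have "L t = 2 * of_real pi * \<i> * of_real (Im (L t) / (2 * pi))" by (simp add: complex_eq_iff)
      then show ?thesis using eq unfolding ex_def by metis
    qed
    moreover have "continuous_on UNIV (\<lambda>t. Im (L t) / (2 * pi))" by (intro continuous_intros L(1)) auto
    ultimately show ?thesis by blast
  qed
  obtain g1 where g1: "continuous_on UNIV g1" "\<And>t s. \<phi> s = Y t ==> ex (xc s) = ex (g1 t)"
    using coord[OF continuous_coords(1)] by (auto simp: \<Omega>_iff coords_diff)
  obtain g2 where g2: "continuous_on UNIV g2" "\<And>t s. \<phi> s = Y t ==> ex (yc s) = ex (g2 t)"
    using coord[OF continuous_coords(2)] by (auto simp: \<Omega>_iff coords_diff)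
  show thesis
  proof
    show "continuous_on UNIV (\<lambda>t. of_real (g1 t) * \<omega>1 + of_real (g2 t) * \<omega>2)"
      by (intro continuous_intros g1 g2)
    fix t
    obtain s where s: "\<phi> s = Y t" using Y(2)[of t] range_\<phi> by (metis rangeE)
    have "(of_real (g1 t) * \<omega>1 + of_real (g2 t) * \<omega>2) - s \<in> \<Omega>"
      unfolding \<Omega>_iff coords_diff coords_comb using g1(2)[OF s] g2(2)[OF s] ex_eq
      by (metis Ints_minus minus_diff_eq)
    then show "\<phi> (of_real (g1 t) * \<omega>1 + of_real (g2 t) * \<omega>2) = Y t" using s \<phi>_eq by metis
  qed
qed

lemma continuous_\<Omega>_valued_constant:
  fixes f :: "'a::real_normed_vector => complex"
  assumes "continuous_on UNIV f" "\<And>t. f t \<in> \<Omega>"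
  obtains c where "\<And>t. f t = c"
proof -
  have int: "\<exists>c. \<forall>t. g (f t) = c" if g: "continuous_on UNIV g" "\<And>t. g (f t) \<in> \<int>" for g :: "complex => real"
  proof -
    have "(\<lambda>t. g (f t)) constant_on UNIV"
    proof (rule continuous_discrete_range_constant)
      show "continuous_on UNIV (\<lambda>t. g (f t))" by (rule continuous_on_compose2[OF g(1) assms(1)]) simp
      show "\<exists>e>0. \<forall>y. y \<in> UNIV \<and> g (f y) \<noteq> g (f x) --> e \<le> norm (g (f y) - g (f x))" for x
      proof (intro exI[of _ 1] conjI allI impI)
        fix y assume y: "y \<in> UNIV \<and> g (f y) \<noteq> g (f x)"
        obtain m n where "g (f y) = of_int m" "g (f x) = of_int n" using g(2) by (metis Ints_cases)
        then show "1 \<le> norm (g (f y) - g (f x))" using y by (simp flip: of_int_diff of_int_abs)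
      qed simp
    qed (rule convex_connected[OF convex_UNIV])
    then show ?thesis by (auto simp: constant_on_def)
  qed
  obtain c1 where c1: "\<And>t. xc (f t) = c1" using int[OF continuous_coords(1)] assms(2) by (auto simp: \<Omega>_iff)
  obtain c2 where c2: "\<And>t. yc (f t) = c2" using int[OF continuous_coords(2)] assms(2) by (auto simp: \<Omega>_iff)
  show thesis by (rule that[of "of_real c1 * \<omega>1 + of_real c2 * \<omega>2"]) (metis c1 c2 coords)
qed

text \<open>A holomorphic self-map of the torus is affine: its lift has a periodic, hence bounded derivative.\<close>

lemma holomorphic_self_map_affine:
  assumes YC: "\<And>t. Y t \<in> C" and per: "\<And>t \<omega>. \<omega> \<in> \<Omega> ==> Y (t + \<omega>) = Y t"
    and hol: "\<And>t. \<exists>S y. open S \<and> t \<in> S \<and> (\<forall>i. (\<lambda>s. y s $ i) holomorphic_on S) \<and> (\<forall>s\<in>S. y s \<noteq> 0 \<and> Y s = to_proj2 (y s))"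
  obtains \<alpha> \<beta> where "\<And>t. Y t = \<phi> (\<alpha> * t + \<beta>)" "\<And>\<omega>. \<omega> \<in> \<Omega> ==> \<alpha> * \<omega> \<in> \<Omega>"
proof -
  have Yc: "continuous_on UNIV Y"
  proof (rule continuous_at_imp_continuous_on, rule ballI)
    fix t obtain S y where y: "open S" "t \<in> S" "\<forall>i. (\<lambda>s. y s $ i) holomorphic_on S" "\<forall>s\<in>S. y s \<noteq> 0 \<and> Y s = to_proj2 (y s)"
      using hol[of t] by blast
    have "continuous_on S y" using y(3) by (intro continuous_on_vec3 holomorphic_on_imp_continuous_on) auto
    then have "continuous_on S (\<lambda>s. to_proj2 (y s))" by (rule continuous_on_to_proj2) (use y in auto)
    then have "continuous_on S Y" by (rule continuous_on_eq) (use y(4) in simp)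
    then show "isCont Y t" using continuous_on_eq_continuous_at[of S Y] y(1,2) by blast
  qed
  obtain \<gamma> where \<gamma>: "continuous_on UNIV \<gamma>" "\<And>t. \<phi> (\<gamma> t) = Y t" using continuous_lift[OF Yc YC] by blast
  have \<gamma>c: "isCont \<gamma> t" for t using \<gamma>(1) by (simp add: continuous_on_eq_continuous_at)
  have "\<gamma> field_differentiable (at t0)" for t0
  proof -
    obtain S h where h: "lift S h" "\<gamma> t0 \<in> S" by (rule lift_exists)
    then have hS: "\<And>i. (\<lambda>s. h s $ i) holomorphic_on S" "open S" "cr (h (\<gamma> t0)) (dv h (\<gamma> t0)) \<noteq> 0" by (auto simp: lift_def)
    obtain j k l where jk: "h (\<gamma> t0) $ k \<noteq> 0" "((\<lambda>s. h s $ j / h s $ k) has_field_derivative l) (at (\<gamma> t0))" "l \<noteq> 0"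
      by (rule slope_coordinate[OF hS(1,2) h(2) hS(3)])
    obtain S' y where y: "open S'" "t0 \<in> S'" "\<forall>i. (\<lambda>s. y s $ i) holomorphic_on S'" "\<forall>s\<in>S'. y s \<noteq> 0 \<and> Y s = to_proj2 (y s)"
      using hol[of t0] by blast
    have par: "\<exists>c. c \<noteq> 0 \<and> h (\<gamma> t) = c *s y t" if "\<gamma> t \<in> S" "t \<in> S'" for t
    proof -
      have "to_proj2 (y t) = to_proj2 (h (\<gamma> t))" "y t \<noteq> 0" "h (\<gamma> t) \<noteq> 0"
        using \<gamma>(2)[of t] h(1) y(4) that by (auto simp: lift_def)
      then obtain c where "h (\<gamma> t) = c *s y t" using to_proj2_eq_iff by blast
      then show ?thesis using \<open>h (\<gamma> t) \<noteq> 0\<close> by auto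
    qed
    have yk: "y t0 $ k \<noteq> 0" using par[OF h(2) y(2)] jk(1) by auto
    have "(\<lambda>t. y t $ j / y t $ k) field_differentiable (at t0)"
      using y yk by (intro field_differentiable_divide holomorphic_on_imp_differentiable_at[of _ S']) auto
    then obtain k' where k': "((\<lambda>t. y t $ j / y t $ k) has_field_derivative k') (at t0)"
      by (auto simp: field_differentiable_def)
    have "\<forall>\<^sub>F t in nhds t0. \<gamma> t \<in> S \<and> t \<in> S'"
    proof (rule eventually_conj)
      have "open (\<gamma> -` S)" using hS(2) \<gamma>(1) by (intro open_vimage) auto
      then have "\<forall>\<^sub>F t in nhds t0. t \<in> \<gamma> -` S" using h(2) by (intro eventually_nhds_in_open) auto
      then show "\<forall>\<^sub>F t in nhds t0. \<gamma> t \<in> S" by simp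
      show "\<forall>\<^sub>F t in nhds t0. t \<in> S'" using y by (intro eventually_nhds_in_open) auto
    qed
    then have "\<forall>\<^sub>F t in nhds t0. h (\<gamma> t) $ j / h (\<gamma> t) $ k = y t $ j / y t $ k"
    proof eventually_elim
      case (elim t)
      then obtain c where "c \<noteq> 0" "h (\<gamma> t) = c *s y t" using par by blast
      then show ?case by simp
    qed
    then have "((\<lambda>t. h (\<gamma> t) $ j / h (\<gamma> t) $ k) has_field_derivative k') (at t0)"
      using k' by (subst DERIV_cong_ev[OF refl _ refl])
    then have "(\<gamma> has_field_derivative k' / l) (at t0)"
      by (rule deriv_at_inverse_composition[OF jk(2,3) \<gamma>c])
    then show ?thesis by (auto simp: field_differentiable_def)
  qed
  then have \<gamma>h: "\<gamma> holomorphic_on UNIV" by (simp add: holomorphic_on_def)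
  have shift: "\<exists>c. \<forall>t. \<gamma> (t + \<omega>) = \<gamma> t + c" if "\<omega> \<in> \<Omega>" for \<omega>
  proof -
    have mem: "\<gamma> (t + \<omega>) - \<gamma> t \<in> \<Omega>" for t using per[OF that, of t] \<gamma>(2) by (simp add: \<phi>_eq[symmetric])
    have cont: "continuous_on UNIV (\<lambda>t. \<gamma> (t + \<omega>) - \<gamma> t)"
      by (intro continuous_intros continuous_on_compose2[OF \<gamma>(1)]) auto
    obtain c where c: "\<And>t. \<gamma> (t + \<omega>) - \<gamma> t = c" using continuous_\<Omega>_valued_constant[OF cont mem] by blast
    have "\<gamma> (t + \<omega>) = \<gamma> t + c" for t using c[of t] by (metis add.commute diff_add_cancel)
    then show ?thesis by blast
  qed
  have D: "(\<gamma> has_field_derivative deriv \<gamma> t) (at t)" for t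
    using holomorphic_derivI[OF \<gamma>h open_UNIV] by simp
  have dper: "deriv \<gamma> (t + \<omega>) = deriv \<gamma> t" if \<omega>: "\<omega> \<in> \<Omega>" for t \<omega>
  proof -
    obtain c where c: "\<forall>t. \<gamma> (t + \<omega>) = \<gamma> t + c" using shift[OF \<omega>] by blast
    have "((\<lambda>t. \<gamma> (t + \<omega>)) has_field_derivative deriv \<gamma> (t + \<omega>)) (at t)"
      using D[of "t + \<omega>"] by (simp add: DERIV_shift)
    moreover have "((\<lambda>t. \<gamma> t + c) has_field_derivative deriv \<gamma> t) (at t)"
      using DERIV_add[OF D[of t] DERIV_const[of c]] by simp
    ultimately show ?thesis using c by (auto intro: DERIV_unique)
  qed
  have dh: "deriv \<gamma> holomorphic_on UNIV" by (rule holomorphic_deriv[OF \<gamma>h open_UNIV])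
  have "bounded (deriv \<gamma> ` closure Q)"
    by (intro compact_imp_bounded compact_continuous_image compact_closure_Q
        continuous_on_subset[OF holomorphic_on_imp_continuous_on[OF dh]]) simp
  moreover have "range (deriv \<gamma>) \<subseteq> deriv \<gamma> ` closure Q"
  proof (rule image_subsetI)
    fix t obtain \<omega> where \<omega>: "\<omega> \<in> \<Omega>" "t + \<omega> \<in> closure Q" by (rule reduce_Q)
    show "deriv \<gamma> t \<in> deriv \<gamma> ` closure Q" using imageI[OF \<omega>(2), of "deriv \<gamma>"] dper[OF \<omega>(1), of t] by simp
  qed
  ultimately have "bounded (range (deriv \<gamma>))" by (rule bounded_subset)
  then have "deriv \<gamma> constant_on UNIV" by (rule Liouville_theorem[OF dh])
  then obtain \<alpha> where \<alpha>: "\<And>t. deriv \<gamma> t = \<alpha>" unfolding constant_on_def by blast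
  have "((\<lambda>t. \<gamma> t - \<alpha> * t) has_field_derivative 0) (at t)" for t
    using D[of t] \<alpha>[of t] by (auto intro!: derivative_eq_intros)
  then have "\<exists>\<beta>. \<forall>t\<in>UNIV. \<gamma> t - \<alpha> * t = \<beta>"
    by (intro has_field_derivative_zero_constant) auto
  then obtain \<beta> where "\<And>t. \<gamma> t - \<alpha> * t = \<beta>" by blast
  then have g: "\<gamma> t = \<alpha> * t + \<beta>" for t by (metis add.commute diff_add_cancel)
  show thesis
  proof
    show "Y t = \<phi> (\<alpha> * t + \<beta>)" for t using \<gamma>(2)[of t] g[of t] by simp
    fix \<omega> assume "\<omega> \<in> \<Omega>"
    then have "\<phi> (\<gamma> (0 + \<omega>)) = \<phi> (\<gamma> 0)" using per[of \<omega> 0] \<gamma>(2) by simp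
    then show "\<alpha> * \<omega> \<in> \<Omega>" unfolding g \<phi>_eq by simp
  qed
qed

end

lemma norm_vec3_sq: "(norm (x :: complex^3))\<^sup>2 = (\<Sum>i\<in>UNIV. (norm (x $ i))\<^sup>2)"
  by (simp add: norm_vec_def L2_set_def sum_nonneg)

lemma hermitian_cauchy_schwarz: "norm (\<Sum>i\<in>UNIV. (x::complex^3) $ i * cnj (y $ i)) \<le> norm x * norm y"
proof -
  have "norm (\<Sum>i\<in>UNIV. x $ i * cnj (y $ i)) \<le> (\<Sum>i\<in>UNIV. norm (x $ i * cnj (y $ i)))" by (rule norm_sum)
  also have "\<dots> = (\<Sum>i\<in>UNIV. \<bar>norm (x $ i)\<bar> * \<bar>norm (y $ i)\<bar>)" by (simp add: norm_mult)
  also have "\<dots> \<le> norm x * norm y" unfolding norm_vec_def by (rule L2_set_mult_ineq)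
  finally show ?thesis .
qed

text \<open>The maximum modulus principle for vector-valued holomorphic functions, in the strong form
  available for the Euclidean norm.\<close>

lemma vector_maximum_modulus:
  fixes \<eta> :: "complex => complex ^ 3"
  assumes hol: "\<And>i. (\<lambda>s. \<eta> s $ i) holomorphic_on ball t r" and r: "r > 0"
    and max: "\<And>s. s \<in> ball t r ==> norm (\<eta> s) \<le> norm (\<eta> t)" and s: "s \<in> ball t r"
  shows "\<eta> s = \<eta> t"
proof -
  define q where "q s = (\<Sum>i\<in>UNIV. \<eta> s $ i * cnj (\<eta> t $ i))" for s
  have qt: "q t = of_real ((norm (\<eta> t))\<^sup>2)"
    unfolding norm_vec3_sq q_def by (simp only: of_real_sum complex_norm_square)
  have le: "norm (q s) \<le> norm (q t)" if "s \<in> ball t r" for s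
  proof -
    have "norm (q s) \<le> norm (\<eta> s) * norm (\<eta> t)" unfolding q_def by (rule hermitian_cauchy_schwarz)
    also have "\<dots> \<le> norm (\<eta> t) * norm (\<eta> t)" by (intro mult_right_mono max that) simp
    finally show ?thesis unfolding qt by (simp add: power2_eq_square norm_mult)
  qed
  have "q holomorphic_on ball t r" unfolding q_def by (intro holomorphic_intros hol)
  then have "q constant_on ball t r"
    by (rule maximum_modulus_principle[where U = "ball t r" and \<xi> = t]) (use r le in auto)
  then have qs: "q s = q t" using s r unfolding constant_on_def by (metis centre_in_ball)
  have "(norm (\<eta> s - \<eta> t))\<^sup>2 = (norm (\<eta> s))\<^sup>2 + (norm (\<eta> t))\<^sup>2 - 2 * Re (q s)"
  proof -
    have "(norm (x - y))\<^sup>2 = (norm x)\<^sup>2 + (norm y)\<^sup>2 - 2 * Re (x * cnj y)" for x y :: complex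
      unfolding cmod_power2 by (simp add: power2_eq_square algebra_simps)
    then show ?thesis unfolding norm_vec3_sq q_def
      by (simp add: sum.distrib sum_subtractf sum_distrib_left)
  qed
  also have "\<dots> \<le> (norm (\<eta> t))\<^sup>2 + (norm (\<eta> t))\<^sup>2 - 2 * (norm (\<eta> t))\<^sup>2"
    unfolding qs qt using max[OF s] by (simp add: power_mono)
  finally show ?thesis by simp
qed

lemma discrete_countable:
  fixes R :: "'a::euclidean_space set"
  assumes "\<And>t. \<not> t islimpt R" shows "countable R"
proof -
  have "R = (\<Union>n::nat. cball 0 (real n) \<inter> R)"
    using real_arch_simple by (fastforce simp: dist_norm)
  moreover have "finite (cball 0 (real n) \<inter> R)" for n
    by (rule finite_not_islimpt_in_compact) (use assms in auto)
  ultimately show ?thesis by (metis countable_UN countable_finite countableI_type)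
qed

context uniformized
begin

text \<open>Functions of the 1-jet of a lift that do not depend on the lift are functions on the curve.\<close>

definition jet_invariant :: "(complex ^ 3 => complex ^ 3 => real) => bool" where
  "jet_invariant f \<longleftrightarrow> (\<forall>u w g g'. g \<noteq> 0 --> u \<noteq> 0 --> f (g *s u) (g *s w + g' *s u) = f u w)"

definition val :: "(complex ^ 3 => complex ^ 3 => real) => complex => real" where
  "val f t = (let h = (SOME h. \<exists>S. lift S h \<and> t \<in> S) in f (h t) (dv h t))"

lemma val_eq:
  assumes f: "jet_invariant f" and h: "lift S h" "s \<in> S"
  shows "val f s = f (h s) (dv h s)"
proof -
  define h' where "h' = (SOME h. \<exists>S. lift S h \<and> s \<in> S)"
  have "\<exists>h S. lift S h \<and> s \<in> S" using h by blast
  then have "\<exists>S. lift S h' \<and> s \<in> S" unfolding h'_def by (rule someI_ex)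
  then obtain S' where h': "lift S' h'" "s \<in> S'" by blast
  obtain g g' where g: "g \<noteq> 0" "h' s = g *s h s" "dv h' s = g *s dv h s + g' *s h s"
    by (rule lift_change[OF h h' refl])
  have "h s \<noteq> 0" using h by (simp add: lift_def)
  then have "f (h' s) (dv h' s) = f (h s) (dv h s)" using f g unfolding jet_invariant_def by metis
  then show ?thesis by (simp add: val_def Let_def h'_def)
qed

lemma val_invariant:
  assumes f: "jet_invariant f" and "\<phi> s = \<phi> t"
  shows "val f s = val f t"
proof -
  obtain S h where h: "lift S h" "s \<in> S" by (rule lift_exists)
  obtain S' h' where h': "lift S' h'" "t \<in> S'" by (rule lift_exists)
  obtain g g' where g: "g \<noteq> 0" "h' t = g *s h s" "dv h' t = g *s dv h s + g' *s h s"
    by (rule lift_change[OF h h' assms(2)])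
  have "h s \<noteq> 0" using h by (simp add: lift_def)
  then show ?thesis unfolding val_eq[OF f h] val_eq[OF f h'] g using f g(1) unfolding jet_invariant_def by metis
qed

text \<open>A line bundle of negative degree has no section: the function \<open>\<bar>k\<bar> \<bar>h\<bar>\<^sup>c\<close> would have a maximum,
  and by the maximum modulus principle for \<open>h k\<^bsup>1/c\<^esup>\<close> the curve would be locally constant there.\<close>

lemma no_negative_section:
  fixes B :: "complex => real"
  assumes cont: "continuous_on UNIV B" and inv: "\<And>s t. \<phi> s = \<phi> t ==> B s = B t" and c: "c > 0"
    and loc: "\<And>t. B t > 0 ==> \<exists>S h k. lift S h \<and> t \<in> S \<and> k holomorphic_on S \<and> k t \<noteq> 0 \<and>
      (\<forall>s\<in>S. B s = norm (k s) * norm (h s) powr c)"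
  shows "B t \<le> 0"
proof (rule ccontr)
  assume "\<not> B t \<le> 0"
  obtain \<omega>0 where "\<omega>0 \<in> \<Omega>" "0 + \<omega>0 \<in> closure Q" by (rule reduce_Q)
  then have ne: "closure Q \<noteq> {}" by (metis empty_iff)
  have "\<exists>x\<in>closure Q. \<forall>y\<in>closure Q. B y \<le> B x"
    by (rule continuous_attains_sup[OF compact_closure_Q ne continuous_on_subset[OF cont subset_UNIV]])
  then obtain t0 where t0: "t0 \<in> closure Q" "\<And>s. s \<in> closure Q ==> B s \<le> B t0" by blast
  have max: "B s \<le> B t0" for s
  proof -
    obtain \<omega> where \<omega>: "\<omega> \<in> \<Omega>" "s + \<omega> \<in> closure Q" by (rule reduce_Q)
    have "B s = B (s + \<omega>)" by (rule inv) (simp add: periodic_\<phi>[OF \<omega>(1)])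
    then show ?thesis using t0(2)[OF \<omega>(2)] by simp
  qed
  have "B t0 > 0" using max[of t] \<open>\<not> B t \<le> 0\<close> by linarith
  then obtain S h k where h: "lift S h" "t0 \<in> S" and k: "k holomorphic_on S" "k t0 \<noteq> 0"
    and B: "\<And>s. s \<in> S ==> B s = norm (k s) * norm (h s) powr c" using loc by blast
  have S: "open S" using h by (simp add: lift_def)
  have "open {s \<in> S. k s \<noteq> 0}"
    using continuous_open_preimage[OF holomorphic_on_imp_continuous_on[OF k(1)] S open_Compl[OF closed_singleton[of 0]]]
    by (simp add: vimage_def Int_def)
  moreover have "t0 \<in> {s \<in> S. k s \<noteq> 0}" using h k by simp
  ultimately obtain r where r: "r > 0" "ball t0 r \<subseteq> {s \<in> S. k s \<noteq> 0}" by (rule openE)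
  obtain L where L: "L holomorphic_on ball t0 r" "\<And>s. s \<in> ball t0 r ==> k s = exp (L s)"
  proof (rule holomorphic_logarithm_exists[of "ball t0 r" k t0])
    show "k holomorphic_on ball t0 r" by (rule holomorphic_on_subset[OF k(1)]) (use r in blast)
  qed (use r in auto)
  define \<eta> where "\<eta> s = exp (L s / of_real c) *s h s" for s
  have n\<eta>: "norm (\<eta> s) = B s powr (1/c)" if s: "s \<in> ball t0 r" for s
  proof -
    have hs: "h s \<noteq> 0" using h(1) r s by (auto simp: lift_def)
    have "B s powr (1/c) = exp (Re (L s)) powr (1/c) * (norm (h s) powr c) powr (1/c)"
      using r s L(2)[OF s] by (subst B) (auto simp: powr_mult)
    also have "\<dots> = exp (Re (L s) / c) * norm (h s)"
      using c hs by (simp add: powr_powr) (simp add: powr_def)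
    finally show ?thesis by (simp add: \<eta>_def del: norm_scaleR)
  qed
  have const: "\<eta> s = \<eta> t0" if s: "s \<in> ball t0 r" for s
  proof (rule vector_maximum_modulus[OF _ r(1) _ s])
    show "(\<lambda>s. \<eta> s $ i) holomorphic_on ball t0 r" for i
      unfolding \<eta>_def using L(1) h(1) r c
      by (auto simp: lift_def intro!: holomorphic_intros intro: holomorphic_on_subset)
    fix s assume "s \<in> ball t0 r"
    moreover have "0 \<le> B s" using B[of s] r calculation by (auto simp: subset_iff)
    ultimately show "norm (\<eta> s) \<le> norm (\<eta> t0)"
      using n\<eta> r(1) max[of s] c by (auto intro!: powr_mono2)
  qed
  have "\<phi> s = \<phi> t0" if s: "s \<in> ball t0 r" for s
  proof -
    have "h s \<noteq> 0" "h t0 \<noteq> 0" "\<phi> s = to_proj2 (h s)" "\<phi> t0 = to_proj2 (h t0)"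
      using h r s by (auto simp: lift_def)
    moreover have "to_proj2 (h s) = to_proj2 (\<eta> s)" "to_proj2 (h t0) = to_proj2 (\<eta> t0)"
      unfolding \<eta>_def using calculation by (simp_all add: to_proj2_smult)
    ultimately show ?thesis using const[OF s] by simp
  qed
  then have "ball t0 r \<subseteq> (\<lambda>\<omega>. t0 + \<omega>) ` \<Omega>" by (force simp: \<phi>_eq image_iff)
  then have "countable (ball t0 r)" using countable_\<Omega> countable_subset by blast
  then show False using uncountable_ball[OF r(1)] by blast
qed

lemma no_negative_line_bundle:
  assumes f: "jet_invariant f" and c: "c > 0"
    and loc: "\<And>t. \<exists>S h k. lift S h \<and> t \<in> S \<and> k holomorphic_on S \<and> (\<forall>s\<in>S. k s \<noteq> 0) \<and>
      (\<forall>s\<in>S. f (h s) (dv h s) = norm (k s) * norm (h s) powr c)"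
  shows False
proof -
  have loc': "\<exists>S h k. lift S h \<and> t \<in> S \<and> k holomorphic_on S \<and> k t \<noteq> 0 \<and> (\<forall>s\<in>S. k s \<noteq> 0) \<and>
      (\<forall>s\<in>S. val f s = norm (k s) * norm (h s) powr c)" for t
  proof -
    obtain S h k where *: "lift S h" "t \<in> S" "k holomorphic_on S" "\<forall>s\<in>S. k s \<noteq> 0"
      "\<forall>s\<in>S. f (h s) (dv h s) = norm (k s) * norm (h s) powr c" using loc[of t] by blast
    then have "\<forall>s\<in>S. val f s = norm (k s) * norm (h s) powr c" using val_eq[OF f] by metis
    then show ?thesis using * by blast
  qed
  have "isCont (val f) t" for t
  proof -
    obtain S h k where *: "lift S h" "t \<in> S" "k holomorphic_on S" "\<forall>s\<in>S. k s \<noteq> 0"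
      "\<forall>s\<in>S. val f s = norm (k s) * norm (h s) powr c" using loc'[of t] by blast
    have "continuous_on S (\<lambda>s. norm (k s) * norm (h s) powr c)"
      using *(1) by (intro continuous_intros holomorphic_on_imp_continuous_on[OF *(3)] lift_cont[OF *(1)]) (auto simp: lift_def)
    then have "continuous_on S (val f)" by (rule continuous_on_eq) (use *(5) in simp)
    moreover have "open S" using *(1) by (simp add: lift_def)
    ultimately show ?thesis using continuous_on_eq_continuous_at *(2) by blast
  qed
  then have "continuous_on UNIV (val f)" by (simp add: continuous_at_imp_continuous_on)
  then have "val f 0 \<le> 0"
    by (rule no_negative_section[OF _ val_invariant[OF f] c]) (use loc' in blast)+
  moreover have "val f 0 > 0"
    using loc'[of 0]
  proof (elim exE conjE)
    fix S h k
    assume *: "lift S h" "0 \<in> S" "k 0 \<noteq> 0" "\<forall>s\<in>S. val f s = norm (k s) * norm (h s) powr c"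
    then have "val f 0 = norm (k 0) * norm (h 0) powr c" "h 0 \<noteq> 0" by (auto simp: lift_def)
    then show "val f 0 > 0" using *(3) by simp
  qed
  ultimately show False by simp
qed

lemma cr_jet: "cr (g *s u) (g *s w + g' *s u) = g\<^sup>2 *s cr u (w :: complex^3)"
  by (simp add: cr_smult cr_smult_left cr_add vector_smult_assoc power2_eq_square)

definition Rl :: "complex ^ 3 => complex set" where "Rl a = {t. dt a (rep_proj2 (\<phi> t)) = 0}"

lemma Rl_iff: "v \<noteq> 0 ==> to_proj2 v = \<phi> t ==> t \<in> Rl a \<longleftrightarrow> dt a v = 0"
proof -
  assume v: "v \<noteq> 0" "to_proj2 v = \<phi> t"
  then obtain c where c: "rep_proj2 (\<phi> t) = c *s v"
    using to_proj2_eq_iff[OF v(1) rep_proj2_nonzero] by (metis to_proj2_rep)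
  then have "c \<noteq> 0" using rep_proj2_nonzero[of "\<phi> t"] by auto
  then show ?thesis by (simp add: Rl_def c)
qed

lemma Rl_lift: "lift S h ==> s \<in> S ==> s \<in> Rl a \<longleftrightarrow> dt a (h s) = 0"
  by (rule Rl_iff) (auto simp: lift_def)

text \<open>On a line with normal vector \<open>a\<close> the vector \<open>h \<times> h'\<close> is a multiple of \<open>a\<close>, so that
  \<open>\<bar>h\<bar>\<^sup>2 / \<bar>h \<times> h'\<bar>\<close> would be a nonvanishing section of negative degree.\<close>

lemma not_in_line:
  assumes a: "a \<noteq> 0" shows "Rl a \<noteq> UNIV"
proof
  assume all: "Rl a = UNIV"
  obtain i where i: "a $ i \<noteq> 0" using nonzero_nth[OF a] by blast
  define f where "f u w = (norm u)\<^sup>2 / norm (cr u w)" for u w :: "complex^3"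
  have f: "jet_invariant f"
    unfolding jet_invariant_def f_def cr_jet by (simp add: norm_power power_mult_distrib)
  show False
  proof (rule no_negative_line_bundle[OF f, of 2])
    fix t
    obtain S h where h: "lift S h" "t \<in> S" by (rule lift_exists)
    have par: "\<exists>k. cr (h s) (dv h s) = k *s a \<and> k \<noteq> 0" if s: "s \<in> S" for s
    proof -
      have z: "dt a (h s) = 0" if "s \<in> S" for s using Rl_lift[OF h(1) that] all by blast
      have "((\<lambda>s. dt a (h s)) has_field_derivative dt a (dv h s)) (at s)"
        unfolding dt_def by (intro DERIV_sum DERIV_cmult lift_deriv[OF h(1) s])
      moreover have "((\<lambda>s. dt a (h s)) has_field_derivative 0) (at s)"
      proof (rule has_field_derivative_transform_within_open[OF DERIV_const[of 0] _ s])
        show "open S" using h(1) by (simp add: lift_def)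
      qed (simp add: z)
      ultimately have "dt a (dv h s) = 0" by (rule DERIV_unique)
      then obtain k where "cr (h s) (dv h s) = k *s a" using cr_parallel_normal[OF z[OF s] _ a] by blast
      moreover have "cr (h s) (dv h s) \<noteq> 0" using h(1) s by (simp add: lift_def)
      ultimately show ?thesis by auto
    qed
    define k where "k s = (a $ i / of_real (norm a)) / cr (h s) (dv h s) $ i" for s
    have crh: "(\<lambda>s. cr (h s) (dv h s) $ i) holomorphic_on S"
    proof -
      obtain j l where "\<forall>u v. cr u v $ i = u$j * v$l - u$l * (v::complex^3)$j" using cr_nth_cases by blast
      then show ?thesis using h(1) dv_holomorphic[OF h(1)] by (auto simp: lift_def intro!: holomorphic_intros)
    qed
    have nz: "cr (h s) (dv h s) $ i \<noteq> 0" if "s \<in> S" for s using par[OF that] i by auto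
    have "k holomorphic_on S" unfolding k_def using nz a by (intro holomorphic_intros crh) auto
    moreover have "k s \<noteq> 0" if "s \<in> S" for s using nz[OF that] i a by (simp add: k_def)
    moreover have "f (h s) (dv h s) = norm (k s) * norm (h s) powr 2" if s: "s \<in> S" for s
    proof -
      obtain k0 where "cr (h s) (dv h s) = k0 *s a" "k0 \<noteq> 0" using par[OF s] by blast
      then show ?thesis using i a by (simp add: f_def k_def norm_divide norm_mult)
    qed
    ultimately show "\<exists>S h k. lift S h \<and> t \<in> S \<and> k holomorphic_on S \<and> (\<forall>s\<in>S. k s \<noteq> 0) \<and>
      (\<forall>s\<in>S. f (h s) (dv h s) = norm (k s) * norm (h s) powr 2)" using h by blast
  qed simp
qed

lemma dt_lift_holomorphic: "lift S h ==> (\<lambda>s. dt a (h s)) holomorphic_on S"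
  unfolding dt_def by (intro holomorphic_intros) (simp add: lift_def)

lemma line_isolated:
  assumes "a \<noteq> 0" shows "\<not> t islimpt Rl a"
proof
  assume "t islimpt Rl a"
  then have "Rl a = UNIV"
  proof (rule local_zero_set_identity[rotated])
    fix t obtain S h where h: "lift S h" "t \<in> S" by (rule lift_exists)
    moreover have "open S" using h by (simp add: lift_def)
    ultimately obtain r where r: "r > 0" "ball t r \<subseteq> S" by (metis openE)
    then show "\<exists>r>0. \<exists>w. w holomorphic_on ball t r \<and> (\<forall>s\<in>ball t r. s \<in> Rl a \<longleftrightarrow> w s = 0)"
      using holomorphic_on_subset[OF dt_lift_holomorphic[OF h(1)]] Rl_lift[OF h(1)] by blast
  qed
  then show False using not_in_line assms by blast
qed

lemma line_countable: "a \<noteq> 0 ==> countable (Rl a)"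
  using discrete_countable line_isolated by blast

text \<open>The same argument with the gradient in place of \<open>a\<close> computes the degree of a smooth curve
  of genus one.\<close>

lemma degree_three:
  assumes hom: "homogeneous m G" and m: "0 < m" and CG: "C = zero_set G"
    and smooth: "\<And>v. v \<noteq> 0 ==> eval3 G v = 0 ==> grad (eval3 G) v \<noteq> 0"
  shows "m = 3"
proof (rule ccontr)
  assume "m \<noteq> 3"
  let ?G = "grad (eval3 G)"
  have gs: "g *s ?G (g *s u) = g ^ m *s ?G u" for g u
    by (rule grad_homogeneous[OF pfun_eval3 eval3_scale[OF hom]])
  have gn: "norm (?G (g *s u)) = norm g ^ (m - 1) * norm (?G u)" if "g \<noteq> 0" for g u
  proof -
    have "norm g * norm (?G (g *s u)) = norm g * (norm g ^ (m - 1) * norm (?G u))"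
      using gs[of g u] m by (metis norm_smult norm_power power_eq_if mult.assoc less_not_refl)
    then show ?thesis using that by simp
  qed
  have data: "\<exists>k. cr (h s) (dv h s) = k *s ?G (h s) \<and> k \<noteq> 0 \<and> ?G (h s) \<noteq> 0" if h: "lift S h" and s: "s \<in> S" for S h s
  proof -
    have z: "eval3 G (h s) = 0" "h s \<noteq> 0" if "s \<in> S" for s
    proof -
      show "h s \<noteq> 0" using h that by (simp add: lift_def)
      then show "eval3 G (h s) = 0" using zero_set_iff[OF hom] CG h that \<phi>_C[of s] by (simp add: lift_def)
    qed
    have hd: "(h has_derivative (\<lambda>x. x *s dv h s)) (at s)"
      by (rule has_derivative_vec3) (use lift_deriv[OF h s] in \<open>simp add: has_field_derivative_def mult_commute_abs\<close>)
    have "((\<lambda>s. eval3 G (h s)) has_derivative (\<lambda>x. dt (?G (h s)) (x *s dv h s))) (at s)"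
      by (rule has_derivative_compose[where f = h and g = "eval3 G", OF hd pfun_has_derivative[OF pfun_eval3]])
    then have "((\<lambda>s. eval3 G (h s)) has_field_derivative dt (?G (h s)) (dv h s)) (at s)"
      by (simp add: has_field_derivative_def mult.commute[of _ "dt _ _"])
    moreover have "((\<lambda>s. eval3 G (h s)) has_field_derivative 0) (at s)"
    proof (rule has_field_derivative_transform_within_open[OF DERIV_const[of 0] _ s])
      show "open S" using h by (simp add: lift_def)
    qed (simp add: z)
    ultimately have "dt (?G (h s)) (dv h s) = 0" by (rule DERIV_unique)
    moreover have "dt (?G (h s)) (h s) = 0" using euler_identity[OF pfun_eval3 eval3_scale[OF hom], of "h s"] z[OF s] by simp
    moreover have g0: "?G (h s) \<noteq> 0" using smooth z[OF s] by blast
    ultimately obtain k where "cr (h s) (dv h s) = k *s ?G (h s)" using cr_parallel_normal by blast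
    moreover have "cr (h s) (dv h s) \<noteq> 0" using h s by (simp add: lift_def)
    ultimately show ?thesis using g0 by auto
  qed
  have crh: "(\<lambda>s. cr (h s) (dv h s) $ i) holomorphic_on S" if h: "lift S h" for S h i
  proof -
    obtain j l where "\<forall>u v. cr u v $ i = u$j * v$l - u$l * (v::complex^3)$j" using cr_nth_cases by blast
    then show ?thesis using h dv_holomorphic[OF h] by (auto simp: lift_def intro!: holomorphic_intros)
  qed
  have Gh: "(\<lambda>s. ?G (h s) $ i) holomorphic_on S" if h: "lift S h" for S h i
    by (rule pfun_holomorphic[OF pfun_grad[OF pfun_eval3]]) (use h in \<open>simp add: lift_def\<close>)
  have ratio: "\<exists>S h k. lift S h \<and> t \<in> S \<and> k holomorphic_on S \<and> (\<forall>s\<in>S. k s \<noteq> 0) \<and>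
      (\<forall>s\<in>S. norm (cr (h s) (dv h s)) / norm (?G (h s)) = norm (k s))" for t
  proof -
    obtain S h where h: "lift S h" "t \<in> S" by (rule lift_exists)
    obtain i where i: "?G (h t) $ i \<noteq> 0" using data[OF h] nonzero_nth by blast
    define S' where "S' = {s \<in> S. ?G (h s) $ i \<noteq> 0}"
    have op: "open S" using h by (simp add: lift_def)
    have "open S'"
      using continuous_open_preimage[OF holomorphic_on_imp_continuous_on[OF Gh[OF h(1), of i]] op open_Compl[OF closed_singleton[of 0]]]
      by (simp add: vimage_def Int_def S'_def)
    then have h': "lift S' h" by (rule lift_subset[OF h(1)]) (auto simp: S'_def)
    define k where "k s = cr (h s) (dv h s) $ i / ?G (h s) $ i" for s
    have k: "cr (h s) (dv h s) = k s *s ?G (h s)" "k s \<noteq> 0" if "s \<in> S'" for s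
    proof -
      have "s \<in> S" "?G (h s) $ i \<noteq> 0" using that by (auto simp: S'_def)
      moreover obtain k0 where "cr (h s) (dv h s) = k0 *s ?G (h s)" "k0 \<noteq> 0" using data[OF h(1) \<open>s \<in> S\<close>] by blast
      ultimately show "cr (h s) (dv h s) = k s *s ?G (h s)" "k s \<noteq> 0" by (simp_all add: k_def)
    qed
    have "k holomorphic_on S'" unfolding k_def
      by (intro holomorphic_intros crh[OF h'] Gh[OF h']) (simp add: S'_def)
    moreover have "norm (cr (h s) (dv h s)) / norm (?G (h s)) = norm (k s)" if "s \<in> S'" for s
    proof -
      have "?G (h s) \<noteq> 0" using data[OF h' that] by blast
      then show ?thesis using k(1)[OF that] by simp
    qed
    moreover have "t \<in> S'" using h(2) i by (simp add: S'_def)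
    ultimately show ?thesis using h' k(2) by blast
  qed
  show False
  proof (cases "m < 3")
    case True
    define f where "f u w = norm u ^ (3 - m) * (norm (?G u) / norm (cr u w))" for u w :: "complex^3"
    have "jet_invariant f"
      unfolding jet_invariant_def
    proof (intro allI impI)
      fix u w :: "complex^3" and g g' :: complex assume g: "g \<noteq> 0"
      have p: "norm g ^ (3 - m) * norm g ^ (m - 1) = (norm g)\<^sup>2"
        using True m by (simp flip: power_add)
      have "f (g *s u) (g *s w + g' *s u) = (norm g ^ (3 - m) * norm g ^ (m - 1)) * (norm u ^ (3 - m) * norm (?G u)) / ((norm g)\<^sup>2 * norm (cr u w))"
        unfolding f_def cr_jet gn[OF g] norm_smult norm_power by (simp add: power_mult_distrib mult_ac)
      then show "f (g *s u) (g *s w + g' *s u) = f u w" unfolding p using g by (simp add: f_def)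
    qed
    then show False
    proof (rule no_negative_line_bundle[of f "real (3 - m)"])
      fix t
      obtain S h k where *: "lift S h" "t \<in> S" "k holomorphic_on S" "\<forall>s\<in>S. k s \<noteq> 0"
        "\<forall>s\<in>S. norm (cr (h s) (dv h s)) / norm (?G (h s)) = norm (k s)" using ratio[of t] by blast
      have "f (h s) (dv h s) = norm (1 / k s) * norm (h s) powr real (3 - m)" if s: "s \<in> S" for s
      proof -
        have "h s \<noteq> 0" using *(1) s by (simp add: lift_def)
        moreover have "norm (1 / k s) = norm (?G (h s)) / norm (cr (h s) (dv h s))"
          using *(5) s by (simp add: norm_divide) (metis inverse_divide inverse_eq_divide)
        ultimately show ?thesis by (simp add: f_def powr_realpow)
      qed
      moreover have "(\<lambda>s. 1 / k s) holomorphic_on S" using *(3,4) by (intro holomorphic_intros) auto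
      ultimately show "\<exists>S h k. lift S h \<and> t \<in> S \<and> k holomorphic_on S \<and> (\<forall>s\<in>S. k s \<noteq> 0) \<and>
        (\<forall>s\<in>S. f (h s) (dv h s) = norm (k s) * norm (h s) powr real (3 - m))"
        using *(1,2,4) by (intro exI[of _ S] exI[of _ h] exI[of _ "\<lambda>s. 1 / k s"]) auto
    qed (use True in simp)
  next
    case False
    then have m3: "3 < m" using \<open>m \<noteq> 3\<close> by simp
    define f where "f u w = norm u ^ (m - 3) * (norm (cr u w) / norm (?G u))" for u w :: "complex^3"
    have "jet_invariant f"
      unfolding jet_invariant_def
    proof (intro allI impI)
      fix u w :: "complex^3" and g g' :: complex assume g: "g \<noteq> 0"
      have p: "norm g ^ (m - 3) * (norm g)\<^sup>2 = norm g ^ (m - 1)"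
      proof -
        have "m - 3 + 2 = m - 1" using m3 by linarith
        then show ?thesis by (metis power_add)
      qed
      have "f (g *s u) (g *s w + g' *s u) = (norm g ^ (m - 3) * (norm g)\<^sup>2) * (norm u ^ (m - 3) * norm (cr u w)) / (norm g ^ (m - 1) * norm (?G u))"
        unfolding f_def cr_jet gn[OF g] norm_smult norm_power by (simp add: power_mult_distrib mult_ac)
      then show "f (g *s u) (g *s w + g' *s u) = f u w" unfolding p using g by (simp add: f_def)
    qed
    then show False
    proof (rule no_negative_line_bundle[of f "real (m - 3)"])
      fix t
      obtain S h k where *: "lift S h" "t \<in> S" "k holomorphic_on S" "\<forall>s\<in>S. k s \<noteq> 0"
        "\<forall>s\<in>S. norm (cr (h s) (dv h s)) / norm (?G (h s)) = norm (k s)" using ratio[of t] by blast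
      have "f (h s) (dv h s) = norm (k s) * norm (h s) powr real (m - 3)" if s: "s \<in> S" for s
      proof -
        have "h s \<noteq> 0" using *(1) s by (simp add: lift_def)
        then show ?thesis using *(5) s by (simp add: f_def powr_realpow)
      qed
      then show "\<exists>S h k. lift S h \<and> t \<in> S \<and> k holomorphic_on S \<and> (\<forall>s\<in>S. k s \<noteq> 0) \<and>
        (\<forall>s\<in>S. f (h s) (dv h s) = norm (k s) * norm (h s) powr real (m - 3))"
        using * by blast
    qed (use m3 in simp)
  qed
qed

end

lemma exists_orthogonal: fixes v :: "'k::field^3" shows "\<exists>l. l \<noteq> 0 \<and> dt l v = 0"
proof (cases "v $ 1 = 0")
  case True
  have "dt (axis 1 1) v = 0" using True by (simp add: dt3 axis_def)
  then show ?thesis by (intro exI[of _ "axis 1 1"]) (simp add: axis_eq_0_iff)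
next
  case False
  let ?l = "vector [- v$2, v$1, 0] :: 'k^3"
  have "?l $ 2 \<noteq> 0" using False by simp
  then have "?l \<noteq> 0" by (metis zero_index)
  moreover have "dt ?l v = 0" by (simp add: dt3)
  ultimately show ?thesis by blast
qed

context uniformized
begin

lemma Rl_invariant: "\<phi> s = \<phi> t ==> s \<in> Rl a \<longleftrightarrow> t \<in> Rl a"
  by (simp add: Rl_def)

lemma Rl_finite_mod: "a \<noteq> 0 ==> finite (closure Q \<inter> Rl a)"
  by (rule finite_not_islimpt_in_compact[OF compact_closure_Q]) (simp add: line_isolated)

lemma zero_order:
  assumes "a \<noteq> 0" "z \<in> Rl a"
  shows "\<exists>n S h r g. lift S h \<and> 0 < r \<and> ball z r \<subseteq> S \<and> g holomorphic_on ball z r \<and>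
    (\<forall>w\<in>ball z r. dt a (h w) = (w - z) ^ n * g w \<and> g w \<noteq> 0)"
proof -
  obtain S h where h: "lift S h" "z \<in> S" by (rule lift_exists)
  have "open S" using h by (simp add: lift_def)
  then obtain r0 where r0: "r0 > 0" "ball z r0 \<subseteq> S" using h(2) by (rule openE)
  have hol: "(\<lambda>w. dt a (h w)) holomorphic_on ball z r0"
    by (rule holomorphic_on_subset[OF dt_lift_holomorphic[OF h(1)] r0(2)])
  have z0: "dt a (h z) = 0" using Rl_lift[OF h] assms(2) by simp
  have "\<not> (\<lambda>w. dt a (h w)) constant_on ball z r0"
  proof
    assume "(\<lambda>w. dt a (h w)) constant_on ball z r0"
    then have "dt a (h w) = 0" if "w \<in> ball z r0" for w
      using z0 that r0(1) unfolding constant_on_def by (metis centre_in_ball)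
    then have "ball z r0 \<subseteq> Rl a" using Rl_lift[OF h(1)] r0(2) by blast
    moreover have "z islimpt ball z r0" using r0(1) by (intro interior_limit_point) (simp add: interior_open)
    ultimately show False using line_isolated[OF assms(1)] islimpt_subset by blast
  qed
  then obtain g r n where "0 < n" "0 < r" "ball z r \<subseteq> ball z r0" "g holomorphic_on ball z r"
    "\<And>w. w \<in> ball z r ==> dt a (h w) = (w - z) ^ n * g w" "\<And>w. w \<in> ball z r ==> g w \<noteq> 0"
    using holomorphic_factor_zero_nonconstant[OF hol open_ball connected_ball _ z0] r0(1) by (metis centre_in_ball)
  then show ?thesis using h(1) r0(2) by blast
qed

text \<open>If \<open>\<Phi>\<close> induces a translation of the curve, its degree is bounded by a constant: the zeros of
  the linear form \<open>a\<close> composed with \<open>\<Phi>\<close> are translates of the finitely many zeros of \<open>a\<close>. Dividing a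
  product of linear forms that vanish there to a high order by \<open>a \<circ> \<Phi>\<close> gives a section whose
  degree is negative when the degree of \<open>\<Phi>\<close> is large.\<close>

lemma translation_degree_bounded:
  obtains K where "\<And>\<Phi> D \<beta>. (\<And>i. pfun (\<lambda>v. \<Phi> v $ i)) ==> (\<And>c v. \<Phi> (c *s v) = c ^ D *s \<Phi> v) ==>
    (\<And>v t. v \<noteq> 0 ==> to_proj2 v = \<phi> t ==> \<Phi> v \<noteq> 0 \<and> to_proj2 (\<Phi> v) = \<phi> (t + \<beta>)) ==> D \<le> K"
proof -
  define a where "a = (axis 1 1 :: complex^3)"
  have a: "a \<noteq> 0" by (simp add: a_def axis_eq_0_iff)
  define Z0 where "Z0 = closure Q \<inter> Rl a"
  have fin: "finite Z0" unfolding Z0_def by (rule Rl_finite_mod[OF a])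
  have "\<forall>z\<in>Z0. \<exists>n S h r g. lift S h \<and> 0 < r \<and> ball z r \<subseteq> S \<and> g holomorphic_on ball z r \<and>
    (\<forall>w\<in>ball z r. dt a (h w) = (w - z) ^ n * g w \<and> g w \<noteq> 0)"
    using zero_order[OF a] by (simp add: Z0_def)
  then obtain n where n: "\<forall>z\<in>Z0. \<exists>S h r g. lift S h \<and> 0 < r \<and> ball z r \<subseteq> S \<and> g holomorphic_on ball z r \<and>
    (\<forall>w\<in>ball z r. dt a (h w) = (w - z) ^ (n z) * g w \<and> g w \<noteq> 0)" by (rule bchoice[THEN exE])
  define M where "M = (\<Sum>z\<in>Z0. n z)"
  have nM: "n z \<le> M" if "z \<in> Z0" for z unfolding M_def by (rule member_le_sum[OF that _ fin]) simp
  define j where "j = (M + 1) * card Z0"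
  show thesis
  proof (rule that[of j], rule ccontr)
    fix \<Phi> :: "complex^3 => complex^3" and D \<beta>
    assume pf: "\<And>i. pfun (\<lambda>v. \<Phi> v $ i)" and sc: "\<And>c v. \<Phi> (c *s v) = c ^ D *s \<Phi> v"
      and tr: "\<And>v t. v \<noteq> 0 ==> to_proj2 v = \<phi> t ==> \<Phi> v \<noteq> 0 \<and> to_proj2 (\<Phi> v) = \<phi> (t + \<beta>)"
      and "\<not> D \<le> j"
    then have D: "j < D" by simp
    have "\<forall>z. \<exists>l. l \<noteq> 0 \<and> dt l (rep_proj2 (\<phi> (z - \<beta>))) = 0" by (intro allI exists_orthogonal)
    from choice[OF this] obtain l where l: "\<forall>z. l z \<noteq> 0 \<and> dt (l z) (rep_proj2 (\<phi> (z - \<beta>))) = 0" by blast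
    then have l0: "\<And>z. l z \<noteq> 0" and l1: "\<And>z. z - \<beta> \<in> Rl (l z)" by (simp_all add: Rl_def)
    define P where "P A u = (\<Prod>z\<in>A. dt (l z) u ^ (M + 1))" for A u
    have P_scale: "P Z0 (g *s u) = g ^ j * P Z0 u" for g u
      by (simp only: P_def dt_smult power_mult_distrib prod.distrib prod_constant j_def power_mult)
    have pfun_P: "pfun (P A)" for A
      unfolding P_def[abs_def] by (intro pfun_prod pfun_power pfun_dt)
    have pfun_Q: "pfun (\<lambda>v. dt a (\<Phi> v))"
      unfolding dt_def by (intro pfun_sum pfun_mult pfun_const pf)
    define f where "f u w = (if dt a (\<Phi> u) = 0 then 0
      else norm (P Z0 u) * norm u ^ (D - j) / norm (dt a (\<Phi> u)))" for u w :: "complex^3"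
    have f: "jet_invariant f"
      unfolding jet_invariant_def
    proof (intro allI impI)
      fix u w :: "complex^3" and g g' :: complex assume g: "g \<noteq> 0"
      have "norm g ^ j * norm g ^ (D - j) = norm g ^ D" using D by (simp flip: power_add)
      then have "norm (P Z0 (g *s u)) * norm (g *s u) ^ (D - j) = norm g ^ D * (norm (P Z0 u) * norm u ^ (D - j))"
        unfolding P_scale by (simp add: norm_mult norm_power power_mult_distrib mult_ac)
      then show "f (g *s u) (g *s w + g' *s u) = f u w"
        using g unfolding f_def sc by (simp add: norm_mult norm_power)
    qed
    define B where "B = val f"
    have Bh: "B s = f (h s) (dv h s)" if "lift S h" "s \<in> S" for S h s unfolding B_def by (rule val_eq[OF f that])
    have Qh: "(\<lambda>s. dt a (\<Phi> (h s))) holomorphic_on S" if "lift S h" for S h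
      by (rule pfun_holomorphic[OF pfun_Q]) (use that in \<open>simp add: lift_def\<close>)
    have Ph: "(\<lambda>s. P A (h s)) holomorphic_on S" if "lift S h" for S h A
      by (rule pfun_holomorphic[OF pfun_P]) (use that in \<open>simp add: lift_def\<close>)
    have loc: "\<exists>S h k. lift S h \<and> t \<in> S \<and> k holomorphic_on S \<and> k t = P Z0 (h t) / dt a (\<Phi> (h t)) \<and>
        (\<forall>s\<in>S. B s = norm (k s) * norm (h s) powr real (D - j))"
      if h: "lift S h" "t \<in> S" and nz: "dt a (\<Phi> (h t)) \<noteq> 0" for S h t
    proof -
      define S' where "S' = {s \<in> S. dt a (\<Phi> (h s)) \<noteq> 0}"
      have op: "open S" using h by (simp add: lift_def)
      have "open S'"
        using continuous_open_preimage[OF holomorphic_on_imp_continuous_on[OF Qh[OF h(1)]] op open_Compl[OF closed_singleton[of 0]]]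
        by (simp add: vimage_def Int_def S'_def)
      then have h': "lift S' h" by (rule lift_subset[OF h(1)]) (auto simp: S'_def)
      define k where "k s = P Z0 (h s) / dt a (\<Phi> (h s))" for s
      have "k holomorphic_on S'" unfolding k_def by (intro holomorphic_intros Ph[OF h'] Qh[OF h']) (simp add: S'_def)
      moreover have "B s = norm (k s) * norm (h s) powr real (D - j)" if s: "s \<in> S'" for s
      proof -
        have "h s \<noteq> 0" "dt a (\<Phi> (h s)) \<noteq> 0" using h' s by (auto simp: lift_def S'_def)
        then show ?thesis unfolding Bh[OF h' s] f_def k_def by (simp add: norm_divide powr_realpow)
      qed
      moreover have "t \<in> S'" using h(2) nz by (simp add: S'_def)
      ultimately show ?thesis using h' k_def by blast
    qed
    have cont: "isCont B t" for t
    proof -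
      obtain S h where h: "lift S h" "t \<in> S" by (rule lift_exists)
      show ?thesis
      proof (cases "dt a (\<Phi> (h t)) = 0")
        case False
        obtain S' h' k where *: "lift S' h'" "t \<in> S'" "k holomorphic_on S'"
          "\<forall>s\<in>S'. B s = norm (k s) * norm (h' s) powr real (D - j)" using loc[OF h False] by (elim exE conjE)
        have "continuous_on S' (\<lambda>s. norm (k s) * norm (h' s) powr real (D - j))"
          using *(1) by (intro continuous_intros holomorphic_on_imp_continuous_on[OF *(3)] lift_cont[OF *(1)]) (auto simp: lift_def)
        then have "continuous_on S' B" by (rule continuous_on_eq) (use *(4) in simp)
        moreover have "open S'" using *(1) by (simp add: lift_def)
        ultimately show ?thesis using continuous_on_eq_continuous_at *(2) by blast
      next
        case True
        have hs: "h s \<noteq> 0" "to_proj2 (h s) = \<phi> s" if "s \<in> S" for s using h(1) that by (auto simp: lift_def)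
        have "t + \<beta> \<in> Rl a" using Rl_iff[of "\<Phi> (h t)" "t + \<beta>" a] tr[OF hs[OF h(2)]] True by simp
        obtain \<omega> where \<omega>: "\<omega> \<in> \<Omega>" "t + \<beta> + \<omega> \<in> closure Q" by (rule reduce_Q)
        define z where "z = t + \<beta> + \<omega>"
        have z: "z \<in> Z0" using \<omega> \<open>t + \<beta> \<in> Rl a\<close> Rl_invariant[OF periodic_\<phi>[OF \<omega>(1)]] by (simp add: Z0_def z_def)
        obtain S1 h1 r g where g: "lift S1 h1" "0 < r" "ball z r \<subseteq> S1" "g holomorphic_on ball z r"
          "\<And>w. w \<in> ball z r ==> dt a (h1 w) = (w - z) ^ (n z) * g w" "\<And>w. w \<in> ball z r ==> g w \<noteq> 0"
          using bspec[OF n z] by (elim exE conjE) metis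
        define sh where "sh s = s + (\<beta> + \<omega>)" for s
        have sht: "sh t = z" by (simp add: sh_def z_def add.assoc)
        have shz: "sh s - z = s - t" for s by (simp add: sh_def z_def)
        have "t \<in> Rl (l z)"
        proof -
          have "\<phi> t = \<phi> (z - \<beta>)" using \<phi>_eq[of t "z - \<beta>"] \<Omega>_minus[OF \<omega>(1)] by (simp add: z_def)
          then show ?thesis using Rl_invariant l1[of z] by blast
        qed
        then have lt: "dt (l z) (h t) = 0" using Rl_lift[OF h] by simp
        define q where "q s = dt (l z) (h s) / (s - t)" for s
        have "((\<lambda>s. dt (l z) (h s)) has_field_derivative dt (l z) (dv h t)) (at t)"
          unfolding dt_def by (intro DERIV_sum DERIV_cmult lift_deriv[OF h])
        then have qlim: "(q \<longlongrightarrow> dt (l z) (dv h t)) (at t)"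
          unfolding has_field_derivative_iff q_def lt by simp
        define R where "R s = norm (P (Z0 - {z}) (h s)) * norm (h s) ^ (D - j) * norm (h1 (sh s)) / (norm (\<Phi> (h s)) * norm (g (sh s)))" for s
        have hc: "isCont h t" using lift_cont[OF h(1)] h by (auto simp: lift_def continuous_on_eq_continuous_at)
        have shc: "isCont sh t" unfolding sh_def by (intro continuous_intros)
        have pc: "isCont (\<lambda>s. p (h s)) t" if "pfun p" for p
          by (rule isCont_o2[OF hc]) (use pfun_continuous[OF that, of UNIV] in \<open>simp add: continuous_on_eq_continuous_at\<close>)
        have zb: "z \<in> ball z r" using g(2) by simp
        have "z \<in> S1" "open S1" using g(1,3) zb by (auto simp: lift_def)
        then have "isCont h1 z" using lift_cont[OF g(1)] continuous_on_eq_continuous_at by blast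
        then have h1c: "isCont (\<lambda>s. h1 (sh s)) t" by (intro isCont_o2[OF shc]) (simp add: sht)
        have "isCont g z" using holomorphic_on_imp_continuous_on[OF g(4)] zb by (simp add: continuous_on_eq_continuous_at)
        then have gc: "isCont (\<lambda>s. g (sh s)) t" by (intro isCont_o2[OF shc]) (simp add: sht)
        have \<Phi>c: "isCont (\<lambda>s. \<Phi> (h s)) t"
        proof -
          have "continuous_on UNIV \<Phi>" by (rule continuous_on_vec3) (rule pfun_continuous[OF pf])
          then show ?thesis by (intro isCont_o2[OF hc]) (simp add: continuous_on_eq_continuous_at)
        qed
        have "isCont R t" unfolding R_def
          by (intro continuous_intros pc pfun_P hc h1c gc \<Phi>c) (use tr[OF hs[OF h(2)]] g(6)[OF zb] sht in auto)
        then have Rlim: "(R \<longlongrightarrow> R t) (at t)" by (simp add: isCont_def)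
        have "((\<lambda>s. norm (s - t) ^ (M + 1 - n z)) \<longlongrightarrow> norm (t - t) ^ (M + 1 - n z)) (at t)"
          by (intro tendsto_intros)
        moreover have "0 < M + 1 - n z" using nM[OF z] by simp
        ultimately have slim: "((\<lambda>s. norm (s - t) ^ (M + 1 - n z)) \<longlongrightarrow> 0) (at t)" by (simp add: power_0_left)
        have "((\<lambda>s. norm (q s) ^ (M + 1) * norm (s - t) ^ (M + 1 - n z) * R s) \<longlongrightarrow>
            norm (dt (l z) (dv h t)) ^ (M + 1) * 0 * R t) (at t)"
          by (intro tendsto_intros qlim slim Rlim)
        moreover have "\<forall>\<^sub>F s in at t. norm (q s) ^ (M + 1) * norm (s - t) ^ (M + 1 - n z) * R s = B s"
        proof -
          have op: "open S" "open (sh -` ball z r)"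
            using h(1) unfolding sh_def by (auto simp: lift_def intro!: open_vimage continuous_intros)
          have "t \<in> sh -` ball z r" using zb sht by simp
          then have "\<forall>\<^sub>F s in at t. s \<in> S" "\<forall>\<^sub>F s in at t. s \<in> sh -` ball z r"
            using eventually_at_in_open'[OF op(1) h(2)] eventually_at_in_open'[OF op(2)] by blast+
          moreover have "\<forall>\<^sub>F s in at t. s \<noteq> t" by (simp add: eventually_at_filter)
          ultimately show ?thesis
          proof eventually_elim
            case (elim s)
            have sz: "sh s \<in> ball z r" using elim by simp
            have h1n: "h1 (sh s) \<noteq> 0" "to_proj2 (h1 (sh s)) = \<phi> (sh s)" using g(1,3) sz by (auto simp: lift_def)
            have \<Phi>n: "\<Phi> (h s) \<noteq> 0" "to_proj2 (\<Phi> (h s)) = \<phi> (s + \<beta>)" using tr[OF hs[OF elim(1)]] by auto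
            have "\<phi> (sh s) = \<phi> (s + \<beta>)" using periodic_\<phi>[OF \<omega>(1), of "s + \<beta>"] by (simp add: sh_def add.assoc)
            then obtain c where c: "\<Phi> (h s) = c *s h1 (sh s)"
              using to_proj2_eq_iff[OF h1n(1) \<Phi>n(1)] h1n(2) \<Phi>n(2) by auto
            have c0: "c \<noteq> 0" using c \<Phi>n(1) by auto
            have Qs: "dt a (\<Phi> (h s)) = c * ((s - t) ^ n z * g (sh s))" unfolding c using g(5)[OF sz] by (simp add: shz)
            have Q0: "dt a (\<Phi> (h s)) \<noteq> 0" unfolding Qs using c0 g(6)[OF sz] elim by simp
            have Ps: "P Z0 (h s) = dt (l z) (h s) ^ (M + 1) * P (Z0 - {z}) (h s)"
              unfolding P_def by (rule prod.remove[OF fin z])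
            have lq: "dt (l z) (h s) = q s * (s - t)" using elim by (simp add: q_def)
            have split: "norm (s - t) ^ (M + 1) = norm (s - t) ^ (M + 1 - n z) * norm (s - t) ^ n z"
              using nM[OF z] by (simp flip: power_add)
            have "B s = norm (P Z0 (h s)) * norm (h s) ^ (D - j) / norm (dt a (\<Phi> (h s)))"
              unfolding Bh[OF h(1) elim(1)] f_def using Q0 by simp
            also have "\<dots> = norm (q s) ^ (M + 1) * (norm (s - t) ^ (M + 1 - n z) * norm (s - t) ^ n z) * norm (P (Z0 - {z}) (h s)) * norm (h s) ^ (D - j) /
                (norm c * (norm (s - t) ^ n z * norm (g (sh s))))"
              unfolding Ps lq Qs split[symmetric] by (simp add: norm_mult norm_power power_mult_distrib)
            also have "\<dots> = norm (q s) ^ (M + 1) * norm (s - t) ^ (M + 1 - n z) * R s"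
              unfolding R_def c norm_smult using elim c0 h1n(1) g(6)[OF sz] by (simp add: field_simps)
            finally show ?case by simp
          qed
        qed
        ultimately have "(B \<longlongrightarrow> 0) (at t)" by (simp add: Lim_transform_eventually)
        moreover have "B t = 0" unfolding Bh[OF h] f_def using True by simp
        ultimately show ?thesis by (simp add: isCont_def)
      qed
    qed
    then have "continuous_on UNIV B" by (simp add: continuous_at_imp_continuous_on)
    then have le0: "B t \<le> 0" for t
    proof (rule no_negative_section)
      show "B s = B t" if "\<phi> s = \<phi> t" for s t unfolding B_def by (rule val_invariant[OF f that])
      show "real (D - j) > 0" using D by simp
      fix t assume Bt: "B t > 0"
      obtain S h where h: "lift S h" "t \<in> S" by (rule lift_exists)
      have nz: "dt a (\<Phi> (h t)) \<noteq> 0" "P Z0 (h t) \<noteq> 0" using Bt unfolding Bh[OF h] f_def by (auto split: if_splits)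
      show "\<exists>S h k. lift S h \<and> t \<in> S \<and> k holomorphic_on S \<and> k t \<noteq> 0 \<and> (\<forall>s\<in>S. B s = norm (k s) * norm (h s) powr real (D - j))"
        using loc[OF h nz(1)]
      proof (elim exE conjE)
        fix S' h' k assume *: "lift S' h'" "t \<in> S'" "k holomorphic_on S'" "k t = P Z0 (h' t) / dt a (\<Phi> (h' t))"
          "\<forall>s\<in>S'. B s = norm (k s) * norm (h' s) powr real (D - j)"
        have "k t \<noteq> 0"
        proof
          assume "k t = 0"
          then have "B t = 0" using *(2,5) by simp
          then show False using Bt by simp
        qed
        then show ?thesis using * by blast
      qed
    qed
    have "countable ((\<lambda>s. s - \<beta>) ` Rl a \<union> (\<Union>z\<in>Z0. Rl (l z)))"
      using line_countable a l0 fin by (intro countable_Un countable_image countable_UN) (auto intro: countable_finite)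
    then obtain t where t: "t \<notin> (\<lambda>s. s - \<beta>) ` Rl a" "t \<notin> (\<Union>z\<in>Z0. Rl (l z))"
      using uncountable_UNIV_complex by (metis UNIV_eq_I UnCI)
    obtain S h where h: "lift S h" "t \<in> S" by (rule lift_exists)
    have h0: "h t \<noteq> 0" "to_proj2 (h t) = \<phi> t" using h by (auto simp: lift_def)
    have "t + \<beta> \<notin> Rl a" using t(1) by (metis add_diff_cancel_right' image_eqI)
    then have "dt a (\<Phi> (h t)) \<noteq> 0" using Rl_iff[of "\<Phi> (h t)" "t + \<beta>" a] tr[OF h0] by simp
    moreover have "P Z0 (h t) \<noteq> 0" using t(2) Rl_lift[OF h] fin by (auto simp: P_def)
    ultimately have "B t > 0" unfolding Bh[OF h] f_def using h0 by simp
    then show False using le0[of t] by simp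
  qed
qed

lemma \<omega>1: "\<omega>1 \<in> \<Omega>" "\<omega>1 \<noteq> 0"
proof -
  have "xc (of_real 1 * \<omega>1 + of_real 0 * \<omega>2) = 1" "yc (of_real 1 * \<omega>1 + of_real 0 * \<omega>2) = 0" by (rule coords_comb)+
  then have c: "xc \<omega>1 = 1" "yc \<omega>1 = 0" by simp_all
  then show "\<omega>1 \<in> \<Omega>" by (simp add: \<Omega>_iff)
  show "\<omega>1 \<noteq> 0" using nondeg by auto
qed

lemma \<Omega>_isolated: "\<not> t islimpt \<Omega>"
proof -
  obtain l where l: "l \<noteq> 0" "dt l (rep_proj2 (\<phi> 0)) = 0" using exists_orthogonal by blast
  have "\<Omega> \<subseteq> Rl l"
  proof
    fix x assume "x \<in> \<Omega>"
    then have "\<phi> x = \<phi> 0" using \<phi>_eq[of x 0] by simp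
    then show "x \<in> Rl l" using l(2) by (simp add: Rl_def)
  qed
  then show ?thesis using line_isolated[OF l(1)] islimpt_subset by blast
qed

text \<open>The multiplier of \<open>f\<close> on the curve: it has modulus at least one because it preserves the
  lattice, and modulus one would make an iterate of \<open>f\<close> a translation, though the degree grows.\<close>

lemma multiplier_expanding:
  assumes pfun: "\<And>i. pfun (\<lambda>v. f v $ i)" and scale: "\<And>c v. f (c *s v) = c ^ d *s f v" and d: "2 \<le> d"
    and semi: "\<And>v t. v \<noteq> 0 ==> to_proj2 v = \<phi> t ==> f v \<noteq> 0 \<and> to_proj2 (f v) = \<phi> (\<alpha> * t + \<beta>)"
    and mult: "\<And>\<omega>. \<omega> \<in> \<Omega> ==> \<alpha> * \<omega> \<in> \<Omega>"
    and surj: "\<And>p. p \<in> C ==> \<exists>v. v \<noteq> 0 \<and> to_proj2 v \<in> C \<and> to_proj2 (f v) = p"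
  shows "1 < norm \<alpha>"
proof -
  have pw: "\<alpha> ^ n * \<omega>1 \<in> \<Omega>" for n
    by (induction n) (use \<omega>1 mult in \<open>auto simp: mult.assoc\<close>)
  have \<alpha>0: "\<alpha> \<noteq> 0"
  proof
    assume "\<alpha> = 0"
    have "p = \<phi> \<beta>" if p: "p \<in> C" for p
    proof -
      obtain v where v: "v \<noteq> 0" "to_proj2 v \<in> C" "to_proj2 (f v) = p" using surj[OF p] by blast
      obtain t where "to_proj2 v = \<phi> t" using v(2) range_\<phi> by auto
      then show ?thesis using semi[OF v(1)] v(3) \<open>\<alpha> = 0\<close> by simp
    qed
    from this[OF \<phi>_C[of 0]] this[OF \<phi>_C[of "\<omega>1 / 2"]] have "\<phi> 0 = \<phi> (\<omega>1 / 2)" by simp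
    then have "- (\<omega>1 / 2) \<in> \<Omega>" using \<phi>_eq[of 0 "\<omega>1 / 2"] by simp
    moreover have "- (\<omega>1 / 2) = of_real (- (1/2)) * \<omega>1 + of_real 0 * \<omega>2" by simp
    ultimately have "- (1/2 :: real) \<in> \<int>" using \<Omega>_iff coords_comb by metis
    then have "(1/2 :: real) \<in> \<int>" using Ints_minus by fastforce
    then obtain n :: int where "1/2 = real_of_int n" by (auto elim!: Ints_cases)
    then have "real_of_int (2 * n) = 1" by simp
    then have "2 * n = 1" by (simp only: of_int_eq_1_iff)
    then show False by presburger
  qed
  have "\<not> norm \<alpha> < 1"
  proof
    assume lt: "norm \<alpha> < 1"
    have lim: "(\<lambda>n. \<alpha> ^ n * \<omega>1) \<longlonglongrightarrow> 0"
      using tendsto_mult_right[OF LIMSEQ_power_zero[OF lt], of \<omega>1] by simp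
    have "0 islimpt \<Omega>"
      unfolding islimpt_sequential using lim pw \<alpha>0 \<omega>1 by (intro exI[of _ "\<lambda>n. \<alpha> ^ n * \<omega>1"]) auto
    then show False using \<Omega>_isolated by blast
  qed
  moreover have "norm \<alpha> \<noteq> 1"
  proof
    assume one: "norm \<alpha> = 1"
    have "finite (cball 0 (norm \<omega>1) \<inter> \<Omega>)"
      by (rule finite_not_islimpt_in_compact[OF compact_cball]) (simp add: \<Omega>_isolated)
    moreover have "range (\<lambda>n. \<alpha> ^ n * \<omega>1) \<subseteq> cball 0 (norm \<omega>1) \<inter> \<Omega>"
      using pw one by (auto simp: norm_mult norm_power)
    ultimately have "finite (range (\<lambda>n. \<alpha> ^ n * \<omega>1))" by (rule rev_finite_subset)
    then have "\<not> inj (\<lambda>n. \<alpha> ^ n * \<omega>1)" using finite_imageD infinite_UNIV_nat by blast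
    then obtain i j where ij: "i < j" "\<alpha> ^ i * \<omega>1 = \<alpha> ^ j * \<omega>1" unfolding inj_def by (metis nat_neq_iff)
    define J where "J = j - i"
    have "\<alpha> ^ j = \<alpha> ^ i * \<alpha> ^ J" using ij(1) by (simp add: J_def flip: power_add)
    then have J: "\<alpha> ^ J = 1" "0 < J" using ij \<omega>1 \<alpha>0 by (auto simp: J_def)
    define E where "E n = (f ^^ n)" for n
    have pf: "pfun (\<lambda>v. E n v $ i)" for n i
    proof (induction n arbitrary: i)
      case (Suc n)
      then show ?case using pfun_compose[OF pfun[of i], of "E n"] by (simp add: E_def)
    qed (simp add: E_def pfun_coord)
    have sc: "E n (c *s v) = c ^ (d ^ n) *s E n v" for n c v
      by (induction n) (simp_all add: E_def scale power_mult[symmetric] mult.commute)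
    have tr: "E n v \<noteq> 0 \<and> to_proj2 (E n v) = \<phi> (((\<lambda>t. \<alpha> * t + \<beta>) ^^ n) t)" if "v \<noteq> 0" "to_proj2 v = \<phi> t" for n v t
    proof (induction n)
      case (Suc n)
      then show ?case using semi by (simp add: E_def)
    qed (use that in \<open>simp add: E_def\<close>)
    have it: "\<exists>c. \<forall>t. ((\<lambda>t. \<alpha> * t + \<beta>) ^^ n) t = \<alpha> ^ n * t + c" for n
    proof (induction n)
      case (Suc n)
      then obtain c where "\<And>t. ((\<lambda>t. \<alpha> * t + \<beta>) ^^ n) t = \<alpha> ^ n * t + c" by blast
      then show ?case by (intro exI[of _ "\<alpha> * c + \<beta>"]) (simp add: algebra_simps)
    qed (rule exI[of _ 0], simp)
    obtain K where K: "\<And>\<Phi> D \<beta>. (\<And>i. pfun (\<lambda>v. \<Phi> v $ i)) ==> (\<And>c v. \<Phi> (c *s v) = c ^ D *s \<Phi> v) ==>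
      (\<And>v t. v \<noteq> 0 ==> to_proj2 v = \<phi> t ==> \<Phi> v \<noteq> 0 \<and> to_proj2 (\<Phi> v) = \<phi> (t + \<beta>)) ==> D \<le> K"
      using translation_degree_bounded by blast
    have "d ^ (J * K) \<le> K"
    proof -
      obtain c where c: "\<And>t. ((\<lambda>t. \<alpha> * t + \<beta>) ^^ (J * K)) t = \<alpha> ^ (J * K) * t + c" using it by blast
      have "\<alpha> ^ (J * K) = 1" using J by (simp add: power_mult)
      then show ?thesis using tr[of _ _ "J * K"] c by (intro K[of "E (J * K)" _ c] pf sc) simp
    qed
    moreover have "K < 2 ^ K" by (rule less_exp)
    moreover have "(2::nat) ^ K \<le> d ^ (J * K)"
    proof -
      have "(2::nat) ^ K \<le> d ^ K" using d by (intro power_mono) auto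
      also have "\<dots> \<le> d ^ (J * K)" using d J(2) by (intro power_increasing) auto
      finally show ?thesis .
    qed
    ultimately show False by linarith
  qed
  ultimately show ?thesis by linarith
qed

end

section \<open>The center does not lie on the curve\<close>

lemma span_of_normal:
  fixes e v u :: "'k::field^3"
  assumes "cr e v \<noteq> 0" "e \<noteq> 0" "dt (cr e v) u = 0"
  obtains c c' where "u = c *s v + c' *s e" "cr e u = c *s cr e v"
proof -
  obtain c where c: "cr e u = c *s cr e v"
    using cr_parallel_normal[of "cr e v" e u] assms by auto
  have "cr e (u - c *s v) = 0" by (simp add: cr_diff cr_smult c)
  then obtain c' where "u - c *s v = c' *s e" using cr_eq_0D assms(2) by metis
  then have "u = c *s v + c' *s e" by (metis add.commute diff_add_cancel)
  then show thesis using c by (rule that)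
qed

lemma uncountable_UNIV_euclidean: "uncountable (UNIV :: 'a::euclidean_space set)"
  using uncountable_ball[of 1 "0::'a"] countable_subset[OF subset_UNIV] by auto

text \<open>If the center were on the curve, it would be a fixed point at which the derivative \<open>Dc\<close>, taken
  modulo the direction \<open>e\<close>, determines the action of \<open>f\<close> on the lines through the center: this action
  is projective-linear. If \<open>Dc\<close> has rank one, the curve is mapped into a line. Otherwise \<open>f\<close> is injective
  on the lines, so that parameters with the same image under an iterate of \<open>f\<close> lie on the same line
  through the center; but such parameters accumulate.\<close>

lemma center_not_on_curve:
  fixes F :: "'k::{real_normed_field,euclidean_space} polymap" and \<psi> :: "'k => 'k proj2"
  assumes F: "rational_map d F" and el: "elementary F (to_proj2 e)" and e: "e \<noteq> 0"
    and isol: "\<And>n t. n \<noteq> 0 ==> \<not> t islimpt {s. dt n (rep_proj2 (\<psi> s)) = 0}"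
    and semi: "\<And>t. ratmap F (\<psi> t) = \<psi> (a * t + b)" and a: "1 < norm a"
    and nz: "\<And>t. evalmap F (rep_proj2 (\<psi> t)) \<noteq> 0" and Fe: "evalmap F e \<noteq> 0"
    and etale: "cr e (evalmap F e) = 0 ==> \<exists>w. cr e (jac (evalmap F) e w) \<noteq> 0"
    and per: "\<omega>0 \<noteq> 0" "\<And>t. \<psi> (t + \<omega>0) = \<psi> t"
  shows False
proof -
  define r where "r t = rep_proj2 (\<psi> t)" for t
  define Ln where "Ln n = {s. dt n (r s) = 0}" for n
  define T where "T t = a * t + b" for t
  have a0: "a \<noteq> 0" using a by auto
  have r0: "r t \<noteq> 0" for t by (simp add: r_def rep_proj2_nonzero)
  have isol': "\<not> t islimpt Ln n" if "n \<noteq> 0" for n t using isol[OF that] by (simp add: Ln_def r_def)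
  have cnt: "countable (Ln n)" if "n \<noteq> 0" for n by (rule discrete_countable) (rule isol'[OF that])
  have step: "\<exists>c. c \<noteq> 0 \<and> r (T t) = c *s evalmap F (r t)" for t
  proof -
    have "to_proj2 (evalmap F (r t)) = to_proj2 (r (T t))"
      using ratmap_to_proj2[OF F r0[of t]] nz[of t] semi[of t] by (simp add: r_def T_def)
    then have "\<exists>c. r (T t) = c *s evalmap F (r t)"
      by (subst (asm) to_proj2_eq_iff) (use nz[of t] r0 in \<open>auto simp: r_def\<close>)
    then obtain c where "r (T t) = c *s evalmap F (r t)" by blast
    then show ?thesis using r0[of "T t"] by auto
  qed
  have Timg: "\<exists>s. T s = t" for t using a0 by (intro exI[of _ "(t - b) / a"]) (simp add: T_def)
  have Tcount: "countable {t. T t \<in> A}" if "countable A" for A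
  proof -
    have "{t. T t \<in> A} \<subseteq> (\<lambda>s. (s - b) / a) ` A"
    proof
      fix t assume "t \<in> {t. T t \<in> A}"
      then show "t \<in> (\<lambda>s. (s - b) / a) ` A" using a0 by (intro image_eqI[of _ _ "T t"]) (simp_all add: T_def)
    qed
    then show ?thesis by (rule countable_subset) (rule countable_image[OF that])
  qed
  have not_all: "\<not> (\<forall>t. T t \<in> Ln n \<or> t \<in> Ln n')" if "n \<noteq> 0" "n' \<noteq> 0" for n n'
  proof
    assume "\<forall>t. T t \<in> Ln n \<or> t \<in> Ln n'"
    then have "UNIV = {t. T t \<in> Ln n} \<union> Ln n'" by blast
    then have "countable (UNIV :: 'k set)" using Tcount[OF cnt[OF that(1)]] cnt[OF that(2)] by (metis countable_Un)
    then show False using uncountable_UNIV_euclidean by blast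
  qed
  have line_step: "T t \<in> Ln n" if "dt n (evalmap F (r t)) = 0" for n t
  proof -
    obtain c where "r (T t) = c *s evalmap F (r t)" using step by blast
    then show ?thesis using that by (simp add: Ln_def)
  qed
  have fixed: "cr e (evalmap F e) = 0"
  proof (rule ccontr)
    assume ne: "cr e (evalmap F e) \<noteq> 0"
    have "dt (cr e (evalmap F e)) (evalmap F v) = 0" for v
    proof (cases "cr e v = 0")
      case True
      then obtain c where "v = c *s e" using cr_eq_0D e by metis
      then show ?thesis by (simp add: evalmap_scale[OF F])
    next
      case False
      obtain n where n: "n \<noteq> 0" "dt n e = 0" "\<And>x. dt (cr e v) x = 0 ==> dt n (evalmap F x) = 0"
        using elementary_normal[OF F el e False] dt_cr by metis
      obtain c where "cr e (evalmap F e) = c *s n"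
        using cr_parallel_normal[OF n(2) n(3)[of e] n(1)] dt_cr(1) by metis
      then show ?thesis using n(3)[of v] by simp
    qed
    then have "\<forall>t. T t \<in> Ln (cr e (evalmap F e)) \<or> t \<in> Ln (cr e (evalmap F e))" using line_step by blast
    then show False using not_all ne by blast
  qed
  define Dc where "Dc w = cr e (jac (evalmap F) e w)" for w
  have Dc_add: "Dc (v + w) = Dc v + Dc w" and Dc_smult: "Dc (c *s w) = c *s Dc w" and Dc_diff: "Dc (v - w) = Dc v - Dc w" for v w c
    by (simp_all add: Dc_def jac_add jac_diff jac_smult cr_add cr_diff cr_smult)
  have Dc_e: "Dc e = 0"
    unfolding Dc_def jac_euler[where d = d, OF pfun_evalmap evalmap_scale[OF F]] using fixed by (simp add: cr_smult)
  have key: "\<exists>k. cr e (evalmap F v) = k *s Dc v" if v: "Dc v \<noteq> 0" for v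
  proof -
    have "cr e v \<noteq> 0"
    proof
      assume "cr e v = 0"
      then obtain c where "v = c *s e" using cr_eq_0D e by metis
      then show False using v Dc_e by (simp add: Dc_smult)
    qed
    then obtain n where n: "n \<noteq> 0" "dt n e = 0" "\<And>x. dt (cr e v) x = 0 ==> dt n (evalmap F x) = 0"
      using elementary_normal[OF F el e] dt_cr by metis
    have pf: "pfun (\<lambda>x. dt n (evalmap F x))"
      unfolding dt_def by (intro pfun_sum pfun_mult pfun_const pfun_evalmap)
    have "dt n (evalmap F (e + s *s v)) = 0" for s by (rule n(3)) (simp add: dt_add)
    then have "((\<lambda>s. 0) has_field_derivative dt (grad (\<lambda>x. dt n (evalmap F x)) (e + 0 *s v)) v) (at 0)"
      using pfun_along_line[OF pf, of e v 0] by simp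
    then have "dt (grad (\<lambda>x. dt n (evalmap F x)) e) v = 0" using DERIV_unique[OF DERIV_const] by fastforce
    moreover have "grad (dt n) u = n" for u
    proof (rule dt_ext)
      fix w
      have "((\<lambda>s. dt n (u + s *s w)) has_field_derivative dt (grad (dt n) (u + 0 *s w)) w) (at 0)"
        by (rule pfun_along_line[OF pfun_dt])
      moreover have "((\<lambda>s. dt n (u + s *s w)) has_field_derivative dt n w) (at 0)"
        unfolding dt_add dt_smult by (auto intro!: derivative_eq_intros)
      ultimately show "dt (grad (dt n) u) w = dt n w" using DERIV_unique by fastforce
    qed
    ultimately have "dt n (jac (evalmap F) e v) = 0" using grad_compose[OF pfun_dt pfun_evalmap, of n F e v] by simp
    then obtain c where c: "Dc v = c *s n" unfolding Dc_def using cr_parallel_normal[OF n(2) _ n(1)] by blast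
    obtain c' where c': "cr e (evalmap F v) = c' *s n" using cr_parallel_normal[OF n(2) n(3) n(1)] dt_cr(2) by metis
    have "c \<noteq> 0" using c v by auto
    then have "cr e (evalmap F v) = (c'/c) *s Dc v" by (simp add: c c' vector_smult_assoc)
    then show ?thesis by blast
  qed
  obtain w where w: "Dc w \<noteq> 0" using etale[OF fixed] unfolding Dc_def by blast
  show False
  proof (cases "\<exists>v0. cr e v0 \<noteq> 0 \<and> Dc v0 = 0")
    case True
    then obtain v0 where v0: "cr e v0 \<noteq> 0" "Dc v0 = 0" by blast
    have ker: "Dc u = 0" if u: "dt (cr e v0) u = 0" for u
    proof -
      obtain c c' where "u = c *s v0 + c' *s e" by (rule span_of_normal[OF v0(1) e u])
      then show ?thesis using v0(2) Dc_e by (simp add: Dc_add Dc_smult)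
    qed
    define q where "q v = dt (cr e v0) v / dt (cr e v0) w" for v
    have qw: "dt (cr e v0) w \<noteq> 0" using ker[of w] w by blast
    have Dq: "Dc v = q v *s Dc w" for v
    proof -
      have "Dc (v - q v *s w) = 0" using qw by (intro ker) (simp add: dt_diff q_def)
      then show ?thesis by (simp add: Dc_diff Dc_smult)
    qed
    have "T t \<in> Ln (Dc w) \<or> t \<in> Ln (cr e v0)" for t
    proof (cases "q (r t) = 0")
      case True
      then show ?thesis using qw by (simp add: q_def Ln_def)
    next
      case False
      then have "Dc (r t) \<noteq> 0" using w Dq[of "r t"] by (simp add: smult_eq_0)
      then obtain k where "cr e (evalmap F (r t)) = k *s Dc (r t)" using key by blast
      then have k: "cr e (evalmap F (r t)) = (k * q (r t)) *s Dc w" using Dq[of "r t"] by (simp add: vector_smult_assoc)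
      have "dt (Dc w) (evalmap F (r t)) = 0"
      proof (cases "k * q (r t) = 0")
        case True
        then have "cr e (evalmap F (r t)) = 0" unfolding k by simp
        then obtain c where "evalmap F (r t) = c *s e" using cr_eq_0D e by metis
        then show ?thesis by (simp add: Dc_def)
      next
        case False
        have "dt (cr e (evalmap F (r t))) (evalmap F (r t)) = 0" by simp
        then show ?thesis using False unfolding k by simp
      qed
      then show ?thesis using line_step by blast
    qed
    then show False using not_all[OF w v0(1)] by blast
  next
    case False
    then have inj: "\<And>v. Dc v = 0 ==> cr e v = 0" by blast
    define ok where "ok t \<longleftrightarrow> cr e (r t) \<noteq> 0" for t
    have descend: "dt (cr e (r s)) (r t) = 0"
      if ok: "ok s" "ok t" "ok (T s)" "ok (T t)" and col: "dt (cr e (r (T s))) (r (T t)) = 0" for s t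
    proof -
      obtain c1 where c1: "c1 \<noteq> 0" "r (T s) = c1 *s evalmap F (r s)" using step by blast
      obtain c2 where c2: "c2 \<noteq> 0" "r (T t) = c2 *s evalmap F (r t)" using step by blast
      obtain k1 where k1: "cr e (evalmap F (r s)) = k1 *s Dc (r s)" using key inj ok(1) unfolding ok_def by blast
      obtain k2 where k2: "cr e (evalmap F (r t)) = k2 *s Dc (r t)" using key inj ok(2) unfolding ok_def by blast
      have nz1: "cr e (evalmap F (r s)) \<noteq> 0" "cr e (evalmap F (r t)) \<noteq> 0"
        using ok(3,4) c1 c2 by (auto simp: ok_def cr_smult)
      have "dt (cr e (evalmap F (r s))) (evalmap F (r t)) = 0"
        using col c1 c2 by (simp add: cr_smult)
      then obtain c where cc: "cr e (evalmap F (r t)) = c *s cr e (evalmap F (r s))"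
        by (rule span_of_normal[OF nz1(1) e])
      have "k2 *s Dc (r t) = (c * k1) *s Dc (r s)" using cc unfolding k1 k2 by (simp add: vector_smult_assoc)
      then have "Dc (k2 *s r t - (c * k1) *s r s) = 0" by (simp add: Dc_diff Dc_smult)
      then have "cr e (k2 *s r t - (c * k1) *s r s) = 0" by (rule inj)
      then have eq: "k2 *s cr e (r t) = (c * k1) *s cr e (r s)" by (simp add: cr_diff cr_smult)
      have k20: "k2 \<noteq> 0" using k2 nz1(2) by auto
      have "c * k1 \<noteq> 0"
      proof
        assume "c * k1 = 0"
        then have "k2 *s cr e (r t) = 0" unfolding eq by simp
        then show False using k20 ok(2) by (simp add: smult_eq_0 ok_def)
      qed
      moreover have "(c * k1) * dt (cr e (r s)) (r t) = k2 * dt (cr e (r t)) (r t)"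
        using eq by (metis dt_smult_left)
      ultimately show ?thesis by simp
    qed
    have iter: "dt (cr e (r s)) (r t) = 0"
      if "\<And>k. ok ((T ^^ k) s)" "\<And>k. ok ((T ^^ k) t)" "\<psi> ((T ^^ n) s) = \<psi> ((T ^^ n) t)" for n s t
      using that
    proof (induction n arbitrary: s t)
      case 0
      then show ?case by (simp add: r_def)
    next
      case (Suc n)
      have "dt (cr e (r (T s))) (r (T t)) = 0"
      proof (rule Suc.IH)
        show "ok ((T ^^ k) (T s))" "ok ((T ^^ k) (T t))" for k
          using Suc.prems(1)[of "Suc k"] Suc.prems(2)[of "Suc k"] by (simp_all add: funpow_swap1)
        show "\<psi> ((T ^^ n) (T s)) = \<psi> ((T ^^ n) (T t))" using Suc.prems(3) by (simp add: funpow_swap1)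
      qed
      then show ?case using descend[of s t] Suc.prems(1)[of 0] Suc.prems(1)[of 1] Suc.prems(2)[of 0] Suc.prems(2)[of 1] by simp
    qed
    have "countable {t. \<not> ok t}"
    proof -
      obtain n where n: "n \<noteq> 0" "dt n e = 0" using exists_orthogonal by blast
      have "{t. \<not> ok t} \<subseteq> Ln n"
      proof
        fix t assume "t \<in> {t. \<not> ok t}"
        then obtain c where "r t = c *s e" using cr_eq_0D e by (auto simp: ok_def)
        then show "t \<in> Ln n" using n(2) by (simp add: Ln_def)
      qed
      then show ?thesis by (rule countable_subset) (rule cnt[OF n(1)])
    qed
    then have cb: "countable {t. \<not> ok ((T ^^ k) t)}" for k
    proof (induction k)
      case 0
      then show ?case by simp
    next
      case (Suc k)
      have eq: "{t. \<not> ok ((T ^^ Suc k) t)} = {t. T t \<in> {t. \<not> ok ((T ^^ k) t)}}"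
        by (simp only: funpow_Suc_right o_apply mem_Collect_eq)
      show ?case unfolding eq by (rule Tcount[OF Suc.IH[OF Suc.prems]])
    qed
    define s where "s n t = t + \<omega>0 / a ^ n" for n t
    have sb: "countable {t. \<not> ok ((T ^^ k) (s n t))}" for k n
    proof -
      have "{t. \<not> ok ((T ^^ k) (s n t))} \<subseteq> (\<lambda>u. u - \<omega>0 / a ^ n) ` {t. \<not> ok ((T ^^ k) t)}"
      proof
        fix t assume "t \<in> {t. \<not> ok ((T ^^ k) (s n t))}"
        then show "t \<in> (\<lambda>u. u - \<omega>0 / a ^ n) ` {t. \<not> ok ((T ^^ k) t)}"
          by (intro image_eqI[of _ _ "s n t"]) (simp_all add: s_def)
      qed
      then show ?thesis by (rule countable_subset) (rule countable_image[OF cb])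
    qed
    define B where "B = (\<Union>k. {t. \<not> ok ((T ^^ k) t)}) \<union> (\<Union>k. \<Union>n. {t. \<not> ok ((T ^^ k) (s n t))})"
    have "countable B" unfolding B_def using cb sb by (intro countable_Un countable_UN) auto
    then have "B \<noteq> UNIV" using uncountable_UNIV_euclidean by auto
    then obtain t where "t \<notin> B" by auto
    then have t: "\<And>k. ok ((T ^^ k) t)" "\<And>k n. ok ((T ^^ k) (s n t))" by (auto simp: B_def)
    have Ts: "(T ^^ n) (t + x) = (T ^^ n) t + a ^ n * x" for n t x
      by (induction n) (simp_all add: T_def algebra_simps)
    have "dt (cr e (r t)) (r (s n t)) = 0" for n
    proof (rule iter[of t "s n t" n])
      have "(T ^^ n) (s n t) = (T ^^ n) t + \<omega>0" unfolding s_def Ts using a0 by simp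
      then show "\<psi> ((T ^^ n) t) = \<psi> ((T ^^ n) (s n t))" using per(2) by simp
    qed (use t in auto)
    then have mem: "s n t \<in> Ln (cr e (r t))" for n by (simp add: Ln_def)
    have ni: "norm (inverse a) < 1" unfolding norm_inverse using a by (rule inverse_less_1_iff[THEN iffD2, OF disjI2])
    have "(\<lambda>n. t + \<omega>0 * inverse a ^ n) \<longlonglongrightarrow> t + \<omega>0 * 0" by (intro tendsto_intros ni)
    then have lim: "(\<lambda>n. s n t) \<longlonglongrightarrow> t" by (simp add: s_def divide_inverse power_inverse)
    have "t islimpt Ln (cr e (r t))"
      unfolding islimpt_sequential using mem lim per(1) a0
      by (intro exI[of _ "\<lambda>n. s n t"]) (simp add: s_def)
    then show False using isol' t(1)[of 0] by (simp add: ok_def)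
  qed
qed

section \<open>Attracting curves and attracting lines\<close>

lemma smooth_grad:
  assumes "smooth_curve G" "v \<noteq> 0" "eval3 G v = 0"
  shows "grad (eval3 G) v \<noteq> 0"
proof
  assume "grad (eval3 G) v = 0"
  then have "frechet_derivative (eval3 G) (at v) = (\<lambda>w. 0)" by (simp add: pfun_frechet[OF pfun_eval3])
  then show False using assms unfolding smooth_curve_def by blast
qed

lemma slope_chart_transfer:
  assumes "slope_chart e \<psi> t" "\<And>t v w. v \<noteq> 0 ==> to_proj2 v = \<psi> t ==> w \<noteq> 0 ==> to_proj2 w = \<gamma> t ==> \<exists>c. cr e w = c *s cr e v"
  shows "slope_chart e \<gamma> t"
proof -
  have imp: "(\<forall>v. v \<noteq> 0 \<and> to_proj2 v = \<psi> t --> (\<exists>c. cr e v = c *s cr e (h t))) ==>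
      (\<forall>v. v \<noteq> 0 \<and> to_proj2 v = \<gamma> t --> (\<exists>c. cr e v = c *s cr e (h t)))" for h :: "'a => 'a^3" and t
  proof (intro allI impI)
    fix w assume h: "\<forall>v. v \<noteq> 0 \<and> to_proj2 v = \<psi> t --> (\<exists>c. cr e v = c *s cr e (h t))" and w: "w \<noteq> 0 \<and> to_proj2 w = \<gamma> t"
    obtain v where v: "\<psi> t = to_proj2 v" "v \<noteq> 0" by (rule to_proj2_cases)
    obtain c where c: "cr e v = c *s cr e (h t)" using h v by metis
    obtain c' where "cr e w = c' *s cr e v" using assms(2)[of v t w] v w by auto
    then show "\<exists>c. cr e w = c *s cr e (h t)" by (auto simp: c vector_smult_assoc)
  qed
  show ?thesis using assms(1) unfolding slope_chart_def
  proof (elim exE conjE, intro exI conjI ballI)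
    fix S :: "'a set" and h :: "'a => 'a^3" and t
    assume "\<forall>t\<in>S. \<forall>v. v \<noteq> 0 \<and> to_proj2 v = \<psi> t --> (\<exists>c. cr e v = c *s cr e (h t))" "t \<in> S"
    then show "\<forall>v. v \<noteq> 0 \<and> to_proj2 v = \<gamma> t --> (\<exists>c. cr e v = c *s cr e (h t))" by (intro imp) blast
  qed auto
qed

lemma invariant_curve_points:
  assumes F: "rational_map d F" and hom: "homogeneous m G" and inv: "invariant_curve F (zero_set G)"
    and v: "v \<noteq> 0" "eval3 G v = 0"
  shows "evalmap F v \<noteq> 0 \<and> eval3 G (evalmap F v) = 0"
proof -
  have p: "to_proj2 v \<in> zero_set G" using zero_set_iff[OF hom v(1)] v(2) by simp
  then have nz: "evalmap F v \<noteq> 0" using inv indeterminacy_iff[OF F v(1)] by (auto simp: invariant_curve_def)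
  have "ratmap F (to_proj2 v) \<in> zero_set G" using inv p by (auto simp: invariant_curve_def)
  then have "to_proj2 (evalmap F v) \<in> zero_set G" using ratmap_to_proj2[OF F v(1) nz] by simp
  then show ?thesis using zero_set_iff[OF hom nz] nz by simp
qed

text \<open>What the real and the complex case have in common: a parametrized curve that avoids the center,
  on which \<open>f\<close> is an expanding affine map of the parameter.\<close>

locale elementary_parametrization = torus_affine Q \<Omega> a b
  for Q \<Omega> :: "'k::{real_normed_field,euclidean_space} set" and a b +
  fixes F :: "'k polymap" and d :: nat and e :: "'k ^ 3" and \<psi> :: "'k => 'k proj2"
  assumes F: "rational_map d F" and elem: "elementary F (to_proj2 e)" and e: "e \<noteq> 0"
    and \<psi>: "continuous_on UNIV \<psi>" and \<psi>_per: "periodic \<psi>"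
    and semi: "\<And>t. ratmap F (\<psi> t) = \<psi> (T t)"
    and nz: "\<And>v t. v \<noteq> 0 ==> to_proj2 v = \<psi> t ==> evalmap F v \<noteq> 0 \<and> cr e v \<noteq> 0"
    and charts: "countable {t. \<not> slope_chart e \<psi> t}"
begin

theorem attracting_curve:
  assumes hom: "homogeneous m G" and m: "0 < m" and Ge: "eval3 G e \<noteq> 0"
    and smooth: "\<And>v. v \<noteq> 0 ==> eval3 G v = 0 ==> grad (eval3 G) v \<noteq> 0"
    and invar: "\<And>v. v \<noteq> 0 ==> eval3 G v = 0 ==> evalmap F v \<noteq> 0 \<and> eval3 G (evalmap F v) = 0"
    and X: "X = range \<psi>" "X \<subseteq> zero_set G" and N: "transverse_norm G X N"
    and lyap: "transverse_lyapunov F N X (distr (uniform_measure lborel Q) borel \<psi>) < 0"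
  shows "basin_positive F X"
proof -
  interpret elementary_curve_norm Q \<Omega> a b F d m e G X \<psi> N
    by unfold_locales (fact F elem e hom m Ge smooth invar \<psi> X \<psi>_per semi charts N)+
  show ?thesis by (rule attracting[OF lyap])
qed

theorem attracting_line:
  assumes lf: "linear_form H" and He: "to_proj2 e \<notin> zero_set H" and inv: "invariant_curve F (zero_set H)"
    and meets: "\<And>x. cr e x \<noteq> 0 ==> \<exists>t v. v \<noteq> 0 \<and> to_proj2 v = \<psi> t \<and> dt (cr e x) v = 0"
    and N: "transverse_norm H (zero_set H) N"
    and lyap: "transverse_lyapunov F N (zero_set H)
      (line_measure (to_proj2 e) (zero_set H) (distr (uniform_measure lborel Q) borel \<psi>)) < 0"
  shows "basin_positive F (zero_set H)"
proof -
  obtain n where n: "n \<noteq> 0" "eval3 H = dt n" using linear_form_dt[OF lf] by blast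
  have ne: "dt n e \<noteq> 0" using linear_form_zero_set[OF lf n(2) e] He by simp
  have homH: "homogeneous 1 H" using lf by (simp add: linear_form_def)
  have inL: "to_proj2 v \<in> zero_set H \<longleftrightarrow> dt n v = 0" if "v \<noteq> 0" for v by (rule linear_form_zero_set[OF lf n(2) that])
  define \<pi> where "\<pi> v = v - (dt n v / dt n e) *s e" for v
  have \<pi>n: "dt n (\<pi> v) = 0" and \<pi>c: "cr e (\<pi> v) = cr e v" for v using ne by (simp_all add: \<pi>_def dt_diff cr_diff cr_smult)
  have \<pi>0: "\<pi> v \<noteq> 0" if "cr e v \<noteq> 0" for v using \<pi>c[of v] that by auto
  have \<pi>uniq: "\<exists>c. x = c *s \<pi> v" if v: "cr e v \<noteq> 0" and x: "dt n x = 0" "dt (cr e v) x = 0" for v x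
  proof -
    obtain c c' where x': "x = c *s v + c' *s e" by (rule span_of_normal[OF v e x(2)])
    then have "c * dt n v + c' * dt n e = 0" using x(1) by (simp add: dt_add)
    then have c': "c' = - (c * dt n v / dt n e)" using ne by (simp add: field_simps) (metis add.commute add_eq_0_iff)
    have "x = c *s \<pi> v" unfolding x' c' \<pi>_def by (simp add: vec_eq_iff algebra_simps)
    then show ?thesis ..
  qed
  have pf: "proj_from (to_proj2 e) (zero_set H) (to_proj2 v) = to_proj2 (\<pi> v)" if v: "cr e v \<noteq> 0" for v
    unfolding proj_from_def
  proof (rule the_equality)
    have v0: "v \<noteq> 0" using v by auto
    obtain H' where H': "linear_form H'" "eval3 H' = dt (cr e v)" by (rule dt_linear_form[OF v])
    have on: "to_proj2 x \<in> zero_set H' \<longleftrightarrow> dt (cr e v) x = 0" if "x \<noteq> 0" for x by (rule linear_form_zero_set[OF H' that])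
    have "dt (cr e v) (\<pi> v) = 0" using dt_cr(2)[of e "\<pi> v"] by (simp add: \<pi>c)
    then show "to_proj2 (\<pi> v) \<in> zero_set H \<and> (\<exists>M. line M \<and> to_proj2 e \<in> M \<and> to_proj2 v \<in> M \<and> to_proj2 (\<pi> v) \<in> M)"
      using H' on[OF e] on[OF v0] on[OF \<pi>0[OF v]] inL[OF \<pi>0[OF v]] \<pi>n by (auto simp: line_def)
    fix p assume p: "p \<in> zero_set H \<and> (\<exists>M. line M \<and> to_proj2 e \<in> M \<and> to_proj2 v \<in> M \<and> p \<in> M)"
    obtain x where x: "p = to_proj2 x" "x \<noteq> 0" by (rule to_proj2_cases)
    obtain H2 where H2: "linear_form H2" "to_proj2 e \<in> zero_set H2" "to_proj2 v \<in> zero_set H2" "p \<in> zero_set H2"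
      using p by (auto simp: line_def)
    obtain n2 where n2: "n2 \<noteq> 0" "eval3 H2 = dt n2" using linear_form_dt[OF H2(1)] by blast
    have z: "dt n2 e = 0" "dt n2 v = 0" "dt n2 x = 0"
      using H2 linear_form_zero_set[OF H2(1) n2(2)] e v0 x by auto
    obtain c where "cr e v = c *s n2" using cr_parallel_normal[OF z(1,2) n2(1)] by blast
    then have "dt (cr e v) x = 0" using z(3) by simp
    moreover have "dt n x = 0" using p x inL by simp
    ultimately obtain c where c: "x = c *s \<pi> v" using \<pi>uniq[OF v] by blast
    then have "c \<noteq> 0" using x(2) by auto
    then show "p = to_proj2 (\<pi> v)" unfolding x(1) c by (rule to_proj2_smult[OF _ \<pi>0[OF v]])
  qed
  define \<gamma> where "\<gamma> t = proj_from (to_proj2 e) (zero_set H) (\<psi> t)" for t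
  have \<gamma>v: "\<gamma> t = to_proj2 (\<pi> v)" if "v \<noteq> 0" "to_proj2 v = \<psi> t" for t v
    using pf[of v] nz[OF that] that(2) by (simp add: \<gamma>_def)
  let ?pr = "proj_from (to_proj2 e) (zero_set H)"
  have prc: "continuous_on (- {to_proj2 e}) ?pr"
  proof -
    have cr0: "cr e v \<noteq> 0 \<longleftrightarrow> to_proj2 v \<noteq> to_proj2 e" if "v \<noteq> 0" for v
      using that e cr_eq_0D[of e v] to_proj2_eq_iff[OF e that] by (metis cr_self cr_smult smult_zero(2))
    have "open (?pr -` U \<inter> - {to_proj2 e})" if U: "open U" for U
    proof -
      have "{v. v \<noteq> 0 \<and> to_proj2 v \<in> ?pr -` U \<inter> - {to_proj2 e}} = {v. cr e v \<noteq> 0} \<inter> \<pi> -` {v. v \<noteq> 0 \<and> to_proj2 v \<in> U}"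
      proof (intro set_eqI iffI)
        fix v assume "v \<in> {v. v \<noteq> 0 \<and> to_proj2 v \<in> ?pr -` U \<inter> - {to_proj2 e}}"
        then show "v \<in> {v. cr e v \<noteq> 0} \<inter> \<pi> -` {v. v \<noteq> 0 \<and> to_proj2 v \<in> U}"
          using pf[of v] cr0[of v] \<pi>0[of v] by simp
      next
        fix v assume v: "v \<in> {v. cr e v \<noteq> 0} \<inter> \<pi> -` {v. v \<noteq> 0 \<and> to_proj2 v \<in> U}"
        then have "v \<noteq> 0" by auto
        then show "v \<in> {v. v \<noteq> 0 \<and> to_proj2 v \<in> ?pr -` U \<inter> - {to_proj2 e}}"
          using pf[of v] cr0[of v] v by simp
      qed
      moreover have "continuous_on UNIV \<pi>" unfolding \<pi>_def using ne by (intro continuous_intros) auto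
      moreover have "open {v. v \<noteq> 0 \<and> to_proj2 v \<in> U}" using U by (simp add: open_proj2_iff)
      moreover have "open {v. cr e v \<noteq> 0}" by (intro open_Collect_neq continuous_intros)
      ultimately have "open {v. v \<noteq> 0 \<and> to_proj2 v \<in> ?pr -` U \<inter> - {to_proj2 e}}"
        by (simp only: open_Int open_vimage)
      then show ?thesis by (simp add: open_proj2_iff)
    qed
    then show ?thesis unfolding continuous_on_open_invariant by blast
  qed
  have prm: "?pr \<in> borel \<rightarrow>\<^sub>M borel"
  proof (rule borel_measurableI)
    fix U :: "'k proj2 set" assume "open U"
    then obtain A where A: "open A" "A \<inter> - {to_proj2 e} = ?pr -` U \<inter> - {to_proj2 e}"
      using prc unfolding continuous_on_open_invariant by blast
    then have "?pr -` U \<inter> space borel = (A - {to_proj2 e}) \<union> (if ?pr (to_proj2 e) \<in> U then {to_proj2 e} else {})"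
      by auto
    then show "?pr -` U \<inter> space borel \<in> sets borel" using A(1) by auto
  qed
  have \<psi>e: "to_proj2 e \<noteq> \<psi> t" for t using nz[OF e, of t] by auto
  have \<gamma>c: "continuous_on UNIV \<gamma>"
    unfolding \<gamma>_def by (rule continuous_on_compose2[OF prc \<psi>]) (auto simp: \<psi>e)
  have range: "zero_set H = range \<gamma>"
  proof
    show "range \<gamma> \<subseteq> zero_set H"
    proof clarify
      fix t
      obtain v where v: "\<psi> t = to_proj2 v" "v \<noteq> 0" by (rule to_proj2_cases)
      then show "\<gamma> t \<in> zero_set H" using \<gamma>v[of v t] inL[OF \<pi>0] \<pi>n nz[of v t] by simp
    qed
    show "zero_set H \<subseteq> range \<gamma>"
    proof
      fix p assume p: "p \<in> zero_set H"
      obtain x where x: "p = to_proj2 x" "x \<noteq> 0" by (rule to_proj2_cases)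
      have nx: "dt n x = 0" using p x inL by simp
      have "cr e x \<noteq> 0"
      proof
        assume "cr e x = 0"
        then obtain c where "x = c *s e" using cr_eq_0D e by metis
        then show False using nx ne x(2) by auto
      qed
      then obtain t v where v: "v \<noteq> 0" "to_proj2 v = \<psi> t" "dt (cr e x) v = 0" using meets by blast
      have "cr e v \<noteq> 0" using nz v by blast
      obtain c where c: "cr e v = c *s cr e x" by (rule span_of_normal[OF \<open>cr e x \<noteq> 0\<close> e v(3)])
      then have "dt (cr e v) x = 0" by simp
      then obtain c' where c': "x = c' *s \<pi> v" using \<pi>uniq[OF \<open>cr e v \<noteq> 0\<close> nx] by blast
      then have "c' \<noteq> 0" using x(2) by auto
      then have "p = to_proj2 (\<pi> v)" unfolding x(1) c' by (rule to_proj2_smult[OF _ \<pi>0[OF \<open>cr e v \<noteq> 0\<close>]])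
      then show "p \<in> range \<gamma>" using \<gamma>v[OF v(1,2)] by (metis rangeI)
    qed
  qed
  have semi\<gamma>: "ratmap F (\<gamma> t) = \<gamma> (T t)" for t
  proof -
    obtain v where v: "\<psi> t = to_proj2 v" "v \<noteq> 0" by (rule to_proj2_cases)
    have Fv: "evalmap F v \<noteq> 0" "cr e v \<noteq> 0" using nz[OF v(2) v(1)[symmetric]] by auto
    have Tt: "to_proj2 (evalmap F v) = \<psi> (T t)" using ratmap_to_proj2[OF F v(2) Fv(1)] semi[of t] v(1) by simp
    then have cF: "cr e (evalmap F v) \<noteq> 0" using nz[OF Fv(1)] by blast
    have L: "dt n (evalmap F (\<pi> v)) = 0" "evalmap F (\<pi> v) \<noteq> 0"
      using invariant_curve_points[OF F homH inv \<pi>0[OF Fv(2)]] \<pi>n by (simp_all add: n(2))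
    have "dt (cr e v) (\<pi> v) = 0" using dt_cr(2)[of e "\<pi> v"] by (simp add: \<pi>c)
    then obtain c where "cr e (evalmap F (\<pi> v)) = c *s cr e (evalmap F v)"
      using elementary_parallel[OF F elem e Fv(2) cF] by blast
    then have "cr e (evalmap F (\<pi> v) - c *s evalmap F v) = 0" by (simp add: cr_diff cr_smult)
    then obtain c' where "evalmap F (\<pi> v) - c *s evalmap F v = c' *s e" using cr_eq_0D e by metis
    then have "evalmap F (\<pi> v) = c *s evalmap F v + c' *s e" by (metis add.commute diff_add_cancel)
    then have "dt (cr e (evalmap F v)) (evalmap F (\<pi> v)) = 0" by (simp add: dt_add)
    then obtain k where k: "evalmap F (\<pi> v) = k *s \<pi> (evalmap F v)" using \<pi>uniq[OF cF L(1)] by blast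
    then have "k \<noteq> 0" using L(2) by auto
    have "ratmap F (\<gamma> t) = to_proj2 (evalmap F (\<pi> v))"
      unfolding \<gamma>v[OF v(2) v(1)[symmetric]] by (rule ratmap_to_proj2[OF F \<pi>0[OF Fv(2)] L(2)])
    also have "\<dots> = to_proj2 (\<pi> (evalmap F v))" unfolding k by (rule to_proj2_smult[OF \<open>k \<noteq> 0\<close> \<pi>0[OF cF]])
    also have "\<dots> = \<gamma> (T t)" by (rule \<gamma>v[OF Fv(1) Tt, symmetric])
    finally show ?thesis .
  qed
  have chart: "slope_chart e \<gamma> t" if "slope_chart e \<psi> t" for t
  proof (rule slope_chart_transfer[OF that])
    fix t v w assume v: "v \<noteq> 0" "to_proj2 v = \<psi> t" and w: "w \<noteq> 0" "to_proj2 w = \<gamma> t"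
    have "to_proj2 (\<pi> v) = to_proj2 w" using \<gamma>v[OF v] w(2) by simp
    then obtain c where "w = c *s \<pi> v" using to_proj2_eq_iff[OF \<pi>0 w(1)] nz[OF v] by blast
    then show "\<exists>c. cr e w = c *s cr e v" by (auto simp: cr_smult \<pi>c)
  qed
  interpret elementary_curve_norm Q \<Omega> a b F d 1 e H "zero_set H" \<gamma> N
  proof unfold_locales
    show "eval3 H e \<noteq> 0" using ne by (simp add: n(2))
    show "grad (eval3 H) v \<noteq> 0" if "v \<noteq> 0" "eval3 H v = 0" for v
    proof
      assume g: "grad (eval3 H) v = 0"
      obtain i where i: "n $ i \<noteq> 0" using nonzero_nth[OF n(1)] by blast
      have "((\<lambda>s. dt n (v + s *s axis i 1)) has_field_derivative 0) (at 0)"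
        using pfun_along_line[OF pfun_eval3, of H v "axis i 1" 0] g by (simp add: n(2))
      moreover have "((\<lambda>s. dt n (v + s *s axis i 1)) has_field_derivative n $ i) (at 0)"
        unfolding dt_add dt_smult axis_dt by (auto intro!: derivative_eq_intros)
      ultimately show False using DERIV_unique i by blast
    qed
    show "evalmap F v \<noteq> 0 \<and> eval3 H (evalmap F v) = 0" if "v \<noteq> 0" "eval3 H v = 0" for v
      by (rule invariant_curve_points[OF F homH inv that])
    show "periodic \<gamma>" using \<psi>_per by (simp add: periodic_def \<gamma>_def)
    show "countable {t. \<not> slope_chart e \<gamma> t}" by (rule countable_subset[OF _ charts]) (use chart in blast)
  qed (fact F elem e homH \<gamma>c range semi\<gamma> N | simp)+
  have "\<psi> \<in> borel \<rightarrow>\<^sub>M borel" using \<psi> by (rule borel_measurable_continuous_onI)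
  then have "line_measure (to_proj2 e) (zero_set H) (distr (uniform_measure lborel Q) borel \<psi>) =
      distr (uniform_measure lborel Q) borel \<gamma>"
    unfolding line_measure_def by (subst distr_distr[OF prm]) (auto simp: o_def \<gamma>_def[abs_def])
  then show ?thesis using attracting lyap by simp
qed

end

section \<open>Polynomial self-maps of a uniformized curve\<close>

lemma cr_cr_common: "cr (cr e y) (cr e z) = dt e (cr y z) *s (e :: 'k::field^3)"
  by (simp add: v3 algebra_simps)

context uniformized
begin

lemma lift_has_derivative:
  assumes "lift S h" "s \<in> S"
  shows "(h has_derivative (\<lambda>x. x *s dv h s)) (at s)"
proof (rule has_derivative_vec3)
  fix i
  show "((\<lambda>s. h s $ i) has_derivative (\<lambda>x. (x *s dv h s) $ i)) (at s)"
    using lift_deriv[OF assms, of i] by (simp add: has_field_derivative_def mult_commute_abs)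
qed

lemma lift_pfun_deriv:
  assumes h: "lift S h" "s \<in> S" and f: "\<And>i. pfun (\<lambda>v. f v $ i)"
  shows "((\<lambda>s. f (h s) $ i) has_field_derivative jac f (h s) (dv h s) $ i) (at s)"
proof -
  have "((\<lambda>s. f (h s) $ i) has_derivative (\<lambda>x. dt (grad (\<lambda>v. f v $ i) (h s)) (x *s dv h s))) (at s)"
    by (rule has_derivative_compose[OF lift_has_derivative[OF h] pfun_has_derivative[OF f]])
  then show ?thesis by (simp add: has_field_derivative_def jac_def mult_commute_abs)
qed

lemma proj_lift:
  assumes "lift S h" "s \<in> S" "v \<noteq> 0" "to_proj2 v = \<phi> s"
  obtains c where "c \<noteq> 0" "v = c *s h s"
proof -
  have "\<exists>c. v = c *s h s" using assms to_proj2_eq_iff[of "h s" v] by (auto simp: lift_def)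
  then show thesis using assms(3) that by auto
qed

text \<open>The parameters at which the tangent of the curve passes through \<open>e\<close>; there the slope of the line
  joining \<open>e\<close> to the moving point is stationary.\<close>

definition "tangential e = {t. \<forall>S h. lift S h --> t \<in> S --> dt e (cr (h t) (dv h t)) = 0}"

lemma tangential_lift:
  assumes h: "lift S h" "t \<in> S"
  shows "t \<in> tangential e \<longleftrightarrow> dt e (cr (h t) (dv h t)) = 0"
proof
  assume z: "dt e (cr (h t) (dv h t)) = 0"
  show "t \<in> tangential e" unfolding tangential_def
  proof (intro CollectI allI impI)
    fix S' h' assume h': "lift S' h'" "t \<in> S'"
    obtain g g' where "h' t = g *s h t" "dv h' t = g *s dv h t + g' *s h t" by (rule lift_change[OF h h' refl])
    then show "dt e (cr (h' t) (dv h' t)) = 0" using z by (simp add: cr_jet)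
  qed
qed (use h in \<open>auto simp: tangential_def\<close>)

text \<open>The tangential parameters form the zero set of a holomorphic function. Were it everything, the slope
  would be locally constant and an open piece of the curve would lie on a line.\<close>

lemma countable_tangential:
  assumes e: "e \<noteq> 0" and off: "\<And>v t. v \<noteq> 0 ==> to_proj2 v = \<phi> t ==> cr e v \<noteq> 0"
  shows "countable (tangential e)"
proof (rule discrete_countable, rule notI)
  fix t0 assume lim: "t0 islimpt tangential e"
  have all: "tangential e = UNIV"
  proof (rule local_zero_set_identity[OF _ lim])
    fix t
    obtain S h where h: "lift S h" "t \<in> S" by (rule lift_exists)
    then obtain r where r: "0 < r" "ball t r \<subseteq> S" using openE[of S t] by (auto simp: lift_def)
    let ?w = "\<lambda>s. dt e (cr (h s) (dv h s))"
    have "(\<lambda>s. h s $ i) holomorphic_on ball t r" "(\<lambda>s. dv h s $ i) holomorphic_on ball t r" for i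
      using h(1) dv_holomorphic[OF h(1), of i] r(2) holomorphic_on_subset by (auto simp: lift_def)
    then have "?w holomorphic_on ball t r" unfolding dt3 cr_nth by (intro holomorphic_intros)
    moreover have "\<forall>s\<in>ball t r. s \<in> tangential e \<longleftrightarrow> ?w s = 0" using tangential_lift[OF h(1)] r(2) by blast
    ultimately show "\<exists>r>0. \<exists>w. w holomorphic_on ball t r \<and> (\<forall>s\<in>ball t r. s \<in> tangential e \<longleftrightarrow> w s = 0)"
      using r(1) by blast
  qed
  obtain S h where h: "lift S h" "0 \<in> S" by (rule lift_exists)
  define u where "u s = cr e (h s)" for s
  have u0: "u s \<noteq> 0" if "s \<in> S" for s using off[of "h s" s] h(1) that by (simp add: lift_def u_def)
  obtain k where k: "u 0 $ k \<noteq> 0" using nonzero_nth[OF u0[OF h(2)]] by blast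
  have pf: "pfun (\<lambda>v. cr e v $ i)" for i
  proof -
    obtain j l where "\<forall>u v :: complex^3. cr u v $ i = u$j * v$l - u$l * v$j" using cr_nth_cases by blast
    then have "(\<lambda>v. cr e v $ i) = (\<lambda>v. e$j * v$l + - e$l * v$j)" by auto
    then show ?thesis by (simp only: pfun.intros)
  qed
  have jc: "jac (cr e) v w = cr e w" for v w
  proof -
    have "((\<lambda>x. cr e x $ i) has_derivative (\<lambda>x. cr e x $ i)) (at v)" for i
    proof -
      obtain j l where "\<forall>u v :: complex^3. cr u v $ i = u$j * v$l - u$l * v$j" using cr_nth_cases by blast
      then show ?thesis
        by (auto intro!: derivative_eq_intros bounded_linear_imp_has_derivative bounded_linear_vec_nth
            bounded_linear_sub bounded_linear_mult_const bounded_linear_const_mult)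
    qed
    then have "frechet_derivative (\<lambda>x. cr e x $ i) (at v) = (\<lambda>x. cr e x $ i)" for i
      using frechet_derivative_at by metis
    then show ?thesis using pfun_frechet[OF pf] by (simp add: jac_def vec_eq_iff)
  qed
  have du: "((\<lambda>s. u s $ i) has_field_derivative cr e (dv h s) $ i) (at s)" if "s \<in> S" for s i
    using lift_pfun_deriv[OF h(1) that, of "cr e" i] pf unfolding jc u_def by blast
  have par: "\<exists>c. cr e (dv h s) = c *s u s" if s: "s \<in> S" for s
  proof -
    have "cr (u s) (cr e (dv h s)) = 0"
      using tangential_lift[OF h(1) s, of e] all by (simp add: u_def cr_cr_common)
    then show ?thesis using cr_eq_0D u0[OF s] by blast
  qed
  have "continuous_on S (\<lambda>s. u s $ k)" using du by (intro continuous_at_imp_continuous_on ballI) (rule DERIV_isCont)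
  then have "open (S \<inter> (\<lambda>s. u s $ k) -` (- {0}))" using h(1) by (intro continuous_open_preimage) (auto simp: lift_def)
  moreover have "0 \<in> S \<inter> (\<lambda>s. u s $ k) -` (- {0})" using h(2) k by simp
  ultimately obtain r where r: "0 < r" "ball 0 r \<subseteq> S \<inter> (\<lambda>s. u s $ k) -` (- {0})" by (rule openE)
  have const: "u s $ j / u s $ k = u 0 $ j / u 0 $ k" if s: "s \<in> ball 0 r" for s j
  proof -
    have "((\<lambda>s. u s $ j / u s $ k) has_field_derivative 0) (at x within ball 0 r)" if x: "x \<in> ball 0 r" for x
    proof -
      have xS: "x \<in> S" "u x $ k \<noteq> 0" using r(2) x by auto
      obtain c where c: "cr e (dv h x) = c *s u x" using par[OF xS(1)] by blast
      show ?thesis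
        by (rule has_field_derivative_at_within, rule DERIV_cong[OF DERIV_divide[OF du[OF xS(1)] du[OF xS(1)] xS(2)]])
          (simp add: c)
    qed
    then obtain c where "\<forall>x\<in>ball 0 r. u x $ j / u x $ k = c"
      using has_field_derivative_zero_constant[of "ball 0 r" "\<lambda>s. u s $ j / u s $ k"] convex_ball by blast
    then show ?thesis using r(1) s by simp
  qed
  have "s \<in> Rl (u 0)" if s: "s \<in> ball 0 r" for s
  proof -
    have xS: "s \<in> S" "u s $ k \<noteq> 0" using r(2) s by auto
    have "u s = (u s $ k / u 0 $ k) *s u 0" using const[OF s] k xS(2) by (simp add: vec_eq_iff field_simps)
    then have "(u s $ k / u 0 $ k) * dt (u 0) (h s) = dt (u s) (h s)" by (metis dt_smult_left)
    then have "dt (u 0) (h s) = 0" using k xS(2) by (simp add: u_def)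
    then show ?thesis using Rl_lift[OF h(1) xS(1)] by simp
  qed
  then have "(0::complex) islimpt Rl (u 0)" using r(1) islimpt_subset[of 0 "ball 0 r" "Rl (u 0)"] islimpt_ball[of 0 0 r] by (simp add: subset_iff)
  then show False using line_isolated[OF u0[OF h(2)]] by blast
qed

text \<open>Off the tangents through \<open>e\<close> the slope is a local coordinate on the curve, with a holomorphic inverse.\<close>

lemma slope_inverse:
  assumes e: "e \<noteq> 0" and t: "t \<notin> tangential e"
  obtains S h i j D \<sigma> where "lift S h" "t \<in> S" "\<sigma> holomorphic_on D" "open D"
    "\<And>s. s \<in> S ==> cr e (h s) $ i \<noteq> 0 \<and> cr e (h s) $ j / cr e (h s) $ i \<in> D \<and> \<sigma> (cr e (h s) $ j / cr e (h s) $ i) = s"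
proof -
  obtain S h where h: "lift S h" "t \<in> S" by (rule lift_exists)
  have oS: "open S" and hh: "\<And>i. (\<lambda>s. h s $ i) holomorphic_on S" using h(1) by (auto simp: lift_def)
  define u where "u s = cr e (h s)" for s
  have hu: "(\<lambda>s. u s $ i) holomorphic_on S" for i
  proof -
    obtain j l where "\<forall>u v :: complex^3. cr u v $ i = u$j * v$l - u$l * v$j" using cr_nth_cases by blast
    then show ?thesis by (simp add: u_def) (intro holomorphic_intros hh)
  qed
  have "dv u t $ i = cr e (dv h t) $ i" for i
  proof -
    obtain j l where jl: "\<forall>u v :: complex^3. cr u v $ i = u$j * v$l - u$l * v$j" using cr_nth_cases by blast
    have "((\<lambda>s. e$j * h s $ l - e$l * h s $ j) has_field_derivative e$j * dv h t $ l - e$l * dv h t $ j) (at t)"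
      by (auto intro!: derivative_eq_intros lift_deriv[OF h])
    then show ?thesis using jl by (simp add: dv_def u_def DERIV_imp_deriv)
  qed
  then have du: "dv u t = cr e (dv h t)" by (simp add: vec_eq_iff)
  have "cr (u t) (dv u t) \<noteq> 0" using t tangential_lift[OF h] e by (simp add: du u_def cr_cr_common smult_eq_0)
  then obtain j k l where l: "u t $ k \<noteq> 0" "((\<lambda>s. u s $ j / u s $ k) has_field_derivative l) (at t)" "l \<noteq> 0"
    by (rule slope_coordinate[OF hu oS h(2)])
  define f where "f s = u s $ j / u s $ k" for s
  define S1 where "S1 = S \<inter> (\<lambda>s. u s $ k) -` (- {0})"
  have S1: "open S1" "t \<in> S1" unfolding S1_def using l(1) h(2)
    by (auto intro!: continuous_open_preimage holomorphic_on_imp_continuous_on hu oS)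
  have hf: "f holomorphic_on S1" unfolding f_def S1_def
    by (intro holomorphic_intros holomorphic_on_subset[OF hu]) auto
  have "deriv f t \<noteq> 0" using l by (simp add: f_def[abs_def] DERIV_imp_deriv)
  then obtain r where r: "0 < r" "ball t r \<subseteq> S1" "inj_on f (ball t r)"
    by (rule has_complex_derivative_locally_injective[OF hf S1(2,1)])
  have hf': "f holomorphic_on ball t r" using hf r(2) holomorphic_on_subset by blast
  obtain \<sigma> where \<sigma>: "\<sigma> holomorphic_on (f ` ball t r)" "\<And>s. s \<in> ball t r ==> \<sigma> (f s) = s"
    by (rule holomorphic_has_inverse[OF hf' open_ball r(3)]) blast
  have "open (f ` ball t r)" by (rule open_mapping_thm3[OF hf' open_ball r(3)])
  moreover have "lift (ball t r) h" using lift_subset[OF h(1) open_ball] r(2) by (auto simp: S1_def)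
  ultimately show thesis using \<sigma> r(1,2)
    by (intro that[of "ball t r" h \<sigma> "f ` ball t r" k j]) (auto simp: f_def u_def S1_def)
qed

lemma slope_chart_\<phi>:
  assumes e: "e \<noteq> 0" and t: "t \<notin> tangential e"
  shows "slope_chart e \<phi> t"
proof -
  obtain S h i j D \<sigma> where h: "lift S h" "t \<in> S" and \<sigma>: "\<sigma> holomorphic_on D" "open D" and
    s: "\<And>s. s \<in> S ==> cr e (h s) $ i \<noteq> 0 \<and> cr e (h s) $ j / cr e (h s) $ i \<in> D \<and> \<sigma> (cr e (h s) $ j / cr e (h s) $ i) = s"
    by (rule slope_inverse[OF e t]) blast
  have "\<forall>s\<in>S. \<forall>v. v \<noteq> 0 \<and> to_proj2 v = \<phi> s --> (\<exists>c. cr e v = c *s cr e (h s))"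
  proof (intro ballI allI impI)
    fix s v assume "s \<in> S" "v \<noteq> 0 \<and> to_proj2 v = \<phi> s"
    then obtain c where "v = c *s h s" using proj_lift[OF h(1)] by metis
    then show "\<exists>c. cr e v = c *s cr e (h s)" by (auto simp: cr_smult)
  qed
  moreover have "open S" "\<forall>l. (\<lambda>t. h t $ l) differentiable_on S" using h(1)
    by (auto simp: lift_def holomorphic_on_imp_differentiable_on)
  moreover have "\<sigma> differentiable_on D" by (rule holomorphic_on_imp_differentiable_on[OF \<sigma>(1)])
  ultimately show ?thesis unfolding slope_chart_def using h(2) s
    by (intro exI[of _ S] exI[of _ h] exI[of _ i] exI[of _ j] exI[of _ D] exI[of _ \<sigma>]) simp
qed

end

locale polynomial_self_map = uniformized \<omega>1 \<omega>2 \<phi> C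
  for \<omega>1 \<omega>2 :: complex and \<phi> :: "complex => complex proj2" and C :: "complex proj2 set" +
  fixes f :: "complex ^ 3 => complex ^ 3" and d :: nat
  assumes f_pfun: "\<And>i. pfun (\<lambda>v. f v $ i)" and f_scale: "\<And>c v. f (c *s v) = c ^ d *s f v" and d: "2 \<le> d"
    and f_C: "\<And>v. v \<noteq> 0 ==> to_proj2 v \<in> C ==> f v \<noteq> 0 \<and> to_proj2 (f v) \<in> C"
    and f_surj: "\<And>p. p \<in> C ==> \<exists>v. v \<noteq> 0 \<and> to_proj2 v \<in> C \<and> to_proj2 (f v) = p"
begin

lemma affine_lift:
  obtains \<alpha> \<beta> where "\<And>v t. v \<noteq> 0 ==> to_proj2 v = \<phi> t ==> f v \<noteq> 0 \<and> to_proj2 (f v) = \<phi> (\<alpha> * t + \<beta>)"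
    "1 < norm \<alpha>" "\<And>\<omega>. \<omega> \<in> \<Omega> ==> \<alpha> * \<omega> \<in> \<Omega>"
proof -
  define Y where "Y t = to_proj2 (f (rep_proj2 (\<phi> t)))" for t
  have Y: "f v \<noteq> 0 \<and> Y t = to_proj2 (f v) \<and> Y t \<in> C" if v: "v \<noteq> 0" "to_proj2 v = \<phi> t" for v t
  proof -
    have fv: "f v \<noteq> 0 \<and> to_proj2 (f v) \<in> C" using f_C[OF v(1)] v(2) by simp
    have "\<exists>c. rep_proj2 (\<phi> t) = c *s v" using to_proj2_eq_iff[OF v(1) rep_proj2_nonzero, of "\<phi> t"] v(2) by simp
    then obtain c where c: "rep_proj2 (\<phi> t) = c *s v" by blast
    then have "c \<noteq> 0" using rep_proj2_nonzero[of "\<phi> t"] by auto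
    then have "Y t = to_proj2 (f v)" unfolding Y_def c f_scale using fv by (intro to_proj2_smult) auto
    then show ?thesis using fv by simp
  qed
  obtain \<alpha> \<beta> where ab: "\<And>t. Y t = \<phi> (\<alpha> * t + \<beta>)" "\<And>\<omega>. \<omega> \<in> \<Omega> ==> \<alpha> * \<omega> \<in> \<Omega>"
  proof (rule holomorphic_self_map_affine[of Y])
    show "Y t \<in> C" for t using Y[OF rep_proj2_nonzero to_proj2_rep, of t] by blast
    show "Y (t + \<omega>) = Y t" if "\<omega> \<in> \<Omega>" for t \<omega> by (simp add: Y_def periodic_\<phi>[OF that])
    fix t
    obtain S h where h: "lift S h" "t \<in> S" by (rule lift_exists)
    have "(\<lambda>s. f (h s) $ i) holomorphic_on S" for i
      by (rule pfun_holomorphic[OF f_pfun]) (use h(1) in \<open>simp add: lift_def\<close>)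
    moreover have "\<forall>s\<in>S. f (h s) \<noteq> 0 \<and> Y s = to_proj2 (f (h s))"
    proof
      fix s assume "s \<in> S"
      then have "h s \<noteq> 0" "to_proj2 (h s) = \<phi> s" using h(1) by (auto simp: lift_def)
      then show "f (h s) \<noteq> 0 \<and> Y s = to_proj2 (f (h s))" using Y by blast
    qed
    ultimately show "\<exists>S y. open S \<and> t \<in> S \<and> (\<forall>i. (\<lambda>s. y s $ i) holomorphic_on S) \<and> (\<forall>s\<in>S. y s \<noteq> 0 \<and> Y s = to_proj2 (y s))"
      using h by (intro exI[of _ S] exI[of _ "\<lambda>s. f (h s)"]) (simp add: lift_def)
  qed blast
  have semi: "f v \<noteq> 0 \<and> to_proj2 (f v) = \<phi> (\<alpha> * t + \<beta>)" if "v \<noteq> 0" "to_proj2 v = \<phi> t" for v t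
    using Y[OF that] ab(1)[of t] by simp
  have "1 < norm \<alpha>" by (rule multiplier_expanding[OF f_pfun f_scale d semi ab(2) f_surj])
  then show thesis using that semi ab(2) by blast
qed

text \<open>An expanding affine map has no critical points; at a fixed point \<open>e\<close> of the curve this means
  that the derivative of the plane map does not vanish along the curve.\<close>

lemma etale_at_fixed_point:
  assumes e: "e \<noteq> 0" "to_proj2 e \<in> C" and fp: "cr e (f e) = 0"
  shows "\<exists>w. cr e (jac f e w) \<noteq> 0"
proof -
  obtain \<alpha> \<beta> where semi: "\<And>v t. v \<noteq> 0 ==> to_proj2 v = \<phi> t ==> f v \<noteq> 0 \<and> to_proj2 (f v) = \<phi> (\<alpha> * t + \<beta>)"
    and \<alpha>: "1 < norm \<alpha>" by (rule affine_lift) blast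
  obtain t where t: "to_proj2 e = \<phi> t" using e(2) range_\<phi> by auto
  obtain S h where h: "lift S h" "t \<in> S" by (rule lift_exists)
  obtain S1 h1 where h1: "lift S1 h1" "\<alpha> * t + \<beta> \<in> S1" by (rule lift_exists)
  define y where "y s = h1 (\<alpha> * s + \<beta>)" for s
  obtain c where c: "c \<noteq> 0" "e = c *s h t" by (rule proj_lift[OF h e(1) t])
  have rel: "\<exists>\<kappa>. \<kappa> \<noteq> 0 \<and> f (h s) = \<kappa> *s y s" if "s \<in> S" "\<alpha> * s + \<beta> \<in> S1" for s
  proof -
    have "f (h s) \<noteq> 0 \<and> to_proj2 (f (h s)) = \<phi> (\<alpha> * s + \<beta>)" using semi[of "h s" s] h(1) that(1) by (simp add: lift_def)
    then show ?thesis using proj_lift[OF h1(1) that(2), of "f (h s)"] unfolding y_def by metis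
  qed
  obtain \<kappa> where \<kappa>: "\<kappa> \<noteq> 0" "f (h t) = \<kappa> *s y t" using rel h(2) h1(2) by blast
  define w where "w = jac f (h t) (dv h t)"
  have dy: "((\<lambda>s. y s $ i) has_field_derivative \<alpha> * dv h1 (\<alpha> * t + \<beta>) $ i) (at t)" for i
    unfolding y_def by (rule DERIV_cong[OF DERIV_chain2[where f = "\<lambda>s. h1 s $ i" and g = "\<lambda>s. \<alpha> * s + \<beta>", OF lift_deriv[OF h1]]]) (auto intro!: derivative_eq_intros)
  have df: "((\<lambda>s. f (h s) $ i) has_field_derivative w $ i) (at t)" for i
    unfolding w_def by (rule lift_pfun_deriv[OF h f_pfun])
  have ev: "\<forall>\<^sub>F s in nhds t. cr (y s) (f (h s)) = 0"
  proof -
    have "open (S \<inter> (\<lambda>s. \<alpha> * s + \<beta>) -` S1)" using h(1) h1(1)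
      by (intro continuous_open_preimage continuous_intros) (auto simp: lift_def)
    moreover have "t \<in> S \<inter> (\<lambda>s. \<alpha> * s + \<beta>) -` S1" using h h1 by simp
    moreover have "cr (y s) (f (h s)) = 0" if s: "s \<in> S \<inter> (\<lambda>s. \<alpha> * s + \<beta>) -` S1" for s
    proof -
      obtain k where "f (h s) = k *s y s" using rel[of s] s by auto
      then show ?thesis by (simp add: cr_smult)
    qed
    ultimately show ?thesis unfolding eventually_nhds by blast
  qed
  have "(cr (\<alpha> *s dv h1 (\<alpha> * t + \<beta>)) (f (h t)) + cr (y t) w) $ i = 0" for i
  proof -
    obtain j l where jl: "\<forall>u v :: complex^3. cr u v $ i = u$j * v$l - u$l * v$j" using cr_nth_cases by blast
    have "((\<lambda>s. cr (y s) (f (h s)) $ i) has_field_derivative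
        (cr (\<alpha> *s dv h1 (\<alpha> * t + \<beta>)) (f (h t)) + cr (y t) w) $ i) (at t)"
      unfolding jl[rule_format] vector_add_component
      by (auto intro!: derivative_eq_intros dy df simp: algebra_simps)
    moreover have "((\<lambda>s. cr (y s) (f (h s)) $ i) has_field_derivative 0) (at t)"
      by (subst DERIV_cong_ev[OF refl _ refl, where g = "\<lambda>s. 0"]) (use ev in \<open>auto elim: eventually_mono\<close>)
    ultimately show ?thesis by (rule DERIV_unique)
  qed
  then have "cr (\<alpha> *s dv h1 (\<alpha> * t + \<beta>)) (f (h t)) + cr (y t) w = 0" unfolding vec_eq_iff by simp
  then have "cr (y t) w = - ((\<alpha> * \<kappa>) *s cr (dv h1 (\<alpha> * t + \<beta>)) (y t))"
    by (simp add: \<kappa>(2) cr_smult cr_smult_left vector_smult_assoc eq_neg_iff_add_eq_0 add.commute mult.commute)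
  also have "\<dots> = (\<alpha> * \<kappa>) *s cr (y t) (dv h1 (\<alpha> * t + \<beta>))" by (subst cr_swap) simp
  finally have "cr (y t) w \<noteq> 0" using \<kappa>(1) \<alpha> h1 by (auto simp: smult_eq_0 y_def lift_def)
  have "cr e (c ^ d *s (\<kappa> *s y t)) = 0" using fp unfolding c(2) f_scale \<kappa>(2) .
  then have "cr e (y t) = 0" using c(1) \<kappa>(1) by (simp add: cr_smult smult_eq_0)
  then obtain k where k: "y t = k *s e" using cr_eq_0D e(1) by metis
  then have "cr e w \<noteq> 0" using \<open>cr (y t) w \<noteq> 0\<close> by (auto simp: cr_smult_left)
  moreover have "jac f e (c *s dv h t) = c ^ d *s w"
    unfolding c(2) w_def by (rule jac_homogeneous[OF f_pfun f_scale])
  ultimately have "cr e (jac f e (c *s dv h t)) \<noteq> 0" using c(1) by (simp add: cr_smult smult_eq_0)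
  then show ?thesis by blast
qed

end

section \<open>The complex case\<close>

lemma complex_invariant_basin:
  fixes F :: "complex polymap"
  assumes F: "rational_map d F" and elem: "elementary F p0" and smooth: "smooth_curve G"
    and unif: "uniformization \<omega>1 \<omega>2 \<phi> (zero_set G)" and inv: "invariant_curve F (zero_set G)"
  shows "\<And>N. transverse_norm G (zero_set G) N ==>
      transverse_lyapunov F N (zero_set G) (torus_measure \<omega>1 \<omega>2 \<phi>) < 0 ==> basin_positive F (zero_set G)"
    and "\<And>H N. linear_form H ==> p0 \<notin> zero_set H ==> invariant_curve F (zero_set H) ==>
      transverse_norm H (zero_set H) N ==> transverse_lyapunov F N (zero_set H)
        (line_measure p0 (zero_set H) (torus_measure \<omega>1 \<omega>2 \<phi>)) < 0 ==> basin_positive F (zero_set H)"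
proof -
  obtain e where e: "p0 = to_proj2 e" "e \<noteq> 0" by (rule to_proj2_cases)
  obtain m where m: "0 < m" "homogeneous m G" using smooth by (auto simp: smooth_curve_def)
  have on: "to_proj2 v \<in> zero_set G \<longleftrightarrow> eval3 G v = 0" if "v \<noteq> 0" for v by (rule zero_set_iff[OF m(2) that])
  have invar: "evalmap F v \<noteq> 0 \<and> eval3 G (evalmap F v) = 0" if "v \<noteq> 0" "eval3 G v = 0" for v
    by (rule invariant_curve_points[OF F m(2) inv that])
  interpret polynomial_self_map \<omega>1 \<omega>2 \<phi> "zero_set G" "evalmap F" d
  proof unfold_locales
    show "evalmap F v \<noteq> 0 \<and> to_proj2 (evalmap F v) \<in> zero_set G" if "v \<noteq> 0" "to_proj2 v \<in> zero_set G" for v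
      using that invar on by simp
    show "\<exists>v. v \<noteq> 0 \<and> to_proj2 v \<in> zero_set G \<and> to_proj2 (evalmap F v) = p" if p: "p \<in> zero_set G" for p
    proof -
      obtain q where q: "q \<in> zero_set G" "p = ratmap F q" using inv p by (auto simp: invariant_curve_def)
      obtain v where v: "q = to_proj2 v" "v \<noteq> 0" by (rule to_proj2_cases)
      have "evalmap F v \<noteq> 0" using invar[OF v(2)] q(1) v on by simp
      then show ?thesis using ratmap_to_proj2[OF F v(2)] q v by auto
    qed
    show "2 \<le> d" using F by (simp add: rational_map_def)
  qed (fact unif pfun_evalmap evalmap_scale[OF F])+
  obtain \<alpha> \<beta> where semi: "\<And>v t. v \<noteq> 0 ==> to_proj2 v = \<phi> t ==> evalmap F v \<noteq> 0 \<and> to_proj2 (evalmap F v) = \<phi> (\<alpha> * t + \<beta>)"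
    and \<alpha>: "1 < norm \<alpha>" "\<And>\<omega>. \<omega> \<in> \<Omega> ==> \<alpha> * \<omega> \<in> \<Omega>" by (rule affine_lift) blast
  have rsemi: "ratmap F (\<phi> t) = \<phi> (\<alpha> * t + \<beta>)" for t
    using semi[OF rep_proj2_nonzero, of "\<phi> t" t] by (simp add: ratmap_def)
  have Ge: "eval3 G e \<noteq> 0"
  proof
    assume z: "eval3 G e = 0"
    show False
    proof (rule center_not_on_curve[where \<psi> = \<phi>, OF F elem[unfolded e(1)] e(2) _ rsemi \<alpha>(1)])
      show "\<not> t islimpt {s. dt n (rep_proj2 (\<phi> s)) = 0}" if "n \<noteq> 0" for n t
        using line_isolated[OF that, of t] by (simp add: Rl_def)
      show "evalmap F (rep_proj2 (\<phi> t)) \<noteq> 0" for t using semi[OF rep_proj2_nonzero, of "\<phi> t" t] by simp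
      show "evalmap F e \<noteq> 0" using invar[OF e(2) z] by simp
      show "\<exists>w. cr e (jac (evalmap F) e w) \<noteq> 0" if "cr e (evalmap F e) = 0"
        by (rule etale_at_fixed_point[OF e(2) _ that]) (simp add: on[OF e(2)] z)
      show "\<omega>1 \<noteq> 0" "\<phi> (t + \<omega>1) = \<phi> t" for t using \<omega>1 periodic_\<phi> by auto
    qed
  qed
  have off: "cr e v \<noteq> 0" if v: "v \<noteq> 0" "to_proj2 v = \<phi> t" for v t
  proof
    assume "cr e v = 0"
    then obtain c where c: "v = c *s e" using cr_eq_0D e(2) by metis
    then have "c \<noteq> 0" using v(1) by auto
    have "to_proj2 v \<in> zero_set G" using v(2) by simp
    then have "eval3 G v = 0" using on[OF v(1)] by simp
    then show False using Ge \<open>c \<noteq> 0\<close> by (simp add: c eval3_scale[OF m(2)])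
  qed
  interpret E: elementary_parametrization Q \<Omega> \<alpha> \<beta> F d e \<phi>
  proof unfold_locales
    interpret A: torus_affine Q \<Omega> \<alpha> \<beta> by unfold_locales (fact \<alpha>)+
    show "ratmap F (\<phi> t) = \<phi> (A.T t)" for t by (simp add: A.T_def rsemi)
    show "periodic \<phi>" by (simp add: periodic_def periodic_\<phi>)
    show "evalmap F v \<noteq> 0 \<and> cr e v \<noteq> 0" if "v \<noteq> 0" "to_proj2 v = \<phi> t" for v t using semi[OF that] off[OF that] by simp
    show "countable {t. \<not> slope_chart e \<phi> t}"
      by (rule countable_subset[OF _ countable_tangential[OF e(2) off]]) (use slope_chart_\<phi>[OF e(2)] in blast)
  qed (fact \<alpha> F elem[unfolded e(1)] e(2) continuous_\<phi>)+
  have tm: "torus_measure \<omega>1 \<omega>2 \<phi> = distr (uniform_measure lborel Q) borel \<phi>"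
    by (simp add: torus_measure_def Q_def)
  show "basin_positive F (zero_set G)"
    if "transverse_norm G (zero_set G) N" "transverse_lyapunov F N (zero_set G) (torus_measure \<omega>1 \<omega>2 \<phi>) < 0" for N
    by (rule E.attracting_curve[OF m(2,1) Ge smooth_grad[OF smooth] invar _ _ that(1)]) (use that(2) range_\<phi> tm in auto)
  have meets: "\<exists>t v. v \<noteq> 0 \<and> to_proj2 v = \<phi> t \<and> dt (cr e x) v = 0" if x: "cr e x \<noteq> 0" for x
  proof -
    obtain p where p: "\<And>z. poly p z = eval3 G (x + z *s e)" "degree p \<le> m" "coeff p m = eval3 G e"
      by (rule eval3_line_poly[OF m(2)]) blast
    have "degree p = m" using p Ge le_degree[of p m] by simp
    then have "degree p \<noteq> 0" using m(1) by simp
    then obtain z where "poly p z = 0" using alg_closed_imp_poly_has_root[of p] by auto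
    moreover have v: "x + z *s e \<noteq> 0"
    proof
      assume "x + z *s e = 0"
      then have "cr e (x + z *s e) = 0" by simp
      then show False using x by (simp add: cr_add cr_smult)
    qed
    ultimately have "to_proj2 (x + z *s e) \<in> range \<phi>" using on[OF v] p(1) range_\<phi> by simp
    then obtain t where "to_proj2 (x + z *s e) = \<phi> t" by blast
    moreover have "dt (cr e x) (x + z *s e) = 0" by (simp add: dt_add)
    ultimately show ?thesis using v by blast
  qed
  show "basin_positive F (zero_set H)"
    if "linear_form H" "p0 \<notin> zero_set H" "invariant_curve F (zero_set H)" "transverse_norm H (zero_set H) N"
      "transverse_lyapunov F N (zero_set H) (line_measure p0 (zero_set H) (torus_measure \<omega>1 \<omega>2 \<phi>)) < 0" for H N
    by (rule E.attracting_line[OF that(1) _ that(3) meets that(4)]) (use that(2,5) e(1) tm in auto)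
qed

section \<open>Complexification\<close>

definition cv :: "real ^ 3 => complex ^ 3" where "cv v = (\<chi> i. of_real (v $ i))"

lemma cv_nth [simp]: "cv v $ i = of_real (v $ i)" by (simp add: cv_def)
lemma cv_inject: "cv v = cv w \<longleftrightarrow> v = w" and cv_0_iff: "cv v = 0 \<longleftrightarrow> v = 0" and cv_0: "cv 0 = 0"
  by (auto simp: vec_eq_iff)
lemma cv_add: "cv (v + w) = cv v + cv w" and cv_smult: "cv (c *s v) = of_real c *s cv v"
  by (simp_all add: vec_eq_iff)
lemma cv_cr: "cr (cv u) (cv v) = cv (cr u v)" and cv_dt: "dt (cv u) (cv v) = of_real (dt u v)"
  by (simp_all add: v3)

lemma lookup_complexify: "Poly_Mapping.lookup (complexify P) k = of_real (Poly_Mapping.lookup P k)"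
  by (simp add: complexify_def Poly_Mapping.map.rep_eq when_def)

lemma keys_complexify: "Poly_Mapping.keys (complexify P) = Poly_Mapping.keys P"
  by (auto simp: in_keys_iff lookup_complexify)

lemma eval3_complexify: "eval3 (complexify P) (cv v) = of_real (eval3 P v)"
  by (simp add: eval3_def keys_complexify lookup_complexify)

lemma homogeneous_complexify: "homogeneous d (complexify P) \<longleftrightarrow> homogeneous d P"
  by (simp add: homogeneous_def keys_complexify)

lemma evalmap_complexify: "evalmap (complexify_map F) (cv v) = cv (evalmap F v)"
  by (simp add: evalmap_def complexify_map_def vec_eq_iff eval3_complexify)

lemma complexify_map_scale:
  assumes "rational_map d F" shows "evalmap (complexify_map F) (c *s v) = c ^ d *s evalmap (complexify_map F) v"
proof -
  have "homogeneous d (complexify (F $ i))" for i using assms by (simp add: rational_map_def homogeneous_complexify)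
  then show ?thesis by (simp add: evalmap_def complexify_map_def vec_eq_iff eval3_scale)
qed

lemma cv_bounded_linear: "bounded_linear (\<lambda>v. cv v $ i)"
  unfolding cv_nth by (intro bounded_linear_compose[OF bounded_linear_of_real bounded_linear_vec_nth])

lemma cv_has_derivative: "(cv has_derivative cv) (at v)"
  by (rule has_derivative_vec3) (rule bounded_linear_imp_has_derivative[OF cv_bounded_linear])

lemma grad_cv:
  assumes f: "pfun f" "pfun g" and fg: "\<And>v. g (cv v) = of_real (f v)"
  shows "dt (grad g (cv v)) (cv w) = of_real (dt (grad f v) w)"
proof -
  have A: "((\<lambda>v. g (cv v)) has_derivative (\<lambda>w. dt (grad g (cv v)) (cv w))) (at v)"
    by (rule has_derivative_compose[OF cv_has_derivative pfun_has_derivative[OF f(2)]])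
  have "((\<lambda>v. complex_of_real (f v)) has_derivative (\<lambda>w. of_real (dt (grad f v) w))) (at v)"
    by (rule has_derivative_of_real[OF pfun_has_derivative[OF f(1)]])
  then have "((\<lambda>v. g (cv v)) has_derivative (\<lambda>w. of_real (dt (grad f v) w))) (at v)" by (simp only: fg)
  from fun_cong[OF has_derivative_unique[OF A this], of w] show ?thesis .
qed

lemma jac_cv: "jac (evalmap (complexify_map F)) (cv v) (cv w) = cv (jac (evalmap F) v w)"
proof -
  have "dt (grad (\<lambda>u. evalmap (complexify_map F) u $ i) (cv v)) (cv w) = of_real (dt (grad (\<lambda>u. evalmap F u $ i) v) w)" for i
    by (rule grad_cv[OF pfun_evalmap pfun_evalmap]) (simp add: evalmap_complexify)
  then show ?thesis by (simp add: jac_def vec_eq_iff)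
qed

lemma smooth_complexify:
  assumes "\<And>v. v \<noteq> 0 ==> eval3 (complexify G) v = 0 ==> grad (eval3 (complexify G)) v \<noteq> 0"
    and v: "v \<noteq> 0" "eval3 G v = 0"
  shows "grad (eval3 G) v \<noteq> 0"
proof
  assume z: "grad (eval3 G) v = 0"
  have "dt (grad (eval3 (complexify G)) (cv v)) (cv w) = 0" for w
    by (subst grad_cv[OF pfun_eval3 pfun_eval3 eval3_complexify]) (simp add: z)
  then have "dt (grad (eval3 (complexify G)) (cv v)) (axis i 1) = 0" for i
  proof -
    have "cv (axis i 1) = axis i 1" by (simp add: vec_eq_iff axis_def)
    then show ?thesis using \<open>\<And>w. dt (grad (eval3 (complexify G)) (cv v)) (cv w) = 0\<close>[of "axis i 1"] by simp
  qed
  then have "grad (eval3 (complexify G)) (cv v) = 0" by (simp add: axis_dt vec_eq_iff)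
  then show False using assms(1)[of "cv v"] v by (simp add: cv_0_iff eval3_complexify)
qed

definition cproj :: "real proj2 => complex proj2" where "cproj p = to_proj2 (cv (rep_proj2 p))"

lemma cproj_to_proj2: assumes v: "v \<noteq> 0" shows "cproj (to_proj2 v) = to_proj2 (cv v)"
proof -
  have "\<exists>c. rep_proj2 (to_proj2 v) = c *s v" using to_proj2_eq_iff[OF v rep_proj2_nonzero, of "to_proj2 v"] by simp
  then obtain c where c: "rep_proj2 (to_proj2 v) = c *s v" by blast
  then have "c \<noteq> 0" using rep_proj2_nonzero[of "to_proj2 v"] by auto
  then have "to_proj2 (of_real c *s cv v) = to_proj2 (cv v)" using v by (intro to_proj2_smult) (auto simp: cv_0_iff)
  then show ?thesis by (simp add: cproj_def c cv_smult)
qed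

lemma cproj_inject: "cproj p = cproj q ==> p = q"
proof -
  assume eq: "cproj p = cproj q"
  obtain v where v: "p = to_proj2 v" "v \<noteq> 0" by (rule to_proj2_cases)
  obtain w where w: "q = to_proj2 w" "w \<noteq> 0" by (rule to_proj2_cases)
  have "to_proj2 (cv v) = to_proj2 (cv w)" using eq v w by (simp add: cproj_to_proj2)
  then obtain c where c: "cv w = c *s cv v" using to_proj2_eq_iff[of "cv v" "cv w"] v w by (auto simp: cv_0_iff)
  have "w $ i = Re c * v $ i" for i
  proof -
    have "of_real (w $ i) = c * of_real (v $ i)" using arg_cong[OF c, of "\<lambda>x. x $ i"] by simp
    then have "Re (of_real (w $ i)) = Re (c * of_real (v $ i))" by simp
    then show ?thesis by simp
  qed
  then have "w = Re c *s v" by (simp add: vec_eq_iff)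
  then show "p = q" using v w to_proj2_eq_iff[OF v(2) w(2)] by blast
qed

lemma continuous_cproj: "continuous_on UNIV cproj"
proof -
  have "open (cproj -` U)" if U: "open U" for U
  proof -
    have "{v. v \<noteq> 0 \<and> to_proj2 v \<in> cproj -` U} = cv -` {v. v \<noteq> 0 \<and> to_proj2 v \<in> U}"
      by (auto simp: cproj_to_proj2 cv_0_iff)
    moreover have "open {v. v \<noteq> 0 \<and> to_proj2 v \<in> U}" using U by (simp add: open_proj2_iff)
    moreover have "continuous_on UNIV cv" by (intro continuous_on_vec3) (simp, intro continuous_intros)
    ultimately show ?thesis by (simp only: open_proj2_iff open_vimage)
  qed
  then show ?thesis by (simp add: continuous_on_open_vimage)
qed

lemma real_part_differentiable:
  assumes "g field_differentiable (at (of_real t * \<omega> + c))"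
  shows "(\<lambda>t. Re (g (of_real t * \<omega> + c))) differentiable (at t)"
proof -
  obtain g' where "(g has_field_derivative g') (at (of_real t * \<omega> + c))" using assms by (auto simp: field_differentiable_def)
  then have g: "(g has_derivative (\<lambda>x. g' * x)) (at (of_real t * \<omega> + c))" by (simp add: has_field_derivative_def)
  have "((\<lambda>t. of_real t * \<omega> + c) has_derivative (\<lambda>x. of_real x * \<omega>)) (at t)" by (auto intro!: derivative_eq_intros)
  from has_derivative_compose[OF this g]
  have "((\<lambda>t. g (of_real t * \<omega> + c)) has_derivative (\<lambda>x. g' * (of_real x * \<omega>))) (at t)" .
  from bounded_linear.has_derivative[OF bounded_linear_Re this] show ?thesis unfolding differentiable_def by blast
qed

lemma binet_cauchy: "dt (cr a b) (cr u v) = dt a u * dt b v - dt a v * dt b (u :: 'k::field^3)"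
  by (simp add: v3 algebra_simps)

lemma dt_cr_rotate: "dt e (cr u v) = dt (cr e u) (v :: 'k::field^3)"
  by (simp add: v3 algebra_simps)

lemma dt_self_pos: "n \<noteq> 0 ==> dt n n > (0::real)"
proof -
  assume "n \<noteq> 0"
  then obtain i where "n $ i \<noteq> 0" using nonzero_nth by blast
  then have "0 < (\<Sum>i\<in>UNIV. n $ i * n $ i)" by (intro sum_pos2[of _ i]) (auto simp: zero_less_mult_iff)
  then show ?thesis by (simp add: dt_def)
qed

section \<open>Real components of the curve are geodesic circles on the torus\<close>

locale real_curve = polynomial_self_map \<omega>1 \<omega>2 \<phi> "zero_set (complexify G)" "evalmap (complexify_map F)" d
  for \<omega>1 \<omega>2 :: complex and \<phi> :: "complex => complex proj2" and G :: "real poly3" and F :: "real polymap" and d :: nat +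
  fixes m :: nat and e :: "real ^ 3" and \<psi> :: "real => real proj2" and a :: int and b :: real
  assumes F: "rational_map d F" and elem: "elementary F (to_proj2 e)" and e: "e \<noteq> 0"
    and hom: "homogeneous m G" and m: "0 < m"
    and smooth: "\<And>v. v \<noteq> 0 ==> eval3 (complexify G) v = 0 ==> grad (eval3 (complexify G)) v \<noteq> 0"
    and \<psi>: "continuous_on UNIV \<psi>" and \<psi>_eq: "\<And>s t. \<psi> s = \<psi> t \<longleftrightarrow> s - t \<in> \<int>" and \<psi>_G: "range \<psi> \<subseteq> zero_set G"
    and semi: "\<And>t. ratmap F (\<psi> t) = \<psi> (of_int a * t + b)"
begin

lemma on_complex: "v \<noteq> 0 ==> to_proj2 v \<in> zero_set (complexify G) \<longleftrightarrow> eval3 (complexify G) v = 0"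
  by (rule zero_set_iff[where m = m]) (simp_all add: homogeneous_complexify hom)

lemma curve_point: "v \<noteq> 0 ==> to_proj2 v = \<psi> t ==> eval3 G v = 0"
  using zero_set_iff[OF hom, of v] \<psi>_G by auto

lemma invar:
  assumes v: "v \<noteq> 0" "eval3 G v = 0" shows "evalmap F v \<noteq> 0 \<and> eval3 G (evalmap F v) = 0"
proof -
  have cv: "cv v \<noteq> 0" using v(1) by (simp add: cv_0_iff)
  have "to_proj2 (cv v) \<in> zero_set (complexify G)" using on_complex[OF cv] v(2) by (simp add: eval3_complexify)
  then have "cv (evalmap F v) \<noteq> 0 \<and> to_proj2 (cv (evalmap F v)) \<in> zero_set (complexify G)"
    using f_C[OF cv] by (simp add: evalmap_complexify)
  then show ?thesis using on_complex[of "cv (evalmap F v)"] by (simp add: eval3_complexify cv_0_iff)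
qed

text \<open>A lift of the parametrization to the universal covering differs from a linear function by a bounded
  function on which the expanding multiplier acts; such a function is constant.\<close>

lemma linear_parametrization:
  obtains \<omega> c where "\<omega> \<noteq> 0" "\<And>t. cproj (\<psi> t) = \<phi> (of_real t * \<omega> + c)" "1 < \<bar>real_of_int a\<bar>"
proof -
  obtain \<alpha> \<beta> where sem: "\<And>v t. v \<noteq> 0 ==> to_proj2 v = \<phi> t ==>
      evalmap (complexify_map F) v \<noteq> 0 \<and> to_proj2 (evalmap (complexify_map F) v) = \<phi> (\<alpha> * t + \<beta>)"
    and \<alpha>: "1 < norm \<alpha>" by (rule affine_lift) blast
  have Y: "cproj (\<psi> t) \<in> zero_set (complexify G)" for t
  proof -
    obtain v where v: "\<psi> t = to_proj2 v" "v \<noteq> 0" by (rule to_proj2_cases)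
    have "eval3 G v = 0" by (rule curve_point[OF v(2) v(1)[symmetric]])
    then show ?thesis using v on_complex[of "cv v"] by (simp add: cproj_to_proj2 eval3_complexify cv_0_iff)
  qed
  have contY: "continuous_on UNIV (\<lambda>t. cproj (\<psi> t))" by (rule continuous_on_compose2[OF continuous_cproj \<psi>]) simp
  obtain \<gamma> where \<gamma>: "continuous_on UNIV \<gamma>" "\<And>t. \<phi> (\<gamma> t) = cproj (\<psi> t)" by (rule continuous_lift[OF contY Y]) blast
  have step: "\<phi> (\<gamma> (of_int a * t + b)) = \<phi> (\<alpha> * \<gamma> t + \<beta>)" for t
  proof -
    obtain v where v: "\<psi> t = to_proj2 v" "v \<noteq> 0" by (rule to_proj2_cases)
    have Fv: "evalmap F v \<noteq> 0" using invar[OF v(2) curve_point[OF v(2) v(1)[symmetric]]] by simp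
    have "\<psi> (of_int a * t + b) = to_proj2 (evalmap F v)" using semi[of t] ratmap_to_proj2[OF F v(2) Fv] v(1) by simp
    then have "cproj (\<psi> (of_int a * t + b)) = to_proj2 (cv (evalmap F v))" using cproj_to_proj2[OF Fv] by simp
    also have "\<dots> = to_proj2 (evalmap (complexify_map F) (cv v))" by (simp add: evalmap_complexify)
    also have "\<dots> = \<phi> (\<alpha> * \<gamma> t + \<beta>)" using sem[of "cv v" "\<gamma> t"] v cproj_to_proj2[OF v(2)] \<gamma>(2)[of t] by (simp add: cv_0_iff)
    finally show ?thesis by (simp add: \<gamma>(2))
  qed
  have \<gamma>c: "continuous_on UNIV (\<lambda>t. \<gamma> (f t))" if "continuous_on UNIV f" for f :: "real => real"
    by (rule continuous_on_compose2[OF \<gamma>(1) that]) simp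
  obtain \<omega> where \<omega>: "\<And>t. \<gamma> (t + 1) - \<gamma> t = \<omega>"
  proof (rule continuous_\<Omega>_valued_constant[of "\<lambda>t. \<gamma> (t + 1) - \<gamma> t"])
    show "continuous_on UNIV (\<lambda>t. \<gamma> (t + 1) - \<gamma> t)" by (intro continuous_intros \<gamma>c \<gamma>(1))
    show "\<gamma> (t + 1) - \<gamma> t \<in> \<Omega>" for t
    proof -
      have "\<psi> (t + 1) = \<psi> t" using \<psi>_eq[of "t + 1" t] by simp
      then show ?thesis using \<phi>_eq[of "\<gamma> (t + 1)" "\<gamma> t"] \<gamma>(2) by simp
    qed
  qed blast
  obtain \<kappa> where \<kappa>: "\<And>t. \<gamma> (of_int a * t + b) - (\<alpha> * \<gamma> t + \<beta>) = \<kappa>"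
  proof (rule continuous_\<Omega>_valued_constant[of "\<lambda>t. \<gamma> (of_int a * t + b) - (\<alpha> * \<gamma> t + \<beta>)"])
    show "continuous_on UNIV (\<lambda>t. \<gamma> (of_int a * t + b) - (\<alpha> * \<gamma> t + \<beta>))" by (intro continuous_intros \<gamma>c \<gamma>(1))
    show "\<gamma> (of_int a * t + b) - (\<alpha> * \<gamma> t + \<beta>) \<in> \<Omega>" for t
      using \<phi>_eq[of "\<gamma> (of_int a * t + b)" "\<alpha> * \<gamma> t + \<beta>"] step[of t] by blast
  qed blast
  define \<delta> where "\<delta> t = \<gamma> t - of_real t * \<omega>" for t
  have per1: "\<delta> (t + 1) = \<delta> t" for t using \<omega>[of t] by (simp add: \<delta>_def algebra_simps)
  have pern: "\<delta> (t + of_nat n) = \<delta> t" for t n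
  proof (induction n)
    case (Suc n)
    have "\<delta> (t + of_nat (Suc n)) = \<delta> ((t + of_nat n) + 1)" by (simp add: add_ac)
    then show ?case using per1[of "t + of_nat n"] Suc by simp
  qed simp
  have per: "\<delta> (t + of_int k) = \<delta> t" for t k
  proof (cases "0 \<le> k")
    case True
    then show ?thesis using pern[of t "nat k"] by simp
  next
    case False
    then show ?thesis using pern[of "t + of_int k" "nat (- k)"] by simp
  qed
  have dstep: "\<gamma> (of_int a * t + b) - \<gamma> (of_int a * s + b) = \<alpha> * (\<gamma> t - \<gamma> s)" for s t
  proof -
    have "\<gamma> (of_int a * t + b) = \<alpha> * \<gamma> t + \<beta> + \<kappa>" "\<gamma> (of_int a * s + b) = \<alpha> * \<gamma> s + \<beta> + \<kappa>"
      using \<kappa>[of t] \<kappa>[of s] by (simp_all add: algebra_simps)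
    then show ?thesis by (simp add: algebra_simps)
  qed
  have \<alpha>\<omega>: "\<alpha> * \<omega> = of_int a * \<omega>"
  proof -
    have "\<gamma> (b + of_int a) - \<gamma> b = of_int a * \<omega>" using per[of b a] by (simp add: \<delta>_def algebra_simps)
    moreover have "\<gamma> (b + of_int a) - \<gamma> b = \<alpha> * (\<gamma> 1 - \<gamma> 0)" using dstep[of 1 0] by (simp add: add.commute)
    moreover have "\<gamma> 1 - \<gamma> 0 = \<omega>" using \<omega>[of 0] by simp
    ultimately show ?thesis by simp
  qed
  have \<delta>step: "\<delta> (of_int a * t + b) - \<delta> (of_int a * s + b) = \<alpha> * (\<delta> t - \<delta> s)" for s t
  proof -
    have "\<delta> (of_int a * t + b) - \<delta> (of_int a * s + b) =
        (\<gamma> (of_int a * t + b) - \<gamma> (of_int a * s + b)) - of_real (t - s) * (of_int a * \<omega>)"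
      by (simp add: \<delta>_def algebra_simps)
    also have "\<dots> = \<alpha> * (\<gamma> t - \<gamma> s) - of_real (t - s) * (\<alpha> * \<omega>)" by (simp only: dstep \<alpha>\<omega>)
    also have "\<dots> = \<alpha> * (\<delta> t - \<delta> s)" by (simp add: \<delta>_def algebra_simps)
    finally show ?thesis .
  qed
  have "continuous_on {0..1} \<delta>" unfolding \<delta>_def
    by (intro continuous_intros continuous_on_subset[OF \<gamma>(1)]) auto
  then have "bounded (\<delta> ` {0..1})" by (intro compact_imp_bounded compact_continuous_image) auto
  then obtain M where "\<forall>x\<in>\<delta> ` {0..1}. norm x \<le> M" unfolding bounded_iff by blast
  then have M: "\<And>t. t \<in> {0..1} ==> norm (\<delta> t) \<le> M" by blast
  have M': "norm (\<delta> t) \<le> M" for t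
  proof -
    have "\<delta> t = \<delta> (frac t)" using per[of "frac t" "\<lfloor>t\<rfloor>"] by (simp add: frac_def)
    then show ?thesis using M[of "frac t"] frac_ge_0[of t] frac_lt_1[of t] by simp
  qed
  have const: "\<delta> t = \<delta> s" for s t
  proof (rule ccontr)
    assume ne: "\<delta> t \<noteq> \<delta> s"
    have it: "\<exists>x y. \<delta> x - \<delta> y = \<alpha> ^ n * (\<delta> t - \<delta> s)" for n
    proof (induction n)
      case (Suc n)
      then obtain x y where xy: "\<delta> x - \<delta> y = \<alpha> ^ n * (\<delta> t - \<delta> s)" by blast
      have "\<delta> (of_int a * x + b) - \<delta> (of_int a * y + b) = \<alpha> ^ Suc n * (\<delta> t - \<delta> s)"
        unfolding \<delta>step xy by simp
      then show ?case by blast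
    qed auto
    obtain n where n: "2 * M / norm (\<delta> t - \<delta> s) < norm \<alpha> ^ n" using real_arch_pow[OF \<alpha>] by blast
    obtain x y where xy: "\<delta> x - \<delta> y = \<alpha> ^ n * (\<delta> t - \<delta> s)" using it by blast
    have "norm (\<delta> x - \<delta> y) \<le> 2 * M" using norm_triangle_ineq4[of "\<delta> x" "\<delta> y"] M'[of x] M'[of y] by linarith
    moreover have "2 * M < norm \<alpha> ^ n * norm (\<delta> t - \<delta> s)" using n ne by (simp add: divide_less_eq)
    ultimately show False unfolding xy by (simp add: norm_mult norm_power)
  qed
  define c where "c = \<delta> 0"
  have g: "\<gamma> t = of_real t * \<omega> + c" for t using const[of t 0] by (simp add: \<delta>_def c_def algebra_simps)
  have \<omega>0: "\<omega> \<noteq> 0"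
  proof
    assume "\<omega> = 0"
    then have "cproj (\<psi> (1/2)) = cproj (\<psi> 0)" using \<gamma>(2)[of "1/2"] \<gamma>(2)[of 0] g by simp
    then have "\<psi> (1/2) = \<psi> 0" by (rule cproj_inject)
    then have "(1/2::real) \<in> \<int>" using \<psi>_eq[of "1/2" 0] by simp
    then obtain i :: int where "(1/2::real) = of_int i" by (auto elim: Ints_cases)
    then have "real_of_int (2 * i) = real_of_int 1" by simp
    then have "2 * i = 1" by (simp only: of_int_eq_iff)
    then show False by presburger
  qed
  then have "\<alpha> = of_int a" using \<alpha>\<omega> by simp
  then have a: "1 < \<bar>real_of_int a\<bar>" using \<alpha> by simp
  have "cproj (\<psi> t) = \<phi> (of_real t * \<omega> + c)" for t using \<gamma>(2)[of t] g[of t] by simp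
  then show thesis by (rule that[OF \<omega>0 _ a])
qed

end

locale real_circle = real_curve +
  fixes \<omega> c :: complex
  assumes \<omega>: "\<omega> \<noteq> 0" and param: "\<And>t. cproj (\<psi> t) = \<phi> (of_real t * \<omega> + c)" and a: "1 < \<bar>real_of_int a\<bar>"
begin

definition z :: "real => complex" where "z t = of_real t * \<omega> + c"

lemma \<phi>_z: "v \<noteq> 0 ==> to_proj2 v = \<psi> t ==> cv v \<noteq> 0 \<and> to_proj2 (cv v) = \<phi> (z t)"
  using param[of t] cproj_to_proj2[of v] by (simp add: z_def cv_0_iff)

lemma real_lift:
  assumes "lift S h" "z t \<in> S" "v \<noteq> 0" "to_proj2 v = \<psi> t"
  obtains k where "k \<noteq> 0" "cv v = k *s h (z t)"
proof -
  have "cv v \<noteq> 0" "to_proj2 (cv v) = \<phi> (z t)" using \<phi>_z[OF assms(3,4)] by auto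
  then obtain k where "k \<noteq> 0" "cv v = k *s h (z t)" by (rule proj_lift[OF assms(1,2)])
  then show thesis by (rule that)
qed

lemma z_inj: "z s = z t \<longleftrightarrow> s = t" using \<omega> by (simp add: z_def)

lemma continuous_z: "continuous_on S z" unfolding z_def by (intro continuous_intros)

lemma islimpt_z:
  assumes "t islimpt A" "\<And>s. s \<in> A ==> z s \<in> B" shows "z t islimpt B"
proof -
  obtain f where f: "\<And>n. f n \<in> A - {t}" "f \<longlonglongrightarrow> t" using assms(1) unfolding islimpt_sequential by blast
  have "(\<lambda>n. z (f n)) \<longlonglongrightarrow> z t" unfolding z_def by (intro tendsto_intros f(2))
  moreover have "\<forall>n. z (f n) \<in> B - {z t}" using f(1) assms(2) z_inj by auto
  ultimately show ?thesis unfolding islimpt_sequential by (intro exI[of _ "\<lambda>n. z (f n)"]) simp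
qed

lemma isolated: assumes n: "n \<noteq> 0" shows "\<not> t islimpt {s. dt n (rep_proj2 (\<psi> s)) = 0}"
proof
  assume lim: "t islimpt {s. dt n (rep_proj2 (\<psi> s)) = 0}"
  have "z t islimpt Rl (cv n)"
  proof (rule islimpt_z[OF lim])
    fix s assume s: "s \<in> {s. dt n (rep_proj2 (\<psi> s)) = 0}"
    have "cv (rep_proj2 (\<psi> s)) \<noteq> 0 \<and> to_proj2 (cv (rep_proj2 (\<psi> s))) = \<phi> (z s)" by (rule \<phi>_z[OF rep_proj2_nonzero to_proj2_rep])
    then have "z s \<in> Rl (cv n) \<longleftrightarrow> dt (cv n) (cv (rep_proj2 (\<psi> s))) = 0" using Rl_iff by blast
    then show "z s \<in> Rl (cv n)" using s by (simp add: cv_dt)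
  qed
  then show False using line_isolated[of "cv n"] n by (simp add: cv_0_iff)
qed

lemma center_off: "eval3 G e \<noteq> 0"
proof
  assume Ge: "eval3 G e = 0"
  show False
  proof (rule center_not_on_curve[where \<psi> = \<psi> and a = "of_int a", OF F elem e isolated])
    show "ratmap F (\<psi> t) = \<psi> (of_int a * t + b)" for t by (rule semi)
    show "1 < norm (real_of_int a)" using a by simp
    show "evalmap F (rep_proj2 (\<psi> t)) \<noteq> 0" for t
      using invar[OF rep_proj2_nonzero curve_point[OF rep_proj2_nonzero to_proj2_rep]] by blast
    show "evalmap F e \<noteq> 0" using invar[OF e Ge] by simp
    show "\<exists>w. cr e (jac (evalmap F) e w) \<noteq> 0" if "cr e (evalmap F e) = 0"
    proof (rule ccontr)
      assume "\<nexists>w. cr e (jac (evalmap F) e w) \<noteq> 0"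
      then have no: "cr (cv e) (jac (evalmap (complexify_map F)) (cv e) (cv w)) = 0" for w
        by (simp add: jac_cv cv_cr cv_0)
      have "to_proj2 (cv e) \<in> zero_set (complexify G)" using on_complex[of "cv e"] e Ge by (simp add: cv_0_iff eval3_complexify)
      then have "\<exists>w. cr (cv e) (jac (evalmap (complexify_map F)) (cv e) w) \<noteq> 0"
        by (intro etale_at_fixed_point) (simp_all add: e that cv_0_iff evalmap_complexify cv_cr)
      then obtain w where w: "cr (cv e) (jac (evalmap (complexify_map F)) (cv e) w) \<noteq> 0" by blast
      define x y where "x = (\<chi> i. Re (w $ i))" and "y = (\<chi> i. Im (w $ i))"
      have dec: "w = cv x + \<i> *s cv y" by (simp add: x_def y_def vec_eq_iff complex_eq)
      have "cr (cv e) (jac (evalmap (complexify_map F)) (cv e) (cv x + \<i> *s cv y)) = 0"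
        by (simp only: jac_add jac_smult cr_add cr_smult no smult_zero add_0)
      then have "cr (cv e) (jac (evalmap (complexify_map F)) (cv e) w) = 0" by (simp only: dec)
      then show False using w by simp
    qed
    show "(1::real) \<noteq> 0" "\<psi> (t + 1) = \<psi> t" for t using \<psi>_eq[of "t + 1" t] by auto
  qed
qed

lemma complex_off:
  assumes v: "v \<noteq> 0" "to_proj2 v = \<phi> t" shows "cr (cv e) v \<noteq> 0"
proof
  assume "cr (cv e) v = 0"
  moreover have "cv e \<noteq> 0" using e by (simp add: cv_0_iff)
  ultimately obtain k where k: "v = k *s cv e" by (rule cr_eq_0D)
  then have "k \<noteq> 0" using v(1) by auto
  have "eval3 (complexify G) v = 0" using on_complex[OF v(1)] v(2) by simp
  moreover have "eval3 (complexify G) v = k ^ m * eval3 (complexify G) (cv e)"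
    unfolding k by (rule eval3_scale) (simp add: homogeneous_complexify hom)
  ultimately show False using center_off \<open>k \<noteq> 0\<close> by (simp add: eval3_complexify)
qed

lemma real_off:
  assumes v: "v \<noteq> 0" "to_proj2 v = \<psi> t" shows "cr e v \<noteq> 0"
  using complex_off[of "cv v"] \<phi>_z[OF v] by (auto simp: cv_cr cv_0_iff)

text \<open>The real chart is the real part of the complex one: on real points the slope is real, and
  the complex coordinate is an affine function of the real parameter.\<close>

lemma slope_chart_\<psi>:
  assumes t0: "z t0 \<notin> tangential (cv e)"
  shows "slope_chart e \<psi> t0"
proof -
  have ce: "cv e \<noteq> 0" using e by (simp add: cv_0_iff)
  obtain S h i j D \<sigma> where h: "lift S h" "z t0 \<in> S" and \<sigma>: "\<sigma> holomorphic_on D" "open D" and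
    s: "\<And>s. s \<in> S ==> cr (cv e) (h s) $ i \<noteq> 0 \<and> cr (cv e) (h s) $ j / cr (cv e) (h s) $ i \<in> D \<and>
      \<sigma> (cr (cv e) (h s) $ j / cr (cv e) (h s) $ i) = s"
    by (rule slope_inverse[OF ce t0]) blast
  have "h (z t0) \<noteq> 0" using h by (simp add: lift_def)
  then obtain k where k: "h (z t0) $ k \<noteq> 0" using nonzero_nth by blast
  define S1 where "S1 = S \<inter> (\<lambda>s. h s $ k) -` (- {0})"
  have hol: "(\<lambda>s. h s $ l) holomorphic_on S" "open S" for l using h(1) by (auto simp: lift_def)
  have S1: "open S1" unfolding S1_def
    by (intro continuous_open_preimage holomorphic_on_imp_continuous_on hol) auto
  define R where "R = z -` S1"
  have R: "open R" unfolding R_def by (rule open_vimage[OF S1 continuous_z])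
  define hr :: "real => real^3" where "hr t = (\<chi> l. Re (h (z t) $ l / h (z t) $ k))" for t
  have main: "\<exists>\<kappa> \<mu>. \<kappa> \<noteq> 0 \<and> cv (hr t) = \<kappa> *s h (z t) \<and> v = \<mu> *s hr t"
    if t: "t \<in> R" and v: "v \<noteq> 0" "to_proj2 v = \<psi> t" for t v
  proof -
    have zS: "z t \<in> S" "h (z t) $ k \<noteq> 0" using t by (auto simp: R_def S1_def)
    obtain q where q: "q \<noteq> 0" "cv v = q *s h (z t)" by (rule real_lift[OF h(1) zS(1) v])
    have vl: "complex_of_real (v $ l) = q * h (z t) $ l" for l using arg_cong[OF q(2), of "\<lambda>x. x $ l"] by simp
    have vk: "v $ k \<noteq> 0" using vl[of k] q(1) zS(2) by auto
    have ratio: "h (z t) $ l / h (z t) $ k = of_real (v $ l / v $ k)" for l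
      using vl[of l] vl[of k] q(1) zS(2) vk by (simp add: divide_simps)
    have hv: "hr t = (1 / v $ k) *s v" by (simp add: hr_def ratio vec_eq_iff)
    have "v = v $ k *s hr t" unfolding hv using vk by (simp add: vector_smult_assoc)
    moreover have "cv (hr t) = (of_real (1 / v $ k) * q) *s h (z t)" unfolding hv cv_smult q(2) by (simp add: vector_smult_assoc)
    moreover have "of_real (1 / v $ k) * q \<noteq> 0" using vk q(1) by simp
    ultimately show ?thesis by blast
  qed
  have ratio: "cr e (hr t) $ i \<noteq> 0 \<and> of_real (cr e (hr t) $ j / cr e (hr t) $ i) = cr (cv e) (h (z t)) $ j / cr (cv e) (h (z t)) $ i"
    if t: "t \<in> R" for t
  proof -
    obtain \<kappa> where \<kappa>: "\<kappa> \<noteq> 0" "cv (hr t) = \<kappa> *s h (z t)" using main[OF t rep_proj2_nonzero to_proj2_rep] by blast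
    have l: "complex_of_real (cr e (hr t) $ l) = \<kappa> * cr (cv e) (h (z t)) $ l" for l
    proof -
      have eq: "cv (cr e (hr t)) = \<kappa> *s cr (cv e) (h (z t))" by (simp only: cv_cr[symmetric] \<kappa>(2) cr_smult)
      show ?thesis using arg_cong[OF eq, of "\<lambda>x. x $ l"] by simp
    qed
    have "cr (cv e) (h (z t)) $ i \<noteq> 0" using s[of "z t"] t by (simp add: R_def S1_def)
    then have "cr e (hr t) $ i \<noteq> 0" using l[of i] \<kappa>(1) by auto
    then show ?thesis using \<kappa>(1) by (simp add: l)
  qed
  define \<sigma>r where "\<sigma>r y = Re ((\<sigma> (of_real y) - c) / \<omega>)" for y
  define Dr where "Dr = {y. complex_of_real y \<in> D}"
  have Dr: "open Dr"
  proof -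
    have "open (complex_of_real -` D)" by (rule open_vimage[OF \<sigma>(2)]) (intro continuous_intros)
    then show ?thesis by (simp add: Dr_def vimage_def)
  qed
  have "\<forall>t\<in>R. cr e (hr t) $ i \<noteq> 0 \<and> cr e (hr t) $ j / cr e (hr t) $ i \<in> Dr \<and> \<sigma>r (cr e (hr t) $ j / cr e (hr t) $ i) = t"
  proof
    fix t assume t: "t \<in> R"
    then have "z t \<in> S" by (simp add: R_def S1_def)
    from s[OF this] show "cr e (hr t) $ i \<noteq> 0 \<and> cr e (hr t) $ j / cr e (hr t) $ i \<in> Dr \<and> \<sigma>r (cr e (hr t) $ j / cr e (hr t) $ i) = t"
      using ratio[OF t] \<omega> unfolding Dr_def \<sigma>r_def mem_Collect_eq by (simp add: z_def)
  qed
  moreover have "\<forall>t\<in>R. \<forall>v. v \<noteq> 0 \<and> to_proj2 v = \<psi> t --> (\<exists>c. cr e v = c *s cr e (hr t))"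
  proof (intro ballI allI impI)
    fix t v assume "t \<in> R" "v \<noteq> 0 \<and> to_proj2 v = \<psi> t"
    then obtain \<mu> where "v = \<mu> *s hr t" using main by blast
    then have "cr e v = \<mu> *s cr e (hr t)" by (simp only: cr_smult)
    then show "\<exists>c. cr e v = c *s cr e (hr t)" by blast
  qed
  moreover have "\<forall>l. (\<lambda>t. hr t $ l) differentiable_on R"
  proof
    fix l
    have "(\<lambda>t. hr t $ l) differentiable (at t)" if t: "t \<in> R" for t
    proof -
      have "z t \<in> S1" using t by (simp add: R_def)
      moreover have "(\<lambda>s. h s $ l / h s $ k) holomorphic_on S1"
        by (intro holomorphic_intros holomorphic_on_subset[OF hol(1)]) (auto simp: S1_def)
      ultimately have "(\<lambda>s. h s $ l / h s $ k) field_differentiable at (z t)" using S1 holomorphic_on_imp_differentiable_at by blast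
      then show ?thesis using real_part_differentiable[of "\<lambda>s. h s $ l / h s $ k" t \<omega> c] by (simp add: hr_def z_def)
    qed
    then show "(\<lambda>t. hr t $ l) differentiable_on R" using R by (simp add: differentiable_on_def differentiable_at_withinI)
  qed
  moreover have "\<sigma>r differentiable_on Dr"
  proof -
    have "\<sigma>r differentiable (at y)" if "y \<in> Dr" for y
    proof -
      have "(\<lambda>s. (\<sigma> s - c) / \<omega>) holomorphic_on D" using \<omega> by (intro holomorphic_intros \<sigma>(1)) auto
      then have "(\<lambda>s. (\<sigma> s - c) / \<omega>) field_differentiable at (of_real y * 1 + 0)"
        using that \<sigma>(2) holomorphic_on_imp_differentiable_at by (auto simp: Dr_def)
      then show ?thesis using real_part_differentiable[of "\<lambda>s. (\<sigma> s - c) / \<omega>" y 1 0] by (simp add: \<sigma>r_def[abs_def])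
    qed
    then show ?thesis by (simp add: differentiable_on_def differentiable_at_withinI)
  qed
  moreover have "t0 \<in> R" using h(2) k by (simp add: R_def S1_def)
  ultimately show ?thesis using R unfolding slope_chart_def
    by (intro exI[of _ R] exI[of _ hr] exI[of _ i] exI[of _ j] exI[of _ Dr] exI[of _ \<sigma>r]) simp
qed

lemma countable_bad: "countable {t. \<not> slope_chart e \<psi> t}"
proof -
  have "countable (tangential (cv e))" using e by (intro countable_tangential complex_off) (simp_all add: cv_0_iff)
  moreover have "z ` {t. z t \<in> tangential (cv e)} \<subseteq> tangential (cv e)" by auto
  ultimately have "countable (z ` {t. z t \<in> tangential (cv e)})" using countable_subset by blast
  then have "countable {t. z t \<in> tangential (cv e)}" by (rule countable_image_inj_on) (simp add: inj_on_def z_inj)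
  then show ?thesis by (rule countable_subset[rotated]) (use slope_chart_\<psi> in blast)
qed

end

lemma fundamental_domain_real: "fundamental_domain {0..<1::real} \<int>"
proof
  show "countable (\<int> :: real set)" by (simp add: Ints_def)
  fix x :: real
  show "\<exists>!\<omega>. \<omega> \<in> \<int> \<and> x + \<omega> \<in> {0..<1}"
  proof (rule ex1I[of _ "- of_int \<lfloor>x\<rfloor>"])
    show "- of_int \<lfloor>x\<rfloor> \<in> \<int> \<and> x + - of_int \<lfloor>x\<rfloor> \<in> {0..<1}" by (auto, linarith+)
    fix \<omega> :: real assume w: "\<omega> \<in> \<int> \<and> x + \<omega> \<in> {0..<1}"
    then obtain k where k: "\<omega> = of_int k" by (auto elim: Ints_cases)
    then have "\<lfloor>x\<rfloor> = - k" using w by (intro floor_unique) auto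
    then show "\<omega> = - of_int \<lfloor>x\<rfloor>" by (simp add: k)
  qed
qed (auto simp: emeasure_lborel_Ico)

sublocale real_circle \<subseteq> E: elementary_parametrization "{0..<1}" \<int> "of_int a" b F d e \<psi>
proof -
  interpret R: fundamental_domain "{0..<1::real}" \<int> by (rule fundamental_domain_real)
  interpret A: torus_affine "{0..<1::real}" \<int> "of_int a" b
    by unfold_locales (use a in auto)
  show "elementary_parametrization {0..<1} \<int> (of_int a) b F d e \<psi>"
  proof unfold_locales
    show "ratmap F (\<psi> t) = \<psi> (A.T t)" for t by (simp add: A.T_def semi)
    show "R.periodic \<psi>" by (auto simp: R.periodic_def \<psi>_eq)
    show "evalmap F v \<noteq> 0 \<and> cr e v \<noteq> 0" if "v \<noteq> 0" "to_proj2 v = \<psi> t" for v t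
      using real_off[OF that] invar[OF that(1) curve_point[OF that]] by simp
  qed (fact F elem e \<psi> countable_bad)+
qed

section \<open>Every line through the center meets the real curve\<close>

text \<open>A fixed-point free involution needs an even number of points. The involution is given by its graph.\<close>

lemma no_involution_on_three_points:
  assumes "card Z = 3" and ex: "\<And>y. y \<in> Z ==> \<exists>y'\<in>Z. rel y y'" and sym: "\<And>y y'. rel y y' ==> rel y' y"
    and fn: "\<And>y y1 y2. rel y y1 ==> rel y y2 ==> y1 = y2" and irrefl: "\<And>y. y \<in> Z ==> \<not> rel y y"
  shows False
proof -
  obtain x y w where Z: "Z = {x, y, w}" "x \<noteq> y" "y \<noteq> w" "x \<noteq> w" using assms(1) unfolding card_3_iff by blast
  have x: "rel x y \<or> rel x w" and y: "rel y x \<or> rel y w" and w: "rel w x \<or> rel w y"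
    using ex[of x] ex[of y] ex[of w] irrefl[of x] irrefl[of y] irrefl[of w] Z(1) by auto
  show False
  proof (cases "rel x y")
    case True
    then have "\<not> rel x w" "\<not> rel y w" using fn[OF True, of w] fn[OF sym[OF True], of w] Z by auto
    then show False using w sym[of w x] sym[of w y] by blast
  next
    case False
    then have xw: "rel x w" using x by blast
    then have "\<not> rel w y" using fn[OF sym[OF xw], of y] Z by auto
    then show False using y False sym[of y x] sym[of y w] by blast
  qed
qed

lemma card_simple_roots:
  fixes P :: "complex poly"
  assumes P: "P \<noteq> 0" and simple: "\<And>y. poly P y = 0 ==> poly (pderiv P) y \<noteq> 0"
  shows "card {y. poly P y = 0} = degree P"
proof -
  have rs: "rsquarefree P" unfolding rsquarefree_roots using simple by blast
  have ord: "order y P = 1" if y: "poly P y = 0" for y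
  proof -
    have "\<forall>y. order y P = 0 \<or> order y P = 1" using rs unfolding rsquarefree_def by (rule conjunct2)
    then have "order y P = 0 \<or> order y P = 1" by (rule spec)
    moreover have "order y P \<noteq> 0" using y P order_root[of P y] by simp
    ultimately show ?thesis by simp
  qed
  have "(\<Prod>y|poly P y = 0. [:-y, 1:] ^ order y P) = (\<Prod>y|poly P y = 0. [:-y, 1:])"
    by (rule prod.cong) (simp_all add: ord)
  then have dec: "smult (lead_coeff P) (\<Prod>y|poly P y = 0. [:-y, 1:]) = P"
    using complex_poly_decompose[of P] by simp
  have "degree P = degree (\<Prod>y|poly P y = 0. [:-y, 1:])"
    using arg_cong[OF dec, of degree] P by simp
  also have "\<dots> = (\<Sum>y|poly P y = 0. degree [:-y, 1:])" by (rule degree_prod_sum_eq) simp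
  finally show ?thesis by simp
qed

context real_circle
begin

definition r where "r t = rep_proj2 (\<psi> t)"
definition TT :: "real => real" where "TT t = of_int a * t + b"

lemma r: "r t \<noteq> 0" "to_proj2 (r t) = \<psi> t" by (simp_all add: r_def rep_proj2_nonzero)

lemma r_periodic: "r (t + of_int k) = r t"
proof -
  have "\<psi> (t + of_int k) = \<psi> t" by (simp add: \<psi>_eq)
  then show ?thesis by (simp add: r_def)
qed

lemma r_off: "cr e (r t) \<noteq> 0" by (rule real_off[OF r])

lemma cv_r: "cv (r t) \<noteq> 0" "to_proj2 (cv (r t)) = \<phi> (z t)" using \<phi>_z[OF r] by auto

lemma r_step: obtains k where "k \<noteq> 0" "evalmap F (r t) = k *s r (TT t)"
proof -
  have Fv: "evalmap F (r t) \<noteq> 0" using invar[OF r(1) curve_point[OF r]] by blast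
  have "to_proj2 (r (TT t)) = to_proj2 (evalmap F (r t))"
    using semi[of t] ratmap_to_proj2[OF F r(1) Fv] by (simp add: r(2) TT_def)
  then obtain k where k: "evalmap F (r t) = k *s r (TT t)" using to_proj2_eq_iff[OF r(1) Fv] by blast
  then have "k \<noteq> 0" using Fv by auto
  then show thesis using k by (rule that)
qed

text \<open>Elementarity: points on a common line through the center are mapped to such points.\<close>

lemma collinear_step:
  assumes "dt (cr e (r s)) (r t) = 0" shows "dt (cr e (r (TT s))) (r (TT t)) = 0"
proof -
  obtain k1 where k1: "k1 \<noteq> 0" "evalmap F (r s) = k1 *s r (TT s)" by (rule r_step)
  obtain k2 where k2: "k2 \<noteq> 0" "evalmap F (r t) = k2 *s r (TT t)" by (rule r_step)
  have "cr e (evalmap F (r s)) \<noteq> 0" using k1 r_off[of "TT s"] by (simp add: cr_smult smult_eq_0)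
  then obtain q where q: "cr e (evalmap F (r t)) = q *s cr e (evalmap F (r s))"
    by (rule elementary_parallel[OF F elem e r_off _ assms])
  then have eq: "k2 *s cr e (r (TT t)) = (q * k1) *s cr e (r (TT s))" by (simp add: k1(2) k2(2) cr_smult vector_smult_assoc)
  have "k2 *s cr e (r (TT t)) \<noteq> 0" using k2(1) r_off by (simp add: smult_eq_0)
  then have "q * k1 \<noteq> 0" unfolding eq by (auto simp: smult_eq_0)
  moreover have "(q * k1) * dt (cr e (r (TT s))) (r (TT t)) = k2 * dt (cr e (r (TT t))) (r (TT t))"
    unfolding dt_smult_left[symmetric] eq ..
  ultimately show ?thesis by simp
qed

lemma collinear_iterate:
  "dt (cr e (r s)) (r t) = 0 ==> dt (cr e (r ((TT ^^ n) s))) (r ((TT ^^ n) t)) = 0"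
  by (induction n) (simp_all add: collinear_step)

lemma iterate_TT: "(TT ^^ n) (t + x) = (TT ^^ n) t + of_int a ^ n * x"
  by (induction n) (simp_all add: TT_def algebra_simps)

end

text \<open>The slope \<open>p\<close> of the line joining the center to the moving point, normalized so that the missed line
  has infinite slope, is a real-analytic function on the circle. It attains a maximum, where it is a fold.\<close>

locale missed_line = real_circle +
  fixes n0 :: "real ^ 3"
  assumes n0: "n0 \<noteq> 0" "dt n0 e = 0" and miss: "\<And>t. dt n0 (rep_proj2 (\<psi> t)) \<noteq> 0"
begin

definition p where "p t = dt (cr e n0) (r t) / dt n0 (r t)"

lemma miss_r: "dt n0 (r t) \<noteq> 0" using miss by (simp add: r_def)

lemma p_eq: "p s = p t \<longleftrightarrow> dt (cr e (r s)) (r t) = 0"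
proof -
  have c: "cr (cr e n0) n0 = (- dt n0 n0) *s e"
    using cr_cr[of e n0 n0] n0(2) by (simp add: dt_comm[of e n0] vec_eq_iff)
  have "dt (cr e n0) (r s) * dt n0 (r t) - dt (cr e n0) (r t) * dt n0 (r s) = dt (cr (cr e n0) n0) (cr (r s) (r t))"
    by (rule binet_cauchy[symmetric])
  also have "\<dots> = - dt n0 n0 * dt (cr e (r s)) (r t)" unfolding c dt_cr_rotate cr_smult_left dt_smult_left ..
  finally have id: "dt (cr e n0) (r s) * dt n0 (r t) - dt (cr e n0) (r t) * dt n0 (r s) = - dt n0 n0 * dt (cr e (r s)) (r t)" .
  have "p s = p t \<longleftrightarrow> dt (cr e n0) (r s) * dt n0 (r t) - dt (cr e n0) (r t) * dt n0 (r s) = 0"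
    by (simp add: p_def frac_eq_eq miss_r)
  then show ?thesis unfolding id using dt_self_pos[OF n0(1)] by simp
qed

lemma p_periodic: "p (t + of_int k) = p t" by (simp add: p_def r_periodic)

lemma p_iterate: "p s = p t ==> p ((TT ^^ n) s) = p ((TT ^^ n) t)"
  unfolding p_eq by (rule collinear_iterate)

lemma p_local:
  obtains \<rho> f where "0 < \<rho>" "f holomorphic_on ball (z t) \<rho>" "\<And>s. z s \<in> ball (z t) \<rho> ==> of_real (p s) = f (z s)"
proof -
  obtain S h where h: "lift S h" "z t \<in> S" by (rule lift_exists)
  define q where "q s = dt (cv n0) (h s)" for s
  have hol: "q holomorphic_on S" unfolding q_def by (rule dt_lift_holomorphic[OF h(1)])
  have rel: "q (z s) \<noteq> 0 \<and> of_real (p s) = dt (cv (cr e n0)) (h (z s)) / q (z s)" if s: "z s \<in> S" for s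
  proof -
    obtain k where k: "k \<noteq> 0" "cv (r s) = k *s h (z s)" by (rule real_lift[OF h(1) s r])
    have d: "complex_of_real (dt n (r s)) = k * dt (cv n) (h (z s))" for n
      unfolding cv_dt[symmetric] k(2) by simp
    have "q (z s) \<noteq> 0" using d[of n0] miss_r[of s] by (auto simp: q_def)
    moreover have "complex_of_real (p s) = complex_of_real (dt (cr e n0) (r s)) / complex_of_real (dt n0 (r s))"
      by (simp add: p_def)
    ultimately show ?thesis using k(1) unfolding d q_def by simp
  qed
  have oS: "open S" using h(1) by (simp add: lift_def)
  have "open (S \<inter> q -` (- {0}))"
    by (intro continuous_open_preimage holomorphic_on_imp_continuous_on hol oS) auto
  moreover have "z t \<in> S \<inter> q -` (- {0})" using h(2) rel by simp
  ultimately obtain \<rho> where \<rho>: "0 < \<rho>" "ball (z t) \<rho> \<subseteq> S \<inter> q -` (- {0})" by (rule openE)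
  have "(\<lambda>s. dt (cv (cr e n0)) (h s) / q s) holomorphic_on ball (z t) \<rho>"
    by (intro holomorphic_intros holomorphic_on_subset[OF hol] holomorphic_on_subset[OF dt_lift_holomorphic[OF h(1)]])
      (use \<rho>(2) in auto)
  then show thesis using \<rho> rel by (intro that[of \<rho>]) auto
qed

lemma z_open: "open U ==> open {s. z s \<in> U}"
  using open_vimage[OF _ continuous_z[of UNIV]] by (simp add: vimage_def)

lemma isCont_z: "isCont z t"
  using continuous_z[of UNIV] continuous_on_eq_continuous_at[OF open_UNIV] by blast

lemma p_cont: "isCont p t"
proof -
  obtain \<rho> f where f: "0 < \<rho>" "f holomorphic_on ball (z t) \<rho>" "\<And>s. z s \<in> ball (z t) \<rho> ==> of_real (p s) = f (z s)"
    by (rule p_local) blast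
  have "isCont f (z t)"
    using holomorphic_on_imp_continuous_on[OF f(2)] continuous_on_eq_continuous_at[OF open_ball] f(1) by (metis centre_in_ball)
  from isCont_o2[OF isCont_z this] have "isCont (\<lambda>s. Re (f (z s))) t" by (rule continuous_Re)
  moreover have ev: "\<forall>\<^sub>F s in nhds t. p s = Re (f (z s))"
    unfolding eventually_nhds
  proof (intro exI[of _ "{s. z s \<in> ball (z t) \<rho>}"] conjI ballI)
    show "open {s. z s \<in> ball (z t) \<rho>}" by (rule z_open) simp
    show "t \<in> {s. z s \<in> ball (z t) \<rho>}" using f(1) by simp
    fix s assume "s \<in> {s. z s \<in> ball (z t) \<rho>}"
    then show "p s = Re (f (z s))" using f(3)[of s] by (metis Re_complex_of_real mem_Collect_eq)
  qed
  ultimately show ?thesis using isCont_cong[OF ev] by simp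
qed

lemma p_max: obtains t1 where "\<And>s. p s \<le> p t1"
proof -
  have "\<exists>x\<in>{0..1}. \<forall>y\<in>{0..1}. p y \<le> p x"
    by (rule continuous_attains_sup) (auto intro: continuous_at_imp_continuous_on p_cont)
  then obtain t1 where t1: "\<And>y. y \<in> {0..1} ==> p y \<le> p t1" by blast
  have "p s \<le> p t1" for s
  proof -
    have "p s = p (frac s)" using p_periodic[of "frac s" "\<lfloor>s\<rfloor>"] by (simp add: frac_def)
    then show ?thesis using t1[of "frac s"] frac_ge_0[of s] frac_lt_1[of s] by simp
  qed
  then show thesis by (rule that)
qed

lemma p_factor:
  assumes max: "\<And>s. p s \<le> p t1"
  obtains n H \<delta> where "even n" "0 < n" "isCont H 0" "0 < H 0" "0 < \<delta>" "\<And>\<tau>. \<bar>\<tau>\<bar> < \<delta> ==> p t1 - p (t1 + \<tau>) = \<tau> ^ n * H \<tau>"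
proof -
  obtain \<rho> f where f: "0 < \<rho>" "f holomorphic_on ball (z t1) \<rho>" "\<And>s. z s \<in> ball (z t1) \<rho> ==> of_real (p s) = f (z s)"
    by (rule p_local) blast
  define f0 where "f0 w = of_real (p t1) - f w" for w
  have cen: "z t1 \<in> ball (z t1) \<rho>" using f(1) by simp
  have f0z: "f0 (z t1) = 0" using f(3)[OF cen] by (simp add: f0_def)
  have hol: "f0 holomorphic_on ball (z t1) \<rho>" unfolding f0_def by (intro holomorphic_intros f(2))
  have nonconst: "\<not> f0 constant_on ball (z t1) \<rho>"
  proof
    assume "f0 constant_on ball (z t1) \<rho>"
    then have zero: "f0 w = 0" if "w \<in> ball (z t1) \<rho>" for w using that cen f0z unfolding constant_on_def by metis
    have sub: "{s. z s \<in> ball (z t1) \<rho>} \<subseteq> {s. dt (cr e (r t1)) (rep_proj2 (\<psi> s)) = 0}"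
    proof
      fix s assume "s \<in> {s. z s \<in> ball (z t1) \<rho>}"
      then have s: "z s \<in> ball (z t1) \<rho>" by simp
      have "complex_of_real (p t1) = of_real (p s)" using zero[OF s] f(3)[OF s] by (simp add: f0_def)
      then have "p t1 = p s" by simp
      then show "s \<in> {s. dt (cr e (r t1)) (rep_proj2 (\<psi> s)) = 0}" unfolding p_eq by (simp add: r_def)
    qed
    have "open {s. z s \<in> ball (z t1) \<rho>}" by (rule z_open) simp
    then have "t1 islimpt {s. z s \<in> ball (z t1) \<rho>}" using cen by (intro interior_limit_point) (simp add: interior_open)
    then have "t1 islimpt {s. dt (cr e (r t1)) (rep_proj2 (\<psi> s)) = 0}" using sub by (rule islimpt_subset)
    then show False using isolated[OF r_off] by blast
  qed
  obtain g q n where g: "0 < n" "0 < q" "ball (z t1) q \<subseteq> ball (z t1) \<rho>" "g holomorphic_on ball (z t1) q"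
    "\<And>w. w \<in> ball (z t1) q ==> f0 w = (w - z t1) ^ n * g w" "\<And>w. w \<in> ball (z t1) q ==> g w \<noteq> 0"
    by (rule holomorphic_factor_zero_nonconstant[OF hol open_ball connected_ball cen f0z nonconst]) blast
  define K where "K \<tau> = \<omega> ^ n * g (z (t1 + \<tau>))" for \<tau>
  define H where "H \<tau> = Re (K \<tau>)" for \<tau>
  define V where "V = {\<tau>. z (t1 + \<tau>) \<in> ball (z t1) q}"
  have "continuous_on UNIV (\<lambda>\<tau>. z (t1 + \<tau>))" by (rule continuous_on_compose2[OF continuous_z[of UNIV]]) (auto intro!: continuous_intros)
  then have V: "open V" unfolding V_def using open_vimage[OF open_ball] by (simp add: vimage_def)
  have V0: "0 \<in> V" using g(2) by (simp add: V_def)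
  have eq: "complex_of_real (p t1 - p (t1 + \<tau>)) = of_real (\<tau> ^ n) * K \<tau>" if \<tau>: "\<tau> \<in> V" for \<tau>
  proof -
    have b: "z (t1 + \<tau>) \<in> ball (z t1) q" using \<tau> by (simp add: V_def)
    then have "of_real (p (t1 + \<tau>)) = f (z (t1 + \<tau>))" using f(3) g(3) by blast
    then have "complex_of_real (p t1 - p (t1 + \<tau>)) = f0 (z (t1 + \<tau>))" by (simp add: f0_def)
    also have "\<dots> = (z (t1 + \<tau>) - z t1) ^ n * g (z (t1 + \<tau>))" by (rule g(5)[OF b])
    also have "z (t1 + \<tau>) - z t1 = of_real \<tau> * \<omega>" by (simp add: z_def algebra_simps)
    finally show ?thesis by (simp add: K_def power_mult_distrib mult_ac)
  qed
  have eqH: "p t1 - p (t1 + \<tau>) = \<tau> ^ n * H \<tau>" if "\<tau> \<in> V" for \<tau>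
    using arg_cong[OF eq[OF that], of Re] by (simp add: H_def)
  have im: "Im (K \<tau>) = 0" if "\<tau> \<in> V" "\<tau> \<noteq> 0" for \<tau>
    using arg_cong[OF eq[OF that(1)], of Im] that(2) by simp
  have cg: "isCont g (z (t1 + 0))"
    using holomorphic_on_imp_continuous_on[OF g(4)] continuous_on_eq_continuous_at[OF open_ball] g(2)
    by (metis centre_in_ball add_0_right)
  have "isCont (\<lambda>\<tau>. z (t1 + \<tau>)) 0" unfolding z_def by (intro continuous_intros)
  from isCont_o2[OF this cg] have cK: "isCont K 0" unfolding K_def by (intro continuous_intros)
  have cH: "isCont H 0" unfolding H_def by (rule continuous_Re[OF cK])
  have "((\<lambda>\<tau>. Im (K \<tau>)) \<longlongrightarrow> Im (K 0)) (at 0)" using continuous_Im[OF cK] by (simp add: isCont_def)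
  moreover have "((\<lambda>\<tau>. Im (K \<tau>)) \<longlongrightarrow> 0) (at 0)"
    by (rule tendsto_eventually) (use V V0 im in \<open>auto simp: eventually_at_topological\<close>)
  ultimately have "Im (K 0) = 0" using tendsto_unique[of "at (0::real)"] by simp
  moreover have "K 0 \<noteq> 0" using g(6)[of "z t1"] g(2) \<omega> by (simp add: K_def)
  ultimately have H0: "H 0 \<noteq> 0" by (simp add: H_def complex_eq_iff)
  have "(H \<longlongrightarrow> H 0) (nhds 0)" using cH by (simp add: isCont_def tendsto_at_iff_tendsto_nhds)
  then have "\<forall>\<^sub>F \<tau> in nhds 0. dist (H \<tau>) (H 0) < \<bar>H 0\<bar>" by (rule tendstoD) (use H0 in simp)
  moreover have "\<forall>\<^sub>F \<tau> in nhds 0. \<tau> \<in> V" by (rule eventually_nhds_in_open[OF V V0])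
  ultimately have "\<forall>\<^sub>F \<tau> in nhds 0. dist (H \<tau>) (H 0) < \<bar>H 0\<bar> \<and> \<tau> \<in> V" by (rule eventually_conj)
  then obtain \<delta> where \<delta>: "0 < \<delta>" "\<And>\<tau>. \<bar>\<tau>\<bar> < \<delta> ==> \<bar>H \<tau> - H 0\<bar> < \<bar>H 0\<bar> \<and> \<tau> \<in> V"
    unfolding eventually_nhds_metric by (auto simp: dist_real_def)
  have nn: "0 \<le> \<tau> ^ n * H \<tau>" if "\<bar>\<tau>\<bar> < \<delta>" for \<tau>
    using eqH[of \<tau>] \<delta>(2)[OF that] max[of "t1 + \<tau>"] by simp
  have H0pos: "0 < H 0"
  proof (rule ccontr)
    assume "\<not> 0 < H 0"
    then have "H (\<delta> / 2) < 0" using \<delta>(2)[of "\<delta> / 2"] \<delta>(1) H0 by auto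
    then have "(\<delta> / 2) ^ n * H (\<delta> / 2) < 0" using \<delta>(1) by (intro mult_pos_neg) auto
    then show False using nn[of "\<delta> / 2"] \<delta>(1) by auto
  qed
  have "even n"
  proof (rule ccontr)
    assume n: "odd n"
    have "0 < H (- \<delta> / 2)" using \<delta>(2)[of "- \<delta> / 2"] \<delta>(1) H0pos by auto
    moreover have "(- \<delta> / 2) ^ n < 0" using n \<delta>(1) by (simp add: power_less_zero_eq)
    ultimately have "(- \<delta> / 2) ^ n * H (- \<delta> / 2) < 0" by (intro mult_neg_pos)
    then show False using nn[of "- \<delta> / 2"] \<delta>(1) by auto
  qed
  then show thesis using g(1) cH H0pos \<delta> eqH by (intro that[of n H \<delta>]) auto
qed

text \<open>At the maximum \<open>p\<close> takes equal values at parameters whose distances to the maximum have a ratio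
  close to one, because the leading term of its Taylor expansion has even degree.\<close>

lemma p_reflect_near:
  assumes max: "\<And>s. p s \<le> p t1" and \<epsilon>: "0 < \<epsilon>" "\<epsilon> < 1"
  obtains \<tau>0 where "0 < \<tau>0" "\<And>\<tau>. 0 < \<tau> ==> \<tau> < \<tau>0 ==> \<exists>\<sigma>. (1 - \<epsilon>) * \<tau> \<le> \<sigma> \<and> \<sigma> \<le> (1 + \<epsilon>) * \<tau> \<and> p (t1 + \<tau>) = p (t1 - \<sigma>)"
proof -
  obtain n H \<delta> where n: "even n" "0 < n" and H: "isCont H 0" "0 < H 0" and \<delta>: "0 < \<delta>"
    "\<And>\<tau>. \<bar>\<tau>\<bar> < \<delta> ==> p t1 - p (t1 + \<tau>) = \<tau> ^ n * H \<tau>" by (rule p_factor[OF max]) blast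
  define A where "A = 1 - \<epsilon>"
  define B where "B = 1 + \<epsilon>"
  have AB: "0 < A" "A < 1" "1 < B" "B < 2" using \<epsilon> by (auto simp: A_def B_def)
  have HC: "isCont (\<lambda>\<tau>. H (- (q * \<tau>))) 0" for q
  proof -
    have "isCont (\<lambda>\<tau>. - (q * \<tau>)) 0" by (intro continuous_intros)
    moreover have "isCont H (- (q * 0))" using H(1) by simp
    ultimately show ?thesis by (rule isCont_o2)
  qed
  define D1 where "D1 \<tau> = B ^ n * H (- (B * \<tau>)) - H \<tau>" for \<tau>
  define D2 where "D2 \<tau> = H \<tau> - A ^ n * H (- (A * \<tau>))" for \<tau>
  have "1 < B ^ n" using AB n(2) by (simp add: one_less_power)
  then have D10: "0 < D1 0" using H(2) by (simp add: D1_def)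
  have "A ^ n < 1 ^ n" using AB n(2) by (intro power_strict_mono) auto
  then have D20: "0 < D2 0" using H(2) by (simp add: D2_def)
  have "isCont D1 0" "isCont D2 0" unfolding D1_def D2_def by (intro continuous_intros HC H(1))+
  then have "(D1 \<longlongrightarrow> D1 0) (nhds 0)" "(D2 \<longlongrightarrow> D2 0) (nhds 0)" by (simp_all add: isCont_def tendsto_at_iff_tendsto_nhds)
  then have "\<forall>\<^sub>F \<tau> in nhds 0. 0 < D1 \<tau>" "\<forall>\<^sub>F \<tau> in nhds 0. 0 < D2 \<tau>"
    using order_tendstoD(1) D10 D20 by blast+
  then have "\<forall>\<^sub>F \<tau> in nhds 0. 0 < D1 \<tau> \<and> 0 < D2 \<tau>" by (rule eventually_conj)
  then obtain \<delta>1 where \<delta>1: "0 < \<delta>1" "\<And>\<tau>. \<bar>\<tau>\<bar> < \<delta>1 ==> 0 < D1 \<tau> \<and> 0 < D2 \<tau>"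
    unfolding eventually_nhds_metric by (auto simp: dist_real_def)
  show thesis
  proof (rule that[of "min \<delta>1 (\<delta> / 2)"])
    show "0 < min \<delta>1 (\<delta> / 2)" using \<delta>1(1) \<delta>(1) by simp
    fix \<tau> assume \<tau>: "0 < \<tau>" "\<tau> < min \<delta>1 (\<delta> / 2)"
    have "B * \<tau> < 2 * \<tau>" "A * \<tau> < 1 * \<tau>" using \<tau>(1) AB by (intro mult_strict_right_mono; simp)+
    moreover have "\<tau> < \<delta>1" "\<tau> < \<delta> / 2" using \<tau>(2) by simp_all
    moreover have pos: "0 < A * \<tau>" "0 < B * \<tau>" using \<tau>(1) AB by simp_all
    ultimately have lt: "B * \<tau> < \<delta>" "A * \<tau> < \<delta>" "\<tau> < \<delta>" "\<tau> < \<delta>1" using \<tau>(1) by linarith+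
    have small: "\<bar>- (B * \<tau>)\<bar> < \<delta>" "\<bar>- (A * \<tau>)\<bar> < \<delta>" "\<bar>\<tau>\<bar> < \<delta>" "\<bar>\<tau>\<bar> < \<delta>1"
      using lt by (simp_all only: abs_minus_cancel abs_of_pos pos \<tau>(1))
    have refl: "p t1 - p (t1 - q * \<tau>) = \<tau> ^ n * (q ^ n * H (- (q * \<tau>)))" if "\<bar>- (q * \<tau>)\<bar> < \<delta>" for q
    proof -
      have "(- (q * \<tau>)) ^ n = \<tau> ^ n * q ^ n" using n(1) by (simp add: power_minus_even power_mult_distrib)
      then show ?thesis using \<delta>(2)[OF that] by (simp add: mult.assoc)
    qed
    have \<tau>n: "0 < \<tau> ^ n" using \<tau>(1) by simp
    have "H \<tau> < B ^ n * H (- (B * \<tau>))" "A ^ n * H (- (A * \<tau>)) < H \<tau>"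
      using \<delta>1(2)[OF small(4)] by (auto simp: D1_def D2_def)
    then have "\<tau> ^ n * H \<tau> < \<tau> ^ n * (B ^ n * H (- (B * \<tau>)))" "\<tau> ^ n * (A ^ n * H (- (A * \<tau>))) < \<tau> ^ n * H \<tau>"
      using \<tau>n by simp_all
    then have "p (t1 - B * \<tau>) \<le> p (t1 + \<tau>)" "p (t1 + \<tau>) \<le> p (t1 - A * \<tau>)"
      using refl[OF small(1)] refl[OF small(2)] \<delta>(2)[OF small(3)] by linarith+
    moreover have "A * \<tau> \<le> B * \<tau>" using AB \<tau>(1) by simp
    moreover have "isCont (\<lambda>\<sigma>. p (t1 - \<sigma>)) \<sigma>" for \<sigma>
    proof -
      have "isCont (\<lambda>\<sigma>. t1 - \<sigma>) \<sigma>" by (intro continuous_intros)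
      then show ?thesis using p_cont by (rule isCont_o2)
    qed
    then have "continuous_on {A * \<tau>..B * \<tau>} (\<lambda>\<sigma>. p (t1 - \<sigma>))" by (intro continuous_at_imp_continuous_on) blast
    ultimately have "\<exists>\<sigma>\<ge>A * \<tau>. \<sigma> \<le> B * \<tau> \<and> p (t1 - \<sigma>) = p (t1 + \<tau>)" by (rule IVT2')
    then show "\<exists>\<sigma>. (1 - \<epsilon>) * \<tau> \<le> \<sigma> \<and> \<sigma> \<le> (1 + \<epsilon>) * \<tau> \<and> p (t1 + \<tau>) = p (t1 - \<sigma>)"
      unfolding A_def B_def by (metis (no_types))
  qed
qed

text \<open>The expanding iterates magnify the approximate symmetry at the maximum to an exact global one.
  Even iterates avoid a distinction of signs.\<close>

lemma p_symmetric: obtains l where "\<And>s. p (l + s) = p (l - s)"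
proof -
  obtain t1 where max: "\<And>s. p s \<le> p t1" by (rule p_max) blast
  define A where "A = (real_of_int a)\<^sup>2"
  have "1 < \<bar>real_of_int a\<bar> ^ 2" by (rule one_less_power[OF a]) simp
  then have A: "1 < A" by (simp only: A_def power2_abs)
  define y where "y j = (TT ^^ (2 * j)) t1" for j
  have comp: "seq_compact {0..1::real}" by (intro compact_imp_seq_compact compact_Icc)
  have "\<forall>j. frac (y j) \<in> {0..1}" using frac_ge_0 frac_lt_1 less_imp_le by auto
  then obtain l \<rho> where l: "strict_mono (\<rho> :: nat => nat)" "((\<lambda>j. frac (y j)) \<circ> \<rho>) \<longlonglongrightarrow> l"
    using seq_compactE[OF comp, of "\<lambda>j. frac (y j)"] by metis
  have fr: "p (frac (y j) + x) = p (y j + x)" for j x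
    using p_periodic[of "frac (y j) + x" "\<lfloor>y j\<rfloor>"] by (simp add: frac_def algebra_simps)
  have main: "p (l + s) = p (l - s)" if s: "0 < s" for s
  proof (rule ccontr)
    assume ne: "p (l + s) \<noteq> p (l - s)"
    define \<eta> where "\<eta> = \<bar>p (l + s) - p (l - s)\<bar> / 2"
    have \<eta>: "0 < \<eta>" using ne by (simp add: \<eta>_def)
    obtain \<delta>1 where \<delta>1: "0 < \<delta>1" "\<And>x. \<bar>x - (l + s)\<bar> < \<delta>1 ==> \<bar>p x - p (l + s)\<bar> < \<eta>"
      using p_cont[of "l + s"] \<eta> unfolding continuous_at_eps_delta dist_real_def by blast
    obtain \<delta>2 where \<delta>2: "0 < \<delta>2" "\<And>x. \<bar>x - (l - s)\<bar> < \<delta>2 ==> \<bar>p x - p (l - s)\<bar> < \<eta>"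
      using p_cont[of "l - s"] \<eta> unfolding continuous_at_eps_delta dist_real_def by blast
    define \<delta> where "\<delta> = min \<delta>1 \<delta>2"
    define \<epsilon> where "\<epsilon> = min (1 / 2) (\<delta> / (4 * s))"
    have \<delta>: "0 < \<delta>" using \<delta>1(1) \<delta>2(1) by (simp add: \<delta>_def)
    have \<epsilon>: "0 < \<epsilon>" "\<epsilon> < 1" using \<delta> s by (auto simp: \<epsilon>_def)
    have "\<epsilon> * s \<le> \<delta> / (4 * s) * s" using s by (intro mult_right_mono) (auto simp: \<epsilon>_def)
    then have \<epsilon>s: "\<epsilon> * s \<le> \<delta> / 4" using s by simp
    obtain \<tau>0 where \<tau>0: "0 < \<tau>0" "\<And>\<tau>. 0 < \<tau> ==> \<tau> < \<tau>0 ==>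
        \<exists>\<sigma>. (1 - \<epsilon>) * \<tau> \<le> \<sigma> \<and> \<sigma> \<le> (1 + \<epsilon>) * \<tau> \<and> p (t1 + \<tau>) = p (t1 - \<sigma>)"
      by (rule p_reflect_near[OF max \<epsilon>]) blast
    obtain N where N: "s / \<tau>0 < A ^ N" using real_arch_pow[OF A] by blast
    obtain N2 where N2: "\<And>i. N2 \<le> i ==> \<bar>frac (y (\<rho> i)) - l\<bar> < \<delta> / 2"
      using l(2) \<delta> unfolding lim_sequentially dist_real_def o_def by (meson half_gt_zero)
    define i where "i = max N N2"
    define j where "j = \<rho> i"
    have "N \<le> j" using seq_suble[OF l(1), of i] by (simp add: i_def j_def)
    then have "A ^ N \<le> A ^ j" using A by (intro power_increasing) auto
    then have "s / \<tau>0 < A ^ j" using N by linarith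
    then have "s / A ^ j < \<tau>0" using \<tau>0(1) A s by (simp add: divide_less_eq mult.commute)
    moreover have "0 < s / A ^ j" using s A by simp
    ultimately obtain \<sigma> where \<sigma>: "(1 - \<epsilon>) * (s / A ^ j) \<le> \<sigma>" "\<sigma> \<le> (1 + \<epsilon>) * (s / A ^ j)" "p (t1 + s / A ^ j) = p (t1 - \<sigma>)"
      using \<tau>0(2) by blast
    have Aj: "0 < A ^ j" using A by simp
    define \<sigma>' where "\<sigma>' = A ^ j * \<sigma>"
    have "A ^ j * ((1 - \<epsilon>) * (s / A ^ j)) \<le> \<sigma>'" "\<sigma>' \<le> A ^ j * ((1 + \<epsilon>) * (s / A ^ j))"
      unfolding \<sigma>'_def using \<sigma>(1,2) Aj by (simp_all only: mult_left_mono less_imp_le)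
    moreover have cancel: "x * (q * (s / x)) = q * s" if "0 < x" for x q :: real using that by simp
    ultimately have "(1 - \<epsilon>) * s \<le> \<sigma>'" "\<sigma>' \<le> (1 + \<epsilon>) * s" by (simp_all only: cancel[OF Aj])
    then have \<sigma>': "\<bar>\<sigma>' - s\<bar> \<le> \<delta> / 4" using \<epsilon>s unfolding left_diff_distrib distrib_right by linarith
    have Tj: "(TT ^^ (2 * j)) (t1 + x) = y j + A ^ j * x" for x
      by (simp add: iterate_TT y_def A_def power_mult)
    have "p ((TT ^^ (2 * j)) (t1 + s / A ^ j)) = p ((TT ^^ (2 * j)) (t1 + (- \<sigma>)))"
      by (rule p_iterate) (use \<sigma>(3) in simp)
    moreover have cancel1: "x * (s / x) = s" if "0 < x" for x :: real using that by simp
    ultimately have "p (y j + s) = p (y j - \<sigma>')"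
      unfolding Tj cancel1[OF Aj] \<sigma>'_def by (simp only: mult_minus_right add_uminus_conv_diff)
    then have pp: "p (frac (y j) + s) = p (frac (y j) - \<sigma>')" using fr[of j s] fr[of j "- \<sigma>'"] by simp
    have near: "\<bar>frac (y j) - l\<bar> < \<delta> / 2" using N2[of i] by (simp add: i_def j_def)
    have "\<bar>p (frac (y j) + s) - p (l + s)\<bar> < \<eta>" by (rule \<delta>1(2)) (use near \<delta> in \<open>simp add: \<delta>_def\<close>)
    moreover have "\<bar>p (frac (y j) - \<sigma>') - p (l - s)\<bar> < \<eta>"
    proof (rule \<delta>2(2))
      have "\<bar>frac (y j) - \<sigma>' - (l - s)\<bar> \<le> \<bar>frac (y j) - l\<bar> + \<bar>\<sigma>' - s\<bar>" by linarith
      also have "\<dots> < \<delta>" using near \<sigma>' \<delta> by linarith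
      finally show "\<bar>frac (y j) - \<sigma>' - (l - s)\<bar> < \<delta>2" by (simp add: \<delta>_def)
    qed
    ultimately show False unfolding pp \<eta>_def by (simp add: abs_if split: if_splits)
  qed
  have "p (l + s) = p (l - s)" for s
  proof (cases "0 < s")
    case False
    then show ?thesis using main[of "- s"] by (cases "s = 0") auto
  qed (rule main)
  then show thesis by (rule that)
qed

text \<open>The symmetry extends from the real circle to the whole curve by the identity theorem.\<close>

lemma complex_symmetric:
  obtains c' where "\<And>w v u. v \<noteq> 0 ==> to_proj2 v = \<phi> w ==> u \<noteq> 0 ==> to_proj2 u = \<phi> (c' - w) ==> dt (cr (cv e) v) u = 0"
proof -
  obtain l where l: "\<And>s. p (l + s) = p (l - s)" by (rule p_symmetric) blast
  define c' where "c' = 2 * z l"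
  define R where "R = {w. dt (cr (cv e) (rep_proj2 (\<phi> w))) (rep_proj2 (\<phi> (c' - w))) = 0}"
  have R: "w \<in> R \<longleftrightarrow> dt (cr (cv e) v) u = 0"
    if v: "v \<noteq> 0" "to_proj2 v = \<phi> w" and u: "u \<noteq> 0" "to_proj2 u = \<phi> (c' - w)" for v u w
  proof -
    have "\<exists>k. rep_proj2 (\<phi> w) = k *s v" using to_proj2_eq_iff[OF v(1) rep_proj2_nonzero, of "\<phi> w"] v(2) by simp
    then obtain k where k: "rep_proj2 (\<phi> w) = k *s v" by blast
    have "\<exists>k. rep_proj2 (\<phi> (c' - w)) = k *s u" using to_proj2_eq_iff[OF u(1) rep_proj2_nonzero, of "\<phi> (c' - w)"] u(2) by simp
    then obtain k' where k': "rep_proj2 (\<phi> (c' - w)) = k' *s u" by blast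
    have "k \<noteq> 0" "k' \<noteq> 0" using k k' rep_proj2_nonzero[of "\<phi> w"] rep_proj2_nonzero[of "\<phi> (c' - w)"] by auto
    then show ?thesis by (simp add: R_def k k' cr_smult)
  qed
  have "z (l + s) \<in> R" for s
  proof (rule R[THEN iffD2])
    show "cv (r (l + s)) \<noteq> 0" "to_proj2 (cv (r (l + s))) = \<phi> (z (l + s))" "cv (r (l - s)) \<noteq> 0" by (rule cv_r)+
    have "c' - z (l + s) = z (l - s)" by (simp add: c'_def z_def algebra_simps)
    then show "to_proj2 (cv (r (l - s))) = \<phi> (c' - z (l + s))" by (simp add: cv_r)
    show "dt (cr (cv e) (cv (r (l + s)))) (cv (r (l - s))) = 0" using l[of s] by (simp add: p_eq cv_cr cv_dt)
  qed
  from this[of "t - l" for t] have "z t \<in> R" for t by simp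
  then have lim: "z l islimpt R" by (intro islimpt_z[of l UNIV]) auto
  have "R = UNIV"
  proof (rule local_zero_set_identity[OF _ lim])
    fix t
    obtain S h where h: "lift S h" "t \<in> S" by (rule lift_exists)
    obtain S1 h1 where h1: "lift S1 h1" "c' - t \<in> S1" by (rule lift_exists)
    have "open (S \<inter> (\<lambda>w. c' - w) -` S1)"
      using h(1) h1(1) by (intro continuous_open_preimage continuous_intros) (auto simp: lift_def)
    moreover have "t \<in> S \<inter> (\<lambda>w. c' - w) -` S1" using h(2) h1(2) by simp
    ultimately obtain q where q: "0 < q" "ball t q \<subseteq> S \<inter> (\<lambda>w. c' - w) -` S1" by (rule openE)
    let ?w = "\<lambda>w. dt (cr (cv e) (h w)) (h1 (c' - w))"
    have A: "(\<lambda>w. h w $ i) holomorphic_on ball t q" for i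
      using h(1) q(2) by (auto simp: lift_def intro: holomorphic_on_subset)
    have "(\<lambda>w. h1 w $ i) holomorphic_on S1" for i using h1(1) by (simp add: lift_def)
    then have B: "(\<lambda>w. h1 (c' - w) $ i) holomorphic_on ball t q" for i
      by (rule holomorphic_on_compose_gen[of "\<lambda>w. c' - w" _ "\<lambda>w. h1 w $ i", unfolded o_def, rotated])
        (use q(2) in \<open>auto intro!: holomorphic_intros\<close>)
    have "?w holomorphic_on ball t q" unfolding dt3 cr_nth by (intro holomorphic_intros A B)
    moreover have "\<forall>w\<in>ball t q. w \<in> R \<longleftrightarrow> ?w w = 0"
    proof
      fix w assume "w \<in> ball t q"
      then have "w \<in> S" "c' - w \<in> S1" using q(2) by auto
      then show "w \<in> R \<longleftrightarrow> ?w w = 0" using h(1) h1(1) by (intro R) (auto simp: lift_def)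
    qed
    ultimately show "\<exists>r>0. \<exists>w. w holomorphic_on ball t r \<and> (\<forall>s\<in>ball t r. s \<in> R \<longleftrightarrow> w s = 0)" using q(1) by blast
  qed
  then show thesis using R by (intro that[of c']) blast
qed

text \<open>A generic line through the center meets the cubic in three distinct points, which the symmetry
  permutes without fixed points.\<close>

theorem no_missed_line: False
proof -
  let ?G = "complexify G"
  obtain c' where sym: "\<And>w v u. v \<noteq> 0 ==> to_proj2 v = \<phi> w ==> u \<noteq> 0 ==> to_proj2 u = \<phi> (c' - w) ==> dt (cr (cv e) v) u = 0"
    by (rule complex_symmetric) blast
  have ce: "cv e \<noteq> 0" using e by (simp add: cv_0_iff)
  have homc: "homogeneous m ?G" by (simp add: homogeneous_complexify hom)
  have m3: "m = 3" by (rule degree_three[OF homc m refl smooth])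
  have Gs: "eval3 ?G (k *s v) = k ^ m * eval3 ?G v" for k v by (rule eval3_scale[OF homc])
  define B where "B = tangential (cv e) \<union> {w. 2 * w - c' \<in> \<Omega>}"
  have "{w. 2 * w - c' \<in> \<Omega>} \<subseteq> (\<lambda>x. (x + c') / 2) ` \<Omega>"
  proof
    fix w assume "w \<in> {w. 2 * w - c' \<in> \<Omega>}"
    then show "w \<in> (\<lambda>x. (x + c') / 2) ` \<Omega>" by (intro image_eqI[of _ _ "2 * w - c'"]) auto
  qed
  then have "countable {w. 2 * w - c' \<in> \<Omega>}" by (rule countable_subset) (intro countable_image countable_\<Omega>)
  moreover have "countable (tangential (cv e))" by (rule countable_tangential[OF ce complex_off])
  ultimately have cB: "countable B" by (simp add: B_def)
  have offw: "cr (cv e) (rep_proj2 (\<phi> w)) \<noteq> 0" for w by (rule complex_off[OF rep_proj2_nonzero to_proj2_rep])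
  have "countable (\<Union>w\<in>B. Rl (cr (cv e) (rep_proj2 (\<phi> w))))" using cB line_countable[OF offw] by (intro countable_UN) auto
  then have "(\<Union>w\<in>B. Rl (cr (cv e) (rep_proj2 (\<phi> w)))) \<noteq> UNIV" using uncountable_UNIV_euclidean[where 'a = complex] by metis
  then obtain s where s: "\<And>w. w \<in> B ==> s \<notin> Rl (cr (cv e) (rep_proj2 (\<phi> w)))" by blast
  define v where "v = rep_proj2 (\<phi> s)"
  define x where "x y = v + y *s cv e" for y
  have cx: "cr (cv e) (x y) = cr (cv e) v" for y by (simp add: x_def cr_add cr_smult)
  have off: "cr (cv e) v \<noteq> 0" unfolding v_def by (rule offw)
  have x0: "x y \<noteq> 0" for y
  proof
    assume "x y = 0"
    then show False using cx[of y] off by simp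
  qed
  obtain P where P: "\<And>y. poly P y = eval3 ?G (x y)" "degree P \<le> m" "coeff P m = eval3 ?G (cv e)"
    unfolding x_def by (rule eval3_line_poly[OF homc]) blast
  have lc: "coeff P m \<noteq> 0" using center_off by (simp add: P(3) eval3_complexify)
  then have P0: "P \<noteq> 0" and dP: "degree P = 3" using P(2) le_degree[of P m] m3 by auto
  have onc: "\<exists>w. to_proj2 (x y) = \<phi> w" if "poly P y = 0" for y
  proof -
    have "to_proj2 (x y) \<in> range \<phi>" using that on_complex[OF x0] by (simp add: P(1) range_\<phi>)
    then show ?thesis by blast
  qed
  have good: "w \<notin> B" if w: "to_proj2 (x y) = \<phi> w" for y w
  proof
    assume B: "w \<in> B"
    have "\<exists>k. rep_proj2 (\<phi> w) = k *s x y" using to_proj2_eq_iff[OF x0 rep_proj2_nonzero, of y "\<phi> w"] w by simp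
    then obtain k where "rep_proj2 (\<phi> w) = k *s x y" by blast
    then have "dt (cr (cv e) (rep_proj2 (\<phi> w))) v = 0" by (simp add: cr_smult cx)
    then have "s \<in> Rl (cr (cv e) (rep_proj2 (\<phi> w)))" by (simp add: Rl_def v_def)
    then show False using s[OF B] by blast
  qed
  have simple: "poly (pderiv P) y \<noteq> 0" if y: "poly P y = 0" for y
  proof
    assume z: "poly (pderiv P) y = 0"
    obtain w where w: "to_proj2 (x y) = \<phi> w" using onc[OF y] by blast
    obtain S h where h: "lift S h" "w \<in> S" by (rule lift_exists)
    obtain k where k: "k \<noteq> 0" "x y = k *s h w" by (rule proj_lift[OF h x0 w])
    have "((\<lambda>y. eval3 ?G (v + y *s cv e)) has_field_derivative dt (grad (eval3 ?G) (v + y *s cv e)) (cv e)) (at y)"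
      by (rule pfun_along_line[OF pfun_eval3])
    moreover have "(\<lambda>y. eval3 ?G (v + y *s cv e)) = poly P" by (simp add: fun_eq_iff P(1) x_def)
    ultimately have "dt (grad (eval3 ?G) (x y)) (cv e) = poly (pderiv P) y"
      using DERIV_unique[OF _ poly_DERIV] by (simp add: x_def)
    then have "k * dt (grad (eval3 ?G) (k *s h w)) (cv e) = 0" using z k(2) by simp
    then have "k ^ m * dt (grad (eval3 ?G) (h w)) (cv e) = 0"
      using grad_homogeneous[OF pfun_eval3 Gs, of k "h w"] by (metis dt_smult_left)
    then have ge: "dt (grad (eval3 ?G) (h w)) (cv e) = 0" using k(1) by simp
    have Gh: "eval3 ?G (h u) = 0" if "u \<in> S" for u
      using h(1) that on_complex[of "h u"] \<phi>_C[of u] by (auto simp: lift_def)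
    have eu: "dt (grad (eval3 ?G) (h w)) (h w) = 0" using euler_identity[OF pfun_eval3 Gs] Gh[OF h(2)] by simp
    have "((\<lambda>u. eval3 ?G (h u)) has_derivative (\<lambda>q. dt (grad (eval3 ?G) (h w)) (q *s dv h w))) (at w)"
      by (rule has_derivative_compose[OF lift_has_derivative[OF h] pfun_has_derivative[OF pfun_eval3]])
    then have D: "((\<lambda>u. eval3 ?G (h u)) has_field_derivative dt (grad (eval3 ?G) (h w)) (dv h w)) (at w)"
      by (simp add: has_field_derivative_def mult_commute_abs)
    have "open S" using h(1) by (simp add: lift_def)
    from has_field_derivative_transform_within_open[OF D this h(2), of "\<lambda>_. 0"]
    have "((\<lambda>_. 0) has_field_derivative dt (grad (eval3 ?G) (h w)) (dv h w)) (at w)" using Gh by simp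
    then have dd: "dt (grad (eval3 ?G) (h w)) (dv h w) = 0" using DERIV_unique[OF _ DERIV_const] by blast
    have "grad (eval3 ?G) (h w) \<noteq> 0" using smooth[OF _ Gh[OF h(2)]] h by (auto simp: lift_def)
    then obtain q where "cr (h w) (dv h w) = q *s grad (eval3 ?G) (h w)" by (rule cr_parallel_normal[OF eu dd])
    then have "dt (cv e) (cr (h w) (dv h w)) = 0" using ge by (simp add: dt_comm[of "cv e"])
    then have "w \<in> B" using tangential_lift[OF h] by (simp add: B_def)
    then show False using good[OF w] by blast
  qed
  define rel where "rel y y' \<longleftrightarrow> (\<exists>w. to_proj2 (x y) = \<phi> w \<and> to_proj2 (x y') = \<phi> (c' - w))" for y y'
  have inj: "y = y'" if "to_proj2 (x y) = to_proj2 (x y')" for y y'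
  proof -
    have "\<exists>k. x y' = k *s x y" using that to_proj2_eq_iff[OF x0[of y] x0[of y']] by simp
    then obtain k where k: "x y' = k *s x y" by blast
    have eq: "cr (cv e) v = k *s cr (cv e) v" using cr_smult[of "cv e" k "x y"] by (simp only: k[symmetric] cx)
    obtain i where i: "cr (cv e) v $ i \<noteq> 0" using nonzero_nth[OF off] by blast
    have "cr (cv e) v $ i = k * cr (cv e) v $ i" using arg_cong[OF eq, of "\<lambda>u. u $ i"] by simp
    then have k1: "k = 1" using i by simp
    obtain l where l: "cv e $ l \<noteq> 0" using nonzero_nth[OF ce] by blast
    have "v $ l + y' * cv e $ l = v $ l + y * cv e $ l"
      using arg_cong[OF k, of "\<lambda>u. u $ l"] unfolding k1 x_def vector_add_component vector_smult_component by simp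
    then show ?thesis using l by simp
  qed
  show False
  proof (rule no_involution_on_three_points[where Z = "{y. poly P y = 0}" and rel = rel])
    show "card {y. poly P y = 0} = 3" using card_simple_roots[OF P0 simple] dP by simp
    show "\<exists>y'\<in>{y. poly P y = 0}. rel y y'" if yZ: "y \<in> {y. poly P y = 0}" for y
    proof -
      have "poly P y = 0" using yZ by simp
      then obtain w where w: "to_proj2 (x y) = \<phi> w" using onc by blast
      define u where "u = rep_proj2 (\<phi> (c' - w))"
      have u: "u \<noteq> 0" "to_proj2 u = \<phi> (c' - w)" by (simp_all add: u_def rep_proj2_nonzero)
      have cxy: "cr (cv e) (x y) \<noteq> 0" using off by (simp add: cx)
      obtain k k' where k: "u = k *s x y + k' *s cv e" "cr (cv e) u = k *s cr (cv e) (x y)"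
        by (rule span_of_normal[OF cxy ce sym[OF x0 w u]])
      have "k \<noteq> 0" using complex_off[OF u] k(2) by auto
      then have "u = k *s x (y + k' / k)" unfolding k(1) x_def by (simp add: vec_eq_iff algebra_simps)
      then have y': "to_proj2 (x (y + k' / k)) = \<phi> (c' - w)" using u(2) to_proj2_smult[OF \<open>k \<noteq> 0\<close> x0] by simp
      moreover have "to_proj2 (x (y + k' / k)) \<in> zero_set ?G" unfolding y' by simp
      then have "poly P (y + k' / k) = 0" using on_complex[OF x0] by (simp add: P(1))
      ultimately show ?thesis using w unfolding rel_def by blast
    qed
    show "rel y' y" if rl: "rel y y'" for y y'
    proof -
      obtain w where w: "to_proj2 (x y) = \<phi> w" "to_proj2 (x y') = \<phi> (c' - w)" using rl unfolding rel_def by blast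
      then show ?thesis unfolding rel_def by (intro exI[of _ "c' - w"]) simp
    qed
    show "y1 = y2" if rels: "rel y y1" "rel y y2" for y y1 y2
    proof -
      obtain w1 where w1: "to_proj2 (x y) = \<phi> w1" "to_proj2 (x y1) = \<phi> (c' - w1)" using rels(1) unfolding rel_def by blast
      obtain w2 where w2: "to_proj2 (x y) = \<phi> w2" "to_proj2 (x y2) = \<phi> (c' - w2)" using rels(2) unfolding rel_def by blast
      have "w2 - w1 \<in> \<Omega>" using \<phi>_eq[of w2 w1] w1(1) w2(1) by simp
      then have "\<phi> (c' - w1) = \<phi> (c' - w2)" using \<phi>_eq[of "c' - w1" "c' - w2"] by (simp add: algebra_simps)
      then show ?thesis using w1(2) w2(2) by (intro inj) simp
    qed
    show "\<not> rel y y" if "y \<in> {y. poly P y = 0}" for y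
    proof
      assume "rel y y"
      then obtain w where w: "to_proj2 (x y) = \<phi> w" "to_proj2 (x y) = \<phi> (c' - w)" by (auto simp: rel_def)
      then have "w - (c' - w) \<in> \<Omega>" using \<phi>_eq[of w "c' - w"] by simp
      moreover have "w - (c' - w) = 2 * w - c'" by simp
      ultimately have "w \<in> B" by (simp add: B_def)
      then show False using good[OF w(1)] by blast
    qed
  qed
qed

end

section \<open>The real case and the theorem\<close>

lemma (in real_circle) every_line_meets:
  assumes x: "cr e x \<noteq> 0" shows "\<exists>t v. v \<noteq> 0 \<and> to_proj2 v = \<psi> t \<and> dt (cr e x) v = 0"
proof (rule ccontr)
  assume no: "\<nexists>t v. v \<noteq> 0 \<and> to_proj2 v = \<psi> t \<and> dt (cr e x) v = 0"
  interpret M: missed_line \<omega>1 \<omega>2 \<phi> G F d m e \<psi> a b \<omega> c "cr e x"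
  proof unfold_locales
    show "cr e x \<noteq> 0" "dt (cr e x) e = 0" using x by simp_all
    show "dt (cr e x) (rep_proj2 (\<psi> t)) \<noteq> 0" for t
      using no rep_proj2_nonzero[of "\<psi> t"] to_proj2_rep[of "\<psi> t"] by blast
  qed
  show False by (rule M.no_missed_line)
qed

text \<open>The complexification provides the uniformization, and with it the expanding multiplier, the position
  of the center and the charts; the dynamics itself is that of the real map.\<close>

lemma real_invariant_basin:
  fixes F :: "real polymap"
  assumes rF: "rational_map d F" and elF: "elementary F p0" and smooth_cG: "smooth_curve (complexify G)"
    and unif: "uniformization \<omega>1 \<omega>2 \<phi> (zero_set (complexify G))"
    and invC: "invariant_curve (complexify_map F) (zero_set (complexify G))"
    and comp: "C \<in> components (zero_set G)" and aparam: "affine_parametrization F \<psi> C"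
  shows "\<And>N. transverse_norm G C N ==>
      transverse_lyapunov F N C (circle_measure \<psi>) < 0 ==> basin_positive F C"
    and "\<And>H N. linear_form H ==> p0 \<notin> zero_set H ==> invariant_curve F (zero_set H) ==>
      transverse_norm H (zero_set H) N ==> transverse_lyapunov F N (zero_set H)
        (line_measure p0 (zero_set H) (circle_measure \<psi>)) < 0 ==> basin_positive F (zero_set H)"
proof -
  let ?G = "complexify G" and ?F = "complexify_map F"
  obtain e where pe: "p0 = to_proj2 e" "e \<noteq> 0" by (rule to_proj2_cases)
  obtain m where hm: "0 < m" "homogeneous m G" using smooth_cG by (auto simp: smooth_curve_def homogeneous_complexify)
  have homc: "homogeneous m ?G" by (simp add: homogeneous_complexify hm(2))
  have on: "to_proj2 v \<in> zero_set ?G \<longleftrightarrow> eval3 ?G v = 0" if "v \<noteq> 0" for v by (rule zero_set_iff[OF homc that])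
  have rm: "ratmap ?F (to_proj2 v) = to_proj2 (evalmap ?F v)" if v: "v \<noteq> 0" "evalmap ?F v \<noteq> 0" for v
  proof -
    have "\<exists>k. rep_proj2 (to_proj2 v) = k *s v" using to_proj2_eq_iff[OF v(1) rep_proj2_nonzero, of "to_proj2 v"] by simp
    then obtain k where k: "rep_proj2 (to_proj2 v) = k *s v" by blast
    then have "k \<noteq> 0" using rep_proj2_nonzero[of "to_proj2 v"] by auto
    then show ?thesis unfolding ratmap_def k complexify_map_scale[OF rF] using v(2) by (intro to_proj2_smult) auto
  qed
  have nz: "evalmap ?F v \<noteq> 0" if v: "v \<noteq> 0" "to_proj2 v \<in> zero_set ?G" for v
    using invC v by (auto simp: invariant_curve_def indeterminacy_def)
  obtain a b where ab: "\<And>t. ratmap F (\<psi> t) = \<psi> (of_int a * t + b)" using aparam by (auto simp: affine_parametrization_def)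
  interpret real_curve \<omega>1 \<omega>2 \<phi> G F d m e \<psi> a b
  proof unfold_locales
    show "uniformization \<omega>1 \<omega>2 \<phi> (zero_set ?G)" by (rule unif)
    show "pfun (\<lambda>v. evalmap ?F v $ i)" for i by (rule pfun_evalmap)
    show "evalmap ?F (k *s v) = k ^ d *s evalmap ?F v" for k v by (rule complexify_map_scale[OF rF])
    show "2 \<le> d" using rF by (simp add: rational_map_def)
    show "evalmap ?F v \<noteq> 0 \<and> to_proj2 (evalmap ?F v) \<in> zero_set ?G" if v: "v \<noteq> 0" "to_proj2 v \<in> zero_set ?G" for v
    proof -
      have "ratmap ?F (to_proj2 v) \<in> zero_set ?G" using invC v(2) by (auto simp: invariant_curve_def)
      then show ?thesis using rm[OF v(1) nz[OF v]] nz[OF v] by simp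
    qed
    show "\<exists>v. v \<noteq> 0 \<and> to_proj2 v \<in> zero_set ?G \<and> to_proj2 (evalmap ?F v) = p" if p: "p \<in> zero_set ?G" for p
    proof -
      obtain q where q: "q \<in> zero_set ?G" "p = ratmap ?F q" using invC p by (auto simp: invariant_curve_def)
      obtain v where v: "q = to_proj2 v" "v \<noteq> 0" by (rule to_proj2_cases)
      then show ?thesis using rm[OF v(2) nz] q by auto
    qed
    show "rational_map d F" by (rule rF)
    show "elementary F (to_proj2 e)" using elF pe(1) by simp
    show "e \<noteq> 0" by (rule pe(2))
    show "homogeneous m G" "0 < m" by (rule hm)+
    show "grad (eval3 ?G) v \<noteq> 0" if "v \<noteq> 0" "eval3 ?G v = 0" for v by (rule smooth_grad[OF smooth_cG that])
    show "continuous_on UNIV \<psi>" "\<psi> s = \<psi> t \<longleftrightarrow> s - t \<in> \<int>" for s t using aparam by (auto simp: affine_parametrization_def)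
    show "range \<psi> \<subseteq> zero_set G" using aparam in_components_subset[OF comp] by (simp add: affine_parametrization_def)
    show "ratmap F (\<psi> t) = \<psi> (of_int a * t + b)" for t by (rule ab)
  qed
  obtain \<omega> c where w: "\<omega> \<noteq> 0" "\<And>t. cproj (\<psi> t) = \<phi> (of_real t * \<omega> + c)" "1 < \<bar>real_of_int a\<bar>"
    by (rule linear_parametrization) blast
  interpret real_circle \<omega>1 \<omega>2 \<phi> G F d m e \<psi> a b \<omega> c by unfold_locales (fact w)+
  have C: "C = range \<psi>" using aparam by (simp add: affine_parametrization_def)
  have cm: "circle_measure \<psi> = distr (uniform_measure lborel {0..<1}) borel \<psi>" by (simp add: circle_measure_def)
  show "basin_positive F C" if N: "transverse_norm G C N" "transverse_lyapunov F N C (circle_measure \<psi>) < 0" for N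
  proof (rule E.attracting_curve[OF hm(2,1) center_off _ invar C _ N(1)])
    show "grad (eval3 G) v \<noteq> 0" if "v \<noteq> 0" "eval3 G v = 0" for v
      by (rule smooth_complexify[OF smooth_grad[OF smooth_cG] that])
    show "C \<subseteq> zero_set G" unfolding C by (rule \<psi>_G)
    show "transverse_lyapunov F N C (distr (uniform_measure lborel {0..<1}) borel \<psi>) < 0" using N(2) by (simp only: cm)
  qed
  show "basin_positive F (zero_set H)"
    if H: "linear_form H" "p0 \<notin> zero_set H" "invariant_curve F (zero_set H)" "transverse_norm H (zero_set H) N"
      "transverse_lyapunov F N (zero_set H) (line_measure p0 (zero_set H) (circle_measure \<psi>)) < 0" for H N
  proof (rule E.attracting_line[OF H(1) _ H(3) every_line_meets H(4)])
    show "to_proj2 e \<notin> zero_set H" using H(2) pe(1) by simp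
    show "transverse_lyapunov F N (zero_set H) (line_measure (to_proj2 e) (zero_set H)
        (distr (uniform_measure lborel {0..<1}) borel \<psi>)) < 0" using H(5) by (simp only: cm pe(1))
  qed
qed

theorem theorem6p2:
  shows
   "(\<forall>(F :: complex polymap) d p0 G \<omega>1 \<omega>2 \<phi>.
       rational_map d F \<and> elementary F p0 \<and>
       smooth_curve G \<and> uniformization \<omega>1 \<omega>2 \<phi> (zero_set G) \<and>
       invariant_curve F (zero_set G)
       \<longrightarrow>
       (\<forall>N. transverse_norm G (zero_set G) N \<and>
            transverse_lyapunov F N (zero_set G) (torus_measure \<omega>1 \<omega>2 \<phi>) < 0
            \<longrightarrow> basin_positive F (zero_set G)) \<and>
       (\<forall>H N. linear_form H \<and> p0 \<notin> zero_set H \<and> invariant_curve F (zero_set H) \<and>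
              transverse_norm H (zero_set H) N \<and>
              transverse_lyapunov F N (zero_set H)
                (line_measure p0 (zero_set H) (torus_measure \<omega>1 \<omega>2 \<phi>)) < 0
              \<longrightarrow> basin_positive F (zero_set H)))
    \<and>
    (\<forall>(F :: real polymap) d p0 G \<omega>1 \<omega>2 \<phi> C \<psi>.
       rational_map d F \<and> elementary F p0 \<and>
       smooth_curve (complexify G) \<and> uniformization \<omega>1 \<omega>2 \<phi> (zero_set (complexify G)) \<and>
       invariant_curve (complexify_map F) (zero_set (complexify G)) \<and>
       C \<in> components (zero_set G) \<and> invariant_curve F C \<and>
       affine_parametrization F \<psi> C
       \<longrightarrow>
       (\<forall>N. transverse_norm G C N \<and>
            transverse_lyapunov F N C (circle_measure \<psi>) < 0
            \<longrightarrow> basin_positive F C) \<and>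
       (\<forall>H N. linear_form H \<and> p0 \<notin> zero_set H \<and> invariant_curve F (zero_set H) \<and>
              transverse_norm H (zero_set H) N \<and>
              transverse_lyapunov F N (zero_set H)
                (line_measure p0 (zero_set H) (circle_measure \<psi>)) < 0
              \<longrightarrow> basin_positive F (zero_set H)))"
proof (intro conjI allI impI; elim conjE)
qed ((rule complex_invariant_basin(1); assumption) | (rule complex_invariant_basin(2); assumption) |
  (rule real_invariant_basin(1); assumption) | (rule real_invariant_basin(2); assumption))+

end
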